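(* Suppose that $(X,Y),(X_i,Y_i)_{i\ge 1}$ are independent and identically distributed with common distribution $P$ on $\mathbb R^d\times S$ and that $X$ has density $f_X$ with respect to Lebesgue measure on $\mathbb R^d$. Let $x\in\mathbb R^d$ and assume that $f_X$ is continuous at $x$ and $f_X(x)>0$. Let $\mathcal G$ be a class of real-valued measurable functions on $(S,\mathcal S)$. Suppose there are $\delta>0$ and an envelope $G$ for the class $\mathcal G$ such that: (i) for any positive sequence $(\delta_n)_{n\ge1}$ going to $0$, $\limsup_{n\ge 1}\ \sup_{0<u\le\delta} J(\mathcal G,L_2(\mu_{x,u}),\delta_n)=0$ (with $J$ normalized by the envelope $G$); (ii) for all $\epsilon>0$ there is $M>0$ such that $\sup_{0<u\le\delta}\mu_{x,u}(G^2\mathbf 1_{\{G>M\}})\le\epsilon$; (iii) $(\mathcal G,\rho_\delta)$ is totally bounded, where $\rho_\delta(g_1,g_2)=\sup_{0<u\le\delta}\|g_1-g_2\|_{L_2(\mu_{x,u})}$. Suppose also that for any pair $(g_1,g_2)$ in $\mathcal G$, the map $z\mapsto(\mu_z(g_1g_2),\mu_z(g_1),\mu_z(G^2))$ is continuous at $x$. If, in addition, $k:=k_n$ satisfies $k\to\infty$ and $k/n\to0$, then $$\left\{k^{-1/2}\sum_{i\in N_{n,k}(x)}\bigl(g(Y_i)-\mu_{X_i}(g)\bigr)\right\}_{g\in\mathcal G}$$ converges weakly in $\ell^\infty(\mathcal G)$ to a Gaussian process with covariance function $(g_1,g_2)\mapsto\mu_x(g_1g_2)-\mu_x(g_1)\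mu_x(g_2)$.
   Context: $(S,\mathcal S)$ is a measurable space. $\mathbb R^d$ carries the Euclidean norm $\|\cdot\|$, and $B(x,\tau)=\{z:\|x-z\|\le\tau\}$. $P_X$ is the law of $X$. $\mu_x$ denotes the regular conditional distribution of $Y$ given $X=x$ (assumed to exist): $\mu_x$ is a probability measure on $(S,\mathcal S)$ for $P_X$-almost every $x$, $x\mapsto\mu_x(A)$ is measurable for each $A\in\mathcal S$, and $\mathbb P(Y\in A,X\in B)=\int_B\mu_x(A)f_X(x)\,dx$ for all $A\in\mathcal S$ and Borel $B$. For a measure $\mu$ and function $g$, $\mu(g)=\int g\,d\mu$. $N_{n,k}(x)$ is the index set of the $k$ nearest neighbors of $x$ among $X_1,\dots,X_n$, $1\le k\le n$ (ties broken by lexicographic order). For $u>0$, $\mu_{x,u}$ is the probability measure on $(S,\mathcal S)$ given by $\mu_{x,u}(A)=E[\mu_X(A)\mathbf 1_{B(x,u^{1/d})}(X)]/E[\mathbf 1_{B(x,u^{1/d})}(X)]$. An envelope for $\mathcal G$ is a measurable function $G:S\to\mathbb R$ with $|g(s)|\le G(s)$ for all $s\in S$, $g\in\mathcal G$. For a probability measure $Q$ on $(S,\mathcal S)$, $L_2(Q)$ is the set of $g:S\to\mathbb R$ with $\|g\|_{L_2(Q)}^2=Q(g^2)<\infty$. For $\underline f,\overline f\in L_2(Q)$, the bracket $[\underline f,\overline f]$ is the set of $g\in L_2(Q)$ with $\underline f\le g\le\overline f$; it is an $\epsilon$-bracket if $\|\underline f-\overline f\|_{L_2(Q)}\le\epsilon$.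 The bracketing number $\mathcal N_{[\,]}(\mathcal G,L_2(Q),\epsilon)$ is the smallest number of $\epsilon$-brackets needed to cover $\mathcal G$. The bracketing integral is $$J(\mathcal G,L_2(Q),\delta)=\int_0^\delta\sqrt{\log\mathcal N_{[\,]}(\mathcal G,L_2(Q),\epsilon\|G\|_{L_2(Q)})}\,d\epsilon.$$ $\ell^\infty(T)$ is the space of bounded real functions on $T$ (sup norm); weak convergence in it is in the usual empirical-process (outer expectation) sense. A Gaussian process specified only through its covariance function is understood to be centered. *)

theory Defs
  imports "HOL-Probability.Probability" "HOL-Library.Extended_Nat"
begin

section \<open>Nearest neighbours and conditional distributions\<close>

text \<open>
  The \<open>k\<close> nearest neighbours of \<open>x\<close> among the points \<open>X\<^sub>1, \<dots>, X\<^sub>n\<close>: the indices are ordered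
  lexicographically by (distance to \<open>x\<close>, index), and those with fewer than \<open>k\<close> predecessors
  are kept.
\<close>

definition nn_before :: "'a::metric_space \<Rightarrow> (nat \<Rightarrow> 'a) \<Rightarrow> nat \<Rightarrow> nat \<Rightarrow> bool" where
  "nn_before x X i j \<longleftrightarrow>
     dist x (X i) < dist x (X j) \<or> (dist x (X i) = dist x (X j) \<and> i < j)"

definition nn_set :: "(nat \<Rightarrow> 'a::metric_space) \<Rightarrow> nat \<Rightarrow> nat \<Rightarrow> 'a \<Rightarrow> nat set" where
  "nn_set X n k x = {i \<in> {1..n}. card {j \<in> {1..n}. nn_before x X j i} < k}"

text \<open>
  \<open>\<mu>\<close> is a regular conditional distribution of \<open>Y\<close> given \<open>X\<close>, where \<open>X\<close> has Lebesgue density \<open>f\<close>.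
  Only almost every \<open>\<mu> z\<close> is required to be a probability measure on \<open>S\<close>.
\<close>

definition regular_cond_dist ::
  "'w measure \<Rightarrow> 's measure \<Rightarrow> ('w \<Rightarrow> 'a::euclidean_space) \<Rightarrow> ('w \<Rightarrow> 's) \<Rightarrow> ('a \<Rightarrow> real)
     \<Rightarrow> ('a \<Rightarrow> 's measure) \<Rightarrow> bool" where
  "regular_cond_dist M S X Y f \<mu> \<longleftrightarrow>
     (AE z in distr M borel X. prob_space (\<mu> z) \<and> sets (\<mu> z) = sets S) \<and>
     (\<forall>A\<in>sets S. (\<lambda>z. emeasure (\<mu> z) A) \<in> borel_measurable borel) \<and>
     (\<forall>A\<in>sets S. \<forall>B\<in>sets borel.
        emeasure M {\<omega> \<in> space M. Y \<omega> \<in> A \<and> X \<omega> \<in> B} =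
        (\<integral>\<^sup>+z. emeasure (\<mu> z) A * ennreal (f z) * indicator B z \<partial>lborel))"

text \<open>The probability measure \<open>\<mu>\<^sub>x\<^sub>,\<^sub>u\<close>, the mixture of the \<open>\<mu> z\<close> over the ball of radius \<open>u\<^sup>1\<^sup>/\<^sup>d\<close>.\<close>

definition local_mixture ::
  "'w measure \<Rightarrow> 's measure \<Rightarrow> ('w \<Rightarrow> real ^ 'd) \<Rightarrow> (real ^ 'd \<Rightarrow> 's measure)
     \<Rightarrow> real ^ 'd \<Rightarrow> real \<Rightarrow> 's measure" where
  "local_mixture M S X \<mu> x u =
     (let B = cball x (u powr (1 / real CARD('d))) in
      measure_of (space S) (sets S)
        (\<lambda>A. (\<integral>\<^sup>+\<omega>. emeasure (\<mu> (X \<omega>)) A * indicator B (X \<omega>) \<partial>M) /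
             (\<integral>\<^sup>+\<omega>. indicator B (X \<omega>) \<partial>M)))"

section \<open>Bracketing\<close>

definition L2_space :: "'s measure \<Rightarrow> ('s \<Rightarrow> real) set" where
  "L2_space Q = {g \<in> borel_measurable Q. integrable Q (\<lambda>s. (g s)\<^sup>2)}"

definition L2_nrm :: "'s measure \<Rightarrow> ('s \<Rightarrow> real) \<Rightarrow> real" where
  "L2_nrm Q g = sqrt (\<integral>s. (g s)\<^sup>2 \<partial>Q)"

definition bracket :: "'s measure \<Rightarrow> ('s \<Rightarrow> real) \<Rightarrow> ('s \<Rightarrow> real) \<Rightarrow> ('s \<Rightarrow> real) set" where
  "bracket Q l h = {g \<in> L2_space Q. \<forall>s\<in>space Q. l s \<le> g s \<and> g s \<le> h s}"

text \<open>The bracketing number is \<open>\<infinity>\<close> (the infimum of the empty set) if no finite cover exists.\<close>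

definition bracketing_number :: "('s \<Rightarrow> real) set \<Rightarrow> 's measure \<Rightarrow> real \<Rightarrow> enat" where
  "bracketing_number \<G> Q \<epsilon> =
     Inf {enat (card C) | C. finite C \<and>
       (\<forall>(l, h)\<in>C. l \<in> L2_space Q \<and> h \<in> L2_space Q \<and> L2_nrm Q (\<lambda>s. l s - h s) \<le> \<epsilon>) \<and>
       \<G> \<subseteq> (\<Union>(l, h)\<in>C. bracket Q l h)}"

definition sqrt_log :: "enat \<Rightarrow> ennreal" where
  "sqrt_log N = (case N of enat m \<Rightarrow> ennreal (sqrt (ln (real m))) | \<infinity> \<Rightarrow> \<infinity>)"

definition bracketing_integral ::
  "('s \<Rightarrow> real) set \<Rightarrow> ('s \<Rightarrow> real) \<Rightarrow> 's measure \<Rightarrow> real \<Rightarrow> ennreal" where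
  "bracketing_integral \<G> G Q \<delta> =
     (\<integral>\<^sup>+\<epsilon>. sqrt_log (bracketing_number \<G> Q (\<epsilon> * L2_nrm Q G)) * indicator {0<..<\<delta>} \<epsilon> \<partial>lborel)"

definition is_envelope :: "'s measure \<Rightarrow> ('s \<Rightarrow> real) set \<Rightarrow> ('s \<Rightarrow> real) \<Rightarrow> bool" where
  "is_envelope S \<G> G \<longleftrightarrow>
     G \<in> borel_measurable S \<and> (\<forall>g\<in>\<G>. \<forall>s\<in>space S. \<bar>g s\<bar> \<le> G s)"

text \<open>Total boundedness for a pseudometric, possibly with value \<open>\<infinity>\<close>.\<close>

definition totally_bounded_wrt :: "('t \<Rightarrow> 't \<Rightarrow> ennreal) \<Rightarrow> 't set \<Rightarrow> bool" where
  "totally_bounded_wrt \<rho> T \<longleftrightarrow>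
     (\<forall>\<epsilon>>0. \<exists>F. finite F \<and> F \<subseteq> T \<and> (\<forall>t\<in>T. \<exists>s\<in>F. \<rho> s t < ennreal \<epsilon>))"

section \<open>Weak convergence of processes with bounded sample paths\<close>

text \<open>
  The space of bounded real functions on \<open>T\<close> with the supremum metric; its points are
  extensional on \<open>T\<close>.
\<close>

definition linf :: "'t set \<Rightarrow> ('t \<Rightarrow> real) metric" where
  "linf T = funspace T euclidean_metric"

lemma mspace_linf: "mspace (linf T) = {z \<in> extensional T. bounded (z ` T)}"
  by (auto simp: linf_def Met_TC.fspace_def)

lemma mdist_linf:
  assumes "y \<in> mspace (linf T)" "z \<in> mspace (linf T)" "T \<noteq> {}"
  shows "mdist (linf T) y z = (SUP t\<in>T. \<bar>y t - z t\<bar>)"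
  using assms unfolding linf_def by (simp add: Met_TC.fdist_def dist_real_def)

definition linf_borel :: "'t set \<Rightarrow> ('t \<Rightarrow> real) measure" where
  "linf_borel T = sigma (mspace (linf T)) {U. openin (mtopology_of (linf T)) U}"

text \<open>The outer expectation; it is only used for bounded \<open>f\<close>, so that integrable majorants suffice.\<close>

definition outer_expectation :: "'w measure \<Rightarrow> ('w \<Rightarrow> real) \<Rightarrow> real" where
  "outer_expectation M f =
     Inf {integral\<^sup>L M U | U. integrable M U \<and> (\<forall>\<omega>\<in>space M. f \<omega> \<le> U \<omega>)}"

text \<open>
  The limit is Borel measurable, while the maps \<open>Z n\<close> need not be measurable.
  A path of \<open>Z n\<close> may also be unbounded: the test function \<open>h\<close> is continuous on the bounded
  functions and has an arbitrary, but bounded, extension to all other arguments. As all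
  extensions are considered, unbounded paths must have outer probability tending to \<open>0\<close>.
\<close>

definition weakly_converges_linf ::
  "'w measure \<Rightarrow> (nat \<Rightarrow> 'w \<Rightarrow> 't \<Rightarrow> real) \<Rightarrow> 't set \<Rightarrow> 'v measure \<Rightarrow> ('v \<Rightarrow> 't \<Rightarrow> real) \<Rightarrow> bool" where
  "weakly_converges_linf M Z T N W \<longleftrightarrow>
     (\<lambda>v. restrict (W v) T) \<in> measurable N (linf_borel T) \<and>
     (\<forall>h C. continuous_map (mtopology_of (linf T)) euclideanreal h \<and> (\<forall>z. \<bar>h z\<bar> \<le> C) \<longrightarrow>
        (\<lambda>n. outer_expectation M (\<lambda>\<omega>. h (restrict (Z n \<omega>) T)))
          \<longlonglongrightarrow> (\<integral>v. h (restrict (W v) T) \<partial>N))"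

text \<open>Normal laws on the line, including the point masses (variance \<open>0\<close>).\<close>

definition is_normal_law :: "real measure \<Rightarrow> bool" where
  "is_normal_law D \<longleftrightarrow>
     (\<exists>m. D = return borel m) \<or>
     (\<exists>m \<sigma>. \<sigma> > 0 \<and> D = density lborel (\<lambda>y. ennreal (normal_density m \<sigma> y)))"

definition gaussian_process :: "'v measure \<Rightarrow> ('v \<Rightarrow> 't \<Rightarrow> real) \<Rightarrow> 't set \<Rightarrow> bool" where
  "gaussian_process N W T \<longleftrightarrow>
     (\<forall>t\<in>T. (\<lambda>v. W v t) \<in> borel_measurable N) \<and>
     (\<forall>F c. finite F \<and> F \<subseteq> T \<longrightarrow> is_normal_law (distr N borel (\<lambda>v. \<Sum>t\<in>F. c t * W v t)))"

definition centered_gaussian_process ::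
  "'v measure \<Rightarrow> ('v \<Rightarrow> 't \<Rightarrow> real) \<Rightarrow> 't set \<Rightarrow> ('t \<Rightarrow> 't \<Rightarrow> real) \<Rightarrow> bool" where
  "centered_gaussian_process N W T K \<longleftrightarrow>
     gaussian_process N W T \<and>
     (\<forall>t\<in>T. (\<integral>v. W v t \<partial>N) = 0) \<and>
     (\<forall>s\<in>T. \<forall>t\<in>T. (\<integral>v. W v s * W v t \<partial>N) = K s t)"

section \<open>The nearest neighbour process\<close>

text \<open>
  Where \<open>g\<close> is not integrable with respect to \<open>\<mu> z\<close>, the integral has the value \<open>0\<close>.
\<close>

definition nn_process ::
  "(nat \<Rightarrow> 'w \<Rightarrow> 'a::metric_space) \<Rightarrow> (nat \<Rightarrow> 'w \<Rightarrow> 's) \<Rightarrow> ('a \<Rightarrow> 's measure) \<Rightarrow> (nat \<Rightarrow> nat) \<Rightarrow> 'a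
     \<Rightarrow> nat \<Rightarrow> 'w \<Rightarrow> ('s \<Rightarrow> real) \<Rightarrow> real" where
  "nn_process X Y \<mu> k x n \<omega> g =
     (1 / sqrt (real (k n))) *
     (\<Sum>i\<in>nn_set (\<lambda>j. X j \<omega>) n (k n) x. (g (Y i \<omega>) - (\<integral>y. g y \<partial>\<mu> (X i \<omega>))))"

end

theory Submission
  imports Defs
begin

text \<open>
  Given the covariates, the responses are independent, and the neighbours form an index set that
  depends on the covariates only. With probability tending to one they lie in a deterministic ball
  around \<open>x\<close> that carries between \<open>4k\<close> and \<open>16k\<close> observations on average, so that the
  centred sums over the neighbours can be compared with the mixture of the \<open>\<mu> z\<close> over this ball. The
  moment generating function of such a sum is bounded by that of all observations in the ball; the
  resulting Bernstein inequality and Ossiander's chaining by brackets with adaptive truncation give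
  asymptotic equicontinuity, and Lindeberg's expansion of the conditional characteristic functions,
  together with continuity of the moments at \<open>x\<close>, gives the finite-dimensional limits.

  The limit process is an almost surely uniform limit of finite-range projections of a Gaussian
  sequence, obtained from a Cholesky factorization. Convergence of characteristic functions is
  transferred to bounded Lipschitz functions by Gaussian smoothing and Scheffe's lemma, and from
  these to bounded continuous functions by monotone Lipschitz regularization.
\<close>

subsection \<open>Convergence of finite-dimensional laws\<close>

definition gauss_kernel :: "nat \<Rightarrow> real \<Rightarrow> (nat \<Rightarrow> real) \<Rightarrow> (nat \<Rightarrow> real) \<Rightarrow> real" where
  "gauss_kernel r \<sigma> y z = (\<Prod>j<r. normal_density 0 \<sigma> (y j - z j))"

lemma normal_density_shift: "normal_density 0 \<sigma> (y - z) = normal_density z \<sigma> y"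
  by (simp add: normal_density_def)

lemma gauss_kernel_nonneg: "0 \<le> gauss_kernel r \<sigma> y z"
  by (auto simp: gauss_kernel_def intro!: prod_nonneg)

interpretation lborel_prod: product_sigma_finite "\<lambda>_::nat. lborel :: real measure"
  by standard

interpretation std_normal_space: prob_space "std_normal_distribution"
  by (rule prob_space_normal_density) simp

interpretation std_normal_prod: product_prob_space "\<lambda>_. std_normal_distribution" I for I :: "nat set"
  by unfold_locales

lemma gauss_kernel_integral:
  assumes "\<sigma> > 0"
  shows "integrable (\<Pi>\<^sub>M j\<in>{..<r}. lborel) (\<lambda>y. gauss_kernel r \<sigma> y z)"
    "(\<integral>y. gauss_kernel r \<sigma> y z \<partial>(\<Pi>\<^sub>M j\<in>{..<r}. lborel)) = 1"
  unfolding gauss_kernel_def normal_density_shift using assms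
  by (auto intro!: lborel_prod.product_integrable_prod)
    (subst lborel_prod.product_integral_prod, auto)

lemma gauss_kernel_moment:
  assumes "\<sigma> > 0" "i < r"
  shows "integrable (\<Pi>\<^sub>M j\<in>{..<r}. lborel) (\<lambda>y. gauss_kernel r \<sigma> y z * \<bar>y i - z i\<bar>)"
    "(\<integral>y. gauss_kernel r \<sigma> y z * \<bar>y i - z i\<bar> \<partial>(\<Pi>\<^sub>M j\<in>{..<r}. lborel)) \<le> \<sigma>"
proof -
  define F where "F = (\<lambda>j (u::real). normal_density (z j) \<sigma> u * (if j = i then \<bar>u - z i\<bar> else 1))"
  have eq: "gauss_kernel r \<sigma> y z * \<bar>y i - z i\<bar> = (\<Prod>j<r. F j (y j))" for y
  proof -
    have "(\<Prod>j<r. if j = i then \<bar>y j - z i\<bar> else 1) = \<bar>y i - z i\<bar>"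
      using assms(2) by (subst prod.delta) auto
    then show ?thesis
      unfolding gauss_kernel_def normal_density_shift F_def prod.distrib by simp
  qed
  have int: "integrable lborel (F j)" for j
    using integrable_normal_moment_abs[OF assms(1), of "z j" 1] assms(1)
    by (cases "j = i") (simp_all add: F_def)
  have val: "integral\<^sup>L lborel (F j) = (if j = i then \<sigma> * sqrt (2 / pi) else 1)" for j
    using integral_normal_moment_abs_odd[OF assms(1), of "z j" 0] assms(1)
    by (cases "j = i") (simp_all add: F_def)
  show "integrable (\<Pi>\<^sub>M j\<in>{..<r}. lborel) (\<lambda>y. gauss_kernel r \<sigma> y z * \<bar>y i - z i\<bar>)"
    unfolding eq by (rule lborel_prod.product_integrable_prod) (auto intro: int)
  have "(\<integral>y. gauss_kernel r \<sigma> y z * \<bar>y i - z i\<bar> \<partial>(\<Pi>\<^sub>M j\<in>{..<r}. lborel)) = \<sigma> * sqrt (2 / pi)"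
    unfolding eq using assms(2) int
    by (subst lborel_prod.product_integral_prod) (simp_all add: val)
  also have "\<dots> \<le> \<sigma> * 1"
    using assms(1) pi_gt3 by (intro mult_left_mono) (auto simp: real_sqrt_le_1_iff)
  finally show "(\<integral>y. gauss_kernel r \<sigma> y z * \<bar>y i - z i\<bar> \<partial>(\<Pi>\<^sub>M j\<in>{..<r}. lborel)) \<le> \<sigma>" by simp
qed

lemma gauss_kernel_fourier:
  assumes "\<sigma> > 0"
  shows "complex_of_real (gauss_kernel r \<sigma> y z) = (1 / sqrt (2 * pi * \<sigma>\<^sup>2)) ^ r *
    (\<integral>v. iexp (\<Sum>j<r. (y j - z j) / \<sigma> * v j) \<partial>(\<Pi>\<^sub>M j\<in>{..<r}. std_normal_distribution))"
proof -
  have int: "integrable std_normal_distribution (\<lambda>v. iexp (t * v))" for t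
    by (rule std_normal_space.integrable_const_bound[where B=1]) auto
  have 1: "(\<integral>v. iexp (t * v) \<partial>std_normal_distribution) = of_real (exp (- t\<^sup>2 / 2))" for t
    using char_std_normal_distribution by (simp add: char_def fun_eq_iff)
  have 2: "complex_of_real (normal_density 0 \<sigma> u) =
      (1 / sqrt (2 * pi * \<sigma>\<^sup>2)) * (\<integral>v. iexp (u / \<sigma> * v) \<partial>std_normal_distribution)" for u
    unfolding 1 by (simp add: normal_density_def power_divide mult.commute)
  have iexp_sum: "iexp (\<Sum>j<r. (y j - z j) / \<sigma> * v j) = (\<Prod>j<r. iexp ((y j - z j) / \<sigma> * v j))" for v
    by (simp add: exp_sum sum_distrib_left)
  have "(\<integral>v. iexp (\<Sum>j<r. (y j - z j) / \<sigma> * v j) \<partial>(\<Pi>\<^sub>M j\<in>{..<r}. std_normal_distribution))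
    = (\<Prod>j<r. \<integral>v. iexp ((y j - z j) / \<sigma> * v) \<partial>std_normal_distribution)"
    unfolding iexp_sum by (rule std_normal_prod.product_integral_prod) (blast intro: int finite_lessThan)+
  moreover have "complex_of_real (gauss_kernel r \<sigma> y z) =
     (\<Prod>j<r. (1 / sqrt (2 * pi * \<sigma>\<^sup>2)) * (\<integral>v. iexp ((y j - z j) / \<sigma> * v) \<partial>std_normal_distribution))"
    unfolding gauss_kernel_def of_real_prod 2 ..
  ultimately show ?thesis
    by (simp only: prod.distrib prod_constant card_lessThan of_real_power)
qed

lemma measurable_finite_lipschitz:
  fixes H :: "(nat \<Rightarrow> real) \<Rightarrow> real"
  assumes lip: "\<And>y z. \<bar>H y - H z\<bar> \<le> L * (\<Sum>j<r. \<bar>y j - z j\<bar>)"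
    and meas: "\<And>j. j < r \<Longrightarrow> (\<lambda>w. Z w j) \<in> borel_measurable M"
  shows "(\<lambda>w. H (Z w)) \<in> borel_measurable M"
proof -
  have "isCont H z" for z
  proof -
    have "((\<lambda>y. y j) \<longlongrightarrow> z j) (at z)" for j
      using continuous_on_product_coordinates[of j, where ?'b=real] unfolding continuous_on_def by (meson UNIV_I)
    then have "((\<lambda>y. L * (\<Sum>j<r. \<bar>y j - z j\<bar>)) \<longlongrightarrow> L * (\<Sum>j<r. \<bar>z j - z j\<bar>)) (at z)"
      by (intro tendsto_intros)
    then have lim: "((\<lambda>y. L * (\<Sum>j<r. \<bar>y j - z j\<bar>)) \<longlongrightarrow> 0) (at z)"
      by (simp only: diff_self abs_zero sum.neutral_const mult_zero_right)
    have "((\<lambda>y. H y - H z) \<longlongrightarrow> 0) (at z)"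
    proof (rule Lim_null_comparison[OF _ lim])
      show "\<forall>\<^sub>F y in at z. norm (H y - H z) \<le> L * (\<Sum>j<r. \<bar>y j - z j\<bar>)"
        unfolding real_norm_def by (rule always_eventually) (rule allI, rule lip)
    qed
    then show ?thesis
      unfolding isCont_def by (rule LIM_zero_cancel)
  qed
  then have H: "H \<in> borel_measurable borel"
    by (intro borel_measurable_continuous_onI continuous_at_imp_continuous_on) auto
  define Z' where "Z' = (\<lambda>w j. if j < r then Z w j else 0)"
  have "Z' \<in> borel_measurable M"
    unfolding Z'_def
  proof (rule measurable_coordinatewise_then_product)
    show "(\<lambda>w. if j < r then Z w j else 0) \<in> borel_measurable M" for j
      using meas[of j] by (cases "j < r") auto
  qed
  then have "(\<lambda>w. H (Z' w)) \<in> borel_measurable M"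
    using H by measurable
  moreover have "H (Z' w) = H (Z w)" for w
    using lip[of "Z' w" "Z w"] by (simp add: Z'_def)
  ultimately show ?thesis by simp
qed

definition smoothed_density :: "'w measure \<Rightarrow> ('w \<Rightarrow> nat \<Rightarrow> real) \<Rightarrow> nat \<Rightarrow> real \<Rightarrow> (nat \<Rightarrow> real) \<Rightarrow> real" where
  "smoothed_density M Z r \<sigma> y = (\<integral>w. gauss_kernel r \<sigma> y (Z w) \<partial>M)"

lemma integral_abs_le:
  fixes f g :: "'a \<Rightarrow> real"
  assumes "integrable M f" "integrable M g" "\<And>x. \<bar>f x\<bar> \<le> g x"
  shows "\<bar>\<integral>x. f x \<partial>M\<bar> \<le> (\<integral>x. g x \<partial>M)"
proof -
  have "\<bar>\<integral>x. f x \<partial>M\<bar> \<le> (\<integral>x. \<bar>f x\<bar> \<partial>M)" by (rule integral_abs_bound)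
  also have "\<dots> \<le> (\<integral>x. g x \<partial>M)" by (rule integral_mono) (use assms in auto)
  finally show ?thesis .
qed

lemma smoothed_density_props:
  fixes H :: "(nat \<Rightarrow> real) \<Rightarrow> real"
  assumes "prob_space M" and \<sigma>: "\<sigma> > 0"
    and ZZ: "\<forall>j<r. (\<lambda>w. Z w j) \<in> borel_measurable M"
    and lip: "\<And>y z. \<bar>H y - H z\<bar> \<le> L * (\<Sum>j<r. \<bar>y j - z j\<bar>)"
    and bnd: "\<And>z. \<bar>H z\<bar> \<le> C" and L: "L \<ge> 0"
  defines "q \<equiv> smoothed_density M Z r \<sigma>"
  defines "\<Lambda> \<equiv> \<Pi>\<^sub>M j\<in>{..<r}. (lborel :: real measure)"
  shows "integrable \<Lambda> q" "(\<integral>\<^sup>+y. ennreal (norm (q y)) \<partial>\<Lambda>) = 1"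
    "integrable \<Lambda> (\<lambda>y. H y * q y)"
    "\<bar>(\<integral>y. H y * q y \<partial>\<Lambda>) - (\<integral>w. H (Z w) \<partial>M)\<bar> \<le> L * r * \<sigma>"
    "complex_of_real (q y) = (1 / sqrt (2 * pi * \<sigma>\<^sup>2)) ^ r *
      (\<integral>v. iexp (\<Sum>j<r. y j / \<sigma> * v j) * (\<integral>w. iexp (\<Sum>j<r. - v j / \<sigma> * Z w j) \<partial>M)
        \<partial>(\<Pi>\<^sub>M j\<in>{..<r}. std_normal_distribution))"
proof -
  have q_def: "q = (\<lambda>y. \<integral>w. gauss_kernel r \<sigma> y (Z w) \<partial>M)"
    by (simp add: q_def fun_eq_iff smoothed_density_def)
  have Z: "\<And>j. j < r \<Longrightarrow> (\<lambda>w. Z w j) \<in> borel_measurable M" using ZZ by blast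
  interpret prob_space M by fact
  interpret L: sigma_finite_measure \<Lambda>
    unfolding \<Lambda>_def by (rule lborel_prod.sigma_finite) simp
  interpret P: pair_sigma_finite M \<Lambda> ..
  have comp: "(\<lambda>y. y j) \<in> borel_measurable \<Lambda>" if "j < r" for j
    unfolding \<Lambda>_def using measurable_component_singleton[of j "{..<r}" "\<lambda>_. lborel"] that by simp
  have Hm: "H \<in> borel_measurable \<Lambda>"
    using measurable_finite_lipschitz[OF lip, of "\<lambda>y. y" \<Lambda>] comp by simp
  have HZ: "(\<lambda>w. H (Z w)) \<in> borel_measurable M"
    by (rule measurable_finite_lipschitz[OF lip Z])
  have gm: "(\<lambda>p. gauss_kernel r \<sigma> (snd p) (Z (fst p))) \<in> borel_measurable (M \<Otimes>\<^sub>M \<Lambda>)"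
    unfolding gauss_kernel_def
    by (intro borel_measurable_prod measurable_compose[OF _ borel_measurable_normal_density] borel_measurable_diff
        measurable_compose[OF measurable_snd comp] measurable_compose[OF measurable_fst Z]) auto
  note gi = gauss_kernel_integral[OF \<sigma>, where r=r, folded \<Lambda>_def]
  have norm_g: "\<bar>gauss_kernel r \<sigma> y z\<bar> = gauss_kernel r \<sigma> y z" for y z
    using gauss_kernel_nonneg by simp
  have int1: "integrable (M \<Otimes>\<^sub>M \<Lambda>) (\<lambda>p. gauss_kernel r \<sigma> (snd p) (Z (fst p)))"
    by (intro P.Fubini_integrable gm) (auto simp: norm_g gi)
  have Cpos: "C \<ge> 0" using bnd[of undefined] by linarith
  have int2: "integrable (M \<Otimes>\<^sub>M \<Lambda>) (\<lambda>p. H (snd p) * gauss_kernel r \<sigma> (snd p) (Z (fst p)))"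
  proof (rule Bochner_Integration.integrable_bound[OF integrable_mult_right[OF int1, of C]])
    show "(\<lambda>p. H (snd p) * gauss_kernel r \<sigma> (snd p) (Z (fst p))) \<in> borel_measurable (M \<Otimes>\<^sub>M \<Lambda>)"
      by (intro borel_measurable_times gm measurable_compose[OF measurable_snd Hm])
    show "AE p in M \<Otimes>\<^sub>M \<Lambda>. norm (H (snd p) * gauss_kernel r \<sigma> (snd p) (Z (fst p))) \<le>
        norm (C * gauss_kernel r \<sigma> (snd p) (Z (fst p)))"
      using bnd Cpos by (auto simp: abs_mult norm_g intro!: mult_right_mono gauss_kernel_nonneg)
  qed
  show iq: "integrable \<Lambda> q"
    unfolding q_def using P.integrable_snd[of "\<lambda>w y. gauss_kernel r \<sigma> y (Z w)"] int1
    by (simp add: split_beta')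
  have q0: "q y \<ge> 0" for y
    unfolding q_def by (auto intro!: integral_nonneg_AE gauss_kernel_nonneg)
  have "(\<integral>y. q y \<partial>\<Lambda>) = (\<integral>w. (\<integral>y. gauss_kernel r \<sigma> y (Z w) \<partial>\<Lambda>) \<partial>M)"
    unfolding q_def using P.Fubini_integral[of "\<lambda>w y. gauss_kernel r \<sigma> y (Z w)"] int1
    by (simp add: split_beta')
  also have "\<dots> = 1" by (simp add: gi prob_space)
  finally show "(\<integral>\<^sup>+y. ennreal (norm (q y)) \<partial>\<Lambda>) = 1"
    using q0 iq by (simp add: nn_integral_eq_integral)
  have qH: "H y * q y = (\<integral>w. H y * gauss_kernel r \<sigma> y (Z w) \<partial>M)" for y
    unfolding q_def by simp
  show "integrable \<Lambda> (\<lambda>y. H y * q y)"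
    unfolding qH using P.integrable_snd[of "\<lambda>w y. H y * gauss_kernel r \<sigma> y (Z w)"] int2
    by (simp add: split_beta')
  have e1: "(\<integral>y. H y * q y \<partial>\<Lambda>) = (\<integral>w. (\<integral>y. H y * gauss_kernel r \<sigma> y (Z w) \<partial>\<Lambda>) \<partial>M)"
    unfolding qH using P.Fubini_integral[of "\<lambda>w y. H y * gauss_kernel r \<sigma> y (Z w)"] int2
    by (simp add: split_beta')
  have int3: "integrable M (\<lambda>w. (\<integral>y. H y * gauss_kernel r \<sigma> y (Z w) \<partial>\<Lambda>))"
    using P.integrable_fst'[OF int2] by simp
  have int4: "integrable M (\<lambda>w. H (Z w))"
    by (rule integrable_const_bound[where B=C]) (use bnd HZ in auto)
  have int5: "integrable \<Lambda> (\<lambda>y. H y * gauss_kernel r \<sigma> y z)" for z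
  proof (rule Bochner_Integration.integrable_bound[OF integrable_mult_right[OF gi(1), of C]])
    show "(\<lambda>y. H y * gauss_kernel r \<sigma> y z) \<in> borel_measurable \<Lambda>"
      using Hm gi(1) by (intro borel_measurable_times) auto
    show "AE y in \<Lambda>. norm (H y * gauss_kernel r \<sigma> y z) \<le> norm (C * gauss_kernel r \<sigma> y z)"
      using bnd Cpos by (auto simp: abs_mult norm_g intro!: mult_right_mono gauss_kernel_nonneg)
  qed
  have diff: "\<bar>(\<integral>y. H y * gauss_kernel r \<sigma> y z \<partial>\<Lambda>) - H z\<bar> \<le> L * r * \<sigma>" for z
  proof -
    have im: "integrable \<Lambda> (\<lambda>y. gauss_kernel r \<sigma> y z * \<bar>y i - z i\<bar>)"
      "(\<integral>y. gauss_kernel r \<sigma> y z * \<bar>y i - z i\<bar> \<partial>\<Lambda>) \<le> \<sigma>" if "i < r" for i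
      using gauss_kernel_moment[OF \<sigma> that, of z] unfolding \<Lambda>_def by auto
    have isum: "integrable \<Lambda> (\<lambda>y. L * (\<Sum>i<r. gauss_kernel r \<sigma> y z * \<bar>y i - z i\<bar>))"
      using im(1) by auto
    have "(\<integral>y. H y * gauss_kernel r \<sigma> y z \<partial>\<Lambda>) - H z = (\<integral>y. (H y - H z) * gauss_kernel r \<sigma> y z \<partial>\<Lambda>)"
      using int5[of z] gi by (simp add: left_diff_distrib)
    also have "\<bar>\<dots>\<bar> \<le> (\<integral>y. L * (\<Sum>i<r. gauss_kernel r \<sigma> y z * \<bar>y i - z i\<bar>) \<partial>\<Lambda>)"
    proof (rule integral_abs_le)
      show "integrable \<Lambda> (\<lambda>y. L * (\<Sum>i<r. gauss_kernel r \<sigma> y z * \<bar>y i - z i\<bar>))" by (rule isum)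
      show "integrable \<Lambda> (\<lambda>y. (H y - H z) * gauss_kernel r \<sigma> y z)"
        using int5[of z] gi(1)[of z] by (simp add: left_diff_distrib)
      show "\<bar>(H y - H z) * gauss_kernel r \<sigma> y z\<bar> \<le> L * (\<Sum>i<r. gauss_kernel r \<sigma> y z * \<bar>y i - z i\<bar>)" for y
        using mult_right_mono[OF lip[of y z] gauss_kernel_nonneg[of r \<sigma> y z]]
        by (simp add: abs_mult norm_g sum_distrib_left sum_distrib_right ac_simps)
    qed
    also have "\<dots> = L * (\<Sum>i<r. \<integral>y. gauss_kernel r \<sigma> y z * \<bar>y i - z i\<bar> \<partial>\<Lambda>)"
      using im(1) by simp
    also have "\<dots> \<le> L * (\<Sum>i<r. \<sigma>)"
      using im(2) L by (intro mult_left_mono sum_mono) auto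
    finally show ?thesis by (simp add: ac_simps)
  qed
  have "(\<integral>y. H y * q y \<partial>\<Lambda>) - (\<integral>w. H (Z w) \<partial>M) =
      (\<integral>w. (\<integral>y. H y * gauss_kernel r \<sigma> y (Z w) \<partial>\<Lambda>) - H (Z w) \<partial>M)"
    unfolding e1 using int3 int4 by simp
  also have "\<bar>\<dots>\<bar> \<le> (\<integral>w. L * r * \<sigma> \<partial>M)"
    by (rule integral_abs_le) (use int3 int4 diff in auto)
  finally show "\<bar>(\<integral>y. H y * q y \<partial>\<Lambda>) - (\<integral>w. H (Z w) \<partial>M)\<bar> \<le> L * r * \<sigma>"
    by (simp add: prob_space)
  let ?G = "\<Pi>\<^sub>M j\<in>{..<r}. std_normal_distribution"
  interpret G: pair_prob_space M ?G ..
  let ?c = "complex_of_real ((1 / sqrt (2 * pi * \<sigma>\<^sup>2)) ^ r)"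
  have Gcomp: "(\<lambda>v. v j) \<in> borel_measurable ?G" if "j < r" for j
    using measurable_component_singleton[of j "{..<r}" "\<lambda>_. std_normal_distribution"] that by simp
  have "(\<lambda>p. (y j - Z (fst p) j) / \<sigma> * snd p j) \<in> borel_measurable (M \<Otimes>\<^sub>M ?G)" if "j < r" for j y
    using measurable_compose[OF measurable_snd Gcomp[OF that]]
      measurable_compose[OF measurable_fst Z[OF that]] by measurable
  then have em: "(\<lambda>p. iexp (\<Sum>j<r. (y j - Z (fst p) j) / \<sigma> * snd p j)) \<in> borel_measurable (M \<Otimes>\<^sub>M ?G)" for y
    by measurable
  have "complex_of_real (q y) = (\<integral>w. complex_of_real (gauss_kernel r \<sigma> y (Z w)) \<partial>M)"
    unfolding q_def by (simp only: integral_complex_of_real)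
  also have "\<dots> = ?c * (\<integral>w. (\<integral>v. iexp (\<Sum>j<r. (y j - Z w j) / \<sigma> * v j) \<partial>?G) \<partial>M)"
    unfolding gauss_kernel_fourier[OF \<sigma>] by (rule integral_mult_right_zero)
  also have "(\<integral>w. (\<integral>v. iexp (\<Sum>j<r. (y j - Z w j) / \<sigma> * v j) \<partial>?G) \<partial>M)
     = (\<integral>v. (\<integral>w. iexp (\<Sum>j<r. (y j - Z w j) / \<sigma> * v j) \<partial>M) \<partial>?G)"
    by (rule G.Fubini_integral[symmetric], rule G.integrable_const_bound[where B=1])
       (use em in \<open>auto simp: split_beta'\<close>)
  also have "\<dots> = (\<integral>v. iexp (\<Sum>j<r. y j / \<sigma> * v j) * (\<integral>w. iexp (\<Sum>j<r. - v j / \<sigma> * Z w j) \<partial>M) \<partial>?G)"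
  proof (rule Bochner_Integration.integral_cong[OF refl])
    fix v
    have "iexp (\<Sum>j<r. (y j - Z w j) / \<sigma> * v j) =
        iexp (\<Sum>j<r. y j / \<sigma> * v j) * iexp (\<Sum>j<r. - v j / \<sigma> * Z w j)" for w
    proof -
      have "(\<Sum>j<r. (y j - Z w j) / \<sigma> * v j) = (\<Sum>j<r. y j / \<sigma> * v j) + (\<Sum>j<r. - v j / \<sigma> * Z w j)"
        by (simp add: sum.distrib[symmetric] diff_divide_distrib left_diff_distrib right_diff_distrib ac_simps)
      then show ?thesis by (simp only: of_real_add distrib_left exp_add)
    qed
    then show "(\<integral>w. iexp (\<Sum>j<r. (y j - Z w j) / \<sigma> * v j) \<partial>M) =
      iexp (\<Sum>j<r. y j / \<sigma> * v j) * (\<integral>w. iexp (\<Sum>j<r. - v j / \<sigma> * Z w j) \<partial>M)"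
      by (simp only: integral_mult_right_zero)
  qed
  finally show "complex_of_real (q y) = ?c *
      (\<integral>v. iexp (\<Sum>j<r. y j / \<sigma> * v j) * (\<integral>w. iexp (\<Sum>j<r. - v j / \<sigma> * Z w j) \<partial>M) \<partial>?G)" .
qed

theorem fidi_convergence:
  fixes H :: "(nat \<Rightarrow> real) \<Rightarrow> real"
  assumes M: "prob_space M" and N: "prob_space N"
    and Z: "\<And>n j. j < r \<Longrightarrow> (\<lambda>w. Z n w j) \<in> borel_measurable M"
    and W: "\<And>j. j < r \<Longrightarrow> (\<lambda>v. W v j) \<in> borel_measurable N"
    and char: "\<And>c. (\<lambda>n. \<integral>w. iexp (\<Sum>j<r. c j * Z n w j) \<partial>M) \<longlonglongrightarrow> (\<integral>v. iexp (\<Sum>j<r. c j * W v j) \<partial>N)"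
    and lip: "\<And>y z. \<bar>H y - H z\<bar> \<le> L * (\<Sum>j<r. \<bar>y j - z j\<bar>)"
    and bnd: "\<And>z. \<bar>H z\<bar> \<le> C" and L: "L \<ge> 0"
  shows "(\<lambda>n. \<integral>w. H (Z n w) \<partial>M) \<longlonglongrightarrow> (\<integral>v. H (W v) \<partial>N)"
proof (rule LIMSEQ_I)
  fix e :: real assume e: "e > 0"
  interpret M: prob_space M by fact
  interpret N: prob_space N by fact
  define \<sigma> where "\<sigma> = e / (4 * (L * r + 1))"
  have Lr: "L * r \<ge> 0" using L by simp
  have \<sigma>: "\<sigma> > 0" unfolding \<sigma>_def using e Lr by simp
  have "L * r * \<sigma> = (L * r / (L * r + 1)) * (e / 4)"
    unfolding \<sigma>_def by (simp add: field_simps)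
  also have "\<dots> \<le> 1 * (e / 4)"
    by (rule mult_right_mono) (use e Lr in auto)
  finally have Le: "L * r * \<sigma> \<le> e / 4" by simp
  let ?G = "\<Pi>\<^sub>M j\<in>{..<r}. std_normal_distribution"
  define \<Lambda> where "\<Lambda> = (\<Pi>\<^sub>M j\<in>{..<r}. (lborel :: real measure))"
  define qn where "qn n = smoothed_density M (Z n) r \<sigma>" for n
  define q where "q = smoothed_density N W r \<sigma>"
  have Z': "\<forall>j<r. (\<lambda>w. Z n w j) \<in> borel_measurable M" for n using Z by blast
  have W': "\<forall>j<r. (\<lambda>w. W w j) \<in> borel_measurable N" using W by blast
  note sn = smoothed_density_props[OF M \<sigma> Z' lip bnd L, folded \<Lambda>_def, folded qn_def]
  note sw = smoothed_density_props[OF N \<sigma> W' lip bnd L, folded \<Lambda>_def, folded q_def]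
  have pt: "(\<lambda>n. qn n y) \<longlonglongrightarrow> q y" for y
  proof -
    have Gcomp: "(\<lambda>v. v j) \<in> borel_measurable ?G" if "j < r" for j
      using measurable_component_singleton[of j "{..<r}" "\<lambda>_. std_normal_distribution"] that by simp
    have ms: "(\<lambda>v. iexp (\<Sum>j<r. y j / \<sigma> * v j) * (\<integral>w. iexp (\<Sum>j<r. - v j / \<sigma> * Z' w j) \<partial>M')) \<in> borel_measurable ?G"
      if "prob_space M'" "\<And>j. j < r \<Longrightarrow> (\<lambda>w. Z' w j) \<in> borel_measurable M'" for M' :: "'z measure" and Z'
    proof -
      interpret M': prob_space M' by fact
      have "(\<lambda>p. - (fst p j) / \<sigma> * Z' (snd p) j) \<in> borel_measurable (?G \<Otimes>\<^sub>M M')" if "j < r" for j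
        using measurable_compose[OF measurable_fst Gcomp[OF that]]
          measurable_compose[OF measurable_snd \<open>\<And>j. j < r \<Longrightarrow> (\<lambda>w. Z' w j) \<in> borel_measurable M'\<close>[OF that]]
        by measurable
      then have "(\<lambda>p. iexp (\<Sum>j<r. - (fst p j) / \<sigma> * Z' (snd p) j)) \<in> borel_measurable (?G \<Otimes>\<^sub>M M')"
        by measurable
      then have "(\<lambda>v. \<integral>w. iexp (\<Sum>j<r. - v j / \<sigma> * Z' w j) \<partial>M') \<in> borel_measurable ?G"
        using M'.borel_measurable_lebesgue_integral[of "\<lambda>v w. iexp (\<Sum>j<r. - v j / \<sigma> * Z' w j)" ?G]
        by (simp add: split_beta')
      then show ?thesis
        by (intro borel_measurable_exp borel_measurable_times borel_measurable_of_real borel_measurable_sum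
            Gcomp borel_measurable_const) auto
    qed
    have "(\<lambda>n. complex_of_real (qn n y)) \<longlonglongrightarrow> complex_of_real (q y)"
      unfolding sn(5) sw(5)
    proof (rule tendsto_mult[OF tendsto_const integral_dominated_convergence[where w="\<lambda>_. 1"]])
      show "(\<lambda>v. iexp (\<Sum>j<r. y j / \<sigma> * v j) * (\<integral>w. iexp (\<Sum>j<r. - v j / \<sigma> * W w j) \<partial>N)) \<in> borel_measurable ?G"
        by (rule ms[OF N W])
      show "(\<lambda>v. iexp (\<Sum>j<r. y j / \<sigma> * v j) * (\<integral>w. iexp (\<Sum>j<r. - v j / \<sigma> * Z n w j) \<partial>M)) \<in> borel_measurable ?G" for n
        by (rule ms[OF M Z])
      show "AE v in ?G. (\<lambda>n. iexp (\<Sum>j<r. y j / \<sigma> * v j) * (\<integral>w. iexp (\<Sum>j<r. - v j / \<sigma> * Z n w j) \<partial>M))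
        \<longlonglongrightarrow> iexp (\<Sum>j<r. y j / \<sigma> * v j) * (\<integral>w. iexp (\<Sum>j<r. - v j / \<sigma> * W w j) \<partial>N)"
        by (intro AE_I2 tendsto_mult tendsto_const char)
      show "AE v in ?G. norm (iexp (\<Sum>j<r. y j / \<sigma> * v j) * (\<integral>w. iexp (\<Sum>j<r. - v j / \<sigma> * Z n w j) \<partial>M)) \<le> 1" for n
      proof (rule AE_I2)
        fix v
        have "norm (\<integral>w. iexp (\<Sum>j<r. - v j / \<sigma> * Z n w j) \<partial>M) \<le> (\<integral>w. norm (iexp (\<Sum>j<r. - v j / \<sigma> * Z n w j)) \<partial>M)"
          by (rule integral_norm_bound)
        also have "\<dots> = 1" by (simp add: M.prob_space)
        finally show "norm (iexp (\<Sum>j<r. y j / \<sigma> * v j) * (\<integral>w. iexp (\<Sum>j<r. - v j / \<sigma> * Z n w j) \<partial>M)) \<le> 1"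
          by (simp add: norm_mult)
      qed
    qed (rule std_normal_prod.integrable_const)
    then show ?thesis by (simp only: tendsto_of_real_iff)
  qed
  have sch: "(\<lambda>n. \<integral>\<^sup>+y. norm (qn n y - q y) \<partial>\<Lambda>) \<longlonglongrightarrow> 0"
    by (rule Scheffe_lemma2) (use sn(1,2) sw(1,2) pt in auto)
  have C: "C \<ge> 0" using bnd[of undefined] by linarith
  have "(\<lambda>n. ennreal C * (\<integral>\<^sup>+y. norm (qn n y - q y) \<partial>\<Lambda>)) \<longlonglongrightarrow> ennreal C * 0"
    by (rule ennreal_tendsto_cmult[OF _ sch]) simp
  then have "eventually (\<lambda>n. ennreal C * (\<integral>\<^sup>+y. norm (qn n y - q y) \<partial>\<Lambda>) < ennreal (e / 4)) sequentially"
    by (rule order_tendstoD(2)) (use e in simp)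
  then obtain n0 where n0: "\<And>n. n \<ge> n0 \<Longrightarrow> ennreal C * (\<integral>\<^sup>+y. norm (qn n y - q y) \<partial>\<Lambda>) < ennreal (e / 4)"
    unfolding eventually_sequentially by blast
  have "norm ((\<integral>w. H (Z n w) \<partial>M) - (\<integral>v. H (W v) \<partial>N)) < e" if "n \<ge> n0" for n
  proof -
    have i1: "integrable \<Lambda> (\<lambda>y. C * norm (qn n y - q y))" using sn(1) sw(1) by auto
    have "\<bar>(\<integral>y. H y * qn n y \<partial>\<Lambda>) - (\<integral>y. H y * q y \<partial>\<Lambda>)\<bar> = \<bar>\<integral>y. H y * qn n y - H y * q y \<partial>\<Lambda>\<bar>"
      using sn(3) sw(3) by simp
    also have "\<dots> \<le> (\<integral>y. C * norm (qn n y - q y) \<partial>\<Lambda>)"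
    proof (rule integral_abs_le)
      show "integrable \<Lambda> (\<lambda>y. C * norm (qn n y - q y))" by (rule i1)
      show "integrable \<Lambda> (\<lambda>y. H y * qn n y - H y * q y)" using sn(3) sw(3) by simp
      show "\<bar>H y * qn n y - H y * q y\<bar> \<le> C * norm (qn n y - q y)" for y
        using mult_right_mono[OF bnd[of y] abs_ge_zero[of "qn n y - q y"]]
        by (simp add: right_diff_distrib[symmetric] abs_mult)
    qed
    also have "\<dots> < e / 4"
    proof -
      have "ennreal (\<integral>y. C * norm (qn n y - q y) \<partial>\<Lambda>) = (\<integral>\<^sup>+y. ennreal (C * norm (qn n y - q y)) \<partial>\<Lambda>)"
        using i1 C by (intro nn_integral_eq_integral[symmetric]) auto
      also have "\<dots> = ennreal C * (\<integral>\<^sup>+y. norm (qn n y - q y) \<partial>\<Lambda>)"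
        using C sn(1)[of n] sw(1) by (simp add: ennreal_mult nn_integral_cmult)
      finally have "ennreal (\<integral>y. C * norm (qn n y - q y) \<partial>\<Lambda>) < ennreal (e / 4)" using n0[OF that] by simp
      then show ?thesis using e by (simp add: ennreal_less_iff C)
    qed
    finally show ?thesis using sn(4)[of n] sw(4) Le unfolding real_norm_def by linarith
  qed
  then show "\<exists>no. \<forall>n\<ge>no. norm ((\<integral>w. H (Z n w) \<partial>M) - (\<integral>v. H (W v) \<partial>N)) < e" by blast
qed

subsection \<open>Gaussian sequences\<close>

definition psd_kernel :: "(nat \<Rightarrow> nat \<Rightarrow> real) \<Rightarrow> bool" where
  "psd_kernel K \<longleftrightarrow> (\<forall>i j. K i j = K j i) \<and> (\<forall>n c. 0 \<le> (\<Sum>i<n. \<Sum>j<n. c i * c j * K i j))"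

lemma psd_kernel_sym: "psd_kernel K \<Longrightarrow> K i j = K j i"
  by (auto simp: psd_kernel_def)

lemma psd_kernel_quad: "psd_kernel K \<Longrightarrow> 0 \<le> (\<Sum>i<n. \<Sum>j<n. c i * c j * K i j)"
  by (auto simp: psd_kernel_def)

lemma psd_kernel_diag:
  assumes "psd_kernel K"
  shows "0 \<le> K m m"
proof -
  let ?c = "\<lambda>l. if l = m then 1 else 0 :: real"
  have "0 \<le> (\<Sum>i<Suc m. \<Sum>j<Suc m. ?c i * ?c j * K i j)"
    by (rule psd_kernel_quad[OF assms])
  also have "\<dots> = (\<Sum>i<Suc m. if i = m then \<Sum>j<Suc m. if j = m then K i j else 0 else 0)"
    by (intro sum.cong refl) (auto intro!: sum.neutral)
  also have "\<dots> = K m m" by simp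
  finally show ?thesis .
qed

lemma psd_kernel_two:
  assumes "psd_kernel K" "i \<noteq> m"
  shows "0 \<le> K i i + 2 * t * K i m + t\<^sup>2 * K m m"
proof -
  define c where "c l = (if l = i then 1 else if l = m then t else 0)" for l
  define n where "n = Suc (max i m)"
  have s: "(\<Sum>l<n. c l * F l) = F i + t * F m" for F
  proof -
    have "(\<Sum>l<n. c l * F l) = (\<Sum>l\<in>{i, m}. c l * F l)"
      by (rule sum.mono_neutral_right) (auto simp: n_def c_def)
    then show ?thesis using assms(2) by (simp add: c_def)
  qed
  have "0 \<le> (\<Sum>i<n. \<Sum>j<n. c i * c j * K i j)"
    by (rule psd_kernel_quad[OF assms(1)])
  also have "\<dots> = (\<Sum>i<n. c i * (\<Sum>j<n. c j * K i j))"
    by (simp only: sum_distrib_left mult.assoc)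
  also have "\<dots> = (K i i + t * K i m) + t * (K m i + t * K m m)"
    by (simp only: s)
  finally show ?thesis
    using psd_kernel_sym[OF assms(1), of m i] by (simp add: algebra_simps power2_eq_square)
qed

lemma psd_kernel_zero_diag:
  assumes "psd_kernel K" "K m m = 0"
  shows "K i m = 0"
proof (rule ccontr)
  assume ne: "K i m \<noteq> 0"
  then have im: "i \<noteq> m" using assms(2) by auto
  have "0 \<le> K i i + 2 * (- (K i i + 1) / (2 * K i m)) * K i m"
    using psd_kernel_two[OF assms(1) im, of "- (K i i + 1) / (2 * K i m)"] assms(2) by simp
  then show False using ne by (simp add: field_simps)
qed

text \<open>If \<open>K m m = 0\<close>, then the quotient is \<open>0\<close>, in agreement with \<open>psd_kernel_zero_diag\<close>.\<close>

lemma psd_kernel_schur: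
  assumes K: "psd_kernel K"
  shows "psd_kernel (\<lambda>i j. K i j - K i m * K m j / K m m)"
proof (cases "K m m = 0")
  case True
  then show ?thesis using K by simp
next
  case False
  have sym: "K i j = K j i" for i j by (rule psd_kernel_sym[OF K])
  have "0 \<le> (\<Sum>i<n. \<Sum>j<n. c i * c j * (K i j - K i m * K m j / K m m))" for n c
  proof -
    define b where "b = (\<Sum>j<n. c j * K m j)"
    define N where "N = Suc (max n m)"
    define c0 where "c0 i = (if i < n then c i else 0)" for i
    define t where "t = b / K m m"
    have nN: "{..<n} \<subseteq> {..<N}" by (auto simp: N_def)
    have s0: "(\<Sum>i<N. c0 i * F i) = (\<Sum>i<n. c i * F i)" for F
      unfolding c0_def using nN
      by (intro sum.mono_neutral_cong_right) auto
    have sm: "(\<Sum>i<N. (if i = m then t else 0) * F i) = t * F m" for F :: "nat \<Rightarrow> real"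
    proof -
      have "(\<Sum>i<N. (if i = m then t else 0) * F i) = (\<Sum>i<N. if i = m then t * F i else 0)"
        by (rule sum.cong) auto
      also have "\<dots> = t * F m" by (simp add: N_def)
      finally show ?thesis .
    qed
    have s1: "(\<Sum>i<N. (c0 i - (if i = m then t else 0)) * F i) = (\<Sum>i<n. c i * F i) - t * F m" for F
      using s0[of F] sm[of F] by (simp add: left_diff_distrib sum_subtractf)
    have "0 \<le> (\<Sum>i<N. \<Sum>j<N. (c0 i - (if i = m then t else 0)) * (c0 j - (if j = m then t else 0)) * K i j)"
      by (rule psd_kernel_quad[OF K])
    also have "\<dots> = (\<Sum>i<N. (c0 i - (if i = m then t else 0)) * (\<Sum>j<N. (c0 j - (if j = m then t else 0)) * K i j))"
      by (simp add: sum_distrib_left mult.assoc)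
    also have "\<dots> = (\<Sum>i<n. c i * ((\<Sum>j<n. c j * K i j) - t * K i m)) - t * ((\<Sum>j<n. c j * K m j) - t * K m m)"
      unfolding s1 ..
    also have "\<dots> = (\<Sum>i<n. c i * (\<Sum>j<n. c j * K i j)) - t * (\<Sum>i<n. c i * K i m) - t * (b - t * K m m)"
      by (simp add: b_def right_diff_distrib sum_subtractf sum_distrib_left ac_simps)
    also have "(\<Sum>i<n. c i * K i m) = b" unfolding b_def by (simp add: sym[of _ m])
    also have "t * (b - t * K m m) = 0" using False by (simp add: t_def)
    also have "(\<Sum>i<n. c i * (\<Sum>j<n. c j * K i j)) - t * b - 0 =
        (\<Sum>i<n. \<Sum>j<n. c i * c j * (K i j - K i m * K m j / K m m))"
    proof -
      have "t * b = (\<Sum>i<n. c i * K m i) * (\<Sum>j<n. c j * K m j) / K m m"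
        by (simp add: t_def b_def)
      also have "\<dots> = (\<Sum>i<n. \<Sum>j<n. c i * c j * (K i m * K m j / K m m))"
        unfolding sum_product sum_divide_distrib
      proof (intro sum.cong refl)
        fix i j
        show "c i * K m i * (c j * K m j) / K m m = c i * c j * (K i m * K m j / K m m)"
          unfolding sym[of i m] by simp
      qed
      finally show ?thesis
        by (simp add: right_diff_distrib sum_subtractf sum_distrib_left mult.assoc)
    qed
    finally show ?thesis .
  qed
  then show ?thesis
    unfolding psd_kernel_def
  proof (intro conjI allI)
    show "K i j - K i m * K m j / K m m = K j i - K j m * K m i / K m m" for i j
      unfolding sym[of i j] sym[of i m] sym[of j m] by simp
  qed blast
qed

fun cholesky_residual :: "(nat \<Rightarrow> nat \<Rightarrow> real) \<Rightarrow> nat \<Rightarrow> nat \<Rightarrow> nat \<Rightarrow> real" where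
  "cholesky_residual K 0 = K"
| "cholesky_residual K (Suc n) = (\<lambda>i j. cholesky_residual K n i j -
      cholesky_residual K n i n * cholesky_residual K n n j / cholesky_residual K n n n)"

definition cholesky :: "(nat \<Rightarrow> nat \<Rightarrow> real) \<Rightarrow> nat \<Rightarrow> nat \<Rightarrow> real" where
  "cholesky K i l = cholesky_residual K l i l / sqrt (cholesky_residual K l l l)"

lemma psd_cholesky_residual: "psd_kernel K \<Longrightarrow> psd_kernel (cholesky_residual K n)"
  by (induction n) (auto intro: psd_kernel_schur simp del: One_nat_def)

lemma cholesky_residual_zero:
  assumes "psd_kernel K" "i < n"
  shows "cholesky_residual K n i j = 0"
  using assms(2)
proof (induction n arbitrary: i j)
  case (Suc n)
  note psd = psd_cholesky_residual[OF assms(1), of n]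
  show ?case
  proof (cases "i = n")
    case True
    then show ?thesis
      using psd_kernel_zero_diag[OF psd, of n j] psd_kernel_sym[OF psd, of n j]
      by (cases "cholesky_residual K n n n = 0") auto
  next
    case False
    then have "i < n" using Suc by simp
    then show ?thesis using Suc.IH[of i] by simp
  qed
qed simp

lemma cholesky_upper:
  assumes "psd_kernel K" "i < l"
  shows "cholesky K i l = 0"
  using cholesky_residual_zero[OF assms] by (simp add: cholesky_def)

lemma cholesky_factorization:
  assumes K: "psd_kernel K" and "i < n"
  shows "(\<Sum>l<n. cholesky K i l * cholesky K j l) = K i j"
proof -
  have "cholesky K i l * cholesky K j l = cholesky_residual K l i j - cholesky_residual K (Suc l) i j" for l
  proof -
    note psd = psd_cholesky_residual[OF K, of l]
    show ?thesis
      using psd_kernel_diag[OF psd, of l] psd_kernel_sym[OF psd, of l j]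
      by (simp add: cholesky_def)
  qed
  then have "(\<Sum>l<n. cholesky K i l * cholesky K j l) = cholesky_residual K 0 i j - cholesky_residual K n i j"
    by (simp only: sum_lessThan_telescope'[of "\<lambda>l. cholesky_residual K l i j"])
  then show ?thesis using cholesky_residual_zero[OF assms] by simp
qed

definition gaussian_seq :: "(nat \<Rightarrow> nat \<Rightarrow> real) \<Rightarrow> (nat \<Rightarrow> real) \<Rightarrow> nat \<Rightarrow> real" where
  "gaussian_seq K w i = (\<Sum>l\<le>i. cholesky K i l * w l)"

abbreviation std_normal_seq :: "(nat \<Rightarrow> real) measure" where
  "std_normal_seq \<equiv> \<Pi>\<^sub>M l\<in>UNIV. std_normal_distribution"

lemma gaussian_seq_measurable [measurable]: "(\<lambda>w. gaussian_seq K w i) \<in> borel_measurable std_normal_seq"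
proof -
  have "(\<lambda>w. w l) \<in> borel_measurable std_normal_seq" for l :: nat
    using measurable_component_singleton[of l UNIV "\<lambda>_. std_normal_distribution"] by simp
  then show ?thesis unfolding gaussian_seq_def by measurable
qed

lemma char_finite_std_normal:
  "(\<integral>w. iexp (\<Sum>l<n. b l * w l) \<partial>std_normal_seq) = exp (- (\<Sum>l<n. (b l)\<^sup>2) / 2)"
proof -
  let ?P = "\<Pi>\<^sub>M l\<in>{..<n}. std_normal_distribution"
  have int: "integrable std_normal_distribution (\<lambda>v. iexp (t * v))" for t
    by (rule std_normal_space.integrable_const_bound[where B=1]) auto
  have 1: "(\<integral>v. iexp (t * v) \<partial>std_normal_distribution) = of_real (exp (- t\<^sup>2 / 2))" for t
    using char_std_normal_distribution by (simp add: char_def fun_eq_iff)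
  have m: "(\<lambda>w. w l) \<in> borel_measurable ?P" if "l < n" for l
    using measurable_component_singleton[of l "{..<n}" "\<lambda>_. std_normal_distribution"] that by simp
  have "(\<integral>w. iexp (\<Sum>l<n. b l * w l) \<partial>std_normal_seq) =
      (\<integral>w. iexp (\<Sum>l<n. b l * restrict w {..<n} l) \<partial>std_normal_seq)" by simp
  also have "\<dots> = (\<integral>w. iexp (\<Sum>l<n. b l * w l) \<partial>distr std_normal_seq ?P (\<lambda>w. restrict w {..<n}))"
  proof (rule integral_distr[symmetric])
    show "(\<lambda>w. restrict w {..<n}) \<in> measurable std_normal_seq ?P"
      by (rule measurable_restrict_subset) simp
    show "(\<lambda>w. iexp (\<Sum>l<n. b l * w l)) \<in> borel_measurable ?P"
      using m by measurable
  qed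
  also have "distr std_normal_seq ?P (\<lambda>w. restrict w {..<n}) = ?P"
    by (rule std_normal_prod.distr_PiM_restrict_finite) auto
  also have "(\<integral>w. iexp (\<Sum>l<n. b l * w l) \<partial>?P) = (\<integral>w. (\<Prod>l<n. iexp (b l * w l)) \<partial>?P)"
    by (simp add: exp_sum sum_distrib_left)
  also have "\<dots> = (\<Prod>l<n. \<integral>v. iexp (b l * v) \<partial>std_normal_distribution)"
    by (rule std_normal_prod.product_integral_prod) (blast intro: int finite_lessThan)+
  also have "\<dots> = (\<Prod>l<n. of_real (exp (- (b l)\<^sup>2 / 2)))"
    by (simp only: 1)
  also have "\<dots> = of_real (\<Prod>l<n. exp (- (b l)\<^sup>2 / 2))"
    by (simp only: of_real_prod)
  also have "(\<Prod>l<n. exp (- (b l)\<^sup>2 / 2)) = exp (- (\<Sum>l<n. (b l)\<^sup>2) / 2)"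
    by (simp add: exp_sum[symmetric] sum_negf sum_divide_distrib)
  finally show ?thesis .
qed

lemma char_gaussian_seq:
  fixes r :: nat
  assumes K: "psd_kernel K"
  shows "(\<integral>w. iexp (\<Sum>i<r. c i * gaussian_seq K w (e i)) \<partial>std_normal_seq) =
    exp (- (\<Sum>i<r. \<Sum>j<r. c i * c j * K (e i) (e j)) / 2)"
proof -
  define n where "n = Suc (\<Sum>i<r. e i)"
  have en: "e i < n" if "i < r" for i
    unfolding n_def less_Suc_eq_le by (rule member_le_sum) (use that in auto)
  define b where "b l = (\<Sum>i<r. c i * cholesky K (e i) l)" for l
  have g: "gaussian_seq K w i = (\<Sum>l<n. cholesky K i l * w l)" if "i < n" for i w
    unfolding gaussian_seq_def using that cholesky_upper[OF K]
    by (intro sum.mono_neutral_left) auto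
  have "(\<Sum>i<r. c i * gaussian_seq K w (e i)) = (\<Sum>l<n. b l * w l)" for w
  proof -
    have "(\<Sum>i<r. c i * gaussian_seq K w (e i)) = (\<Sum>i<r. \<Sum>l<n. c i * cholesky K (e i) l * w l)"
      by (intro sum.cong refl) (simp add: g en sum_distrib_left mult.assoc)
    also have "\<dots> = (\<Sum>l<n. \<Sum>i<r. c i * cholesky K (e i) l * w l)" by (rule sum.swap)
    finally show ?thesis by (simp add: b_def sum_distrib_right)
  qed
  moreover have "(\<Sum>l<n. (b l)\<^sup>2) = (\<Sum>i<r. \<Sum>j<r. c i * c j * K (e i) (e j))"
  proof -
    have "(\<Sum>l<n. (b l)\<^sup>2) = (\<Sum>l<n. \<Sum>i<r. \<Sum>j<r. c i * c j * (cholesky K (e i) l * cholesky K (e j) l))"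
      unfolding b_def power2_eq_square sum_product by (intro sum.cong refl) (simp add: ac_simps)
    also have "\<dots> = (\<Sum>i<r. \<Sum>l<n. \<Sum>j<r. c i * c j * (cholesky K (e i) l * cholesky K (e j) l))"
      by (rule sum.swap)
    also have "\<dots> = (\<Sum>i<r. \<Sum>j<r. \<Sum>l<n. c i * c j * (cholesky K (e i) l * cholesky K (e j) l))"
      by (intro sum.cong refl sum.swap)
    also have "\<dots> = (\<Sum>i<r. \<Sum>j<r. c i * c j * K (e i) (e j))"
      by (intro sum.cong refl) (simp add: sum_distrib_left[symmetric] cholesky_factorization[OF K] en)
    finally show ?thesis .
  qed
  ultimately show ?thesis by (simp only: char_finite_std_normal)
qed

subsection \<open>Bounded functions with the supremum metric\<close>

interpretation linf: Metric_space "mspace (linf T)" "mdist (linf T)" for T :: "'t set"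
  by (rule Metric_space_mspace_mdist)

lemma mtopology_linf: "mtopology_of (linf T) = linf.mtopology T"
  by (simp add: mtopology_of_def)

lemma openin_linf_subset: "openin (mtopology_of (linf T)) U \<Longrightarrow> U \<subseteq> mspace (linf T)"
  using openin_subset[of "mtopology_of (linf T)" U] by simp

lemma mspace_linf_bdd:
  assumes "y \<in> mspace (linf T)" "z \<in> mspace (linf T)"
  shows "bdd_above ((\<lambda>t. \<bar>y t - z t\<bar>) ` T)"
proof -
  obtain a b where "\<forall>t\<in>T. \<bar>y t\<bar> \<le> a" "\<forall>t\<in>T. \<bar>z t\<bar> \<le> b"
    using assms by (auto simp: mspace_linf bounded_iff)
  then have "\<bar>y t - z t\<bar> \<le> a + b" if "t \<in> T" for t
    using abs_triangle_ineq4[of "y t" "z t"] that by fastforce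
  then show ?thesis by (intro bdd_aboveI2) 
qed

lemma mdist_linf_upper:
  assumes "y \<in> mspace (linf T)" "z \<in> mspace (linf T)" "t \<in> T"
  shows "\<bar>y t - z t\<bar> \<le> mdist (linf T) y z"
proof -
  have "T \<noteq> {}" using assms by auto
  then show ?thesis
    using mdist_linf[OF assms(1,2)] cSUP_upper[OF assms(3) mspace_linf_bdd[OF assms(1,2)]] by simp
qed

lemma mdist_linf_le:
  assumes "y \<in> mspace (linf T)" "z \<in> mspace (linf T)" "T \<noteq> {}" "\<And>t. t \<in> T \<Longrightarrow> \<bar>y t - z t\<bar> \<le> e"
  shows "mdist (linf T) y z \<le> e"
  unfolding mdist_linf[OF assms(1-3)] using assms(3,4) by (intro cSUP_least) auto

lemma space_linf_borel [simp]: "space (linf_borel T) = mspace (linf T)"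
  unfolding linf_borel_def by (rule space_measure_of) (use openin_linf_subset in blast)

lemma sets_linf_borel: "sets (linf_borel T) = sigma_sets (mspace (linf T)) {U. openin (mtopology_of (linf T)) U}"
  unfolding linf_borel_def by (rule sets_measure_of) (use openin_linf_subset in blast)

lemma continuous_map_linf_measurable:
  assumes "continuous_map (mtopology_of (linf T)) euclideanreal h"
  shows "h \<in> borel_measurable (linf_borel T)"
proof (rule borel_measurableI)
  fix U :: "real set" assume "open U"
  then have "openin (mtopology_of (linf T)) {z \<in> mspace (linf T). h z \<in> U}"
    using openin_continuous_map_preimage[OF assms, of U] by simp
  moreover have "h -` U \<inter> space (linf_borel T) = {z \<in> mspace (linf T). h z \<in> U}" by auto
  ultimately show "h -` U \<inter> space (linf_borel T) \<in> sets (linf_borel T)"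
    by (auto simp: sets_linf_borel)
qed

lemma lipschitz_linf_continuous:
  assumes "\<And>y z. y \<in> mspace (linf T) \<Longrightarrow> z \<in> mspace (linf T) \<Longrightarrow> \<bar>h y - h z\<bar> \<le> L * mdist (linf T) y z"
  shows "continuous_map (mtopology_of (linf T)) euclideanreal h"
proof -
  have "Lipschitz_continuous_map (linf T) euclidean_metric h"
    unfolding Lipschitz_continuous_map_def using assms by (auto simp: dist_real_def)
  from Lipschitz_continuous_imp_continuous_map[OF this] show ?thesis by simp
qed

lemma measurable_linf_borelI:
  assumes sp: "\<And>w. w \<in> space M \<Longrightarrow> W w \<in> mspace (linf T)"
    and meas: "\<And>\<phi>. (\<And>y z. y \<in> mspace (linf T) \<Longrightarrow> z \<in> mspace (linf T) \<Longrightarrow>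
        \<bar>\<phi> y - \<phi> z\<bar> \<le> mdist (linf T) y z) \<Longrightarrow> (\<lambda>w. \<phi> (W w)) \<in> borel_measurable M"
  shows "W \<in> measurable M (linf_borel T)"
  unfolding linf_borel_def
proof (rule measurable_measure_of)
  show "W \<in> space M \<rightarrow> mspace (linf T)" using sp by auto
  show "{U. openin (mtopology_of (linf T)) U} \<subseteq> Pow (mspace (linf T))" by (use openin_linf_subset in blast)
  fix U assume "U \<in> {U. openin (mtopology_of (linf T)) U}"
  then have U: "openin (linf.mtopology T) U" by (simp add: mtopology_linf)
  show "W -` U \<inter> space M \<in> sets M"
  proof (cases "mspace (linf T) - U = {}")
    case True
    then have "W -` U \<inter> space M = space M" using sp by auto
    then show ?thesis by simp
  next
    case False
    define C where "C = mspace (linf T) - U"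
    define \<phi> where "\<phi> y = (INF u\<in>C. mdist (linf T) y u)" for y
    have C: "C \<noteq> {}" "C \<subseteq> mspace (linf T)" using False by (auto simp: C_def)
    have bdd: "bdd_below ((\<lambda>u. mdist (linf T) y u) ` C)" for y
      by (intro bdd_belowI2[where m=0]) simp
    have tri: "\<phi> y \<le> mdist (linf T) y z + \<phi> z" if "y \<in> mspace (linf T)" "z \<in> mspace (linf T)" for y z
    proof -
      have "\<phi> y - mdist (linf T) y z \<le> \<phi> z" 
        unfolding \<phi>_def[of z]
      proof (rule cINF_greatest[OF C(1)])
        fix u assume u: "u \<in> C"
        have "\<phi> y \<le> mdist (linf T) y u" unfolding \<phi>_def by (rule cINF_lower[OF bdd u])
        also have "\<dots> \<le> mdist (linf T) y z + mdist (linf T) z u"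
          using linf.triangle that u C by blast
        finally show "\<phi> y - mdist (linf T) y z \<le> mdist (linf T) z u" by simp
      qed
      then show ?thesis by simp
    qed
    have "\<bar>\<phi> y - \<phi> z\<bar> \<le> mdist (linf T) y z" if "y \<in> mspace (linf T)" "z \<in> mspace (linf T)" for y z
      using tri[OF that] tri[OF that(2,1)] linf.commute[of T y z] by (simp add: abs_le_iff)
    then have m: "(\<lambda>w. \<phi> (W w)) \<in> borel_measurable M" by (rule meas)
    have pos: "y \<in> U \<longleftrightarrow> 0 < \<phi> y" if y: "y \<in> mspace (linf T)" for y
    proof
      assume "y \<in> U"
      then obtain e where e: "e > 0" "linf.mball T y e \<subseteq> U"
        using U by (auto simp: linf.openin_mtopology)
      have "e \<le> \<phi> y" unfolding \<phi>_def
      proof (rule cINF_greatest[OF C(1)])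
        fix u assume "u \<in> C"
        then show "e \<le> mdist (linf T) y u"
          using e(2) y by (force simp: C_def linf.in_mball subset_iff)
      qed
      then show "0 < \<phi> y" using e by simp
    next
      assume p: "0 < \<phi> y"
      show "y \<in> U"
      proof (rule ccontr)
        assume "y \<notin> U"
        then have "y \<in> C" using y by (simp add: C_def)
        then have "\<phi> y \<le> mdist (linf T) y y" unfolding \<phi>_def by (rule cINF_lower[OF bdd])
        then show False using p y by simp
      qed
    qed
    have "W -` U \<inter> space M = {w \<in> space M. 0 < \<phi> (W w)}"
      using pos sp by auto
    also have "\<dots> \<in> sets M" using m by measurable
    finally show ?thesis .
  qed
qed

subsection \<open>Outer expectations\<close>

context prob_space begin

lemma outer_expectation_le:
  assumes "integrable M U" "\<And>w. w \<in> space M \<Longrightarrow> f w \<le> U w" "\<And>w. w \<in> space M \<Longrightarrow> - C \<le> f w"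
  shows "outer_expectation M f \<le> integral\<^sup>L M U"
  unfolding outer_expectation_def
proof (rule cInf_lower)
  show "integral\<^sup>L M U \<in> {integral\<^sup>L M U |U. integrable M U \<and> (\<forall>w\<in>space M. f w \<le> U w)}"
    using assms by blast
  show "bdd_below {integral\<^sup>L M U |U. integrable M U \<and> (\<forall>w\<in>space M. f w \<le> U w)}"
  proof (rule bdd_belowI[of _ "- C"])
    fix r assume "r \<in> {integral\<^sup>L M U |U. integrable M U \<and> (\<forall>w\<in>space M. f w \<le> U w)}"
    then obtain U where U: "r = integral\<^sup>L M U" "integrable M U" "\<forall>w\<in>space M. f w \<le> U w" by blast
    have "(\<integral>w. - C \<partial>M) \<le> integral\<^sup>L M U"
      by (rule integral_mono) (use U assms(3) in \<open>auto intro: order_trans\<close>)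
    then show "- C \<le> r" using U by (simp add: prob_space)
  qed
qed

lemma outer_expectation_ge:
  assumes "\<And>w. w \<in> space M \<Longrightarrow> \<bar>f w\<bar> \<le> C"
  shows "- outer_expectation M (\<lambda>w. - f w) \<le> outer_expectation M f"
proof -
  let ?S = "\<lambda>f. {integral\<^sup>L M U |U. integrable M U \<and> (\<forall>w\<in>space M. f w \<le> U w)}"
  have ne: "?S f \<noteq> {}" if "\<And>w. w \<in> space M \<Longrightarrow> f w \<le> C" for f :: "'a \<Rightarrow> real"
    using that by (auto intro!: exI[of _ "\<lambda>_. C"])
  have "- r \<le> outer_expectation M f" if r: "r \<in> ?S (\<lambda>w. - f w)" for r
    unfolding outer_expectation_def
  proof (rule cInf_greatest)
    show "?S f \<noteq> {}" by (rule ne) (use assms in force)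
    fix s assume "s \<in> ?S f"
    then obtain U where U: "s = integral\<^sup>L M U" "integrable M U" "\<forall>w\<in>space M. f w \<le> U w" by blast
    obtain U' where U': "r = integral\<^sup>L M U'" "integrable M U'" "\<forall>w\<in>space M. - f w \<le> U' w" using r by blast
    have "0 \<le> (\<integral>w. U w + U' w \<partial>M)"
      by (rule integral_nonneg_AE) (use U U' in force)
    then show "- r \<le> s" using U U' by simp
  qed
  then have "- outer_expectation M f \<le> r" if "r \<in> ?S (\<lambda>w. - f w)" for r
    using that by force
  moreover have "?S (\<lambda>w. - f w) \<noteq> {}" by (rule ne) (use assms in force)
  ultimately have "- outer_expectation M f \<le> outer_expectation M (\<lambda>w. - f w)"
    unfolding outer_expectation_def[of M "\<lambda>w. - f w"] by (intro cInf_greatest) auto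
  then show ?thesis by simp
qed

lemma outer_expectation_tendstoI:
  assumes bnd: "\<And>n w. \<bar>f n w\<bar> \<le> C"
    and up: "\<And>e. e > 0 \<Longrightarrow> eventually (\<lambda>n. outer_expectation M (f n) \<le> l + e) sequentially"
    and lo: "\<And>e. e > 0 \<Longrightarrow> eventually (\<lambda>n. outer_expectation M (\<lambda>w. - f n w) \<le> - l + e) sequentially"
  shows "(\<lambda>n. outer_expectation M (f n)) \<longlonglongrightarrow> l"
proof (rule tendstoI)
  fix e :: real assume "e > 0"
  then have e: "e / 2 > 0" by simp
  show "eventually (\<lambda>n. dist (outer_expectation M (f n)) l < e) sequentially"
    using up[OF e] lo[OF e]
  proof eventually_elim
    case (elim n)
    have "- outer_expectation M (\<lambda>w. - f n w) \<le> outer_expectation M (f n)"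
      by (rule outer_expectation_ge) (rule bnd)
    then show ?case using elim \<open>e > 0\<close> by (simp add: dist_real_def abs_less_iff)
  qed
qed

end

subsection \<open>Centered normal laws\<close>

definition centered_normal :: "real \<Rightarrow> real measure" where
  "centered_normal v = (if v = 0 then return borel 0
     else density lborel (\<lambda>y. ennreal (normal_density 0 (sqrt v) y)))"

lemma centered_normal_is_normal: "v \<ge> 0 \<Longrightarrow> is_normal_law (centered_normal v)"
  unfolding centered_normal_def is_normal_law_def
  by (cases "v = 0") (simp, blast, simp, rule disjI2, rule exI[of _ 0], rule exI[of _ "sqrt v"], simp)

lemma real_distribution_centered_normal: "v \<ge> 0 \<Longrightarrow> real_distribution (centered_normal v)"
  unfolding centered_normal_def real_distribution_def real_distribution_axioms_def
  by (auto intro!: prob_space_return prob_space_normal_density)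

lemma char_centered_normal:
  assumes "v \<ge> 0"
  shows "char (centered_normal v) t = exp (- (t\<^sup>2 * v) / 2)"
proof (cases "v = 0")
  case True
  then show ?thesis by (simp add: centered_normal_def char_def integral_return)
next
  case False
  then have v: "v > 0" using assms by simp
  have "distributed std_normal_distribution lborel (\<lambda>x. x) std_normal_density"
    unfolding distributed_def by (auto simp: distr_id2)
  from std_normal_space.normal_density_affine[OF this, of "sqrt v" 0]
  have "distributed std_normal_distribution lborel (\<lambda>x. sqrt v * x) (normal_density 0 (sqrt v))"
    using v by simp
  then have "distr std_normal_distribution lborel (\<lambda>x. sqrt v * x) = centered_normal v"
    using v by (simp add: distributed_def centered_normal_def)
  then have "char (centered_normal v) t = char (distr std_normal_distribution lborel (\<lambda>x. sqrt v * x)) t" by simp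
  also have "\<dots> = char std_normal_distribution (t * sqrt v)"
    unfolding char_def by (subst integral_distr) (auto simp: mult.assoc)
  also have "\<dots> = exp (- (t\<^sup>2 * v) / 2)"
    using v by (simp add: char_std_normal_distribution power_mult_distrib)
  finally show ?thesis .
qed

lemma centered_normal_moments:
  assumes "v \<ge> 0"
  shows "integrable (centered_normal v) (\<lambda>x. x)" "(\<integral>x. x \<partial>centered_normal v) = 0"
    "integrable (centered_normal v) (\<lambda>x. x\<^sup>2)" "(\<integral>x. x\<^sup>2 \<partial>centered_normal v) = v"
proof -
  have "integrable (centered_normal v) (\<lambda>x. x) \<and> (\<integral>x. x \<partial>centered_normal v) = 0 \<and>
    integrable (centered_normal v) (\<lambda>x. x\<^sup>2) \<and> (\<integral>x. x\<^sup>2 \<partial>centered_normal v) = v"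
  proof (cases "v = 0")
    case True
    interpret R: prob_space "return borel (0::real)" by (rule prob_space_return) simp
    have "AE x in return borel (0::real). x = 0" by (subst AE_return) auto
    then have "AE x in return borel (0::real). norm x \<le> 0" "AE x in return borel (0::real). norm (x\<^sup>2) \<le> 0"
      by (auto elim: AE_mp)
    then show ?thesis using True
      by (auto simp: centered_normal_def integral_return intro!: R.integrable_const_bound[where B=0])
  next
    case False
    then have v: "0 < sqrt v" using assms by simp
    then show ?thesis
      using integrable_normal_moment[OF v, of 0 1] integral_normal_moment_odd[OF v, of 0 0]
        integrable_normal_moment[OF v, of 0 2] integral_normal_moment_even[OF v, of 0 1] False assms
      by (simp add: centered_normal_def integrable_density integral_density normal_density_nonneg fact_numeral)
  qed
  then show "integrable (centered_normal v) (\<lambda>x. x)" "(\<integral>x. x \<partial>centered_normal v) = 0"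
    "integrable (centered_normal v) (\<lambda>x. x\<^sup>2)" "(\<integral>x. x\<^sup>2 \<partial>centered_normal v) = v" by auto
qed

lemma distr_eq_centered_normal:
  assumes "prob_space N" "U \<in> borel_measurable N" "v \<ge> 0"
    and "\<And>s. (\<integral>w. iexp (s * U w) \<partial>N) = exp (- (s\<^sup>2 * v) / 2)"
  shows "distr N borel U = centered_normal v"
proof (rule Levy_uniqueness)
  interpret prob_space N by fact
  show "real_distribution (distr N borel U)" using assms by simp
  show "real_distribution (centered_normal v)" using assms by (simp add: real_distribution_centered_normal)
  show "char (distr N borel U) = char (centered_normal v)"
    using assms by (auto simp: fun_eq_iff char_def[of "distr N borel U"] integral_distr char_centered_normal)
qed

subsection \<open>Gaussian limits of equicontinuous processes\<close>

lemma norm_iexp_diff: "norm (iexp a - iexp b) \<le> \<bar>a - b\<bar>"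
proof -
  have "iexp a - iexp b = iexp b * (iexp (a - b) - 1)"
    by (simp add: algebra_simps exp_add[symmetric])
  also have "norm \<dots> = norm (iexp (a - b) - 1)" by (simp add: norm_mult)
  also have "\<dots> \<le> \<bar>a - b\<bar>" using iexp_approx1[of "a - b" 0] by simp
  finally show ?thesis .
qed

lemma geometric_increments_limit:
  fixes a :: "nat \<Rightarrow> real"
  assumes "\<And>m. m \<ge> m0 \<Longrightarrow> \<bar>a m - a (Suc m)\<bar> \<le> B * (1/2) ^ m"
  shows "a \<longlonglongrightarrow> lim a" "\<And>m. m \<ge> m0 \<Longrightarrow> \<bar>lim a - a m\<bar> \<le> 2 * B * (1/2) ^ m"
proof -
  have step: "\<bar>a (m + p) - a m\<bar> \<le> 2 * B * (1/2) ^ m * (1 - (1/2) ^ p)" if "m \<ge> m0" for m p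
  proof (induction p)
    case (Suc p)
    have "\<bar>a (m + Suc p) - a m\<bar> \<le> \<bar>a (m + p) - a (Suc (m + p))\<bar> + \<bar>a (m + p) - a m\<bar>" by simp
    also have "\<dots> \<le> B * (1/2) ^ (m + p) + 2 * B * (1/2) ^ m * (1 - (1/2) ^ p)"
      using Suc assms[of "m + p"] that by (intro add_mono) auto
    also have "\<dots> = 2 * B * (1/2) ^ m * (1 - (1/2) ^ Suc p)"
      by (simp add: power_add algebra_simps)
    finally show ?case .
  qed simp
  have B: "0 \<le> B * (1/2) ^ m" if "m \<ge> m0" for m
    using assms[OF that] by linarith
  have step': "\<bar>a n - a m\<bar> \<le> 2 * B * (1/2) ^ m" if "m0 \<le> m" "m \<le> n" for m n
  proof -
    have "\<bar>a n - a m\<bar> \<le> 2 * (B * (1/2) ^ m) * (1 - (1/2) ^ (n - m))"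
      using step[of m "n - m"] that by simp
    also have "\<dots> \<le> 2 * (B * (1/2) ^ m) * 1"
      using B[OF that(1)] by (intro mult_left_mono) auto
    finally show ?thesis by simp
  qed
  have "Cauchy a"
  proof (rule CauchyI')
    fix e :: real assume e: "e > 0"
    have "(\<lambda>m. 2 * B * (1/2) ^ m) \<longlonglongrightarrow> 2 * B * 0"
      by (intro tendsto_intros LIMSEQ_power_zero) auto
    then have "eventually (\<lambda>m. 2 * B * (1/2) ^ m < e) sequentially"
      using e by (intro order_tendstoD(2)) auto
    then obtain m1 where m1: "\<And>m. m \<ge> m1 \<Longrightarrow> 2 * B * (1/2) ^ m < e"
      unfolding eventually_sequentially by blast
    show "\<exists>M. \<forall>m\<ge>M. \<forall>n>m. dist (a m) (a n) < e"
    proof (intro exI allI impI)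
      fix m n assume "m \<ge> max m0 m1" "n > m"
      then show "dist (a m) (a n) < e"
        using step'[of m n] m1[of m] by (simp add: dist_real_def abs_minus_commute)
    qed
  qed
  then show lim: "a \<longlonglongrightarrow> lim a"
    by (simp add: Cauchy_convergent_iff convergent_LIMSEQ_iff)
  fix m assume m: "m \<ge> m0"
  have "(\<lambda>n. \<bar>a n - a m\<bar>) \<longlonglongrightarrow> \<bar>lim a - a m\<bar>" by (intro tendsto_intros lim)
  then show "\<bar>lim a - a m\<bar> \<le> 2 * B * (1/2) ^ m"
    by (rule LIMSEQ_le_const2) (use step' m in blast)
qed

locale gaussian_limit = prob_space M for M :: "'w measure" +
  fixes Z :: "nat \<Rightarrow> 'w \<Rightarrow> 't \<Rightarrow> real" and T :: "'t set" and K :: "'t \<Rightarrow> 't \<Rightarrow> real"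
  assumes nonempty: "T \<noteq> {}"
    and Z_measurable: "\<And>n t. t \<in> T \<Longrightarrow> (\<lambda>w. Z n w t) \<in> borel_measurable M"
    and K_sym: "\<And>s t. s \<in> T \<Longrightarrow> t \<in> T \<Longrightarrow> K s t = K t s"
    and char_limit: "\<And>r c (e :: nat \<Rightarrow> 't). (\<And>i. i < r \<Longrightarrow> e i \<in> T) \<Longrightarrow>
      (\<lambda>n. \<integral>w. iexp (\<Sum>i<r. c i * Z n w (e i)) \<partial>M) \<longlonglongrightarrow>
        complex_of_real (exp (- (\<Sum>i<r. \<Sum>j<r. c i * c j * K (e i) (e j)) / 2))"
    and equicontinuous: "\<And>\<epsilon>. \<epsilon> > 0 \<Longrightarrow> \<exists>p. finite (p ` T) \<and> p ` T \<subseteq> T \<and>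
      (\<forall>\<^sub>F n in sequentially. \<exists>A\<in>events. prob A \<le> \<epsilon> \<and>
         (\<forall>w\<in>space M - A. \<forall>t\<in>T. \<bar>Z n w t - Z n w (p t)\<bar> \<le> \<epsilon>))"
begin

definition proj :: "nat \<Rightarrow> 't \<Rightarrow> 't" where
  "proj m = (SOME p. finite (p ` T) \<and> p ` T \<subseteq> T \<and>
      (\<forall>\<^sub>F n in sequentially. \<exists>A\<in>events. prob A \<le> (1/2) ^ m \<and>
         (\<forall>w\<in>space M - A. \<forall>t\<in>T. \<bar>Z n w t - Z n w (p t)\<bar> \<le> (1/2) ^ m)))"

lemma proj:
  "finite (proj m ` T)" "t \<in> T \<Longrightarrow> proj m t \<in> T"
  "\<forall>\<^sub>F n in sequentially. \<exists>A\<in>events. prob A \<le> (1/2) ^ m \<and>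
     (\<forall>w\<in>space M - A. \<forall>t\<in>T. \<bar>Z n w t - Z n w (proj m t)\<bar> \<le> (1/2) ^ m)"
proof -
  have "(1/2 :: real) ^ m > 0" by simp
  from someI_ex[OF equicontinuous[OF this], folded proj_def]
  show "finite (proj m ` T)" "t \<in> T \<Longrightarrow> proj m t \<in> T"
    "\<forall>\<^sub>F n in sequentially. \<exists>A\<in>events. prob A \<le> (1/2) ^ m \<and>
     (\<forall>w\<in>space M - A. \<forall>t\<in>T. \<bar>Z n w t - Z n w (proj m t)\<bar> \<le> (1/2) ^ m)"
    by blast+
qed

lemma quad_nonneg:
  fixes r :: nat
  assumes "\<And>i. i < r \<Longrightarrow> e i \<in> T"
  shows "0 \<le> (\<Sum>i<r. \<Sum>j<r. c i * c j * K (e i) (e j))"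
proof -
  let ?Q = "\<Sum>i<r. \<Sum>j<r. c i * c j * K (e i) (e j)"
  have "norm (\<integral>w. iexp (\<Sum>i<r. c i * Z n w (e i)) \<partial>M) \<le> 1" for n
  proof -
    have "norm (\<integral>w. iexp (\<Sum>i<r. c i * Z n w (e i)) \<partial>M) \<le> (\<integral>w. norm (iexp (\<Sum>i<r. c i * Z n w (e i))) \<partial>M)"
      by (rule integral_norm_bound)
    also have "\<dots> = 1" by (simp add: prob_space)
    finally show ?thesis .
  qed
  then have "norm (complex_of_real (exp (- ?Q / 2))) \<le> 1"
    using LIMSEQ_le_const2[OF tendsto_norm[OF char_limit[of r e c, OF assms]], of 1] by blast
  then show ?thesis by simp
qed

lemma iexp_Z_integrable:
  assumes "\<And>i. i < r \<Longrightarrow> e i \<in> T"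
  shows "integrable M (\<lambda>w. iexp (\<Sum>i<r. c i * Z n w (e i)))"
  by (rule integrable_const_bound[where B=1]) (use assms Z_measurable in auto)

lemma char_close:
  fixes r :: nat
  assumes e: "\<And>i. i < r \<Longrightarrow> e i \<in> T"
  shows "\<bar>exp (- (\<Sum>i<r. \<Sum>j<r. c i * c j * K (e i) (e j)) / 2) -
      exp (- (\<Sum>i<r. \<Sum>j<r. c i * c j * K (proj m (e i)) (proj m (e j))) / 2)\<bar>
    \<le> ((\<Sum>i<r. \<bar>c i\<bar>) + 2) * (1/2) ^ m" (is "\<bar>?a - ?b\<bar> \<le> ?B")
proof -
  have e': "proj m (e i) \<in> T" if "i < r" for i using e proj that by blast
  let ?f = "\<lambda>n w. iexp (\<Sum>i<r. c i * Z n w (e i)) - iexp (\<Sum>i<r. c i * Z n w (proj m (e i)))"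
  have lim: "(\<lambda>n. norm (\<integral>w. ?f n w \<partial>M)) \<longlonglongrightarrow> norm (complex_of_real ?a - complex_of_real ?b)"
    using tendsto_norm[OF tendsto_diff[OF char_limit[of r e c, OF e] char_limit[of r "\<lambda>i. proj m (e i)" c, OF e']]]
    by (simp only: Bochner_Integration.integral_diff[OF iexp_Z_integrable[OF e] iexp_Z_integrable[OF e']])
  have "\<forall>\<^sub>F n in sequentially. norm (\<integral>w. ?f n w \<partial>M) \<le> ?B"
    using proj(3)[of m]
  proof eventually_elim
    case (elim n)
    then obtain A where A: "A \<in> events" "prob A \<le> (1/2) ^ m"
      "\<And>w t. w \<in> space M - A \<Longrightarrow> t \<in> T \<Longrightarrow> \<bar>Z n w t - Z n w (proj m t)\<bar> \<le> (1/2) ^ m" by blast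
    have Ai: "integrable M (indicator A :: _ \<Rightarrow> real)"
      using A(1) emeasure_finite[of A] by (intro integrable_real_indicator) (auto simp: less_top[symmetric])
    have int: "integrable M (?f n)"
      using iexp_Z_integrable[OF e] iexp_Z_integrable[OF e'] by (rule Bochner_Integration.integrable_diff)
    have "norm (\<integral>w. ?f n w \<partial>M) \<le> (\<integral>w. norm (?f n w) \<partial>M)" by (rule integral_norm_bound)
    also have "\<dots> \<le> (\<integral>w. (\<Sum>i<r. \<bar>c i\<bar>) * (1/2) ^ m + 2 * indicator A w \<partial>M)"
    proof (rule integral_mono)
      show "integrable M (\<lambda>w. norm (?f n w))" using int by (rule integrable_norm)
      show "integrable M (\<lambda>w. (\<Sum>i<r. \<bar>c i\<bar>) * (1/2) ^ m + 2 * indicator A w)"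
        by (intro Bochner_Integration.integrable_add integrable_const integrable_mult_right Ai)
      fix w assume wM: "w \<in> space M"
      show "norm (?f n w) \<le> (\<Sum>i<r. \<bar>c i\<bar>) * (1/2) ^ m + 2 * indicator A w"
      proof (cases "w \<in> A")
        case True
        have "norm (?f n w) \<le> 1 + 1" by (rule norm_triangle_le_diff) simp
        moreover have "0 \<le> (\<Sum>i<r. \<bar>c i\<bar>) * (1/2) ^ m" by (intro mult_nonneg_nonneg sum_nonneg) auto
        moreover have "indicator A w = (1 :: real)" using True by simp
        ultimately show ?thesis by linarith
      next
        case False
        have "norm (?f n w) \<le> \<bar>(\<Sum>i<r. c i * Z n w (e i)) - (\<Sum>i<r. c i * Z n w (proj m (e i)))\<bar>"
          by (rule norm_iexp_diff)
        also have "\<dots> = \<bar>\<Sum>i<r. c i * (Z n w (e i) - Z n w (proj m (e i)))\<bar>"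
          by (simp add: right_diff_distrib sum_subtractf)
        also have "\<dots> \<le> (\<Sum>i<r. \<bar>c i * (Z n w (e i) - Z n w (proj m (e i)))\<bar>)" by (rule sum_abs)
        also have "\<dots> \<le> (\<Sum>i<r. \<bar>c i\<bar> * (1/2) ^ m)"
          unfolding abs_mult using A(3) e wM False by (intro sum_mono mult_left_mono) auto
        finally show ?thesis using False by (simp add: sum_distrib_right)
      qed
    qed
    also have "\<dots> = (\<Sum>i<r. \<bar>c i\<bar>) * (1/2) ^ m + 2 * prob A"
      using A(1) by (subst Bochner_Integration.integral_add) (simp_all add: prob_space Ai)
    also have "\<dots> \<le> ?B" using A(2) by (simp add: distrib_right)
    finally show ?case .
  qed
  then have "norm (complex_of_real ?a - complex_of_real ?b) \<le> ?B"
    by (intro tendsto_upperbound[OF lim]) auto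
  then show ?thesis by (simp only: of_real_diff[symmetric] norm_of_real)
qed

definition D :: "'t set" where "D = (\<Union>m. proj m ` T)"

definition d :: "nat \<Rightarrow> 't" where "d = from_nat_into D"

definition ix :: "'t \<Rightarrow> nat" where "ix = to_nat_on D"

definition Kd :: "nat \<Rightarrow> nat \<Rightarrow> real" where "Kd i j = K (d i) (d j)"

lemma D: "countable D" "D \<subseteq> T" "D \<noteq> {}"
proof -
  show "countable D" unfolding D_def by (rule countable_UN[OF countableI_type countable_finite[OF proj(1)]])
  show "D \<subseteq> T" "D \<noteq> {}" unfolding D_def using proj(2) nonempty by auto
qed

lemma d_in: "d i \<in> T"
  using from_nat_into[OF D(3)] D(2) by (auto simp: d_def)

lemma d_ix: "t \<in> D \<Longrightarrow> d (ix t) = t"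
  unfolding d_def ix_def using D(1) by simp

lemma proj_in_D: "t \<in> T \<Longrightarrow> proj m t \<in> D"
  by (auto simp: D_def)

lemma psd_Kd: "psd_kernel Kd"
  unfolding psd_kernel_def Kd_def using K_sym d_in quad_nonneg[of _ d] by auto

abbreviation "gd \<equiv> gaussian_seq Kd"

lemma fidi:
  fixes H :: "(nat \<Rightarrow> real) \<Rightarrow> real"
  assumes lip: "\<And>y z. \<bar>H y - H z\<bar> \<le> L * (\<Sum>j<r. \<bar>y j - z j\<bar>)"
    and bnd: "\<And>z. \<bar>H z\<bar> \<le> C" and L: "L \<ge> 0"
  shows "(\<lambda>n. \<integral>w. H (\<lambda>j. Z n w (d j)) \<partial>M) \<longlonglongrightarrow> (\<integral>w. H (gd w) \<partial>std_normal_seq)"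
proof (rule fidi_convergence[OF prob_space_axioms std_normal_prod.prob_space_axioms _ _ _ lip bnd L])
  show "(\<lambda>w. Z n w (d j)) \<in> borel_measurable M" for n j using Z_measurable d_in by blast
  show "(\<lambda>w. gd w j) \<in> borel_measurable std_normal_seq" for j by simp
  show "(\<lambda>n. \<integral>w. iexp (\<Sum>j<r. c j * Z n w (d j)) \<partial>M) \<longlonglongrightarrow> (\<integral>v. iexp (\<Sum>j<r. c j * gd v j) \<partial>std_normal_seq)" for c
    using char_limit[of r d c, OF d_in] char_gaussian_seq[OF psd_Kd, where r=r and c=c and e="\<lambda>i. i"] by (simp only: Kd_def)
qed

definition gap :: "nat \<Rightarrow> (nat \<Rightarrow> real) set" where
  "gap m = {w \<in> space std_normal_seq. \<exists>t\<in>T. 3 * (1/2) ^ m < \<bar>gd w (ix (proj m t)) - gd w (ix (proj (Suc m) t))\<bar>}"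

lemma gap:
  shows "gap m \<in> sets std_normal_seq" "measure std_normal_seq (gap m) \<le> 2 * (1/2) ^ m"
proof -
  define \<delta> where "\<delta> = (1/2 :: real) ^ m"
  have \<delta>: "\<delta> > 0" by (simp add: \<delta>_def)
  define P where "P = (\<lambda>t. (ix (proj m t), ix (proj (Suc m) t))) ` T"
  have "P \<subseteq> (ix ` (proj m ` T)) \<times> (ix ` (proj (Suc m) ` T))" by (auto simp: P_def)
  then have fP: "finite P" by (rule finite_subset) (use proj(1) in auto)
  have gap_eq: "gap m = {w \<in> space std_normal_seq. \<exists>p\<in>P. 3 * \<delta> < \<bar>gd w (fst p) - gd w (snd p)\<bar>}"
    by (auto simp: gap_def P_def \<delta>_def)
  show sets: "gap m \<in> sets std_normal_seq"
    unfolding gap_eq by (rule sets.sets_Collect_finite_Ex[OF _ fP]) measurable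
  define r where "r = Suc (\<Sum>p\<in>P. fst p + snd p)"
  have r: "fst p < r" "snd p < r" if "p \<in> P" for p
    using member_le_sum[of p P "\<lambda>p. fst p + snd p"] that fP by (auto simp: r_def)
  define H where "H y = min 1 (\<Sum>p\<in>P. max 0 (\<bar>y (fst p) - y (snd p)\<bar> / \<delta> - 2))" for y :: "nat \<Rightarrow> real"
  define L where "L = (\<Sum>p\<in>P. 2 / \<delta>)"
  have H0: "0 \<le> H y" for y unfolding H_def by (auto intro: sum_nonneg)
  have H1: "H y \<le> 1" for y unfolding H_def by simp
  have lip: "\<bar>H y - H z\<bar> \<le> L * (\<Sum>j<r. \<bar>y j - z j\<bar>)" for y z
  proof -
    have "\<bar>H y - H z\<bar> \<le> \<bar>(\<Sum>p\<in>P. max 0 (\<bar>y (fst p) - y (snd p)\<bar> / \<delta> - 2)) - (\<Sum>p\<in>P. max 0 (\<bar>z (fst p) - z (snd p)\<bar> / \<delta> - 2))\<bar>"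
      unfolding H_def by linarith
    also have "\<dots> \<le> (\<Sum>p\<in>P. \<bar>max 0 (\<bar>y (fst p) - y (snd p)\<bar> / \<delta> - 2) - max 0 (\<bar>z (fst p) - z (snd p)\<bar> / \<delta> - 2)\<bar>)"
      unfolding sum_subtractf[symmetric] by (rule sum_abs)
    also have "\<dots> \<le> (\<Sum>p\<in>P. 2 / \<delta> * (\<Sum>j<r. \<bar>y j - z j\<bar>))"
    proof (rule sum_mono)
      fix p assume p: "p \<in> P"
      have s: "\<bar>y j - z j\<bar> \<le> (\<Sum>j<r. \<bar>y j - z j\<bar>)" if "j < r" for j
        using that by (intro member_le_sum[of j "{..<r}" "\<lambda>j. \<bar>y j - z j\<bar>"]) auto
      have "\<bar>max 0 (\<bar>y (fst p) - y (snd p)\<bar> / \<delta> - 2) - max 0 (\<bar>z (fst p) - z (snd p)\<bar> / \<delta> - 2)\<bar>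
        \<le> \<bar>\<bar>y (fst p) - y (snd p)\<bar> / \<delta> - \<bar>z (fst p) - z (snd p)\<bar> / \<delta>\<bar>" by linarith
      also have "\<dots> = \<bar>\<bar>y (fst p) - y (snd p)\<bar> - \<bar>z (fst p) - z (snd p)\<bar>\<bar> / \<delta>"
        using \<delta> by (simp add: diff_divide_distrib[symmetric])
      also have "\<dots> \<le> (2 * (\<Sum>j<r. \<bar>y j - z j\<bar>)) / \<delta>"
        using s[OF r(1)[OF p]] s[OF r(2)[OF p]] \<delta> by (intro divide_right_mono) linarith+
      finally show "\<bar>max 0 (\<bar>y (fst p) - y (snd p)\<bar> / \<delta> - 2) - max 0 (\<bar>z (fst p) - z (snd p)\<bar> / \<delta> - 2)\<bar>
        \<le> 2 / \<delta> * (\<Sum>j<r. \<bar>y j - z j\<bar>)" by simp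
    qed
    also have "\<dots> = L * (\<Sum>j<r. \<bar>y j - z j\<bar>)" by (simp only: L_def sum_distrib_right)
    finally show ?thesis .
  qed
  have L: "L \<ge> 0" unfolding L_def using \<delta> by (intro sum_nonneg) simp
  have lim: "(\<lambda>n. \<integral>w. H (\<lambda>j. Z n w (d j)) \<partial>M) \<longlonglongrightarrow> (\<integral>w. H (gd w) \<partial>std_normal_seq)"
  proof (rule fidi[OF lip])
    show "\<bar>H z\<bar> \<le> 1" for z using H0[of z] H1[of z] by linarith
  qed (rule L)
  have "\<forall>\<^sub>F n in sequentially. (\<integral>w. H (\<lambda>j. Z n w (d j)) \<partial>M) \<le> 2 * \<delta>"
    using proj(3)[of m] proj(3)[of "Suc m"]
  proof eventually_elim
    case (elim n)
    obtain A where A: "A \<in> events" "prob A \<le> \<delta>"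
      "\<And>w t. w \<in> space M - A \<Longrightarrow> t \<in> T \<Longrightarrow> \<bar>Z n w t - Z n w (proj m t)\<bar> \<le> \<delta>"
      using elim(1) unfolding \<delta>_def by blast
    obtain A' where A': "A' \<in> events" "prob A' \<le> \<delta> / 2"
      "\<And>w t. w \<in> space M - A' \<Longrightarrow> t \<in> T \<Longrightarrow> \<bar>Z n w t - Z n w (proj (Suc m) t)\<bar> \<le> \<delta> / 2"
      using elim(2) unfolding \<delta>_def by auto
    have AA: "A \<union> A' \<in> events" using A A' by auto
    have "(\<integral>w. H (\<lambda>j. Z n w (d j)) \<partial>M) \<le> (\<integral>w. indicator (A \<union> A') w \<partial>M)"
    proof (rule integral_mono)
      show "integrable M (\<lambda>w. H (\<lambda>j. Z n w (d j)))"
      proof (rule integrable_const_bound[where B=1])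
        show "(\<lambda>w. H (\<lambda>j. Z n w (d j))) \<in> borel_measurable M"
          by (rule measurable_finite_lipschitz[OF lip]) (use Z_measurable d_in in blast)
      qed (use H0 H1 in auto)
      show "integrable M (indicator (A \<union> A') :: _ \<Rightarrow> real)"
        using AA emeasure_finite[of "A \<union> A'"] by (intro integrable_real_indicator) (auto simp: less_top[symmetric])
      fix w assume wM: "w \<in> space M"
      show "H (\<lambda>j. Z n w (d j)) \<le> indicator (A \<union> A') w"
      proof (cases "w \<in> A \<union> A'")
        case False
        have "\<bar>Z n w (d (fst p)) - Z n w (d (snd p))\<bar> / \<delta> - 2 \<le> 0" if "p \<in> P" for p
        proof -
          obtain t where t: "t \<in> T" "p = (ix (proj m t), ix (proj (Suc m) t))" using \<open>p \<in> P\<close> unfolding P_def by blast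
          have "\<bar>Z n w (proj m t) - Z n w (proj (Suc m) t)\<bar> \<le> 2 * \<delta>"
          proof -
            have "\<bar>Z n w t - Z n w (proj m t)\<bar> \<le> \<delta>" "\<bar>Z n w t - Z n w (proj (Suc m) t)\<bar> \<le> \<delta> / 2"
              using A(3)[of w t] A'(3)[of w t] wM False t by auto
            then show ?thesis using \<delta> by linarith
          qed
          then show ?thesis using t \<delta> by (simp add: d_ix proj_in_D field_simps)
        qed
        then have "(\<Sum>p\<in>P. max 0 (\<bar>Z n w (d (fst p)) - Z n w (d (snd p))\<bar> / \<delta> - 2)) = 0"
          by (intro sum.neutral ballI max_absorb1)
        then have "H (\<lambda>j. Z n w (d j)) = 0" unfolding H_def by simp
        then show ?thesis using False by simp
      qed (simp add: H1)
    qed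
    also have "\<dots> = prob (A \<union> A')" using AA by simp
    also have "\<dots> \<le> prob A + prob A'" by (rule measure_Un_le[OF A(1) A'(1)])
    finally show ?case using A A' \<delta> by simp
  qed
  then have EH: "(\<integral>w. H (gd w) \<partial>std_normal_seq) \<le> 2 * \<delta>"
    by (intro tendsto_upperbound[OF lim]) auto
  have "measure std_normal_seq (gap m) = (\<integral>w. indicator (gap m) w \<partial>std_normal_seq)" using sets by simp
  also have "\<dots> \<le> (\<integral>w. H (gd w) \<partial>std_normal_seq)"
  proof (rule integral_mono)
    show "integrable std_normal_seq (\<lambda>w. H (gd w))"
    proof (rule std_normal_prod.integrable_const_bound[where B=1])
      show "(\<lambda>w. H (gd w)) \<in> borel_measurable std_normal_seq"
        by (rule measurable_finite_lipschitz[OF lip]) simp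
    qed (use H0 H1 in auto)
    show "integrable std_normal_seq (indicator (gap m) :: _ \<Rightarrow> real)"
      using sets by (intro integrable_real_indicator) (auto simp: less_top[symmetric] std_normal_prod.emeasure_finite)
    fix w assume wM: "w \<in> space std_normal_seq"
    show "indicator (gap m) w \<le> H (gd w)"
    proof (cases "w \<in> gap m")
      case True
      then obtain p where p: "p \<in> P" "3 * \<delta> < \<bar>gd w (fst p) - gd w (snd p)\<bar>" by (auto simp: gap_eq)
      have "1 \<le> max 0 (\<bar>gd w (fst p) - gd w (snd p)\<bar> / \<delta> - 2)"
        using p(2) \<delta> by (simp add: field_simps max_def)
      also have "\<dots> \<le> (\<Sum>p\<in>P. max 0 (\<bar>gd w (fst p) - gd w (snd p)\<bar> / \<delta> - 2))"
        using p(1) fP by (intro member_le_sum[of p P "\<lambda>p. max 0 (\<bar>gd w (fst p) - gd w (snd p)\<bar> / \<delta> - 2)"]) auto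
      finally show ?thesis using True by (simp add: H_def)
    qed (simp add: H0)
  qed
  finally show "measure std_normal_seq (gap m) \<le> 2 * (1/2) ^ m" using EH by (simp add: \<delta>_def)
qed

end

lemma tendsto_abs_diff_le:
  fixes f g :: "nat \<Rightarrow> real"
  assumes "\<And>m. \<bar>x - f m\<bar> \<le> g m" "g \<longlonglongrightarrow> 0"
  shows "f \<longlonglongrightarrow> x"
proof -
  have "(\<lambda>m. x - f m) \<longlonglongrightarrow> 0"
    by (rule Lim_null_comparison[OF always_eventually assms(2)]) (simp add: assms(1))
  from tendsto_diff[OF tendsto_const[of x] this] show ?thesis by simp
qed

context gaussian_limit begin

abbreviation \<Omega> where "\<Omega> \<equiv> std_normal_seq"

definition good :: "(nat \<Rightarrow> real) set" where
  "good = {w \<in> space \<Omega>. \<exists>m0. \<forall>m\<ge>m0. w \<notin> gap m}"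

lemma good_sets [measurable]: "good \<in> sets \<Omega>"
  unfolding good_def using gap(1) by measurable

lemma AE_good: "AE w in \<Omega>. w \<in> good"
proof -
  have "AE w in \<Omega>. eventually (\<lambda>m. w \<in> space \<Omega> - gap m) sequentially"
  proof (rule borel_cantelli_AE1)
    show "gap m \<in> sets \<Omega>" for m by (rule gap)
    show "emeasure \<Omega> (gap m) < \<infinity>" for m
      using std_normal_prod.emeasure_finite by (simp add: less_top[symmetric])
    show "summable (\<lambda>m. measure \<Omega> (gap m))"
    proof (rule summable_comparison_test'[where g="\<lambda>m. 2 * (1/2) ^ m"])
      show "summable (\<lambda>m. 2 * (1/2 :: real) ^ m)" by (intro summable_mult summable_geometric) simp
      show "norm (measure \<Omega> (gap m)) \<le> 2 * (1/2) ^ m" if "m \<ge> 0" for m using gap(2)[of m] by simp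
    qed
  qed
  then show ?thesis
    by (auto simp: good_def eventually_sequentially elim!: AE_mp)
qed

definition path :: "nat \<Rightarrow> (nat \<Rightarrow> real) \<Rightarrow> 't \<Rightarrow> real" where
  "path m w = (\<lambda>t\<in>T. if w \<in> good then gd w (ix (proj m t)) else 0)"

definition limit_path :: "(nat \<Rightarrow> real) \<Rightarrow> 't \<Rightarrow> real" where
  "limit_path w = (\<lambda>t\<in>T. if w \<in> good then lim (\<lambda>m. gd w (ix (proj m t))) else 0)"

lemma finite_range_mspace:
  assumes "finite F" "\<And>t. t \<in> T \<Longrightarrow> y t \<in> F"
  shows "restrict y T \<in> mspace (linf T)"
proof -
  have "(restrict y T) ` T \<subseteq> F" using assms by auto
  then have "bounded ((restrict y T) ` T)" using assms(1) by (meson bounded_subset finite_imp_bounded)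
  then show ?thesis by (simp add: mspace_linf)
qed

lemma proj_mspace: "(\<lambda>t\<in>T. y (proj m t)) \<in> mspace (linf T)"
  by (rule finite_range_mspace[of "y ` (proj m ` T)"]) (use proj(1) in auto)

lemma path_mspace: "path m w \<in> mspace (linf T)"
  unfolding path_def
  by (rule finite_range_mspace[of "insert 0 ((\<lambda>s. gd w (ix s)) ` (proj m ` T))"]) (use proj(1) in auto)

lemma limit_path_close:
  assumes "w \<in> good"
  obtains m0 where "\<And>m t. m \<ge> m0 \<Longrightarrow> t \<in> T \<Longrightarrow> \<bar>limit_path w t - path m w t\<bar> \<le> 6 * (1/2) ^ m"
proof -
  obtain m0 where m0: "\<And>m. m \<ge> m0 \<Longrightarrow> w \<notin> gap m" "w \<in> space \<Omega>"
    using assms by (auto simp: good_def)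
  have "\<bar>lim (\<lambda>m. gd w (ix (proj m t))) - gd w (ix (proj m t))\<bar> \<le> 2 * 3 * (1/2) ^ m"
    if m: "m \<ge> m0" and t: "t \<in> T" for m t
  proof (rule geometric_increments_limit(2)[of m0 "\<lambda>m. gd w (ix (proj m t))", OF _ m])
    fix m assume "m \<ge> m0"
    then have "w \<notin> gap m" by (rule m0)
    then show "\<bar>gd w (ix (proj m t)) - gd w (ix (proj (Suc m) t))\<bar> \<le> 3 * (1/2) ^ m"
      using t m0(2) by (force simp: gap_def not_less)
  qed
  then show ?thesis
    using assms by (intro that[of m0]) (auto simp: limit_path_def path_def)
qed

lemma limit_path_mspace: "limit_path w \<in> mspace (linf T)"
proof (cases "w \<in> good")
  case True
  then obtain m0 where m0: "\<And>m t. m \<ge> m0 \<Longrightarrow> t \<in> T \<Longrightarrow> \<bar>limit_path w t - path m w t\<bar> \<le> 6 * (1/2) ^ m"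
    by (rule limit_path_close) blast
  have "bounded (path m0 w ` T)" using path_mspace[of m0 w] by (simp add: mspace_linf)
  then obtain B where B: "\<And>t. t \<in> T \<Longrightarrow> \<bar>path m0 w t\<bar> \<le> B" by (auto simp: bounded_iff)
  have "\<bar>limit_path w t\<bar> \<le> B + 6 * (1/2) ^ m0" if "t \<in> T" for t
    using m0[OF order_refl that] B[OF that] by linarith
  then have "bounded (limit_path w ` T)" unfolding bounded_iff by (auto intro!: exI[of _ "B + 6 * (1/2) ^ m0"])
  then show ?thesis by (simp add: mspace_linf limit_path_def)
next
  case False
  then show ?thesis unfolding limit_path_def
    by (intro finite_range_mspace[of "{0}"]) auto
qed

lemma path_tendsto: "(\<lambda>m. mdist (linf T) (limit_path w) (path m w)) \<longlonglongrightarrow> 0"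
proof (cases "w \<in> good")
  case True
  then obtain m0 where m0: "\<And>m t. m \<ge> m0 \<Longrightarrow> t \<in> T \<Longrightarrow> \<bar>limit_path w t - path m w t\<bar> \<le> 6 * (1/2) ^ m"
    by (rule limit_path_close) blast
  have ev: "eventually (\<lambda>m. norm (mdist (linf T) (limit_path w) (path m w)) \<le> 6 * (1/2) ^ m) sequentially"
    unfolding eventually_sequentially
    by (intro exI[of _ m0] allI impI)
      (use mdist_linf_le[OF limit_path_mspace path_mspace nonempty m0] in simp)
  have "(\<lambda>m. 6 * (1/2 :: real) ^ m) \<longlonglongrightarrow> 6 * 0" by (intro tendsto_intros LIMSEQ_power_zero) auto
  then show ?thesis by (intro Lim_null_comparison[OF ev]) simp
next
  case False
  then have "path m w = limit_path w" for m by (simp add: path_def limit_path_def)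
  then show ?thesis by (simp add: linf.mdist_zero[OF limit_path_mspace])
qed

lemma lipschitz_proj:
  fixes m :: nat
  assumes lip: "\<And>y z. y \<in> mspace (linf T) \<Longrightarrow> z \<in> mspace (linf T) \<Longrightarrow> \<bar>\<phi> y - \<phi> z\<bar> \<le> L * mdist (linf T) y z"
    and L: "L \<ge> 0"
  defines "H \<equiv> \<lambda>y :: nat \<Rightarrow> real. \<phi> (\<lambda>t\<in>T. y (ix (proj m t)))"
  obtains r where "\<And>y z. \<bar>H y - H z\<bar> \<le> L * (\<Sum>j<r. \<bar>y j - z j\<bar>)"
proof -
  define r where "r = Suc (\<Sum>s\<in>proj m ` T. ix s)"
  have r: "ix (proj m t) < r" if "t \<in> T" for t
    unfolding r_def less_Suc_eq_le by (rule member_le_sum) (use that proj(1) in auto)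
  have "\<bar>H y - H z\<bar> \<le> L * (\<Sum>j<r. \<bar>y j - z j\<bar>)" for y z
  proof -
    have m: "(\<lambda>t\<in>T. y (ix (proj m t))) \<in> mspace (linf T)" for y
      using proj_mspace[of "\<lambda>s. y (ix s)"] by simp
    have "mdist (linf T) (\<lambda>t\<in>T. y (ix (proj m t))) (\<lambda>t\<in>T. z (ix (proj m t))) \<le> (\<Sum>j<r. \<bar>y j - z j\<bar>)"
    proof (rule mdist_linf_le[OF m m nonempty])
      fix t assume t: "t \<in> T"
      have "\<bar>y (ix (proj m t)) - z (ix (proj m t))\<bar> \<le> (\<Sum>j<r. \<bar>y j - z j\<bar>)"
        by (rule member_le_sum[of "ix (proj m t)" "{..<r}" "\<lambda>j. \<bar>y j - z j\<bar>"]) (use r[OF t] in auto)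
      then show "\<bar>(\<lambda>t\<in>T. y (ix (proj m t))) t - (\<lambda>t\<in>T. z (ix (proj m t))) t\<bar> \<le> (\<Sum>j<r. \<bar>y j - z j\<bar>)"
        using t by simp
    qed
    then show ?thesis
      unfolding H_def using order_trans[OF lip[OF m m] mult_left_mono[OF _ L]] by blast
  qed
  then show ?thesis by (rule that)
qed

lemma lipschitz_path_measurable:
  assumes lip: "\<And>y z. y \<in> mspace (linf T) \<Longrightarrow> z \<in> mspace (linf T) \<Longrightarrow> \<bar>\<phi> y - \<phi> z\<bar> \<le> L * mdist (linf T) y z"
    and L: "L \<ge> 0"
  shows "(\<lambda>w. \<phi> (path m w)) \<in> borel_measurable \<Omega>"
proof -
  obtain r where r: "\<And>y z. \<bar>\<phi> (\<lambda>t\<in>T. y (ix (proj m t))) - \<phi> (\<lambda>t\<in>T. z (ix (proj m t)))\<bar> \<le> L * (\<Sum>j<r. \<bar>y j - z j\<bar>)"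
    using lipschitz_proj[OF lip L] by blast
  have [measurable]: "(\<lambda>w. \<phi> (\<lambda>t\<in>T. gd w (ix (proj m t)))) \<in> borel_measurable \<Omega>"
    by (rule measurable_finite_lipschitz[OF r]) simp
  have "\<phi> (path m w) = (if w \<in> good then \<phi> (\<lambda>t\<in>T. gd w (ix (proj m t))) else \<phi> (\<lambda>t\<in>T. 0))" for w
    by (simp add: path_def)
  then show ?thesis by simp
qed

lemma lipschitz_path_tendsto:
  assumes lip: "\<And>y z. y \<in> mspace (linf T) \<Longrightarrow> z \<in> mspace (linf T) \<Longrightarrow> \<bar>\<phi> y - \<phi> z\<bar> \<le> L * mdist (linf T) y z"
  shows "(\<lambda>m. \<phi> (path m w)) \<longlonglongrightarrow> \<phi> (limit_path w)"
proof -
  have "(\<lambda>m. L * mdist (linf T) (limit_path w) (path m w)) \<longlonglongrightarrow> L * 0"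
    by (intro tendsto_intros path_tendsto)
  then have lim: "(\<lambda>m. L * mdist (linf T) (limit_path w) (path m w)) \<longlonglongrightarrow> 0" by simp
  show ?thesis
    by (rule tendsto_abs_diff_le[OF lip[OF limit_path_mspace path_mspace] lim])
qed

lemma lipschitz_limit_measurable:
  assumes lip: "\<And>y z. y \<in> mspace (linf T) \<Longrightarrow> z \<in> mspace (linf T) \<Longrightarrow> \<bar>\<phi> y - \<phi> z\<bar> \<le> L * mdist (linf T) y z"
    and L: "L \<ge> 0"
  shows "(\<lambda>w. \<phi> (limit_path w)) \<in> borel_measurable \<Omega>"
  by (rule borel_measurable_LIMSEQ_real[OF lipschitz_path_tendsto[OF lip] lipschitz_path_measurable[OF lip L]])

lemma limit_path_measurable: "limit_path \<in> measurable \<Omega> (linf_borel T)"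
proof (rule measurable_linf_borelI)
  show "limit_path w \<in> mspace (linf T)" for w by (rule limit_path_mspace)
  fix \<phi> :: "('t \<Rightarrow> real) \<Rightarrow> real"
  assume "\<And>y z. y \<in> mspace (linf T) \<Longrightarrow> z \<in> mspace (linf T) \<Longrightarrow> \<bar>\<phi> y - \<phi> z\<bar> \<le> mdist (linf T) y z"
  then show "(\<lambda>w. \<phi> (limit_path w)) \<in> borel_measurable \<Omega>"
    by (intro lipschitz_limit_measurable[where L=1]) auto
qed

lemma eval_measurable: "t \<in> T \<Longrightarrow> (\<lambda>z. z t) \<in> borel_measurable (linf_borel T)"
  by (intro continuous_map_linf_measurable lipschitz_linf_continuous[where L=1]) (simp add: mdist_linf_upper)

lemma limit_eval_measurable [measurable]: "t \<in> T \<Longrightarrow> (\<lambda>w. limit_path w t) \<in> borel_measurable \<Omega>"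
  using measurable_compose[OF limit_path_measurable eval_measurable] by simp

lemma char_limit_path:
  fixes r :: nat
  assumes e: "\<And>i. i < r \<Longrightarrow> e i \<in> T"
  shows "(\<integral>w. iexp (\<Sum>i<r. c i * limit_path w (e i)) \<partial>\<Omega>) =
    complex_of_real (exp (- (\<Sum>i<r. \<Sum>j<r. c i * c j * K (e i) (e j)) / 2))" (is "_ = complex_of_real ?E")
proof (rule LIMSEQ_unique)
  let ?Em = "\<lambda>m. exp (- (\<Sum>i<r. \<Sum>j<r. c i * c j * K (proj m (e i)) (proj m (e j))) / 2)"
  have em: "(\<integral>w. iexp (\<Sum>i<r. c i * gd w (ix (proj m (e i)))) \<partial>\<Omega>) = complex_of_real (?Em m)" for m
  proof -
    have "Kd (ix (proj m (e i))) (ix (proj m (e j))) = K (proj m (e i)) (proj m (e j))" if "i < r" "j < r" for i j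
      using e that by (simp add: Kd_def d_ix proj_in_D)
    then show ?thesis by (subst char_gaussian_seq[OF psd_Kd]) simp
  qed
  show "(\<lambda>m. \<integral>w. iexp (\<Sum>i<r. c i * gd w (ix (proj m (e i)))) \<partial>\<Omega>) \<longlonglongrightarrow> complex_of_real ?E"
    unfolding em
  proof (rule tendsto_of_real)
    have "(\<lambda>m. ((\<Sum>i<r. \<bar>c i\<bar>) + 2) * (1/2) ^ m) \<longlonglongrightarrow> ((\<Sum>i<r. \<bar>c i\<bar>) + 2) * 0"
      by (intro tendsto_intros LIMSEQ_power_zero) auto
    then have lim: "(\<lambda>m. ((\<Sum>i<r. \<bar>c i\<bar>) + 2) * (1/2) ^ m) \<longlonglongrightarrow> 0" by simp
    show "?Em \<longlonglongrightarrow> ?E"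
      by (rule tendsto_abs_diff_le[OF char_close[OF e] lim])
  qed
  show "(\<lambda>m. \<integral>w. iexp (\<Sum>i<r. c i * gd w (ix (proj m (e i)))) \<partial>\<Omega>) \<longlonglongrightarrow>
    (\<integral>w. iexp (\<Sum>i<r. c i * limit_path w (e i)) \<partial>\<Omega>)"
  proof (rule integral_dominated_convergence[where w="\<lambda>_. 1"])
    show "(\<lambda>w. iexp (\<Sum>i<r. c i * limit_path w (e i))) \<in> borel_measurable \<Omega>" using e by measurable
    show "(\<lambda>w. iexp (\<Sum>i<r. c i * gd w (ix (proj m (e i))))) \<in> borel_measurable \<Omega>" for m by measurable
    show "AE w in \<Omega>. (\<lambda>m. iexp (\<Sum>i<r. c i * gd w (ix (proj m (e i))))) \<longlonglongrightarrow> iexp (\<Sum>i<r. c i * limit_path w (e i))"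
      using AE_good
    proof eventually_elim
      case (elim w)
      have "(\<lambda>m. gd w (ix (proj m (e i)))) \<longlonglongrightarrow> limit_path w (e i)" if i: "i < r" for i
      proof -
        have "(\<lambda>m. path m w (e i)) \<longlonglongrightarrow> limit_path w (e i)"
          by (rule lipschitz_path_tendsto[where L=1]) (simp add: mdist_linf_upper e i)
        then show ?thesis using elim e[OF i] by (simp add: path_def)
      qed
      then show ?case by (intro tendsto_intros) auto
    qed
  qed auto
qed

lemma normal_combination:
  fixes r :: nat
  assumes e: "\<And>i. i < r \<Longrightarrow> e i \<in> T"
  shows "distr \<Omega> borel (\<lambda>w. \<Sum>i<r. c i * limit_path w (e i)) =
    centered_normal (\<Sum>i<r. \<Sum>j<r. c i * c j * K (e i) (e j))"
proof (rule distr_eq_centered_normal)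
  show "(\<lambda>w. \<Sum>i<r. c i * limit_path w (e i)) \<in> borel_measurable \<Omega>" using e by measurable
  show "0 \<le> (\<Sum>i<r. \<Sum>j<r. c i * c j * K (e i) (e j))" by (rule quad_nonneg[OF e])
  fix s
  have "(\<Sum>i<r. \<Sum>j<r. (s * c i) * (s * c j) * K (e i) (e j)) = s\<^sup>2 * (\<Sum>i<r. \<Sum>j<r. c i * c j * K (e i) (e j))"
    by (simp add: sum_distrib_left power2_eq_square ac_simps)
  then show "(\<integral>w. iexp (s * (\<Sum>i<r. c i * limit_path w (e i))) \<partial>\<Omega>) =
      complex_of_real (exp (- (s\<^sup>2 * (\<Sum>i<r. \<Sum>j<r. c i * c j * K (e i) (e j))) / 2))"
    using char_limit_path[OF e, where c="\<lambda>i. s * c i"] by (simp only: sum_distrib_left mult.assoc)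
qed (rule std_normal_prod.prob_space_axioms)

lemma limit_moments:
  assumes s: "s \<in> T" and t: "t \<in> T"
  shows "integrable \<Omega> (\<lambda>w. limit_path w t)" "(\<integral>w. limit_path w t \<partial>\<Omega>) = 0"
    "(\<integral>w. limit_path w s * limit_path w t \<partial>\<Omega>) = K s t"
proof -
  have mom: "integrable \<Omega> U \<and> (\<integral>w. U w \<partial>\<Omega>) = 0 \<and> integrable \<Omega> (\<lambda>w. (U w)\<^sup>2) \<and> (\<integral>w. (U w)\<^sup>2 \<partial>\<Omega>) = v"
    if "distr \<Omega> borel U = centered_normal v" "v \<ge> 0" "U \<in> borel_measurable \<Omega>" for U v
    using centered_normal_moments[OF that(2)] that(3) unfolding that(1)[symmetric]
    by (simp add: integrable_distr_eq integral_distr)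
  have one: "distr \<Omega> borel (\<lambda>w. limit_path w u) = centered_normal (K u u)" "K u u \<ge> 0" if "u \<in> T" for u
    using normal_combination[of 1 "\<lambda>_. u" "\<lambda>_. 1"] quad_nonneg[of 1 "\<lambda>_. u" "\<lambda>_. 1"] that by auto
  have two: "distr \<Omega> borel (\<lambda>w. limit_path w s + limit_path w t) = centered_normal (K s s + 2 * K s t + K t t)"
    "0 \<le> K s s + 2 * K s t + K t t"
    using normal_combination[of 2 "\<lambda>i. if i = 0 then s else t" "\<lambda>_. 1"]
      quad_nonneg[of 2 "\<lambda>i. if i = 0 then s else t" "\<lambda>_. 1"] s t K_sym[OF s t]
    by (auto simp: numeral_2_eq_2 ac_simps)
  note ms = mom[OF one[OF s]] and mt = mom[OF one[OF t]] and m2 = mom[OF two]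
  show "integrable \<Omega> (\<lambda>w. limit_path w t)" "(\<integral>w. limit_path w t \<partial>\<Omega>) = 0" using mt t by auto
  have "(\<integral>w. limit_path w s * limit_path w t \<partial>\<Omega>) =
      (\<integral>w. ((limit_path w s + limit_path w t)\<^sup>2 - (limit_path w s)\<^sup>2 - (limit_path w t)\<^sup>2) / 2 \<partial>\<Omega>)"
    by (rule Bochner_Integration.integral_cong) (simp_all add: power2_sum)
  also have "\<dots> = ((\<integral>w. (limit_path w s + limit_path w t)\<^sup>2 \<partial>\<Omega>) - (\<integral>w. (limit_path w s)\<^sup>2 \<partial>\<Omega>)
      - (\<integral>w. (limit_path w t)\<^sup>2 \<partial>\<Omega>)) / 2"
    using ms mt m2 s t by simp
  also have "\<dots> = ((K s s + 2 * K s t + K t t) - K s s - K t t) / 2"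
    using ms mt m2 s t by simp
  finally show "(\<integral>w. limit_path w s * limit_path w t \<partial>\<Omega>) = K s t" by simp
qed

definition limit_law :: "('t \<Rightarrow> real) measure" where
  "limit_law = distr \<Omega> (linf_borel T) limit_path"

lemma prob_space_limit_law: "prob_space limit_law"
  unfolding limit_law_def by (rule std_normal_prod.prob_space_distr[OF limit_path_measurable])

lemma limit_law_eval: "t \<in> T \<Longrightarrow> (\<lambda>z. z t) \<in> borel_measurable limit_law"
  unfolding limit_law_def using eval_measurable by simp

lemma gaussian_limit_law: "centered_gaussian_process limit_law (\<lambda>z. z) T K"
  unfolding centered_gaussian_process_def gaussian_process_def
proof (intro conjI ballI allI impI)
  show "(\<lambda>z. z t) \<in> borel_measurable limit_law" if "t \<in> T" for t by (rule limit_law_eval[OF that])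
  show "(\<integral>z. z t \<partial>limit_law) = 0" if "t \<in> T" for t
    unfolding limit_law_def using that limit_moments[of t t]
    by (subst integral_distr[OF limit_path_measurable eval_measurable]) auto
  show "(\<integral>z. z s * z t \<partial>limit_law) = K s t" if "s \<in> T" "t \<in> T" for s t
    unfolding limit_law_def using that limit_moments[of s t] eval_measurable
    by (subst integral_distr[OF limit_path_measurable]) auto
  fix F :: "'t set" and c :: "'t \<Rightarrow> real" assume F: "finite F \<and> F \<subseteq> T"
  obtain e where e: "bij_betw e {..<card F} F"
    using F ex_bij_betw_nat_finite[of F] by (auto simp: atLeast0LessThan)
  have eT: "e i \<in> T" if "i < card F" for i
    using bij_betw_apply[OF e, of i] F that by auto
  have eq: "(\<Sum>t\<in>F. c t * z t) = (\<Sum>i<card F. c (e i) * z (e i))" for z :: "'t \<Rightarrow> real"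
    using sum.reindex_bij_betw[OF e, of "\<lambda>t. c t * z t"] by simp
  have "distr limit_law borel (\<lambda>z. \<Sum>t\<in>F. c t * z t) = distr \<Omega> borel (\<lambda>w. \<Sum>i<card F. c (e i) * limit_path w (e i))"
    unfolding limit_law_def eq using eval_measurable eT
    by (subst distr_distr[OF _ limit_path_measurable]) (auto simp: comp_def)
  also have "\<dots> = centered_normal (\<Sum>i<card F. \<Sum>j<card F. c (e i) * c (e j) * K (e i) (e j))"
    by (rule normal_combination[OF eT])
  finally show "is_normal_law (distr limit_law borel (\<lambda>z. \<Sum>t\<in>F. c t * z t))"
    using centered_normal_is_normal[OF quad_nonneg[OF eT]] by simp
qed

text \<open>The Lipschitz regularization \<open>\<phi> y = sup\<^sub>z (h z - j d(y,z))\<close> decreases to \<open>h\<close> as \<open>j \<longlonglongrightarrow> \<infinity>\<close>.\<close>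

lemma outer_limsup_lipschitz:
  fixes h \<phi> :: "('t \<Rightarrow> real) \<Rightarrow> real"
  assumes lip: "\<And>y z. y \<in> mspace (linf T) \<Longrightarrow> z \<in> mspace (linf T) \<Longrightarrow> \<bar>\<phi> y - \<phi> z\<bar> \<le> L * mdist (linf T) y z"
    and L: "L \<ge> 0" and bh: "\<And>z. \<bar>h z\<bar> \<le> C"
    and b\<phi>: "\<And>z. \<bar>\<phi> z\<bar> \<le> C" and le: "\<And>z. z \<in> mspace (linf T) \<Longrightarrow> h z \<le> \<phi> z"
    and e: "e > 0"
  shows "eventually (\<lambda>n. outer_expectation M (\<lambda>w. h (restrict (Z n w) T)) \<le> (\<integral>w. \<phi> (limit_path w) \<partial>\<Omega>) + e) sequentially"
proof -
  have C: "C \<ge> 0" using bh[of undefined] by linarith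
  have "(\<lambda>m. \<integral>w. \<phi> (path m w) \<partial>\<Omega>) \<longlonglongrightarrow> (\<integral>w. \<phi> (limit_path w) \<partial>\<Omega>)"
    by (rule integral_dominated_convergence[where w="\<lambda>_. C"])
      (auto intro!: lipschitz_limit_measurable[OF lip L] lipschitz_path_measurable[OF lip L] lipschitz_path_tendsto[OF lip] b\<phi>)
  then have ev1: "eventually (\<lambda>m. (\<integral>w. \<phi> (path m w) \<partial>\<Omega>) < (\<integral>w. \<phi> (limit_path w) \<partial>\<Omega>) + e / 3) sequentially"
    by (rule order_tendstoD) (use e in simp)
  have "(\<lambda>m. (L + 2 * C) * (1/2) ^ m) \<longlonglongrightarrow> (L + 2 * C) * 0"
    by (intro tendsto_intros LIMSEQ_power_zero) auto
  then have ev2: "eventually (\<lambda>m. (L + 2 * C) * (1/2) ^ m < e / 3) sequentially"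
    by (rule order_tendstoD) (use e in simp)
  obtain m where m1: "(\<integral>w. \<phi> (path m w) \<partial>\<Omega>) < (\<integral>w. \<phi> (limit_path w) \<partial>\<Omega>) + e / 3"
    and m2: "(L + 2 * C) * (1/2) ^ m < e / 3"
    using eventually_happens[OF eventually_conj[OF ev1 ev2]] by auto
  define H where "H = (\<lambda>y :: nat \<Rightarrow> real. \<phi> (\<lambda>t\<in>T. y (ix (proj m t))))"
  obtain r where r: "\<And>y z. \<bar>H y - H z\<bar> \<le> L * (\<Sum>j<r. \<bar>y j - z j\<bar>)"
    unfolding H_def using lipschitz_proj[OF lip L] by blast
  have Hb: "\<bar>H y\<bar> \<le> C" for y unfolding H_def by (rule b\<phi>)
  have "(\<integral>w. H (gd w) \<partial>\<Omega>) = (\<integral>w. \<phi> (path m w) \<partial>\<Omega>)"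
  proof (rule integral_cong_AE)
    show "(\<lambda>w. H (gd w)) \<in> borel_measurable \<Omega>" by (rule measurable_finite_lipschitz[OF r]) simp
    show "AE w in \<Omega>. H (gd w) = \<phi> (path m w)"
      using AE_good by eventually_elim (simp add: H_def path_def)
  qed (rule lipschitz_path_measurable[OF lip L])
  with fidi[OF r Hb L] have lim: "(\<lambda>n. \<integral>w. H (\<lambda>j. Z n w (d j)) \<partial>M) \<longlonglongrightarrow> (\<integral>w. \<phi> (path m w) \<partial>\<Omega>)" by simp
  have "eventually (\<lambda>n. (\<integral>w. H (\<lambda>j. Z n w (d j)) \<partial>M) < (\<integral>w. \<phi> (limit_path w) \<partial>\<Omega>) + e / 3 + e / 3) sequentially"
    by (rule order_tendstoD(2)[OF lim]) (use m1 e in simp)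
  with proj(3)[of m] show ?thesis
  proof eventually_elim
    case (elim n)
    then obtain A where A: "A \<in> events" "prob A \<le> (1/2) ^ m"
      "\<And>w t. w \<in> space M - A \<Longrightarrow> t \<in> T \<Longrightarrow> \<bar>Z n w t - Z n w (proj m t)\<bar> \<le> (1/2) ^ m" by blast
    have Hm: "integrable M (\<lambda>w. H (\<lambda>j. Z n w (d j)))"
    proof (rule integrable_const_bound[where B=C])
      show "(\<lambda>w. H (\<lambda>j. Z n w (d j))) \<in> borel_measurable M"
        by (rule measurable_finite_lipschitz[OF r]) (use Z_measurable d_in in blast)
    qed (use Hb in auto)
    have Am: "integrable M (\<lambda>w. 2 * C * indicator A w)"
      using A(1) emeasure_finite[of A] by (intro integrable_mult_right integrable_real_indicator) (auto simp: less_top[symmetric])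
    let ?U = "\<lambda>w. H (\<lambda>j. Z n w (d j)) + L * (1/2) ^ m + 2 * C * indicator A w"
    have "outer_expectation M (\<lambda>w. h (restrict (Z n w) T)) \<le> integral\<^sup>L M ?U"
    proof (rule outer_expectation_le)
      show "integrable M ?U"
        by (intro Bochner_Integration.integrable_add Hm Am integrable_const)
      show "- C \<le> h (restrict (Z n w) T)" for w using bh[of "restrict (Z n w) T"] by linarith
      fix w assume wM: "w \<in> space M"
      show "h (restrict (Z n w) T) \<le> ?U w"
      proof (cases "w \<in> A")
        case True
        have "0 \<le> L * (1/2) ^ m" using L by simp
        then show ?thesis
          using True bh[of "restrict (Z n w) T"] Hb[of "\<lambda>j. Z n w (d j)"] by simp
      next
        case False
        have H_eq: "H (\<lambda>j. Z n w (d j)) = \<phi> (\<lambda>t\<in>T. Z n w (proj m t))"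
          unfolding H_def by (rule arg_cong[of _ _ \<phi>]) (auto simp: d_ix proj_in_D)
        have pm: "(\<lambda>t\<in>T. Z n w (proj m t)) \<in> mspace (linf T)" by (rule proj_mspace)
        then obtain B where B: "\<And>t. t \<in> T \<Longrightarrow> \<bar>Z n w (proj m t)\<bar> \<le> B"
          by (auto simp: mspace_linf bounded_iff)
        have "\<bar>Z n w t\<bar> \<le> B + (1/2) ^ m" if "t \<in> T" for t
          using A(3)[of w t] B[OF that] wM False that by fastforce
        then have zm: "restrict (Z n w) T \<in> mspace (linf T)"
          by (auto simp: mspace_linf bounded_iff intro!: exI[of _ "B + (1/2) ^ m"])
        have "mdist (linf T) (restrict (Z n w) T) (\<lambda>t\<in>T. Z n w (proj m t)) \<le> (1/2) ^ m"
          by (rule mdist_linf_le[OF zm pm nonempty]) (use A(3) wM False in auto)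
        then have "L * mdist (linf T) (restrict (Z n w) T) (\<lambda>t\<in>T. Z n w (proj m t)) \<le> L * (1/2) ^ m"
          using L by (rule mult_left_mono)
        then show ?thesis
          using le[OF zm] lip[OF zm pm] False unfolding H_eq by (simp add: abs_le_iff)
      qed
    qed
    also have "integral\<^sup>L M ?U = (\<integral>w. H (\<lambda>j. Z n w (d j)) \<partial>M) + L * (1/2) ^ m + 2 * C * prob A"
      using Hm Am A(1) by (simp add: prob_space)
    also have "\<dots> \<le> (\<integral>w. H (\<lambda>j. Z n w (d j)) \<partial>M) + (L + 2 * C) * (1/2) ^ m"
      using mult_left_mono[OF A(2), of "2 * C"] C by (simp add: distrib_right)
    finally show ?case using elim(2) m2 by simp
  qed
qed

end

definition sup_convolution :: "('t set) \<Rightarrow> (('t \<Rightarrow> real) \<Rightarrow> real) \<Rightarrow> nat \<Rightarrow> ('t \<Rightarrow> real) \<Rightarrow> real" where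
  "sup_convolution T h j y = (if y \<in> mspace (linf T)
     then SUP z\<in>mspace (linf T). h z - real j * mdist (linf T) y z else 0)"

lemma penalized_le:
  assumes "\<And>z. \<bar>h z\<bar> \<le> C"
  shows "h z - real j * mdist (linf T) y z \<le> C"
proof -
  have "0 \<le> real j * mdist (linf T) y z" by (rule mult_nonneg_nonneg) simp_all
  moreover have "h z \<le> C" using assms[of z] by linarith
  ultimately show ?thesis by linarith
qed

lemma sup_convolution_bdd:
  assumes "\<And>z. \<bar>h z\<bar> \<le> C"
  shows "bdd_above ((\<lambda>z. h z - real j * mdist (linf T) y z) ` mspace (linf T))"
  by (rule bdd_aboveI2) (rule penalized_le[of h, OF assms])

lemma sup_convolution_ge:
  assumes "\<And>z. \<bar>h z\<bar> \<le> C" "y \<in> mspace (linf T)"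
  shows "h y \<le> sup_convolution T h j y"
  using cSUP_upper[OF assms(2) sup_convolution_bdd[of h C j T y, OF assms(1)]] assms(2)
  by (simp add: sup_convolution_def)

lemma sup_convolution_le:
  assumes "y \<in> mspace (linf T)" "\<And>z. z \<in> mspace (linf T) \<Longrightarrow> h z - real j * mdist (linf T) y z \<le> b"
  shows "sup_convolution T h j y \<le> b"
  unfolding sup_convolution_def using assms by (auto intro!: cSUP_least)

lemma sup_convolution_bound:
  assumes "\<And>z. \<bar>h z\<bar> \<le> C"
  shows "\<bar>sup_convolution T h j y\<bar> \<le> C"
proof (cases "y \<in> mspace (linf T)")
  case True
  have "sup_convolution T h j y \<le> C"
    by (intro sup_convolution_le[OF True] penalized_le assms)
  then show ?thesis using sup_convolution_ge[of h C y T j, OF assms True] assms[of y] by linarith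
next
  case False
  then show ?thesis using assms[of y] by (simp add: sup_convolution_def)
qed

lemma sup_convolution_lipschitz:
  assumes h: "\<And>z. \<bar>h z\<bar> \<le> C" and y: "y \<in> mspace (linf T)" and z: "z \<in> mspace (linf T)"
  shows "\<bar>sup_convolution T h j y - sup_convolution T h j z\<bar> \<le> real j * mdist (linf T) y z"
proof -
  have le: "sup_convolution T h j y \<le> sup_convolution T h j z + real j * mdist (linf T) y z"
    if y: "y \<in> mspace (linf T)" and z: "z \<in> mspace (linf T)" for y z
  proof (rule sup_convolution_le[OF y])
    fix u assume u: "u \<in> mspace (linf T)"
    have "mdist (linf T) z u \<le> mdist (linf T) y z + mdist (linf T) y u"
      using linf.triangle[OF z y u] linf.commute[of T y z] by simp
    then have "real j * mdist (linf T) z u \<le> real j * (mdist (linf T) y z + mdist (linf T) y u)"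
      by (rule mult_left_mono) simp
    moreover have "h u - real j * mdist (linf T) z u \<le> sup_convolution T h j z"
      using cSUP_upper[OF u sup_convolution_bdd[of h C j T z, OF h]] z by (simp add: sup_convolution_def)
    ultimately show "h u - real j * mdist (linf T) y u \<le> sup_convolution T h j z + real j * mdist (linf T) y z"
      by (simp add: distrib_left)
  qed
  show ?thesis using le[OF y z] le[OF z y] linf.commute[of T y z] by (simp add: abs_le_iff)
qed

lemma sup_convolution_tendsto:
  assumes h: "\<And>z. \<bar>h z\<bar> \<le> C" and cont: "continuous_map (mtopology_of (linf T)) euclideanreal h"
    and y: "y \<in> mspace (linf T)"
  shows "(\<lambda>j. sup_convolution T h j y) \<longlonglongrightarrow> h y"
proof (rule LIMSEQ_I)
  fix e :: real assume e: "e > 0"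
  have "openin (linf.mtopology T) {z \<in> mspace (linf T). h z \<in> {..<h y + e / 2}}"
    using openin_continuous_map_preimage[OF cont, of "{..<h y + e / 2}"] by (simp add: mtopology_linf)
  then obtain \<eta> where \<eta>: "\<eta> > 0" "linf.mball T y \<eta> \<subseteq> {z \<in> mspace (linf T). h z \<in> {..<h y + e / 2}}"
    using y e by (auto simp: linf.openin_mtopology)
  obtain j0 :: nat where j0: "2 * C / \<eta> \<le> real j0" using real_arch_simple by blast
  have "norm (sup_convolution T h j y - h y) < e" if j: "j \<ge> j0" for j
  proof -
    have "sup_convolution T h j y \<le> h y + e / 2"
    proof (rule sup_convolution_le[OF y])
      fix z assume z: "z \<in> mspace (linf T)"
      show "h z - real j * mdist (linf T) y z \<le> h y + e / 2"
      proof (cases "mdist (linf T) y z < \<eta>")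
        case True
        then have "h z < h y + e / 2" using \<eta>(2) y z by (auto simp: linf.in_mball)
        moreover have "0 \<le> real j * mdist (linf T) y z" by simp
        ultimately show ?thesis by linarith
      next
        case False
        have "2 * C \<le> real j0 * \<eta>" using j0 \<eta>(1) by (simp add: field_simps)
        also have "\<dots> \<le> real j * mdist (linf T) y z"
          using False j \<eta>(1) by (intro mult_mono) auto
        finally show ?thesis using h[of z] h[of y] e by (simp add: abs_le_iff)
      qed
    qed
    then show ?thesis using sup_convolution_ge[of h C y T j, OF h y] e by simp
  qed
  then show "\<exists>no. \<forall>n\<ge>no. norm (sup_convolution T h n y - h y) < e" by blast
qed

context gaussian_limit begin

lemma outer_limsup:
  assumes cont: "continuous_map (mtopology_of (linf T)) euclideanreal h" and h: "\<And>z. \<bar>h z\<bar> \<le> C" and e: "e > 0"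
  shows "eventually (\<lambda>n. outer_expectation M (\<lambda>w. h (restrict (Z n w) T)) \<le> (\<integral>w. h (limit_path w) \<partial>\<Omega>) + e) sequentially"
proof -
  let ?\<phi> = "sup_convolution T h"
  have lip: "\<bar>?\<phi> j y - ?\<phi> j z\<bar> \<le> real j * mdist (linf T) y z"
    if "y \<in> mspace (linf T)" "z \<in> mspace (linf T)" for j y z
    by (rule sup_convolution_lipschitz[OF h that])
  have "(\<lambda>j. \<integral>w. ?\<phi> j (limit_path w) \<partial>\<Omega>) \<longlonglongrightarrow> (\<integral>w. h (limit_path w) \<partial>\<Omega>)"
  proof (rule integral_dominated_convergence[where w="\<lambda>_. C"])
    show "(\<lambda>w. h (limit_path w)) \<in> borel_measurable \<Omega>"
      using measurable_compose[OF limit_path_measurable continuous_map_linf_measurable[OF cont]] by simp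
    show "(\<lambda>w. ?\<phi> j (limit_path w)) \<in> borel_measurable \<Omega>" for j
      by (rule lipschitz_limit_measurable[OF lip]) simp_all
    show "AE w in \<Omega>. (\<lambda>j. ?\<phi> j (limit_path w)) \<longlonglongrightarrow> h (limit_path w)"
      by (intro AE_I2 sup_convolution_tendsto[OF h cont limit_path_mspace])
    show "AE w in \<Omega>. norm (?\<phi> j (limit_path w)) \<le> C" for j
      using sup_convolution_bound[of h C T j, OF h] by simp
  qed simp
  then have "eventually (\<lambda>j. (\<integral>w. ?\<phi> j (limit_path w) \<partial>\<Omega>) < (\<integral>w. h (limit_path w) \<partial>\<Omega>) + e / 2) sequentially"
    by (rule order_tendstoD) (use e in simp)
  then obtain j where j: "(\<integral>w. ?\<phi> j (limit_path w) \<partial>\<Omega>) < (\<integral>w. h (limit_path w) \<partial>\<Omega>) + e / 2"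
    using eventually_happens by fastforce
  have "e / 2 > 0" using e by simp
  from outer_limsup_lipschitz[where \<phi>="?\<phi> j" and h=h, OF lip _ h sup_convolution_bound[OF h] sup_convolution_ge[OF h] this]
  have "eventually (\<lambda>n. outer_expectation M (\<lambda>w. h (restrict (Z n w) T)) \<le> (\<integral>w. ?\<phi> j (limit_path w) \<partial>\<Omega>) + e / 2) sequentially"
    by simp
  then show ?thesis by eventually_elim (use j in linarith)
qed

theorem weak_limit: "weakly_converges_linf M Z T limit_law (\<lambda>z. z)"
  unfolding weakly_converges_linf_def
proof (intro conjI allI impI)
  have "restrict z T = z" if "z \<in> space limit_law" for z
    using that by (auto simp: limit_law_def mspace_linf extensional_restrict)
  then have "(\<lambda>z. restrict z T) \<in> measurable limit_law (linf_borel T) \<longleftrightarrow> (\<lambda>z. z) \<in> measurable limit_law (linf_borel T)"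
    by (intro measurable_cong) simp
  then show "(\<lambda>z. restrict z T) \<in> measurable limit_law (linf_borel T)"
    by (simp add: limit_law_def)
  fix h C assume "continuous_map (mtopology_of (linf T)) euclideanreal h \<and> (\<forall>z. \<bar>h z\<bar> \<le> C)"
  then have cont: "continuous_map (mtopology_of (linf T)) euclideanreal h" and h: "\<And>z. \<bar>h z\<bar> \<le> C" by auto
  have r: "restrict (limit_path w) T = limit_path w" for w by (simp add: limit_path_def)
  have hm: "(\<lambda>z. h (restrict z T)) \<in> borel_measurable (linf_borel T)"
  proof -
    have "(\<lambda>z. h (restrict z T)) \<in> borel_measurable (linf_borel T) \<longleftrightarrow> h \<in> borel_measurable (linf_borel T)"
      by (rule measurable_cong) (auto simp: mspace_linf extensional_restrict)
    then show ?thesis using continuous_map_linf_measurable[OF cont] by simp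
  qed
  have "(\<integral>z. h (restrict z T) \<partial>limit_law) = (\<integral>w. h (limit_path w) \<partial>\<Omega>)"
    unfolding limit_law_def by (subst integral_distr[OF limit_path_measurable hm]) (simp only: r)
  moreover have "(\<lambda>n. outer_expectation M (\<lambda>w. h (restrict (Z n w) T))) \<longlonglongrightarrow> (\<integral>w. h (limit_path w) \<partial>\<Omega>)"
  proof (rule outer_expectation_tendstoI)
    show "\<bar>h (restrict (Z n w) T)\<bar> \<le> C" for n w by (rule h)
    fix e :: real assume e: "e > 0"
    show "eventually (\<lambda>n. outer_expectation M (\<lambda>w. h (restrict (Z n w) T)) \<le> (\<integral>w. h (limit_path w) \<partial>\<Omega>) + e) sequentially"
      by (rule outer_limsup[OF cont h e])
    have "continuous_map (mtopology_of (linf T)) euclideanreal (\<lambda>z. - h z)"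
      using cont by (intro continuous_map_minus)
    from outer_limsup[OF this _ e, of C] h
    show "eventually (\<lambda>n. outer_expectation M (\<lambda>w. - h (restrict (Z n w) T)) \<le> - (\<integral>w. h (limit_path w) \<partial>\<Omega>) + e) sequentially"
      by simp
  qed
  ultimately show "(\<lambda>n. outer_expectation M (\<lambda>w. h (restrict (Z n w) T))) \<longlonglongrightarrow> (\<integral>z. h (restrict z T) \<partial>limit_law)"
    by simp
qed

end

lemma (in prob_space) outer_expectation_mono_null:
  assumes A: "A \<in> null_sets M" and eq: "\<And>w. w \<in> space M - A \<Longrightarrow> f w = g w"
    and bf: "\<And>w. \<bar>f w\<bar> \<le> C" and bg: "\<And>w. \<bar>g w\<bar> \<le> C"
  shows "outer_expectation M f \<le> outer_expectation M g"
  unfolding outer_expectation_def[of M g]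
proof (rule cInf_greatest)
  have "g w \<le> C" for w using bg[of w] by linarith
  then show "{integral\<^sup>L M U |U. integrable M U \<and> (\<forall>w\<in>space M. g w \<le> U w)} \<noteq> {}"
    by (auto intro!: exI[of _ "\<lambda>_. C"])
  fix r assume "r \<in> {integral\<^sup>L M U |U. integrable M U \<and> (\<forall>w\<in>space M. g w \<le> U w)}"
  then obtain U where U: "r = integral\<^sup>L M U" "integrable M U" "\<And>w. w \<in> space M \<Longrightarrow> g w \<le> U w" by blast
  have Am: "A \<in> sets M" using A by auto
  have Ai: "integrable M (\<lambda>w. 2 * C * indicator A w)"
    using Am emeasure_finite[of A] by (intro integrable_mult_right integrable_real_indicator) (auto simp: less_top[symmetric])
  have "outer_expectation M f \<le> (\<integral>w. U w + 2 * C * indicator A w \<partial>M)"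
  proof (rule outer_expectation_le)
    show "integrable M (\<lambda>w. U w + 2 * C * indicator A w)" using U Ai by auto
    show "- C \<le> f w" for w using bf[of w] by linarith
    show "f w \<le> U w + 2 * C * indicator A w" if wM: "w \<in> space M" for w
    proof (cases "w \<in> A")
      case True
      then show ?thesis using bf[of w] bg[of w] U(3)[OF wM] by (simp add: abs_le_iff)
    qed (use eq wM U(3) in auto)
  qed
  also have "\<dots> = r" using U Ai Am A by (simp add: measure_eq_0_null_sets)
  finally show "outer_expectation M f \<le> r" .
qed

lemma (in prob_space) weakly_converges_linf_cong_null:
  assumes A: "A \<in> null_sets M" and eq: "\<And>n w t. w \<in> space M - A \<Longrightarrow> t \<in> T \<Longrightarrow> Z' n w t = Z n w t"
    and conv: "weakly_converges_linf M Z T N W"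
  shows "weakly_converges_linf M Z' T N W"
proof -
  have "outer_expectation M (\<lambda>w. h (restrict (Z' n w) T)) = outer_expectation M (\<lambda>w. h (restrict (Z n w) T))"
    if h: "\<forall>z. \<bar>h z\<bar> \<le> C" for h C n
  proof -
    have "restrict (Z' n w) T = restrict (Z n w) T" if "w \<in> space M - A" for w
      using eq[OF that] by (auto simp: restrict_def)
    then show ?thesis
      using h by (intro antisym outer_expectation_mono_null[OF A, where C=C]) auto
  qed
  note eq' = this
  show ?thesis
    unfolding weakly_converges_linf_def
  proof (intro conjI allI impI)
    show "(\<lambda>v. restrict (W v) T) \<in> measurable N (linf_borel T)"
      using conv unfolding weakly_converges_linf_def by blast
    fix h C assume h: "continuous_map (mtopology_of (linf T)) euclideanreal h \<and> (\<forall>z. \<bar>h z\<bar> \<le> C)"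
    then have "(\<lambda>n. outer_expectation M (\<lambda>w. h (restrict (Z n w) T))) \<longlonglongrightarrow> (\<integral>v. h (restrict (W v) T) \<partial>N)"
      using conv unfolding weakly_converges_linf_def by blast
    then show "(\<lambda>n. outer_expectation M (\<lambda>w. h (restrict (Z' n w) T))) \<longlonglongrightarrow> (\<integral>v. h (restrict (W v) T) \<partial>N)"
      using eq'[of h C] h by simp
  qed
qed

lemma (in prob_space) weak_limit_empty:
  shows "\<exists>(N :: ('t \<Rightarrow> real) measure) W. prob_space N \<and> centered_gaussian_process N W {} K \<and>
    weakly_converges_linf M Z {} N (W :: ('t \<Rightarrow> real) \<Rightarrow> 't \<Rightarrow> real)"
proof -
  define N where "N = return (linf_borel {}) (\<lambda>_ :: 't. undefined :: real)"
  have sp: "(\<lambda>_. undefined) \<in> mspace (linf ({} :: 't set))" by (simp add: mspace_linf extensional_def)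
  have N: "prob_space N" unfolding N_def by (rule prob_space_return) (use sp in simp)
  interpret N: prob_space N by (rule N)
  have r: "restrict z {} = (\<lambda>_. undefined)" for z :: "'t \<Rightarrow> real" by auto
  have const: "outer_expectation M (\<lambda>w. c) = c" for c :: real
  proof (rule antisym)
    show "outer_expectation M (\<lambda>w. c) \<le> c"
      using outer_expectation_le[of "\<lambda>_. c" "\<lambda>_. c" "- c"] by (simp add: prob_space)
    have "outer_expectation M (\<lambda>w. - c) \<le> - c"
      using outer_expectation_le[of "\<lambda>_. - c" "\<lambda>_. - c" c] by (simp add: prob_space)
    then show "c \<le> outer_expectation M (\<lambda>w. c)"
      using outer_expectation_ge[of "\<lambda>_. c" "\<bar>c\<bar>"] by simp
  qed
  have "centered_gaussian_process N (\<lambda>z. z) {} K"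
    unfolding centered_gaussian_process_def gaussian_process_def is_normal_law_def by auto
  moreover have "weakly_converges_linf M Z {} N (\<lambda>z. z)"
    unfolding weakly_converges_linf_def r using sp by (auto simp: const N.prob_space)
  ultimately show ?thesis using N by blast
qed

subsection \<open>Regression samples\<close>

locale regression_sample = prob_space M for M :: "'w measure" +
  fixes S :: "'s measure" and X :: "nat \<Rightarrow> 'w \<Rightarrow> 'a::euclidean_space" and Y :: "nat \<Rightarrow> 'w \<Rightarrow> 's"
    and \<kappa> :: "'a \<Rightarrow> 's measure"
  assumes XY_measurable: "\<And>i. (\<lambda>w. (X i w, Y i w)) \<in> measurable M (borel \<Otimes>\<^sub>M S)"
    and indep: "indep_vars (\<lambda>_. borel \<Otimes>\<^sub>M S) (\<lambda>i w. (X i w, Y i w)) UNIV"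
    and ident: "\<And>i. distr M (borel \<Otimes>\<^sub>M S) (\<lambda>w. (X i w, Y i w)) = distr M (borel \<Otimes>\<^sub>M S) (\<lambda>w. (X 0 w, Y 0 w))"
    and kernel: "\<kappa> \<in> measurable borel (prob_algebra S)"
    and disintegration: "\<And>A B. A \<in> sets S \<Longrightarrow> B \<in> sets borel \<Longrightarrow>
      emeasure M {w \<in> space M. X 0 w \<in> B \<and> Y 0 w \<in> A} = (\<integral>\<^sup>+w. emeasure (\<kappa> (X 0 w)) A * indicator B (X 0 w) \<partial>M)"
begin

lemma X_measurable [measurable]: "X i \<in> borel_measurable M"
  using measurable_compose[OF XY_measurable measurable_fst] by simp

lemma Y_measurable [measurable]: "Y i \<in> measurable M S"
  using measurable_compose[OF XY_measurable measurable_snd] by simp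

lemma Y_space: "w \<in> space M \<Longrightarrow> Y i w \<in> space S"
  by (rule measurable_space[OF Y_measurable])

lemma kernel_prob: "prob_space (\<kappa> z)" and sets_kernel [simp]: "sets (\<kappa> z) = sets S"
  using measurable_space[OF kernel, of z] by (auto simp: space_prob_algebra)

lemma space_kernel [simp]: "space (\<kappa> z) = space S"
  by (rule sets_eq_imp_space_eq) simp

lemma kernel_subprob [measurable]: "\<kappa> \<in> measurable borel (subprob_algebra S)"
  by (rule measurable_prob_algebraD[OF kernel])

definition kint :: "('a \<times> 's \<Rightarrow> 'b::{banach, second_countable_topology}) \<Rightarrow> 'a \<Rightarrow> 'b" where
  "kint a z = (\<integral>y. a (z, y) \<partial>\<kappa> z)"

abbreviation joint :: "('a \<times> 's) measure" where
  "joint \<equiv> distr M (borel \<Otimes>\<^sub>M S) (\<lambda>w. (X 0 w, Y 0 w))"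

definition slice :: "'a \<Rightarrow> ('a \<times> 's) measure" where
  "slice z = distr (\<kappa> z) (borel \<Otimes>\<^sub>M S) (Pair z)"

lemma slice_kernel: "slice \<in> measurable borel (prob_algebra (borel \<Otimes>\<^sub>M S))"
  unfolding slice_def by (rule measurable_distr_prob_space2[OF kernel]) simp

lemma slice_subprob [measurable]: "slice \<in> measurable borel (subprob_algebra (borel \<Otimes>\<^sub>M S))"
  by (rule measurable_prob_algebraD[OF slice_kernel])

lemma kernel_measurable_iff: "measurable (\<kappa> z) N = measurable S N"
  by (rule measurable_cong_sets) simp_all

lemma Pair_kernel_measurable: "Pair z \<in> measurable (\<kappa> z) (borel \<Otimes>\<^sub>M S)"
  unfolding kernel_measurable_iff by (rule measurable_Pair1') simp

lemma joint_eq_bind: "joint = distr M borel (X 0) \<bind> slice"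
proof (rule measure_eqI_generator_eq)
  let ?E = "{B \<times> A | B A. B \<in> sets (borel :: 'a measure) \<and> A \<in> sets S}"
  let ?N = "distr M borel (X 0) \<bind> slice"
  show "Int_stable ?E" by (rule Int_stable_pair_measure_generator)
  show "?E \<subseteq> Pow (space (borel :: 'a measure) \<times> space S)" by (rule pair_measure_closed)
  show "sets joint = sigma_sets (space (borel :: 'a measure) \<times> space S) ?E" by (simp add: sets_pair_measure)
  have "slice \<in> measurable (distr M borel (X 0)) (subprob_algebra (borel \<Otimes>\<^sub>M S))" by simp
  from sets_bind_measurable[OF this]
  show "sets ?N = sigma_sets (space (borel :: 'a measure) \<times> space S) ?E" by (simp add: sets_pair_measure)
  show "range (\<lambda>_::nat. space (borel :: 'a measure) \<times> space S) \<subseteq> ?E"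
    by (intro image_subsetI CollectI exI[of _ "space (borel :: 'a measure)"] exI[of _ "space S"]) auto
  show "(\<Union>i::nat. space (borel :: 'a measure) \<times> space S) = space (borel :: 'a measure) \<times> space S" by simp
  show "emeasure joint (space (borel :: 'a measure) \<times> space S) \<noteq> \<infinity>"
    using XY_measurable by (subst emeasure_distr) auto
  fix E assume "E \<in> ?E"
  then obtain A B where E: "E = B \<times> A" "B \<in> sets borel" "A \<in> sets S" by blast
  have "emeasure joint E = emeasure M {w \<in> space M. X 0 w \<in> B \<and> Y 0 w \<in> A}"
    using E XY_measurable by (subst emeasure_distr) (auto intro!: arg_cong[of _ _ "emeasure M"])
  also have "\<dots> = (\<integral>\<^sup>+w. emeasure (\<kappa> (X 0 w)) A * indicator B (X 0 w) \<partial>M)"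
    by (rule disintegration[OF E(3,2)])
  also have "\<dots> = (\<integral>\<^sup>+w. emeasure (slice (X 0 w)) E \<partial>M)"
  proof (rule nn_integral_cong)
    fix w
    have "emeasure (slice z) E = emeasure (\<kappa> z) A * indicator B z" for z
    proof -
      have "Pair z -` E \<inter> space (\<kappa> z) = (if z \<in> B then A else {})"
        using E(1,3) sets.sets_into_space[OF E(3)] by auto
      then show ?thesis
        unfolding slice_def using E Pair_kernel_measurable[of z] by (subst emeasure_distr) auto
    qed
    then show "emeasure (\<kappa> (X 0 w)) A * indicator B (X 0 w) = emeasure (slice (X 0 w)) E" by simp
  qed
  also have "\<dots> = (\<integral>\<^sup>+z. emeasure (slice z) E \<partial>distr M borel (X 0))"
    using E by (subst nn_integral_distr) (auto intro!: measurable_emeasure_kernel[OF slice_subprob])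
  also have "\<dots> = emeasure ?N E"
    using E by (intro emeasure_bind[symmetric, where N="borel \<Otimes>\<^sub>M S"]) auto
  finally show "emeasure joint E = emeasure ?N E" .
qed

lemma nn_integral_joint:
  assumes [measurable]: "\<phi> \<in> borel_measurable (borel \<Otimes>\<^sub>M S)"
  shows "(\<integral>\<^sup>+p. \<phi> p \<partial>joint) = (\<integral>\<^sup>+w. (\<integral>\<^sup>+y. \<phi> (X 0 w, y) \<partial>\<kappa> (X 0 w)) \<partial>M)"
proof -
  have sl: "(\<integral>\<^sup>+p. \<phi> p \<partial>slice z) = (\<integral>\<^sup>+y. \<phi> (z, y) \<partial>\<kappa> z)" for z
    unfolding slice_def by (rule nn_integral_distr[OF Pair_kernel_measurable]) simp
  have "(\<integral>\<^sup>+p. \<phi> p \<partial>joint) = (\<integral>\<^sup>+z. (\<integral>\<^sup>+p. \<phi> p \<partial>slice z) \<partial>distr M borel (X 0))"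
    unfolding joint_eq_bind by (rule nn_integral_bind[where B="borel \<Otimes>\<^sub>M S"]) simp_all
  also have "\<dots> = (\<integral>\<^sup>+w. (\<integral>\<^sup>+p. \<phi> p \<partial>slice (X 0 w)) \<partial>M)"
    by (rule nn_integral_distr) simp_all
  finally show ?thesis by (simp add: sl)
qed

lemma nn_disint:
  assumes [measurable]: "\<phi> \<in> borel_measurable (borel \<Otimes>\<^sub>M S)"
  shows "(\<integral>\<^sup>+w. \<phi> (X i w, Y i w) \<partial>M) = (\<integral>\<^sup>+w. (\<integral>\<^sup>+y. \<phi> (X 0 w, y) \<partial>\<kappa> (X 0 w)) \<partial>M)"
  using nn_integral_distr[OF XY_measurable, of \<phi> i] nn_integral_joint[OF assms]
  unfolding ident[of i] by simp

lemma X_ident: "distr M borel (X i) = distr M borel (X 0)"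
proof -
  have "distr M borel (X i) = distr (distr M (borel \<Otimes>\<^sub>M S) (\<lambda>w. (X i w, Y i w))) borel fst" for i
    by (subst distr_distr[OF measurable_fst XY_measurable]) (simp add: comp_def)
  then show ?thesis using ident[of i] by metis
qed

lemma nn_integral_X_ident:
  assumes "g \<in> borel_measurable borel"
  shows "(\<integral>\<^sup>+w. g (X i w) \<partial>M) = (\<integral>\<^sup>+w. g (X 0 w) \<partial>M)"
  using nn_integral_distr[of "X i" M borel g] nn_integral_distr[of "X 0" M borel g] assms X_ident[of i] by simp

lemma kint_measurable [measurable]:
  fixes a :: "'a \<times> 's \<Rightarrow> 'b::{banach, second_countable_topology}"
  assumes [measurable]: "a \<in> borel_measurable (borel \<Otimes>\<^sub>M S)"
  shows "kint a \<in> borel_measurable borel"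
proof -
  have "kint a z = (\<integral>p. a p \<partial>slice z)" for z
    unfolding slice_def kint_def by (rule integral_distr[OF Pair_kernel_measurable, symmetric]) simp
  then have "kint a = (\<lambda>z. \<integral>p. a p \<partial>slice z)" by auto
  then show ?thesis by simp
qed

lemma slice_measurable: "a \<in> borel_measurable (borel \<Otimes>\<^sub>M S) \<Longrightarrow> (\<lambda>y. a (z, y)) \<in> borel_measurable (\<kappa> z)"
  using measurable_compose[OF Pair_kernel_measurable] by simp

lemma kint_integrable:
  fixes a :: "'a \<times> 's \<Rightarrow> 'b::{banach, second_countable_topology}"
  assumes "a \<in> borel_measurable (borel \<Otimes>\<^sub>M S)" "\<And>z y. y \<in> space S \<Longrightarrow> norm (a (z, y)) \<le> C"
  shows "integrable (\<kappa> z) (\<lambda>y. a (z, y))"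
proof -
  interpret K: prob_space "\<kappa> z" by (rule kernel_prob)
  show ?thesis by (rule K.integrable_const_bound[where B=C]) (use assms slice_measurable in auto)
qed

lemma kint_bound:
  fixes a :: "'a \<times> 's \<Rightarrow> 'b::{banach, second_countable_topology}"
  assumes "a \<in> borel_measurable (borel \<Otimes>\<^sub>M S)" "\<And>z y. y \<in> space S \<Longrightarrow> norm (a (z, y)) \<le> C"
  shows "norm (kint a z) \<le> C"
proof -
  interpret K: prob_space "\<kappa> z" by (rule kernel_prob)
  have "norm (kint a z) \<le> (\<integral>y. norm (a (z, y)) \<partial>\<kappa> z)" unfolding kint_def by (rule integral_norm_bound)
  also have "\<dots> \<le> (\<integral>y. C \<partial>\<kappa> z)"
    by (rule integral_mono) (use kint_integrable[OF assms] assms(2) in auto)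
  finally show ?thesis by (simp add: K.prob_space[unfolded space_kernel])
qed

lemma integral_joint_real:
  fixes a :: "'a \<times> 's \<Rightarrow> real"
  assumes [measurable]: "a \<in> borel_measurable (borel \<Otimes>\<^sub>M S)" and b: "\<And>z y. y \<in> space S \<Longrightarrow> \<bar>a (z, y)\<bar> \<le> C"
  shows "(\<integral>p. a p \<partial>joint) = (\<integral>w. kint a (X 0 w) \<partial>M)"
proof -
  have "(\<integral>p. a p \<partial>joint) = (\<integral>z. (\<integral>p. a p \<partial>slice z) \<partial>distr M borel (X 0))"
    unfolding joint_eq_bind
  proof (rule integral_bind)
    show "a \<in> borel_measurable (borel \<Otimes>\<^sub>M S)" by simp
    show "slice \<in> measurable (distr M borel (X 0)) (subprob_algebra (borel \<Otimes>\<^sub>M S))" by simp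
    show "\<bar>a p\<bar> \<le> C" if "p \<in> space (borel \<Otimes>\<^sub>M S)" for p
      using b[of "snd p" "fst p"] that by (auto simp: space_pair_measure)
    show "finite_measure (distr M borel (X 0))" by (rule finite_measure_distr) simp
    show "AE z in distr M borel (X 0). emeasure (slice z) (space (slice z)) \<le> ennreal 1"
    proof (rule AE_I2)
      fix z
      have "prob_space (slice z)" using measurable_space[OF slice_kernel, of z] by (simp add: space_prob_algebra)
      then show "emeasure (slice z) (space (slice z)) \<le> ennreal 1" by (simp add: prob_space.emeasure_space_1)
    qed
  qed
  also have "\<dots> = (\<integral>w. (\<integral>p. a p \<partial>slice (X 0 w)) \<partial>M)"
    by (rule integral_distr) simp_all
  also have "(\<lambda>z. \<integral>p. a p \<partial>slice z) = kint a"
    unfolding slice_def kint_def by (rule ext, rule integral_distr[OF Pair_kernel_measurable]) simp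
  finally show ?thesis by (simp add: fun_eq_iff)
qed

lemma integral_joint:
  fixes a :: "'a \<times> 's \<Rightarrow> complex"
  assumes m [measurable]: "a \<in> borel_measurable (borel \<Otimes>\<^sub>M S)" and b: "\<And>z y. y \<in> space S \<Longrightarrow> norm (a (z, y)) \<le> C"
  shows "(\<integral>p. a p \<partial>joint) = (\<integral>w. kint a (X 0 w) \<partial>M)"
proof -
  interpret J: prob_space joint by (rule prob_space_distr) (rule XY_measurable)
  have ia: "integrable joint a"
  proof (rule J.integrable_const_bound[where B=C])
    show "AE p in joint. norm (a p) \<le> C" by (rule AE_I2) (auto simp: space_pair_measure b)
  qed simp
  have ik: "integrable M (\<lambda>w. kint a (X 0 w))"
    by (rule integrable_const_bound[where B=C]) (use kint_bound[OF m b] in auto)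
  have re: "Re (kint a z) = kint (\<lambda>p. Re (a p)) z" "Im (kint a z) = kint (\<lambda>p. Im (a p)) z" for z
    using kint_integrable[OF m b, of z] by (simp_all add: kint_def)
  have "Re (\<integral>p. a p \<partial>joint) = (\<integral>p. Re (a p) \<partial>joint)" using ia by simp
  also have "\<dots> = (\<integral>w. kint (\<lambda>p. Re (a p)) (X 0 w) \<partial>M)"
    by (rule integral_joint_real[where C=C]) (use b abs_Re_le_cmod order_trans in \<open>auto, blast\<close>)
  also have "\<dots> = Re (\<integral>w. kint a (X 0 w) \<partial>M)" using ik by (simp add: re[symmetric])
  finally have R: "Re (\<integral>p. a p \<partial>joint) = Re (\<integral>w. kint a (X 0 w) \<partial>M)" .
  have "Im (\<integral>p. a p \<partial>joint) = (\<integral>p. Im (a p) \<partial>joint)" using ia by simp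
  also have "\<dots> = (\<integral>w. kint (\<lambda>p. Im (a p)) (X 0 w) \<partial>M)"
    by (rule integral_joint_real[where C=C]) (use b abs_Im_le_cmod order_trans in \<open>auto, blast\<close>)
  also have "\<dots> = Im (\<integral>w. kint a (X 0 w) \<partial>M)" using ik by (simp add: re[symmetric])
  finally show ?thesis using R by (simp add: complex_eq_iff)
qed

subsection \<open>Integrating out the responses\<close>

lemma distr_sample:
  assumes "finite J" "J \<noteq> {}"
  shows "distr M (\<Pi>\<^sub>M i\<in>J. borel \<Otimes>\<^sub>M S) (\<lambda>w. \<lambda>i\<in>J. (X i w, Y i w)) = (\<Pi>\<^sub>M i\<in>J. joint)"
proof -
  have "indep_vars (\<lambda>_. borel \<Otimes>\<^sub>M S) (\<lambda>i w. (X i w, Y i w)) J"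
    by (rule indep_vars_subset[OF indep]) simp
  then have "distr M (\<Pi>\<^sub>M i\<in>J. borel \<Otimes>\<^sub>M S) (\<lambda>w. \<lambda>i\<in>J. (X i w, Y i w)) =
      (\<Pi>\<^sub>M i\<in>J. distr M (borel \<Otimes>\<^sub>M S) (\<lambda>w. (X i w, Y i w)))"
    using indep_vars_iff_distr_eq_PiM'[OF assms(2), where M'="\<lambda>_. borel \<Otimes>\<^sub>M S" and X="\<lambda>i w. (X i w, Y i w)"]
      XY_measurable by simp
  also have "\<dots> = (\<Pi>\<^sub>M i\<in>J. joint)"
    by (rule PiM_cong[OF refl ident])
  finally show ?thesis .
qed

lemma integrate_response:
  fixes G :: "(nat \<Rightarrow> 'a \<times> 's) \<Rightarrow> complex" and a :: "'a \<times> 's \<Rightarrow> complex"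
  assumes J: "finite J" "i \<in> J"
    and G: "G \<in> borel_measurable (\<Pi>\<^sub>M j\<in>J. joint)" and Gb: "\<And>w. w \<in> space (\<Pi>\<^sub>M j\<in>J. joint) \<Longrightarrow> norm (G w) \<le> B"
    and a [measurable]: "a \<in> borel_measurable (borel \<Otimes>\<^sub>M S)" and ab: "\<And>z y. y \<in> space S \<Longrightarrow> norm (a (z, y)) \<le> C"
    and G_indep: "\<And>w y. w \<in> space (\<Pi>\<^sub>M j\<in>J. joint) \<Longrightarrow> y \<in> space S \<Longrightarrow> G (w(i := (fst (w i), y))) = G w"
  shows "(\<integral>w. G w * a (w i) \<partial>(\<Pi>\<^sub>M j\<in>J. joint)) = (\<integral>w. G w * kint a (fst (w i)) \<partial>(\<Pi>\<^sub>M j\<in>J. joint))"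
proof -
  interpret Jo: prob_space joint by (rule prob_space_distr) (rule XY_measurable)
  interpret P: product_prob_space "\<lambda>_. joint" UNIV by unfold_locales
  define I where "I = J - {i}"
  have I: "finite I" "i \<notin> I" "J = insert i I" using J by (auto simp: I_def)
  have spS: "space S \<noteq> {}" using Y_space not_empty by blast
  then obtain y0 where y0: "y0 \<in> space S" by blast
  have B: "B \<ge> 0" using P.not_empty
  proof -
    have "space (\<Pi>\<^sub>M j\<in>J. joint) \<noteq> {}" using y0 by (auto simp: space_PiM space_pair_measure PiE_eq_empty_iff)
    then show ?thesis using Gb norm_ge_zero order_trans by blast
  qed
  have C: "C \<ge> 0" using ab[OF y0] norm_ge_zero order_trans by blast
  have Gm [measurable]: "G \<in> borel_measurable (\<Pi>\<^sub>M j\<in>insert i I. joint)" using G I by simp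
  have comp [measurable]: "(\<lambda>w. w i) \<in> measurable (\<Pi>\<^sub>M j\<in>insert i I. joint) (borel \<Otimes>\<^sub>M S)"
    using measurable_component_singleton[of i "insert i I" "\<lambda>_. joint"] by simp
  have int: "integrable (\<Pi>\<^sub>M j\<in>insert i I. joint) (\<lambda>w. G w * b (w i))"
    if b [measurable]: "b \<in> borel_measurable (borel \<Otimes>\<^sub>M S)" and bb: "\<And>z y. y \<in> space S \<Longrightarrow> norm (b (z, y)) \<le> C" for b
  proof -
    interpret PI: prob_space "\<Pi>\<^sub>M j\<in>insert i I. joint" by (rule prob_space_PiM) (rule Jo.prob_space_axioms)
    show ?thesis
    proof (rule PI.integrable_const_bound[where B="B * C"])
      show "AE w in \<Pi>\<^sub>M j\<in>insert i I. joint. norm (G w * b (w i)) \<le> B * C"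
      proof (rule AE_I2)
        fix w assume w: "w \<in> space (\<Pi>\<^sub>M j\<in>insert i I. joint)"
        then have "snd (w i) \<in> space S" by (auto simp: space_PiM space_pair_measure PiE_def Pi_def mem_Times_iff)
        then have "norm (b (w i)) \<le> C" using bb[of "snd (w i)" "fst (w i)"] by simp
        then show "norm (G w * b (w i)) \<le> B * C"
          using Gb[of w] w I B unfolding norm_mult by (intro mult_mono) auto
      qed
    qed measurable
  qed
  have kb: "norm (kint a z) \<le> C" for z by (rule kint_bound[OF a ab])
  have inner: "(\<integral>p. G (w(i := p)) * a p \<partial>joint) = (\<integral>p. G (w(i := p)) * kint a (fst p) \<partial>joint)"
    if w: "w \<in> space (\<Pi>\<^sub>M j\<in>I. joint)" for w
  proof -
    define g where "g z = G (w(i := (z, y0)))" for z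
    have up: "w(i := p) \<in> space (\<Pi>\<^sub>M j\<in>J. joint)" if "p \<in> space (borel \<Otimes>\<^sub>M S)" for p
      using w that I by (auto simp: space_PiM PiE_def extensional_def Pi_def)
    have gG: "G (w(i := p)) = g (fst p)" if p: "p \<in> space (borel \<Otimes>\<^sub>M S)" for p
      using G_indep[OF up[OF p] y0] by (simp add: g_def)
    have "(\<lambda>z. w(i := (z, y0))) \<in> measurable borel (\<Pi>\<^sub>M j\<in>insert i I. joint)"
      using w y0 by (intro measurable_fun_upd[where J=I]) (auto simp: measurable_const)
    from measurable_compose[OF this Gm] have g [measurable]: "g \<in> borel_measurable borel"
      by (simp add: g_def[abs_def])
    have gb: "norm (g z) \<le> B" for z
      unfolding g_def using up[of "(z, y0)"] y0 by (intro Gb) (auto simp: space_pair_measure)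
    have "(\<integral>p. G (w(i := p)) * a p \<partial>joint) = (\<integral>p. g (fst p) * a p \<partial>joint)"
      by (rule Bochner_Integration.integral_cong) (auto simp: gG)
    also have "\<dots> = (\<integral>\<omega>. kint (\<lambda>p. g (fst p) * a p) (X 0 \<omega>) \<partial>M)"
    proof (rule integral_joint[where C="B * C"])
      show "norm (g (fst (z, y)) * a (z, y)) \<le> B * C" if "y \<in> space S" for z y
        using gb[of z] ab[OF that, of z] B unfolding norm_mult by (intro mult_mono) auto
    qed measurable
    also have "\<dots> = (\<integral>\<omega>. g (X 0 \<omega>) * kint a (X 0 \<omega>) \<partial>M)" by (simp add: kint_def)
    also have "\<dots> = (\<integral>p. g (fst p) * kint a (fst p) \<partial>joint)"
      by (subst integral_distr[OF XY_measurable]) auto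
    also have "\<dots> = (\<integral>p. G (w(i := p)) * kint a (fst p) \<partial>joint)"
      by (rule Bochner_Integration.integral_cong) (auto simp: gG)
    finally show ?thesis .
  qed
  have k2: "norm (kint a (fst (z, y))) \<le> C" for z y using kb by simp
  have "(\<integral>w. G w * a (w i) \<partial>(\<Pi>\<^sub>M j\<in>insert i I. joint)) =
      (\<integral>w. (\<integral>p. G (w(i := p)) * a p \<partial>joint) \<partial>(\<Pi>\<^sub>M j\<in>I. joint))"
    using P.product_integral_insert[OF I(1,2) int[OF a ab]] by simp
  also have "\<dots> = (\<integral>w. (\<integral>p. G (w(i := p)) * kint a (fst p) \<partial>joint) \<partial>(\<Pi>\<^sub>M j\<in>I. joint))"
    by (rule Bochner_Integration.integral_cong) (simp_all add: inner)
  also have "\<dots> = (\<integral>w. G w * kint a (fst (w i)) \<partial>(\<Pi>\<^sub>M j\<in>insert i I. joint))"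
    using P.product_integral_insert[OF I(1,2) int[of "\<lambda>p. kint a (fst p)"]] k2 by simp
  finally show ?thesis using I by simp
qed

end

lemma exp_le_quadratic:
  fixes t :: real
  assumes "\<bar>t\<bar> \<le> 1"
  shows "exp t \<le> 1 + t + t\<^sup>2"
proof (cases "t \<ge> 0")
  case True
  then show ?thesis using exp_bound[of t] assms by simp
next
  case False
  define s where "s = - t"
  have s: "s > 0" "s \<le> 1" using False assms by (auto simp: s_def)
  have "1 \<le> 1 + s ^ 3" using s by simp
  also have "\<dots> = (1 - s + s\<^sup>2) * (1 + s)" by (simp add: algebra_simps power2_eq_square power3_eq_cube)
  also have "\<dots> \<le> (1 - s + s\<^sup>2) * exp s"
  proof (rule mult_left_mono)
    show "1 + s \<le> exp s" by (rule exp_ge_add_one_self)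
    show "0 \<le> 1 - s + s\<^sup>2" using s by simp
  qed
  finally have "exp (- s) \<le> 1 - s + s\<^sup>2" by (simp add: exp_minus field_simps)
  then show ?thesis by (simp add: s_def)
qed

lemma (in prob_space) prob_exp_bound:
  assumes V [measurable]: "V \<in> borel_measurable M" and int: "integrable M (\<lambda>w. exp (V w))"
  shows "prob {w \<in> space M. t \<le> V w} \<le> exp (- t) * (\<integral>w. exp (V w) \<partial>M)"
proof -
  have "prob {w \<in> space M. t \<le> V w} = (\<integral>w. indicator {w \<in> space M. t \<le> V w} w \<partial>M)" by simp
  also have "\<dots> \<le> (\<integral>w. exp (- t) * exp (V w) \<partial>M)"
  proof (rule integral_mono)
    show "integrable M (indicator {w \<in> space M. t \<le> V w} :: _ \<Rightarrow> real)"
      by (rule integrable_real_indicator) (auto simp: less_top[symmetric])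
    show "integrable M (\<lambda>w. exp (- t) * exp (V w))" using int by simp
    show "indicator {w \<in> space M. t \<le> V w} w \<le> exp (- t) * exp (V w)" for w
      by (auto simp: indicator_def exp_add[symmetric] simp del: exp_add)
  qed
  finally show ?thesis by simp
qed

context regression_sample begin

lemma response_product:
  fixes H :: "(nat \<Rightarrow> 'a) \<Rightarrow> complex" and a :: "'a \<times> 's \<Rightarrow> complex"
  assumes J: "finite J" and I: "finite I" "I \<subseteq> J"
    and a: "a \<in> borel_measurable (borel \<Otimes>\<^sub>M S)" and ab: "\<And>z y. y \<in> space S \<Longrightarrow> norm (a (z, y)) \<le> C"
    and H: "H \<in> borel_measurable (\<Pi>\<^sub>M j\<in>J. borel)" and Hb: "\<And>x. norm (H x) \<le> B"
  shows "(\<integral>w. H (\<lambda>j\<in>J. fst (w j)) * (\<Prod>i\<in>I. a (w i)) \<partial>(\<Pi>\<^sub>M j\<in>J. joint)) =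
    (\<integral>w. H (\<lambda>j\<in>J. fst (w j)) * (\<Prod>i\<in>I. kint a (fst (w i))) \<partial>(\<Pi>\<^sub>M j\<in>J. joint))"
  using I H Hb
proof (induction I arbitrary: H B rule: finite_induct)
  case (insert i I)
  let ?P = "\<Pi>\<^sub>M j\<in>J. joint"
  note Hm [measurable] = insert.prems(2) and am [measurable] = a
  have comp: "(\<lambda>w. w j) \<in> measurable ?P (borel \<Otimes>\<^sub>M S)" if "j \<in> J" for j
    using measurable_component_singleton[OF that, of "\<lambda>_. joint"] by simp
  have rm: "(\<lambda>w. \<lambda>j\<in>J. fst (w j)) \<in> measurable ?P (\<Pi>\<^sub>M j\<in>J. borel)"
    by (rule measurable_restrict) (rule measurable_compose[OF comp measurable_fst])
  have wS: "fst (w j) \<in> UNIV" "snd (w j) \<in> space S" if "w \<in> space ?P" "j \<in> J" for w j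
    using that by (auto simp: space_PiM space_pair_measure PiE_def Pi_def mem_Times_iff)
  have C: "C \<ge> 0"
  proof -
    obtain \<omega> where "\<omega> \<in> space M" using not_empty by blast
    then show ?thesis using ab[OF Y_space] norm_ge_zero order_trans by blast
  qed
  have B: "B \<ge> 0" using insert.prems(3) norm_ge_zero order_trans by blast
  define G where "G w = H (\<lambda>j\<in>J. fst (w j)) * (\<Prod>l\<in>I. a (w l))" for w
  have "(\<integral>w. H (\<lambda>j\<in>J. fst (w j)) * (\<Prod>l\<in>insert i I. a (w l)) \<partial>?P) = (\<integral>w. G w * a (w i) \<partial>?P)"
    using insert.hyps by (simp add: G_def ac_simps)
  also have "\<dots> = (\<integral>w. G w * kint a (fst (w i)) \<partial>?P)"
  proof (rule integrate_response[where B="B * C ^ card I" and C=C])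
    show "G \<in> borel_measurable ?P"
      unfolding G_def using insert.prems(1) measurable_compose[OF rm Hm] measurable_compose[OF comp am]
      by (intro borel_measurable_times borel_measurable_prod) auto
    show "norm (G w) \<le> B * C ^ card I" if w: "w \<in> space ?P" for w
    proof -
      have "norm (a (w l)) \<le> C" if "l \<in> I" for l
        using ab[of "snd (w l)" "fst (w l)"] wS[OF w, of l] that insert.prems(1) by auto
      then have "(\<Prod>l\<in>I. norm (a (w l))) \<le> (\<Prod>l\<in>I. C)" by (intro prod_mono) auto
      then show ?thesis
        unfolding G_def norm_mult prod_norm[symmetric] using insert.prems(3) B
        by (intro mult_mono) (auto intro: prod_nonneg)
    qed
    show "G (w(i := (fst (w i), y))) = G w" if "w \<in> space ?P" "y \<in> space S" for w y
    proof -
      have "(\<lambda>j\<in>J. fst ((w(i := (fst (w i), y))) j)) = (\<lambda>j\<in>J. fst (w j))" by (auto simp: restrict_def)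
      moreover have "(\<Prod>l\<in>I. a ((w(i := (fst (w i), y))) l)) = (\<Prod>l\<in>I. a (w l))"
        using insert.hyps by (intro prod.cong) auto
      ultimately show ?thesis unfolding G_def by simp
    qed
  qed (use J insert.prems a ab in auto)
  also have "\<dots> = (\<integral>w. (H (\<lambda>j\<in>J. fst (w j)) * kint a ((\<lambda>j\<in>J. fst (w j)) i)) * (\<Prod>l\<in>I. a (w l)) \<partial>?P)"
    using insert.prems(1) by (simp add: G_def ac_simps)
  also have "\<dots> = (\<integral>w. (H (\<lambda>j\<in>J. fst (w j)) * kint a ((\<lambda>j\<in>J. fst (w j)) i)) * (\<Prod>l\<in>I. kint a (fst (w l))) \<partial>?P)"
  proof (rule insert.IH)
    show "I \<subseteq> J" using insert.prems by simp
    have "(\<lambda>x. x i) \<in> borel_measurable (\<Pi>\<^sub>M j\<in>J. borel :: 'a measure)"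
      using insert.prems(1) by (intro measurable_component_singleton) auto
    from measurable_compose[OF this kint_measurable[OF a]]
    show "(\<lambda>x. H x * kint a (x i)) \<in> borel_measurable (\<Pi>\<^sub>M j\<in>J. borel)"
      by (intro borel_measurable_times Hm)
    show "norm (H x * kint a (x i)) \<le> B * C" for x
      unfolding norm_mult using insert.prems(3)[of x] kint_bound[OF a ab] B by (intro mult_mono) auto
  qed
  also have "\<dots> = (\<integral>w. H (\<lambda>j\<in>J. fst (w j)) * (\<Prod>l\<in>insert i I. kint a (fst (w l))) \<partial>?P)"
    using insert.prems(1) insert.hyps by (simp add: ac_simps)
  finally show ?case .
qed simp

lemma response_product_sample:
  fixes H :: "(nat \<Rightarrow> 'a) \<Rightarrow> complex" and a :: "'a \<times> 's \<Rightarrow> complex"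
  assumes J: "finite J" "J \<noteq> {}" and I: "I \<subseteq> J"
    and a: "a \<in> borel_measurable (borel \<Otimes>\<^sub>M S)" and ab: "\<And>z y. y \<in> space S \<Longrightarrow> norm (a (z, y)) \<le> C"
    and H: "H \<in> borel_measurable (\<Pi>\<^sub>M j\<in>J. borel)" and Hb: "\<And>x. norm (H x) \<le> B"
  shows "(\<integral>\<omega>. H (\<lambda>j\<in>J. X j \<omega>) * (\<Prod>i\<in>I. a (X i \<omega>, Y i \<omega>)) \<partial>M) =
    (\<integral>\<omega>. H (\<lambda>j\<in>J. X j \<omega>) * (\<Prod>i\<in>I. kint a (X i \<omega>)) \<partial>M)"
proof -
  let ?P = "\<Pi>\<^sub>M j\<in>J. joint" and ?w = "\<lambda>\<omega>. \<lambda>j\<in>J. (X j \<omega>, Y j \<omega>)"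
  have W: "?w \<in> measurable M (\<Pi>\<^sub>M i\<in>J. borel \<Otimes>\<^sub>M S)"
    by (rule measurable_restrict) (rule XY_measurable)
  have comp: "(\<lambda>w. w j) \<in> measurable (\<Pi>\<^sub>M i\<in>J. borel \<Otimes>\<^sub>M S) (borel \<Otimes>\<^sub>M S)" if "j \<in> J" for j
    using measurable_component_singleton[OF that, of "\<lambda>_. borel \<Otimes>\<^sub>M S"] .
  have rm: "(\<lambda>w. \<lambda>j\<in>J. fst (w j)) \<in> measurable (\<Pi>\<^sub>M i\<in>J. borel \<Otimes>\<^sub>M S) (\<Pi>\<^sub>M j\<in>J. borel)"
    by (rule measurable_restrict) (rule measurable_compose[OF comp measurable_fst])
  have tr: "(\<integral>\<omega>. H (\<lambda>j\<in>J. X j \<omega>) * (\<Prod>i\<in>I. b (X i \<omega>, Y i \<omega>)) \<partial>M) =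
      (\<integral>w. H (\<lambda>j\<in>J. fst (w j)) * (\<Prod>i\<in>I. b (w i)) \<partial>?P)"
    if b: "b \<in> borel_measurable (borel \<Otimes>\<^sub>M S)" for b
  proof -
    have m: "(\<lambda>w. H (\<lambda>j\<in>J. fst (w j)) * (\<Prod>i\<in>I. b (w i))) \<in> borel_measurable (\<Pi>\<^sub>M i\<in>J. borel \<Otimes>\<^sub>M S)"
      using measurable_compose[OF rm H] measurable_compose[OF comp b] I
      by (intro borel_measurable_times borel_measurable_prod) auto
    have "(\<integral>w. H (\<lambda>j\<in>J. fst (w j)) * (\<Prod>i\<in>I. b (w i)) \<partial>?P) =
       (\<integral>\<omega>. H (\<lambda>j\<in>J. fst (?w \<omega> j)) * (\<Prod>i\<in>I. b (?w \<omega> i)) \<partial>M)"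
      unfolding distr_sample[OF J, symmetric] by (rule integral_distr[OF W m])
    also have "\<dots> = (\<integral>\<omega>. H (\<lambda>j\<in>J. X j \<omega>) * (\<Prod>i\<in>I. b (X i \<omega>, Y i \<omega>)) \<partial>M)"
    proof (rule Bochner_Integration.integral_cong[OF refl])
      fix \<omega>
      have "(\<lambda>j\<in>J. fst (?w \<omega> j)) = (\<lambda>j\<in>J. X j \<omega>)" by (auto simp: restrict_def)
      moreover have "(\<Prod>i\<in>I. b (?w \<omega> i)) = (\<Prod>i\<in>I. b (X i \<omega>, Y i \<omega>))" using I by (intro prod.cong) auto
      ultimately show "H (\<lambda>j\<in>J. fst (?w \<omega> j)) * (\<Prod>i\<in>I. b (?w \<omega> i)) =
        H (\<lambda>j\<in>J. X j \<omega>) * (\<Prod>i\<in>I. b (X i \<omega>, Y i \<omega>))" by simp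
    qed
    finally show ?thesis by simp
  qed
  have "(\<lambda>p. kint a (fst p)) \<in> borel_measurable (borel \<Otimes>\<^sub>M S)"
    using measurable_compose[OF measurable_fst kint_measurable[OF a]] .
  from tr[OF this] tr[OF a] response_product[OF J(1) finite_subset[OF I J(1)] I a ab H Hb]
  show ?thesis by simp
qed

text \<open>The index set \<open>N x\<close> may depend on the covariates only; this is what makes the selected responses conditionally independent.\<close>

definition selection :: "nat set \<Rightarrow> ((nat \<Rightarrow> 'a) \<Rightarrow> nat set) \<Rightarrow> bool" where
  "selection J N \<longleftrightarrow> finite J \<and> J \<noteq> {} \<and> (\<forall>x. N x \<subseteq> J) \<and> (\<forall>x. N (restrict x J) = N x) \<and>
     (\<forall>I. {x \<in> space (\<Pi>\<^sub>M j\<in>J. borel). N x = I} \<in> sets (\<Pi>\<^sub>M j\<in>J. borel))"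

lemma selectionD:
  assumes "selection J N"
  shows "finite J" "J \<noteq> {}" "N x \<subseteq> J" "finite (N x)" "N (restrict x J) = N x"
    "{x \<in> space (\<Pi>\<^sub>M j\<in>J. borel). N x = I} \<in> sets (\<Pi>\<^sub>M j\<in>J. borel)"
proof -
  show J: "finite J" "J \<noteq> {}" "N x \<subseteq> J" "N (restrict x J) = N x"
    "{x \<in> space (\<Pi>\<^sub>M j\<in>J. borel). N x = I} \<in> sets (\<Pi>\<^sub>M j\<in>J. borel)"
    using assms unfolding selection_def by auto
  show "finite (N x)" by (rule finite_subset[OF J(3,1)])
qed

abbreviation sel :: "((nat \<Rightarrow> 'a) \<Rightarrow> nat set) \<Rightarrow> 'w \<Rightarrow> nat set" where
  "sel N w \<equiv> N (\<lambda>j. X j w)"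

lemma sel_event [measurable]:
  assumes "selection J N"
  shows "{w \<in> space M. sel N w = I} \<in> sets M"
proof -
  have "(\<lambda>w. \<lambda>j\<in>J. X j w) \<in> measurable M (\<Pi>\<^sub>M j\<in>J. borel)" by (rule measurable_restrict) simp
  from measurable_sets[OF this selectionD(6)[OF assms, of I]]
  have "(\<lambda>w. \<lambda>j\<in>J. X j w) -` {x \<in> space (\<Pi>\<^sub>M j\<in>J. borel). N x = I} \<inter> space M \<in> sets M" .
  also have "(\<lambda>w. \<lambda>j\<in>J. X j w) -` {x \<in> space (\<Pi>\<^sub>M j\<in>J. borel). N x = I} \<inter> space M = {w \<in> space M. sel N w = I}"
    using selectionD(5)[OF assms] by (auto simp: space_PiM)
  finally show ?thesis .
qed

lemma sel_cases:
  fixes F :: "nat set \<Rightarrow> 'b::{real_normed_field}"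
  assumes "selection J N"
  shows "F (sel N w) = (\<Sum>I\<in>Pow J. (if sel N w = I then 1 else 0) * F I)"
proof -
  have "(\<Sum>I\<in>Pow J. (if sel N w = I then 1 else 0) * F I) = (\<Sum>I\<in>Pow J. if sel N w = I then F I else 0)"
    by (intro sum.cong) auto
  also have "\<dots> = F (sel N w)"
    using selectionD[OF assms] by (simp add: sum.delta)
  finally show ?thesis by simp
qed

lemma sel_measurable:
  fixes F :: "nat set \<Rightarrow> 'w \<Rightarrow> 'b::{real_normed_field, second_countable_topology}"
  assumes N: "selection J N" and F: "\<And>I. I \<subseteq> J \<Longrightarrow> F I \<in> borel_measurable M"
  shows "(\<lambda>w. F (sel N w) w) \<in> borel_measurable M"
proof -
  have "(\<lambda>w. (if sel N w = I then 1 else 0) * F I w) \<in> borel_measurable M" if "I \<subseteq> J" for I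
    using F[OF that] sel_event[OF N, of I] by measurable
  then have "(\<lambda>w. \<Sum>I\<in>Pow J. (if sel N w = I then 1 else 0) * F I w) \<in> borel_measurable M"
    by (intro borel_measurable_sum) auto
  then show ?thesis
    by (subst measurable_cong[where g="\<lambda>w. \<Sum>I\<in>Pow J. (if sel N w = I then 1 else 0) * F I w"])
      (rule sel_cases[OF N, of "\<lambda>I. F I _"])
qed

lemma cond_selection:
  fixes a :: "'a \<times> 's \<Rightarrow> complex"
  assumes N: "selection J N"
    and a: "a \<in> borel_measurable (borel \<Otimes>\<^sub>M S)" and ab: "\<And>z y. y \<in> space S \<Longrightarrow> norm (a (z, y)) \<le> C"
  shows "(\<integral>w. (\<Prod>i\<in>sel N w. a (X i w, Y i w)) \<partial>M) = (\<integral>w. (\<Prod>i\<in>sel N w. kint a (X i w)) \<partial>M)"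
proof -
  let ?ind = "\<lambda>I w. if sel N w = I then 1 else 0 :: complex"
  have int: "integrable M (\<lambda>w. ?ind I w * (\<Prod>i\<in>I. b (X i w, Y i w)))"
    if I: "I \<subseteq> J" and b: "b \<in> borel_measurable (borel \<Otimes>\<^sub>M S)"
      and bb: "\<And>z y. y \<in> space S \<Longrightarrow> norm (b (z, y)) \<le> C" for I b
  proof (rule integrable_const_bound[where B="C ^ card I"])
    have "(\<lambda>w. b (X i w, Y i w)) \<in> borel_measurable M" for i
      using measurable_compose[OF XY_measurable b] .
    then show "(\<lambda>w. ?ind I w * (\<Prod>i\<in>I. b (X i w, Y i w))) \<in> borel_measurable M"
      using sel_event[OF N, of I] by measurable
    show "AE w in M. norm (?ind I w * (\<Prod>i\<in>I. b (X i w, Y i w))) \<le> C ^ card I"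
    proof (rule AE_I2)
      fix w assume wM: "w \<in> space M"
      have C: "C \<ge> 0" using bb[OF Y_space[OF wM]] norm_ge_zero order_trans by blast
      have "(\<Prod>i\<in>I. norm (b (X i w, Y i w))) \<le> (\<Prod>i\<in>I. C)"
        using bb[OF Y_space[OF wM]] by (intro prod_mono) auto
      then show "norm (?ind I w * (\<Prod>i\<in>I. b (X i w, Y i w))) \<le> C ^ card I"
        using C by (auto simp: prod_norm[symmetric])
    qed
  qed
  have one: "(\<integral>w. ?ind I w * (\<Prod>i\<in>I. a (X i w, Y i w)) \<partial>M) = (\<integral>w. ?ind I w * (\<Prod>i\<in>I. kint a (X i w)) \<partial>M)"
    if I: "I \<subseteq> J" for I
  proof -
    let ?H = "\<lambda>x. if N x = I then 1 else 0 :: complex"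
    have "?H \<in> borel_measurable (\<Pi>\<^sub>M j\<in>J. borel)" using selectionD(6)[OF N, of I] by measurable
    from response_product_sample[OF selectionD(1,2)[OF N] I a ab this, of 1]
    show ?thesis using selectionD(5)[OF N] by simp
  qed
  have ka: "(\<lambda>p. kint a (fst p)) \<in> borel_measurable (borel \<Otimes>\<^sub>M S)"
    using measurable_compose[OF measurable_fst kint_measurable[OF a]] .
  have "(\<integral>w. (\<Prod>i\<in>sel N w. a (X i w, Y i w)) \<partial>M) = (\<integral>w. (\<Sum>I\<in>Pow J. ?ind I w * (\<Prod>i\<in>I. a (X i w, Y i w))) \<partial>M)"
    by (subst sel_cases[OF N]) (rule refl)
  also have "\<dots> = (\<Sum>I\<in>Pow J. \<integral>w. ?ind I w * (\<Prod>i\<in>I. a (X i w, Y i w)) \<partial>M)"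
    by (rule Bochner_Integration.integral_sum) (rule int, use a ab in auto)
  also have "\<dots> = (\<Sum>I\<in>Pow J. \<integral>w. ?ind I w * (\<Prod>i\<in>I. kint a (X i w)) \<partial>M)"
    by (intro sum.cong refl one) auto
  also have "\<dots> = (\<integral>w. (\<Sum>I\<in>Pow J. ?ind I w * (\<Prod>i\<in>I. kint a (X i w))) \<partial>M)"
    using int[OF _ ka] kint_bound[OF a ab]
    by (intro Bochner_Integration.integral_sum[symmetric]) auto
  also have "\<dots> = (\<integral>w. (\<Prod>i\<in>sel N w. kint a (X i w)) \<partial>M)"
    by (subst (2) sel_cases[OF N]) (rule refl)
  finally show ?thesis .
qed

subsection \<open>Exponential inequalities\<close>

lemma iid_integral_prod:
  fixes g :: "'a \<times> 's \<Rightarrow> real"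
  assumes J: "finite J" and g [measurable]: "g \<in> borel_measurable (borel \<Otimes>\<^sub>M S)"
    and gb: "\<And>z y. y \<in> space S \<Longrightarrow> \<bar>g (z, y)\<bar> \<le> C"
  shows "integrable M (\<lambda>w. \<Prod>i\<in>J. g (X i w, Y i w))"
    "(\<integral>w. (\<Prod>i\<in>J. g (X i w, Y i w)) \<partial>M) = (\<integral>w. g (X 0 w, Y 0 w) \<partial>M) ^ card J"
proof -
  have "indep_vars (\<lambda>_. borel \<Otimes>\<^sub>M S) (\<lambda>i w. (X i w, Y i w)) J"
    by (rule indep_vars_subset[OF indep]) simp
  then have ind: "indep_vars (\<lambda>_. borel) (\<lambda>i w. g (X i w, Y i w)) J"
    by (rule indep_vars_compose2) (rule g)
  have gm: "(\<lambda>w. g (X i w, Y i w)) \<in> borel_measurable M" for i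
    using measurable_compose[OF XY_measurable g] .
  have int: "integrable M (\<lambda>w. g (X i w, Y i w))" for i
    by (rule integrable_const_bound[where B=C]) (use gb gm Y_space in auto)
  have same: "(\<integral>w. g (X i w, Y i w) \<partial>M) = (\<integral>w. g (X 0 w, Y 0 w) \<partial>M)" for i
    using integral_distr[OF XY_measurable g, of i] integral_distr[OF XY_measurable g, of 0] ident[of i] by simp
  show "integrable M (\<lambda>w. \<Prod>i\<in>J. g (X i w, Y i w))"
    by (rule indep_vars_integrable[OF J ind int])
  show "(\<integral>w. (\<Prod>i\<in>J. g (X i w, Y i w)) \<partial>M) = (\<integral>w. g (X 0 w, Y 0 w) \<partial>M) ^ card J"
  proof -
    have "(\<integral>w. (\<Prod>i\<in>J. g (X i w, Y i w)) \<partial>M) = (\<Prod>i\<in>J. \<integral>w. g (X i w, Y i w) \<partial>M)"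
      by (rule indep_vars_lebesgue_integral[OF J ind int])
    also have "\<dots> = (\<Prod>i\<in>J. \<integral>w. g (X 0 w, Y 0 w) \<partial>M)" by (rule prod.cong[OF refl same])
    finally show ?thesis by simp
  qed
qed

lemma nonneg_sum_tail:
  fixes g :: "'a \<times> 's \<Rightarrow> real"
  assumes J: "finite J" and g [measurable]: "g \<in> borel_measurable (borel \<Otimes>\<^sub>M S)"
    and gb: "\<And>z y. y \<in> space S \<Longrightarrow> 0 \<le> g (z, y) \<and> g (z, y) \<le> b" and b: "b > 0"
  shows "prob {w \<in> space M. t \<le> (\<Sum>i\<in>J. g (X i w, Y i w))}
    \<le> exp (- (t - 2 * card J * (\<integral>w. g (X 0 w, Y 0 w) \<partial>M)) / b)"
proof -
  let ?m = "\<integral>w. g (X 0 w, Y 0 w) \<partial>M"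
  have gm [measurable]: "(\<lambda>w. g (X i w, Y i w)) \<in> borel_measurable M" for i
    using measurable_compose[OF XY_measurable g] .
  have gint: "integrable M (\<lambda>w. g (X 0 w, Y 0 w))"
    by (rule integrable_const_bound[where B=b]) (use gb gm Y_space in auto)
  have eb: "\<bar>exp (g (z, y) / b)\<bar> \<le> exp 1" if "y \<in> space S" for z y
    using gb[OF that, of z] b by simp
  note pr = iid_integral_prod[OF J, of "\<lambda>p. exp (g p / b)" "exp 1", OF _ eb]
  have ex: "exp (\<Sum>i\<in>J. g (X i w, Y i w) / b) = (\<Prod>i\<in>J. exp (g (X i w, Y i w) / b))" for w
    by (rule exp_sum[OF J])
  have "(\<integral>w. exp (g (X 0 w, Y 0 w) / b) \<partial>M) \<le> (\<integral>w. 1 + 2 / b * g (X 0 w, Y 0 w) \<partial>M)"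
  proof (rule integral_mono)
    show "integrable M (\<lambda>w. exp (g (X 0 w, Y 0 w) / b))"
      by (rule integrable_const_bound[where B="exp 1"]) (use eb Y_space in auto)
    show "integrable M (\<lambda>w. 1 + 2 / b * g (X 0 w, Y 0 w))" using gint by simp
    fix w assume wM: "w \<in> space M"
    let ?t = "g (X 0 w, Y 0 w) / b"
    have t: "0 \<le> ?t" "?t \<le> 1" using gb[OF Y_space[OF wM], of "X 0 w" 0] b by auto
    have "exp ?t \<le> 1 + ?t + ?t\<^sup>2" using t by (intro exp_le_quadratic) auto
    also have "?t\<^sup>2 \<le> ?t * 1" unfolding power2_eq_square by (rule mult_left_mono[OF t(2) t(1)])
    finally show "exp ?t \<le> 1 + 2 / b * g (X 0 w, Y 0 w)" by simp
  qed
  also have "\<dots> = 1 + 2 / b * ?m" using gint by (simp add: prob_space)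
  also have "\<dots> \<le> exp (2 / b * ?m)" by (rule exp_ge_add_one_self)
  finally have e: "(\<integral>w. exp (g (X 0 w, Y 0 w) / b) \<partial>M) \<le> exp (2 / b * ?m)" .
  have "{w \<in> space M. t \<le> (\<Sum>i\<in>J. g (X i w, Y i w))} = {w \<in> space M. t / b \<le> (\<Sum>i\<in>J. g (X i w, Y i w) / b)}"
    using b by (auto simp: sum_divide_distrib[symmetric] divide_le_cancel)
  also have "prob \<dots> \<le> exp (- (t / b)) * (\<integral>w. exp (\<Sum>i\<in>J. g (X i w, Y i w) / b) \<partial>M)"
  proof (rule prob_exp_bound)
    show "integrable M (\<lambda>w. exp (\<Sum>i\<in>J. g (X i w, Y i w) / b))" unfolding ex by (rule pr(1)) measurable
  qed measurable
  also have "(\<integral>w. exp (\<Sum>i\<in>J. g (X i w, Y i w) / b) \<partial>M) = (\<integral>w. exp (g (X 0 w, Y 0 w) / b) \<partial>M) ^ card J"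
    unfolding ex by (rule pr(2)) measurable
  also have "\<dots> \<le> exp (2 / b * ?m) ^ card J"
    using e by (intro power_mono) (auto intro: integral_nonneg_AE)
  also have "\<dots> = exp (card J * (2 / b * ?m))" by (rule exp_of_nat_mult[symmetric])
  also have "exp (- (t / b)) * exp (card J * (2 / b * ?m)) = exp (- (t - 2 * card J * ?m) / b)"
  proof -
    have "- (t / b) + card J * (2 / b * ?m) = - (t - 2 * card J * ?m) / b"
      using b by (simp add: diff_divide_distrib)
    then show ?thesis by (simp only: exp_add[symmetric])
  qed
  finally show ?thesis by simp
qed

lemma count_lower_tail:
  assumes J: "finite J" and B [measurable]: "B \<in> sets borel"
  shows "prob {w \<in> space M. (\<Sum>i\<in>J. indicator B (X i w)) \<le> t}
    \<le> exp (t - card J * prob {w \<in> space M. X 0 w \<in> B} / 2)"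
proof -
  let ?p = "prob {w \<in> space M. X 0 w \<in> B}"
  let ?g = "\<lambda>p. exp (- indicator B (fst p)) :: real"
  have gm: "?g \<in> borel_measurable (borel \<Otimes>\<^sub>M S)" by measurable
  have gb: "\<bar>?g (z, y)\<bar> \<le> 1" for z and y :: 's by simp
  note pr = iid_integral_prod[OF J gm gb]
  have ex: "exp (- (\<Sum>i\<in>J. indicator B (X i w))) = (\<Prod>i\<in>J. ?g (X i w, Y i w))" for w
    by (simp add: exp_sum[OF J, symmetric] sum_negf)
  have eh: "exp (-1 :: real) \<le> 1 / 2"
    using exp_ge_add_one_self[of 1] by (simp add: exp_minus field_simps)
  have pe: "(\<integral>w. indicator B (X 0 w) \<partial>M) = ?p"
  proof -
    have "(\<integral>w. indicator B (X 0 w) \<partial>M) = (\<integral>w. indicator {w \<in> space M. X 0 w \<in> B} w \<partial>M :: real)"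
      by (rule Bochner_Integration.integral_cong) (auto simp: indicator_def)
    then show ?thesis by simp
  qed
  have iB: "integrable M (\<lambda>w. indicator B (X 0 w) :: real)"
    by (rule integrable_const_bound[where B=1]) auto
  have "(\<integral>w. ?g (X 0 w, Y 0 w) \<partial>M) \<le> (\<integral>w. 1 - indicator B (X 0 w) / 2 \<partial>M)"
    by (rule integral_mono)
      (use iB eh in \<open>auto intro!: integrable_const_bound[where B=1] simp: indicator_def\<close>)
  also have "\<dots> = 1 - ?p / 2" using iB by (simp add: prob_space pe)
  also have "\<dots> \<le> exp (- (?p / 2))" using exp_ge_add_one_self[of "- (?p / 2)"] by simp
  finally have e: "(\<integral>w. ?g (X 0 w, Y 0 w) \<partial>M) \<le> exp (- (?p / 2))" .
  have "{w \<in> space M. (\<Sum>i\<in>J. indicator B (X i w)) \<le> t} = {w \<in> space M. - t \<le> - (\<Sum>i\<in>J. indicator B (X i w))}" by auto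
  also have "prob \<dots> \<le> exp (- (- t)) * (\<integral>w. exp (- (\<Sum>i\<in>J. indicator B (X i w))) \<partial>M)"
    by (rule prob_exp_bound) (use pr(1) in \<open>auto simp: ex\<close>)
  also have "(\<integral>w. exp (- (\<Sum>i\<in>J. indicator B (X i w))) \<partial>M) = (\<integral>w. ?g (X 0 w, Y 0 w) \<partial>M) ^ card J"
    unfolding ex by (rule pr(2))
  also have "\<dots> \<le> exp (- (?p / 2)) ^ card J"
    using e by (intro power_mono) (auto intro: integral_nonneg_AE)
  also have "\<dots> = exp (card J * (- (?p / 2)))" by (rule exp_of_nat_mult[symmetric])
  also have "exp (- (- t)) * exp (card J * (- (?p / 2))) = exp (t - card J * ?p / 2)"
    by (simp add: exp_add[symmetric])
  finally show ?thesis by simp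
qed

definition cent :: "('s \<Rightarrow> real) \<Rightarrow> 'a \<Rightarrow> 's \<Rightarrow> real" where
  "cent g z y = g y - (\<integral>y. g y \<partial>\<kappa> z)"

definition csum :: "((nat \<Rightarrow> 'a) \<Rightarrow> nat set) \<Rightarrow> ('s \<Rightarrow> real) \<Rightarrow> 'w \<Rightarrow> real" where
  "csum N g w = (\<Sum>i\<in>sel N w. cent g (X i w) (Y i w))"

lemma kernel_integral_measurable [measurable]:
  fixes g :: "'s \<Rightarrow> real"
  assumes [measurable]: "g \<in> borel_measurable S"
  shows "(\<lambda>z. \<integral>y. g y \<partial>\<kappa> z) \<in> borel_measurable borel"
  using kint_measurable[of "\<lambda>p. g (snd p)"] by (simp add: kint_def[abs_def])

lemma cent_measurable [measurable]:
  assumes [measurable]: "g \<in> borel_measurable S"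
  shows "(\<lambda>p. cent g (fst p) (snd p)) \<in> borel_measurable (borel \<Otimes>\<^sub>M S)"
  unfolding cent_def by measurable

lemma csum_measurable [measurable]:
  assumes "selection J N" and [measurable]: "g \<in> borel_measurable S"
  shows "csum N g \<in> borel_measurable M"
  unfolding csum_def[abs_def]
proof (rule sel_measurable[OF assms(1)])
  have "(\<lambda>w. cent g (X i w) (Y i w)) \<in> borel_measurable M" for i
    using measurable_compose[OF XY_measurable cent_measurable[OF assms(2)], of i] by simp
  then show "(\<lambda>w. \<Sum>i\<in>I. cent g (X i w) (Y i w)) \<in> borel_measurable M" for I by measurable
qed

lemma csum_mgf:
  fixes l b :: real
  assumes N: "selection J N" and NB: "\<forall>x. \<forall>i\<in>N x. x i \<in> B" and B [measurable]: "B \<in> sets borel"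
    and \<theta> [measurable]: "\<theta> \<in> borel_measurable S" and \<theta>b: "\<And>y. y \<in> space S \<Longrightarrow> \<bar>\<theta> y\<bar> \<le> b" and l: "\<bar>l\<bar> * (2 * b) \<le> 1"
  shows "integrable M (\<lambda>w. exp (l * csum N \<theta> w))"
    "(\<integral>w. exp (l * csum N \<theta> w) \<partial>M) \<le> exp (card J * l\<^sup>2 * (\<integral>w. indicator B (X 0 w) * (\<theta> (Y 0 w))\<^sup>2 \<partial>M))"
proof -
  have b: "b \<ge> 0" using \<theta>b not_empty Y_space by fastforce
  note fin = selectionD(1)[OF N] and finN = selectionD(4)[OF N]
  have mean_b: "\<bar>\<integral>y. \<theta> y \<partial>\<kappa> z\<bar> \<le> b" for z
    using kint_bound[of "\<lambda>p. \<theta> (snd p)" b z] \<theta>b by (simp add: kint_def)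
  have cb: "\<bar>cent \<theta> z y\<bar> \<le> 2 * b" if "y \<in> space S" for z y
    unfolding cent_def using \<theta>b[OF that] mean_b[of z] by linarith
  have lc: "\<bar>l * cent \<theta> z y\<bar> \<le> 1" if "y \<in> space S" for z y
    using mult_left_mono[OF cb[OF that, of z] abs_ge_zero[of l]] l by (simp add: abs_mult)
  define a where "a p = exp (l * cent \<theta> (fst p) (snd p))" for p
  have a [measurable]: "a \<in> borel_measurable (borel \<Otimes>\<^sub>M S)" unfolding a_def[abs_def] by measurable
  have ab: "\<bar>a (z, y)\<bar> \<le> exp 1" if "y \<in> space S" for z y
    using lc[OF that, of z] by (simp add: a_def abs_le_iff)
  have ac: "(\<lambda>p. complex_of_real (a p)) \<in> borel_measurable (borel \<Otimes>\<^sub>M S)" by measurable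
  have acb: "norm (complex_of_real (a (z, y))) \<le> exp 1" if "y \<in> space S" for z y
    using ab[OF that, of z] by simp
  define v where "v z = (\<integral>y. (\<theta> y)\<^sup>2 \<partial>\<kappa> z)" for z
  have v [measurable]: "v \<in> borel_measurable borel" unfolding v_def by measurable
  have v0: "v z \<ge> 0" for z unfolding v_def by simp
  have vb: "v z \<le> b\<^sup>2" for z
  proof -
    have "\<bar>(\<theta> y)\<^sup>2\<bar> \<le> b\<^sup>2" if "y \<in> space S" for y
      using power_mono[OF \<theta>b[OF that] abs_ge_zero, of 2] by simp
    then have "\<bar>v z\<bar> \<le> b\<^sup>2"
      using kint_bound[of "\<lambda>p. (\<theta> (snd p))\<^sup>2" "b\<^sup>2" z] by (simp add: kint_def v_def)
    then show ?thesis by simp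
  qed
  have ka0: "0 \<le> kint a z" for z unfolding kint_def a_def by simp
  have ka: "kint a z \<le> 1 + l\<^sup>2 * v z" for z
  proof -
    interpret K: prob_space "\<kappa> z" by (rule kernel_prob)
    have \<theta>K [measurable]: "\<theta> \<in> borel_measurable (\<kappa> z)" by (simp add: kernel_measurable_iff)
    have i1: "integrable (\<kappa> z) \<theta>"
      by (rule K.integrable_const_bound[where B=b]) (use \<theta>b in auto)
    have i2: "integrable (\<kappa> z) (\<lambda>y. (\<theta> y)\<^sup>2)"
      by (rule K.integrable_const_bound[where B="b\<^sup>2"]) (use power_mono[OF \<theta>b abs_ge_zero, of _ 2] in auto)
    let ?m = "\<integral>y. \<theta> y \<partial>\<kappa> z"
    have "kint a z \<le> (\<integral>y. 1 + l * cent \<theta> z y + l\<^sup>2 * (cent \<theta> z y)\<^sup>2 \<partial>\<kappa> z)"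
      unfolding kint_def
    proof (rule integral_mono)
      show "integrable (\<kappa> z) (\<lambda>y. a (z, y))" by (rule kint_integrable[OF a, of "exp 1"]) (use ab in auto)
      show "integrable (\<kappa> z) (\<lambda>y. 1 + l * cent \<theta> z y + l\<^sup>2 * (cent \<theta> z y)\<^sup>2)"
        unfolding cent_def power2_diff using i1 i2 by auto
      show "a (z, y) \<le> 1 + l * cent \<theta> z y + l\<^sup>2 * (cent \<theta> z y)\<^sup>2" if "y \<in> space (\<kappa> z)" for y
        using exp_le_quadratic[OF lc, of y z] that by (simp add: a_def power_mult_distrib)
    qed
    also have "\<dots> = 1 + l\<^sup>2 * (v z - ?m\<^sup>2)"
    proof -
      have c0: "(\<integral>y. cent \<theta> z y \<partial>\<kappa> z) = 0" unfolding cent_def using i1 K.prob_space by simp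
      have c1: "integrable (\<kappa> z) (cent \<theta> z)" unfolding cent_def[abs_def] using i1 by simp
      have c2: "integrable (\<kappa> z) (\<lambda>y. (cent \<theta> z y)\<^sup>2)" unfolding cent_def power2_diff using i1 i2 by auto
      have "(\<integral>y. (cent \<theta> z y)\<^sup>2 \<partial>\<kappa> z) = v z - ?m\<^sup>2"
        unfolding cent_def using i1 i2 K.variance_eq[of \<theta>] by (simp add: v_def)
      then show ?thesis using c0 c1 c2 K.prob_space by simp
    qed
    also have "\<dots> \<le> 1 + l\<^sup>2 * v z" by (simp add: mult_left_mono)
    finally show ?thesis .
  qed
  have ex: "exp (l * csum N \<theta> w) = (\<Prod>i\<in>sel N w. a (X i w, Y i w))" for w
    unfolding csum_def sum_distrib_left a_def by (subst exp_sum[OF finN]) simp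
  have csm [measurable]: "csum N \<theta> \<in> borel_measurable M" by (rule csum_measurable[OF N \<theta>])
  show int: "integrable M (\<lambda>w. exp (l * csum N \<theta> w))"
  proof (rule integrable_const_bound[where B="exp (card J)"])
    show "AE w in M. norm (exp (l * csum N \<theta> w)) \<le> exp (card J)"
    proof (rule AE_I2)
      fix w assume wM: "w \<in> space M"
      have "l * csum N \<theta> w = (\<Sum>i\<in>sel N w. l * cent \<theta> (X i w) (Y i w))" by (simp add: csum_def sum_distrib_left)
      also have "\<dots> \<le> (\<Sum>i\<in>sel N w. 1)" using lc[OF Y_space[OF wM]] by (intro sum_mono) (auto simp: abs_le_iff)
      also have "\<dots> \<le> card J" using card_mono[OF fin selectionD(3)[OF N]] by simp
      finally show "norm (exp (l * csum N \<theta> w)) \<le> exp (card J)" by simp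
    qed
  qed measurable
  have kc: "kint (\<lambda>p. complex_of_real (a p)) z = complex_of_real (kint a z)" for z
    by (simp add: kint_def)
  have "complex_of_real (\<integral>w. exp (l * csum N \<theta> w) \<partial>M) = (\<integral>w. (\<Prod>i\<in>sel N w. complex_of_real (a (X i w, Y i w))) \<partial>M)"
    unfolding ex by (simp only: of_real_prod[symmetric] integral_complex_of_real)
  also have "\<dots> = (\<integral>w. (\<Prod>i\<in>sel N w. complex_of_real (kint a (X i w))) \<partial>M)"
    using cond_selection[OF N ac acb] by (simp add: kc)
  also have "\<dots> = complex_of_real (\<integral>w. (\<Prod>i\<in>sel N w. kint a (X i w)) \<partial>M)"
    by (simp only: of_real_prod[symmetric] integral_complex_of_real)
  finally have eq: "(\<integral>w. exp (l * csum N \<theta> w) \<partial>M) = (\<integral>w. (\<Prod>i\<in>sel N w. kint a (X i w)) \<partial>M)"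
    by (simp only: of_real_eq_iff)
  let ?g = "\<lambda>p :: 'a \<times> 's. 1 + l\<^sup>2 * (indicator B (fst p) * v (fst p))"
  have gm: "?g \<in> borel_measurable (borel \<Otimes>\<^sub>M S)" by measurable
  have gb: "\<bar>?g (z, y)\<bar> \<le> 1 + l\<^sup>2 * b\<^sup>2" for z and y :: 's
    using mult_left_mono[OF vb[of z] zero_le_power2[of l]] v0[of z] by (auto simp: indicator_def)
  note pr = iid_integral_prod[OF fin gm gb]
  have iv: "integrable M (\<lambda>w. indicator B (X 0 w) * v (X 0 w))"
    by (rule integrable_const_bound[where B="b\<^sup>2"]) (use vb v0 in \<open>auto simp: indicator_def\<close>)
  have "(\<integral>w. (\<Prod>i\<in>sel N w. kint a (X i w)) \<partial>M) \<le> (\<integral>w. (\<Prod>i\<in>J. ?g (X i w, Y i w)) \<partial>M)"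
  proof (rule integral_mono)
    have pw: "0 \<le> (\<Prod>i\<in>sel N w. kint a (X i w)) \<and> (\<Prod>i\<in>sel N w. kint a (X i w)) \<le> (\<Prod>i\<in>J. ?g (X i w, Y i w))" for w
    proof
      show "0 \<le> (\<Prod>i\<in>sel N w. kint a (X i w))" by (intro prod_nonneg) (simp add: ka0)
      have "(\<Prod>i\<in>sel N w. kint a (X i w)) \<le> (\<Prod>i\<in>sel N w. ?g (X i w, Y i w))"
        using ka ka0 spec[OF NB, of "\<lambda>j. X j w"] by (intro prod_mono) auto
      also have "\<dots> \<le> (\<Prod>i\<in>J. ?g (X i w, Y i w))"
        using v0 by (intro prod_mono2[OF fin selectionD(3)[OF N]]) (auto simp: indicator_def)
      finally show "(\<Prod>i\<in>sel N w. kint a (X i w)) \<le> (\<Prod>i\<in>J. ?g (X i w, Y i w))" .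
    qed
    then show "(\<Prod>i\<in>sel N w. kint a (X i w)) \<le> (\<Prod>i\<in>J. ?g (X i w, Y i w))" for w by blast
    show "integrable M (\<lambda>w. \<Prod>i\<in>J. ?g (X i w, Y i w))" by (rule pr(1))
    show "integrable M (\<lambda>w. \<Prod>i\<in>sel N w. kint a (X i w))"
    proof (rule Bochner_Integration.integrable_bound[OF pr(1)])
      show "(\<lambda>w. \<Prod>i\<in>sel N w. kint a (X i w)) \<in> borel_measurable M"
        by (rule sel_measurable[OF N, where F="\<lambda>I w. \<Prod>i\<in>I. kint a (X i w)"]) measurable
      show "AE w in M. norm (\<Prod>i\<in>sel N w. kint a (X i w)) \<le> norm (\<Prod>i\<in>J. ?g (X i w, Y i w))"
      proof (rule AE_I2)
        fix w
        show "norm (\<Prod>i\<in>sel N w. kint a (X i w)) \<le> norm (\<Prod>i\<in>J. ?g (X i w, Y i w))"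
          unfolding real_norm_def using pw[of w] by linarith
      qed
    qed
  qed
  also have "\<dots> = (\<integral>w. ?g (X 0 w, Y 0 w) \<partial>M) ^ card J" by (rule pr(2))
  also have "(\<integral>w. ?g (X 0 w, Y 0 w) \<partial>M) = 1 + l\<^sup>2 * (\<integral>w. indicator B (X 0 w) * v (X 0 w) \<partial>M)"
    using iv by (simp add: prob_space)
  also have "(\<integral>w. indicator B (X 0 w) * v (X 0 w) \<partial>M) = (\<integral>w. indicator B (X 0 w) * (\<theta> (Y 0 w))\<^sup>2 \<partial>M)"
  proof -
    let ?h = "\<lambda>p. indicator B (fst p) * (\<theta> (snd p))\<^sup>2 :: real"
    have "(\<integral>w. ?h (X 0 w, Y 0 w) \<partial>M) = (\<integral>p. ?h p \<partial>joint)"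
      by (rule integral_distr[OF XY_measurable, symmetric]) measurable
    also have "\<dots> = (\<integral>w. kint ?h (X 0 w) \<partial>M)"
      by (rule integral_joint_real[where C="b\<^sup>2"])
        (use power_mono[OF \<theta>b abs_ge_zero, of _ 2] in \<open>auto simp: indicator_def\<close>)
    finally show ?thesis by (simp add: kint_def v_def)
  qed
  also have "(1 + l\<^sup>2 * (\<integral>w. indicator B (X 0 w) * (\<theta> (Y 0 w))\<^sup>2 \<partial>M)) ^ card J
      \<le> exp (l\<^sup>2 * (\<integral>w. indicator B (X 0 w) * (\<theta> (Y 0 w))\<^sup>2 \<partial>M)) ^ card J"
    by (intro power_mono exp_ge_add_one_self add_nonneg_nonneg mult_nonneg_nonneg) (auto intro: integral_nonneg_AE)
  also have "\<dots> = exp (card J * (l\<^sup>2 * (\<integral>w. indicator B (X 0 w) * (\<theta> (Y 0 w))\<^sup>2 \<partial>M)))"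
    by (rule exp_of_nat_mult[symmetric])
  finally show "(\<integral>w. exp (l * csum N \<theta> w) \<partial>M) \<le> exp (card J * l\<^sup>2 * (\<integral>w. indicator B (X 0 w) * (\<theta> (Y 0 w))\<^sup>2 \<partial>M))"
    unfolding eq by (simp add: mult.assoc)
qed

lemma csum_tail:
  fixes l b v t :: real
  assumes N: "selection J N" and NB: "\<forall>x. \<forall>i\<in>N x. x i \<in> B" and B: "B \<in> sets borel"
    and \<theta>: "\<theta> \<in> borel_measurable S" and \<theta>b: "\<And>y. y \<in> space S \<Longrightarrow> \<bar>\<theta> y\<bar> \<le> b" and l: "l \<ge> 0" "l * (2 * b) \<le> 1"
    and v: "card J * (\<integral>w. indicator B (X 0 w) * (\<theta> (Y 0 w))\<^sup>2 \<partial>M) \<le> v"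
  shows "prob {w \<in> space M. t \<le> \<bar>csum N \<theta> w\<bar>} \<le> 2 * exp (- l * t + l\<^sup>2 * v)"
proof -
  have csm [measurable]: "csum N \<theta> \<in> borel_measurable M" by (rule csum_measurable[OF N \<theta>])
  have one: "prob {w \<in> space M. l * t \<le> l' * csum N \<theta> w} \<le> exp (- l * t + l\<^sup>2 * v)" if "\<bar>l'\<bar> = l" for l'
  proof -
    have l': "\<bar>l'\<bar> * (2 * b) \<le> 1" using that l by simp
    note mgf = csum_mgf[OF N NB B \<theta> \<theta>b l']
    have sq: "l'\<^sup>2 = l\<^sup>2" using that by (metis power2_abs)
    have "prob {w \<in> space M. l * t \<le> l' * csum N \<theta> w} \<le> exp (- (l * t)) * (\<integral>w. exp (l' * csum N \<theta> w) \<partial>M)"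
      by (rule prob_exp_bound) (use mgf(1) in auto)
    also have "\<dots> \<le> exp (- (l * t)) * exp (l\<^sup>2 * v)"
    proof (rule mult_left_mono)
      have "card J * l\<^sup>2 * (\<integral>w. indicator B (X 0 w) * (\<theta> (Y 0 w))\<^sup>2 \<partial>M) \<le> l\<^sup>2 * v"
        using mult_left_mono[OF v zero_le_power2[of l]] by (simp add: ac_simps)
      then show "(\<integral>w. exp (l' * csum N \<theta> w) \<partial>M) \<le> exp (l\<^sup>2 * v)"
        using mgf(2) unfolding sq by (meson exp_le_cancel_iff order_trans)
    qed simp
    finally show ?thesis by (simp add: exp_add[symmetric])
  qed
  have "prob {w \<in> space M. t \<le> \<bar>csum N \<theta> w\<bar>} \<le>
      prob ({w \<in> space M. l * t \<le> l * csum N \<theta> w} \<union> {w \<in> space M. l * t \<le> - l * csum N \<theta> w})"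
  proof (rule finite_measure_mono)
    show "{w \<in> space M. t \<le> \<bar>csum N \<theta> w\<bar>} \<subseteq>
      {w \<in> space M. l * t \<le> l * csum N \<theta> w} \<union> {w \<in> space M. l * t \<le> - l * csum N \<theta> w}"
    proof
      fix w assume "w \<in> {w \<in> space M. t \<le> \<bar>csum N \<theta> w\<bar>}"
      then have "w \<in> space M" "t \<le> csum N \<theta> w \<or> t \<le> - csum N \<theta> w" by auto
      then show "w \<in> {w \<in> space M. l * t \<le> l * csum N \<theta> w} \<union> {w \<in> space M. l * t \<le> - l * csum N \<theta> w}"
        using mult_left_mono[OF _ l(1), of t "csum N \<theta> w"] mult_left_mono[OF _ l(1), of t "- csum N \<theta> w"] by auto
    qed
  qed measurable
  also have "\<dots> \<le> prob {w \<in> space M. l * t \<le> l * csum N \<theta> w} + prob {w \<in> space M. l * t \<le> - l * csum N \<theta> w}"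
    by (rule measure_Un_le) measurable
  also have "\<dots> \<le> exp (- l * t + l\<^sup>2 * v) + exp (- l * t + l\<^sup>2 * v)"
    using l(1) by (intro add_mono one) auto
  finally show ?thesis by simp
qed

end

subsection \<open>Normalized sums over selected observations\<close>

locale local_sample = regression_sample M S X Y \<kappa>
  for M :: "'w measure" and S :: "'s measure" and X :: "nat \<Rightarrow> 'w \<Rightarrow> 'a::euclidean_space"
    and Y :: "nat \<Rightarrow> 'w \<Rightarrow> 's" and \<kappa> :: "'a \<Rightarrow> 's measure" +
  fixes J :: "nat set" and N :: "(nat \<Rightarrow> 'a) \<Rightarrow> nat set" and B :: "'a set" and k :: real and G :: "'s \<Rightarrow> real"
  assumes N: "selection J N" and NB: "\<forall>x. \<forall>i\<in>N x. x i \<in> B" and B [measurable]: "B \<in> sets borel"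
    and k: "k > 0" and card_N: "\<And>x. real (card (N x)) \<le> k"
    and G [measurable]: "G \<in> borel_measurable S" and G_nonneg: "\<And>y. y \<in> space S \<Longrightarrow> 0 \<le> G y"
    and G_square: "integrable M (\<lambda>w. indicator B (X 0 w) * (G (Y 0 w))\<^sup>2)"
begin

lemmas finJ = selectionD(1)[OF N] and N_sub = selectionD(3)[OF N] and finN = selectionD(4)[OF N]

definition m :: "('s \<Rightarrow> real) \<Rightarrow> real" where
  "m \<phi> = card J / k * (\<integral>w. indicator B (X 0 w) * \<phi> (Y 0 w) \<partial>M)"

definition V :: "('s \<Rightarrow> real) \<Rightarrow> 'w \<Rightarrow> real" where
  "V g w = csum N g w / sqrt k"

definition U :: "('s \<Rightarrow> real) \<Rightarrow> 'w \<Rightarrow> real" where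
  "U \<psi> w = (\<Sum>i\<in>J. indicator B (X i w) * \<psi> (Y i w)) / sqrt k"

definition U' :: "('s \<Rightarrow> real) \<Rightarrow> 'w \<Rightarrow> real" where
  "U' \<psi> w = (\<Sum>i\<in>J. indicator B (X i w) * (\<integral>y. \<psi> y \<partial>\<kappa> (X i w))) / sqrt k"

definition bounded_by_envelope :: "('s \<Rightarrow> real) \<Rightarrow> bool" where
  "bounded_by_envelope \<phi> \<longleftrightarrow> \<phi> \<in> borel_measurable S \<and> (\<exists>c. \<forall>y\<in>space S. \<bar>\<phi> y\<bar> \<le> c * G y)"

lemma bounded_by_envelopeD: "bounded_by_envelope \<phi> \<Longrightarrow> \<phi> \<in> borel_measurable S"
  by (simp add: bounded_by_envelope_def)

lemma bounded_by_envelope_add: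
  assumes "bounded_by_envelope \<phi>" "bounded_by_envelope \<psi>"
  shows "bounded_by_envelope (\<lambda>y. \<phi> y + \<psi> y)" "bounded_by_envelope (\<lambda>y. \<phi> y - \<psi> y)"
proof -
  obtain c d where "\<And>y. y \<in> space S \<Longrightarrow> \<bar>\<phi> y\<bar> \<le> c * G y" "\<And>y. y \<in> space S \<Longrightarrow> \<bar>\<psi> y\<bar> \<le> d * G y"
    using assms unfolding bounded_by_envelope_def by blast
  then have "\<bar>\<phi> y + \<psi> y\<bar> \<le> (c + d) * G y \<and> \<bar>\<phi> y - \<psi> y\<bar> \<le> (c + d) * G y" if "y \<in> space S" for y
    unfolding distrib_right using that by fastforce
  then show "bounded_by_envelope (\<lambda>y. \<phi> y + \<psi> y)" "bounded_by_envelope (\<lambda>y. \<phi> y - \<psi> y)"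
    using assms unfolding bounded_by_envelope_def by (blast intro: borel_measurable_add borel_measurable_diff)+
qed

lemma bounded_by_envelope_mono:
  assumes "bounded_by_envelope \<psi>" "\<phi> \<in> borel_measurable S" "\<And>y. y \<in> space S \<Longrightarrow> \<bar>\<phi> y\<bar> \<le> \<bar>\<psi> y\<bar>"
  shows "bounded_by_envelope \<phi>"
  using assms unfolding bounded_by_envelope_def by (meson order_trans)

lemma V_measurable [measurable]: "g \<in> borel_measurable S \<Longrightarrow> V g \<in> borel_measurable M"
  unfolding V_def[abs_def] by (intro borel_measurable_divide csum_measurable[OF N] borel_measurable_const)

lemma U_measurable [measurable]:
  assumes [measurable]: "\<psi> \<in> borel_measurable S"
  shows "U \<psi> \<in> borel_measurable M" "U' \<psi> \<in> borel_measurable M"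
  unfolding U_def[abs_def] U'_def[abs_def] by measurable

definition regular :: "'w set" where
  "regular = {w \<in> space M. \<forall>i\<in>J. X i w \<in> B \<longrightarrow> integrable (\<kappa> (X i w)) (\<lambda>y. (G y)\<^sup>2)}"

lemma integrable_kernel_event: "{z. integrable (\<kappa> z) (\<lambda>y. (G y)\<^sup>2)} \<in> sets borel"
  using measurable_sets[OF measurable_compose[OF kernel_subprob integrable_measurable_subprob_algebra[of "\<lambda>y. (G y)\<^sup>2" S]], of "{True}"]
  by (simp add: vimage_def)

lemma nn_envelope_finite: "(\<integral>\<^sup>+w. (\<integral>\<^sup>+y. ennreal (indicator B (X 0 w) * (G y)\<^sup>2) \<partial>\<kappa> (X 0 w)) \<partial>M) < \<infinity>"
proof -
  have "(\<integral>\<^sup>+w. ennreal (indicator B (X 0 w) * (G (Y 0 w))\<^sup>2) \<partial>M) < \<infinity>"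
    using G_square unfolding integrable_iff_bounded by simp
  then show ?thesis
    using nn_disint[of "\<lambda>p. ennreal (indicator B (fst p) * (G (snd p))\<^sup>2)" 0] by simp
qed

lemma AE_kernel_integrable: "AE w in M. X i w \<in> B \<longrightarrow> integrable (\<kappa> (X i w)) (\<lambda>y. (G y)\<^sup>2)"
proof -
  let ?S = "{z. z \<in> B \<longrightarrow> integrable (\<kappa> z) (\<lambda>y. (G y)\<^sup>2)}"
  have S: "?S \<in> sets borel"
  proof -
    have "?S = - B \<union> {z. integrable (\<kappa> z) (\<lambda>y. (G y)\<^sup>2)}" by auto
    then show ?thesis using B integrable_kernel_event by simp
  qed
  have m [measurable]: "(\<lambda>z. \<integral>\<^sup>+y. ennreal (indicator B z * (G y)\<^sup>2) \<partial>\<kappa> z) \<in> borel_measurable borel"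
    by (rule nn_integral_measurable_subprob_algebra2[where N=S]) measurable
  have "AE w in M. (\<integral>\<^sup>+y. ennreal (indicator B (X 0 w) * (G y)\<^sup>2) \<partial>\<kappa> (X 0 w)) \<noteq> \<infinity>"
    by (rule nn_integral_PInf_AE) (use nn_envelope_finite in auto)
  then have "AE w in M. X 0 w \<in> ?S"
  proof eventually_elim
    case (elim w)
    have "(\<lambda>y. (G y)\<^sup>2) \<in> borel_measurable (\<kappa> (X 0 w))" by (simp add: kernel_measurable_iff)
    then show ?case using elim by (auto simp: integrable_iff_bounded top.not_eq_extremum)
  qed
  then have "AE z in distr M borel (X 0). z \<in> ?S" using S by (subst AE_distr_iff) auto
  then have "AE z in distr M borel (X i). z \<in> ?S" by (simp only: X_ident[of i])
  then show ?thesis using S by (subst (asm) AE_distr_iff) auto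
qed

lemma AE_regular: "AE w in M. w \<in> regular"
proof -
  have "AE w in M. \<forall>i\<in>J. X i w \<in> B \<longrightarrow> integrable (\<kappa> (X i w)) (\<lambda>y. (G y)\<^sup>2)"
    using AE_kernel_integrable by (intro AE_finite_allI finJ) auto
  then show ?thesis by (auto simp: regular_def elim!: AE_mp)
qed

lemma regular_sets [measurable]: "regular \<in> sets M"
proof -
  have "{w \<in> space M. X i w \<in> B \<longrightarrow> integrable (\<kappa> (X i w)) (\<lambda>y. (G y)\<^sup>2)} \<in> sets M" for i
  proof -
    have "- B \<union> {z. integrable (\<kappa> z) (\<lambda>y. (G y)\<^sup>2)} \<in> sets borel" using integrable_kernel_event B by simp
    from measurable_sets[OF X_measurable this, of i]
    have "X i -` (- B \<union> {z. integrable (\<kappa> z) (\<lambda>y. (G y)\<^sup>2)}) \<inter> space M \<in> sets M" .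
    also have "X i -` (- B \<union> {z. integrable (\<kappa> z) (\<lambda>y. (G y)\<^sup>2)}) \<inter> space M =
      {w \<in> space M. X i w \<in> B \<longrightarrow> integrable (\<kappa> (X i w)) (\<lambda>y. (G y)\<^sup>2)}" by auto
    finally show ?thesis .
  qed
  then show ?thesis unfolding regular_def by (intro sets.sets_Collect_finite_All finJ)
qed

lemma kernel_integrable:
  assumes wM: "w \<in> regular" and i: "i \<in> J" "X i w \<in> B" and \<phi>: "bounded_by_envelope \<phi>"
  shows "integrable (\<kappa> (X i w)) \<phi>"
proof -
  interpret K: prob_space "\<kappa> (X i w)" by (rule kernel_prob)
  have G2: "integrable (\<kappa> (X i w)) (\<lambda>y. (G y)\<^sup>2)" using wM i by (auto simp: regular_def)
  have [measurable]: "G \<in> borel_measurable (\<kappa> (X i w))" "\<phi> \<in> borel_measurable (\<kappa> (X i w))"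
    using \<phi> by (simp_all add: kernel_measurable_iff bounded_by_envelopeD)
  have "integrable (\<kappa> (X i w)) (\<lambda>y. 1 + (G y)\<^sup>2)" using G2 by simp
  then have Gi: "integrable (\<kappa> (X i w)) G"
  proof (rule Bochner_Integration.integrable_bound)
    show "AE y in \<kappa> (X i w). norm (G y) \<le> norm (1 + (G y)\<^sup>2)"
    proof (rule AE_I2)
      fix y
      have "0 \<le> (\<bar>G y\<bar> - 1)\<^sup>2 + \<bar>G y\<bar>" by simp
      then show "norm (G y) \<le> norm (1 + (G y)\<^sup>2)" by (simp add: power2_diff)
    qed
  qed measurable
  obtain c where c: "\<And>y. y \<in> space S \<Longrightarrow> \<bar>\<phi> y\<bar> \<le> c * G y" using \<phi> unfolding bounded_by_envelope_def by blast
  have "integrable (\<kappa> (X i w)) (\<lambda>y. c * G y)" using Gi by simp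
  then show ?thesis
    by (rule Bochner_Integration.integrable_bound) (use c in \<open>auto intro!: AE_I2 order_trans[OF c abs_ge_self]\<close>)
qed

lemma V_add:
  assumes wM: "w \<in> regular" and \<phi>: "bounded_by_envelope \<phi>" and \<psi>: "bounded_by_envelope \<psi>"
  shows "V (\<lambda>y. \<phi> y + \<psi> y) w = V \<phi> w + V \<psi> w" "V (\<lambda>y. \<phi> y - \<psi> y) w = V \<phi> w - V \<psi> w"
proof -
  have "integrable (\<kappa> (X i w)) \<phi>" "integrable (\<kappa> (X i w)) \<psi>" if "i \<in> sel N w" for i
    using kernel_integrable[OF wM _ _ \<phi>] kernel_integrable[OF wM _ _ \<psi>] that spec[OF NB, of "\<lambda>j. X j w"]
      N_sub[of "\<lambda>j. X j w"] by auto
  then show "V (\<lambda>y. \<phi> y + \<psi> y) w = V \<phi> w + V \<psi> w" "V (\<lambda>y. \<phi> y - \<psi> y) w = V \<phi> w - V \<psi> w"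
    by (simp_all add: V_def csum_def cent_def add_divide_distrib[symmetric] diff_divide_distrib[symmetric]
        sum.distrib[symmetric] sum_subtractf[symmetric] algebra_simps)
qed

lemma V_zero: "V (\<lambda>_. 0) w = 0"
  by (simp add: V_def csum_def cent_def)

lemma V_sum:
  assumes wM: "w \<in> regular" and "finite F" "\<And>j. j \<in> F \<Longrightarrow> bounded_by_envelope (\<phi> j)"
  shows "V (\<lambda>y. \<Sum>j\<in>F. \<phi> j y) w = (\<Sum>j\<in>F. V (\<phi> j) w) \<and> bounded_by_envelope (\<lambda>y. \<Sum>j\<in>F. \<phi> j y)"
  using assms(2,3)
proof (induction F rule: finite_induct)
  case empty
  then show ?case by (auto simp: V_zero bounded_by_envelope_def intro!: exI[of _ 0])
next
  case (insert j F)
  then show ?case using V_add[OF wM, of "\<phi> j" "\<lambda>y. \<Sum>j\<in>F. \<phi> j y"] bounded_by_envelope_add[of "\<phi> j" "\<lambda>y. \<Sum>j\<in>F. \<phi> j y"] by simp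
qed

lemma V_le_U:
  assumes wS: "w \<in> regular" and \<phi>: "\<phi> \<in> borel_measurable S" and \<psi>: "bounded_by_envelope \<psi>"
    and le: "\<And>y. y \<in> space S \<Longrightarrow> \<bar>\<phi> y\<bar> \<le> \<psi> y"
  shows "\<bar>V \<phi> w\<bar> \<le> U \<psi> w + U' \<psi> w"
proof -
  have wM: "w \<in> space M" using wS by (simp add: regular_def)
  have "\<bar>\<phi> y\<bar> \<le> \<bar>\<psi> y\<bar>" if "y \<in> space S" for y using le[OF that] by linarith
  then have \<phi>e: "bounded_by_envelope \<phi>" by (rule bounded_by_envelope_mono[OF \<psi> \<phi>])
  have \<psi>0: "0 \<le> \<psi> y" if "y \<in> space S" for y using le[OF that] by linarith
  let ?t = "\<lambda>i. indicator B (X i w) * \<psi> (Y i w) + indicator B (X i w) * (\<integral>y. \<psi> y \<partial>\<kappa> (X i w))"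
  have t0: "0 \<le> ?t i" for i
    using \<psi>0 Y_space[OF wM] by (intro add_nonneg_nonneg mult_nonneg_nonneg integral_nonneg_AE AE_I2) auto
  have "\<bar>cent \<phi> (X i w) (Y i w)\<bar> \<le> ?t i" if i: "i \<in> sel N w" for i
  proof -
    have iJ: "i \<in> J" "X i w \<in> B" using i spec[OF NB, of "\<lambda>j. X j w"] N_sub[of "\<lambda>j. X j w"] by auto
    note int = kernel_integrable[OF wS iJ \<phi>e] kernel_integrable[OF wS iJ \<psi>]
    have "\<bar>\<integral>y. \<phi> y \<partial>\<kappa> (X i w)\<bar> \<le> (\<integral>y. \<bar>\<phi> y\<bar> \<partial>\<kappa> (X i w))" by (rule integral_abs_bound)
    also have "\<dots> \<le> (\<integral>y. \<psi> y \<partial>\<kappa> (X i w))"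
      by (rule integral_mono) (use int le in auto)
    finally show ?thesis
      unfolding cent_def using le[OF Y_space[OF wM], of i] iJ(2) by simp
  qed
  then have "(\<Sum>i\<in>sel N w. \<bar>cent \<phi> (X i w) (Y i w)\<bar>) \<le> (\<Sum>i\<in>sel N w. ?t i)" by (rule sum_mono)
  also have "\<dots> \<le> (\<Sum>i\<in>J. ?t i)" by (rule sum_mono2[OF finJ N_sub]) (rule t0)
  finally have "\<bar>csum N \<phi> w\<bar> \<le> (\<Sum>i\<in>J. ?t i)" unfolding csum_def by (rule order_trans[OF sum_abs])
  then have "\<bar>csum N \<phi> w\<bar> / sqrt k \<le> (\<Sum>i\<in>J. ?t i) / sqrt k" using k by (intro divide_right_mono) auto
  then show ?thesis using k by (simp add: V_def U_def U'_def sum.distrib add_divide_distrib)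
qed

lemma V_sup_bound:
  assumes wS: "w \<in> regular" and b: "\<And>y. y \<in> space S \<Longrightarrow> \<bar>\<phi> y\<bar> \<le> b" and \<phi>: "\<phi> \<in> borel_measurable S"
  shows "\<bar>V \<phi> w\<bar> \<le> 2 * sqrt k * b"
proof -
  have wM: "w \<in> space M" using wS by (simp add: regular_def)
  have b0: "0 \<le> b" using b[OF Y_space[OF wM, of 0]] by linarith
  have "\<bar>cent \<phi> z y\<bar> \<le> 2 * b" if "y \<in> space S" for z y
  proof -
    have "\<bar>\<integral>y. \<phi> y \<partial>\<kappa> z\<bar> \<le> b"
      using kint_bound[of "\<lambda>p. \<phi> (snd p)" b z] b \<phi> by (simp add: kint_def)
    then show ?thesis unfolding cent_def using b[OF that] by linarith
  qed
  then have "(\<Sum>i\<in>sel N w. \<bar>cent \<phi> (X i w) (Y i w)\<bar>) \<le> (\<Sum>i\<in>sel N w. 2 * b)"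
    using Y_space[OF wM] by (intro sum_mono) auto
  also have "\<dots> \<le> k * (2 * b)" using card_N[of "\<lambda>j. X j w"] b0 by (simp add: mult_right_mono)
  finally have "\<bar>csum N \<phi> w\<bar> \<le> k * (2 * b)" unfolding csum_def by (rule order_trans[OF sum_abs])
  then have "\<bar>csum N \<phi> w\<bar> / sqrt k \<le> k * (2 * b) / sqrt k" using k by (intro divide_right_mono) auto
  also have "\<dots> = 2 * sqrt k * b" using k by (simp add: real_div_sqrt field_simps)
  finally show ?thesis using k by (simp add: V_def)
qed

lemma V_tail:
  assumes \<theta>: "\<theta> \<in> borel_measurable S" and \<theta>b: "\<And>y. y \<in> space S \<Longrightarrow> \<bar>\<theta> y\<bar> \<le> sqrt k * a"
    and l: "l \<ge> 0" "2 * l * a \<le> 1" and v: "m (\<lambda>y. (\<theta> y)\<^sup>2) \<le> v"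
  shows "prob {w \<in> space M. t \<le> \<bar>V \<theta> w\<bar>} \<le> 2 * exp (- l * t + l\<^sup>2 * v)"
proof -
  have kk: "sqrt k > 0" "sqrt k * sqrt k = k" using k by auto
  have "prob {w \<in> space M. sqrt k * t \<le> \<bar>csum N \<theta> w\<bar>} \<le> 2 * exp (- (l / sqrt k) * (sqrt k * t) + (l / sqrt k)\<^sup>2 * (k * v))"
  proof (rule csum_tail[OF N NB B \<theta> \<theta>b])
    show "0 \<le> l / sqrt k" using l kk by simp
    show "l / sqrt k * (2 * (sqrt k * a)) \<le> 1" using l kk by simp
    show "card J * (\<integral>w. indicator B (X 0 w) * (\<theta> (Y 0 w))\<^sup>2 \<partial>M) \<le> k * v"
      using v k by (simp add: m_def field_simps)
  qed
  also have "- (l / sqrt k) * (sqrt k * t) + (l / sqrt k)\<^sup>2 * (k * v) = - l * t + l\<^sup>2 * v"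
    using kk k by (simp add: power_divide)
  also have "{w \<in> space M. sqrt k * t \<le> \<bar>csum N \<theta> w\<bar>} = {w \<in> space M. t \<le> \<bar>V \<theta> w\<bar>}"
    using kk by (auto simp: V_def field_simps)
  finally show ?thesis .
qed

lemma mean_kernel:
  fixes \<psi> :: "'s \<Rightarrow> real"
  assumes \<psi> [measurable]: "\<psi> \<in> borel_measurable S" and b: "\<And>y. y \<in> space S \<Longrightarrow> 0 \<le> \<psi> y \<and> \<psi> y \<le> b"
  shows "(\<integral>w. indicator B (X 0 w) * (\<integral>y. \<psi> y \<partial>\<kappa> (X 0 w)) \<partial>M) = (\<integral>w. indicator B (X 0 w) * \<psi> (Y 0 w) \<partial>M)"
proof -
  let ?h = "\<lambda>p. indicator B (fst p) * \<psi> (snd p) :: real"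
  have b0: "0 \<le> b" using b not_empty Y_space by fastforce
  have "(\<integral>w. ?h (X 0 w, Y 0 w) \<partial>M) = (\<integral>p. ?h p \<partial>joint)"
    by (rule integral_distr[OF XY_measurable, symmetric]) measurable
  also have "\<dots> = (\<integral>w. kint ?h (X 0 w) \<partial>M)"
    by (rule integral_joint_real[where C=b]) (use b b0 in \<open>auto simp: indicator_def\<close>)
  finally show ?thesis by (simp add: kint_def)
qed

lemma U_tail:
  assumes \<psi> [measurable]: "\<psi> \<in> borel_measurable S" and b: "\<And>y. y \<in> space S \<Longrightarrow> 0 \<le> \<psi> y \<and> \<psi> y \<le> sqrt k * a" and a: "a > 0"
  shows "prob {w \<in> space M. t \<le> U \<psi> w} \<le> exp (- (t - 2 * sqrt k * m \<psi>) / a)"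
    "prob {w \<in> space M. t \<le> U' \<psi> w} \<le> exp (- (t - 2 * sqrt k * m \<psi>) / a)"
proof -
  have kk: "sqrt k > 0" "sqrt k * sqrt k = k" using k by auto
  have b0: "0 < sqrt k * a" using kk a by simp
  have km: "card J * (\<integral>w. indicator B (X 0 w) * \<psi> (Y 0 w) \<partial>M) = sqrt k * sqrt k * m \<psi>"
    using k by (simp add: m_def)
  have e: "- (sqrt k * t - 2 * (sqrt k * sqrt k * m \<psi>)) / (sqrt k * a) = - (t - 2 * sqrt k * m \<psi>) / a"
    using kk(1) a by (simp add: field_simps)
  have 1: "prob {w \<in> space M. sqrt k * t \<le> (\<Sum>i\<in>J. (\<lambda>p. indicator B (fst p) * \<psi> (snd p)) (X i w, Y i w))}
    \<le> exp (- (sqrt k * t - 2 * card J * (\<integral>w. (\<lambda>p. indicator B (fst p) * \<psi> (snd p)) (X 0 w, Y 0 w) \<partial>M)) / (sqrt k * a))"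
    by (rule nonneg_sum_tail[OF finJ _ _ b0]) (use b b0 in \<open>auto simp: indicator_def\<close>)
  have ib: "0 \<le> (\<integral>y. \<psi> y \<partial>\<kappa> z) \<and> (\<integral>y. \<psi> y \<partial>\<kappa> z) \<le> sqrt k * a" for z
  proof
    show "0 \<le> (\<integral>y. \<psi> y \<partial>\<kappa> z)" by (rule integral_nonneg_AE) (use b in auto)
    have "\<bar>\<integral>y. \<psi> y \<partial>\<kappa> z\<bar> \<le> sqrt k * a"
      using kint_bound[of "\<lambda>p. \<psi> (snd p)" "sqrt k * a" z] b by (simp add: kint_def)
    then show "(\<integral>y. \<psi> y \<partial>\<kappa> z) \<le> sqrt k * a" by linarith
  qed
  have 2: "prob {w \<in> space M. sqrt k * t \<le> (\<Sum>i\<in>J. (\<lambda>p. indicator B (fst p) * (\<integral>y. \<psi> y \<partial>\<kappa> (fst p))) (X i w, Y i w))}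
    \<le> exp (- (sqrt k * t - 2 * card J * (\<integral>w. (\<lambda>p. indicator B (fst p) * (\<integral>y. \<psi> y \<partial>\<kappa> (fst p))) (X 0 w, Y 0 w) \<partial>M)) / (sqrt k * a))"
    by (rule nonneg_sum_tail[OF finJ _ _ b0]) (use ib b0 in \<open>auto simp: indicator_def\<close>)
  have s: "{w \<in> space M. t \<le> U \<psi> w} = {w \<in> space M. sqrt k * t \<le> (\<Sum>i\<in>J. indicator B (X i w) * \<psi> (Y i w))}"
    "{w \<in> space M. t \<le> U' \<psi> w} = {w \<in> space M. sqrt k * t \<le> (\<Sum>i\<in>J. indicator B (X i w) * (\<integral>y. \<psi> y \<partial>\<kappa> (X i w)))}"
    using kk by (auto simp: U_def U'_def field_simps)
  show "prob {w \<in> space M. t \<le> U \<psi> w} \<le> exp (- (t - 2 * sqrt k * m \<psi>) / a)"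
    using 1 km unfolding s e[symmetric] by (simp add: mult.assoc)
  show "prob {w \<in> space M. t \<le> U' \<psi> w} \<le> exp (- (t - 2 * sqrt k * m \<psi>) / a)"
    using 2 km mean_kernel[OF \<psi> b] unfolding s e[symmetric] by (simp add: mult.assoc)
qed

lemma U_markov:
  assumes \<psi> [measurable]: "\<psi> \<in> borel_measurable S" and \<psi>0: "\<And>y. y \<in> space S \<Longrightarrow> 0 \<le> \<psi> y"
    and int: "integrable M (\<lambda>w. indicator B (X 0 w) * \<psi> (Y 0 w))" and t: "t > 0"
  shows "prob {w \<in> space M. t \<le> U \<psi> w + U' \<psi> w} \<le> 2 * sqrt k * m \<psi> / t"
proof -
  have kk: "sqrt k > 0" "sqrt k * sqrt k = k" using k by auto
  let ?h = "\<lambda>p. indicator B (fst p) * \<psi> (snd p) :: real"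
  let ?e = "\<integral>w. indicator B (X 0 w) * \<psi> (Y 0 w) \<partial>M"
  have e0: "0 \<le> ?e" by (rule integral_nonneg_AE) (use \<psi>0 Y_space in auto)
  have n1: "(\<integral>\<^sup>+w. ennreal (?h (X i w, Y i w)) \<partial>M) = ennreal ?e" for i
  proof -
    have "(\<integral>\<^sup>+w. ennreal (?h (X i w, Y i w)) \<partial>M) = (\<integral>\<^sup>+w. ennreal (?h (X 0 w, Y 0 w)) \<partial>M)"
      using nn_disint[of "\<lambda>p. ennreal (?h p)" i] nn_disint[of "\<lambda>p. ennreal (?h p)" 0] by simp
    also have "\<dots> = ennreal ?e"
      using int \<psi>0 Y_space by (subst nn_integral_eq_integral) auto
    finally show ?thesis .
  qed
  have n2: "(\<integral>\<^sup>+w. ennreal (indicator B (X i w) * (\<integral>y. \<psi> y \<partial>\<kappa> (X i w))) \<partial>M) \<le> ennreal ?e" for i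
  proof -
    have "(\<integral>\<^sup>+w. ennreal (indicator B (X i w) * (\<integral>y. \<psi> y \<partial>\<kappa> (X i w))) \<partial>M) =
        (\<integral>\<^sup>+w. ennreal (indicator B (X 0 w) * (\<integral>y. \<psi> y \<partial>\<kappa> (X 0 w))) \<partial>M)"
      by (rule nn_integral_X_ident[of "\<lambda>z. ennreal (indicator B z * (\<integral>y. \<psi> y \<partial>\<kappa> z))"]) measurable
    also have "\<dots> \<le> (\<integral>\<^sup>+w. (\<integral>\<^sup>+y. ennreal (?h (X 0 w, y)) \<partial>\<kappa> (X 0 w)) \<partial>M)"
    proof (rule nn_integral_mono)
      fix w
      show "ennreal (indicator B (X 0 w) * (\<integral>y. \<psi> y \<partial>\<kappa> (X 0 w))) \<le> (\<integral>\<^sup>+y. ennreal (?h (X 0 w, y)) \<partial>\<kappa> (X 0 w))"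
      proof (cases "X 0 w \<in> B")
        case True
        show ?thesis
        proof (cases "integrable (\<kappa> (X 0 w)) \<psi>")
          case True
          then show ?thesis
            using \<open>X 0 w \<in> B\<close> \<psi>0 by (subst nn_integral_eq_integral) auto
        qed (simp add: not_integrable_integral_eq)
      qed simp
    qed
    also have "\<dots> = (\<integral>\<^sup>+w. ennreal (?h (X 0 w, Y 0 w)) \<partial>M)"
      using nn_disint[of "\<lambda>p. ennreal (?h p)" 0] by simp
    finally show ?thesis using n1[of 0] by simp
  qed
  have ip: "0 \<le> (\<integral>y. \<psi> y \<partial>\<kappa> z)" for z by (rule integral_nonneg_AE) (use \<psi>0 in auto)
  let ?T = "\<lambda>w. \<Sum>i\<in>J. indicator B (X i w) * \<psi> (Y i w) + indicator B (X i w) * (\<integral>y. \<psi> y \<partial>\<kappa> (X i w))"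
  have "(\<integral>\<^sup>+w. ennreal (?T w) \<partial>M) = (\<integral>\<^sup>+w. (\<Sum>i\<in>J. ennreal (indicator B (X i w) * \<psi> (Y i w)) +
      ennreal (indicator B (X i w) * (\<integral>y. \<psi> y \<partial>\<kappa> (X i w)))) \<partial>M)"
  proof (rule nn_integral_cong)
    fix w assume wM: "w \<in> space M"
    show "ennreal (?T w) = (\<Sum>i\<in>J. ennreal (indicator B (X i w) * \<psi> (Y i w)) +
      ennreal (indicator B (X i w) * (\<integral>y. \<psi> y \<partial>\<kappa> (X i w))))"
      using \<psi>0[OF Y_space[OF wM]] ip
      by (subst sum_ennreal[symmetric]) (auto simp: ennreal_plus intro!: add_nonneg_nonneg)
  qed
  also have "\<dots> = (\<Sum>i\<in>J. (\<integral>\<^sup>+w. ennreal (indicator B (X i w) * \<psi> (Y i w)) \<partial>M) +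
      (\<integral>\<^sup>+w. ennreal (indicator B (X i w) * (\<integral>y. \<psi> y \<partial>\<kappa> (X i w))) \<partial>M))"
    by (subst nn_integral_sum) (auto simp: nn_integral_add)
  also have "\<dots> \<le> (\<Sum>i\<in>J. ennreal ?e + ennreal ?e)"
    using n1 n2 by (intro sum_mono add_mono) auto
  also have "\<dots> = ennreal (2 * card J * ?e)"
    using e0 by (simp add: ennreal_plus[symmetric] ennreal_of_nat_eq_real_of_nat ennreal_mult[symmetric] del: ennreal_plus)
  finally have nT: "(\<integral>\<^sup>+w. ennreal (?T w) \<partial>M) \<le> ennreal (2 * card J * ?e)" .
  have T0: "0 \<le> ?T w" if "w \<in> space M" for w
    using \<psi>0[OF Y_space[OF that]] ip by (intro sum_nonneg add_nonneg_nonneg) auto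
  have iT: "integrable M ?T"
    unfolding integrable_iff_bounded using T0 nT by (auto simp: less_top[symmetric] top_unique intro: le_less_trans cong: nn_integral_cong)
  have "(\<integral>w. ?T w \<partial>M) \<le> 2 * card J * ?e"
    using nT T0 e0 iT by (subst (asm) nn_integral_eq_integral) auto
  moreover have "prob {w \<in> space M. sqrt k * t \<le> ?T w} \<le> (\<integral>w. ?T w \<partial>M) / (sqrt k * t)"
    by (rule integral_Markov_inequality_measure[where A="space M"]) (use iT T0 kk t in auto)
  ultimately have "prob {w \<in> space M. sqrt k * t \<le> ?T w} \<le> 2 * card J * ?e / (sqrt k * t)"
    using kk t by (meson divide_right_mono less_imp_le mult_pos_pos order_trans)
  also have "2 * card J * ?e / (sqrt k * t) = 2 * sqrt k * m \<psi> / t"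
    using kk t k by (simp add: m_def field_simps real_div_sqrt)
  also have "{w \<in> space M. sqrt k * t \<le> ?T w} = {w \<in> space M. t \<le> U \<psi> w + U' \<psi> w}"
    using kk by (auto simp: U_def U'_def sum.distrib add_divide_distrib[symmetric] pos_le_divide_eq mult.commute)
  finally show ?thesis .
qed

end

lemma card_image_factor:
  assumes "finite (c ` A)" "\<And>f g. f \<in> A \<Longrightarrow> g \<in> A \<Longrightarrow> c f = c g \<Longrightarrow> F f = F g"
  shows "finite (F ` A)" "card (F ` A) \<le> card (c ` A)"
proof -
  have "F ` A = (\<lambda>x. F (inv_into A c x)) ` (c ` A)"
  proof -
    have "F g = F (inv_into A c (c g))" if "g \<in> A" for g
      using that assms(2)[of g "inv_into A c (c g)"] by (simp add: f_inv_into_f inv_into_into)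
    then show ?thesis by (auto simp: image_image)
  qed
  then show "finite (F ` A)" "card (F ` A) \<le> card (c ` A)"
    using assms(1) card_image_le[OF assms(1), of "\<lambda>x. F (inv_into A c x)"] by auto
qed

lemma sum_power2_le:
  fixes s :: "'i \<Rightarrow> real"
  assumes "finite F" "\<And>i. i \<in> F \<Longrightarrow> 0 \<le> s i"
  shows "(\<Sum>i\<in>F. (s i)\<^sup>2) \<le> (\<Sum>i\<in>F. s i)\<^sup>2"
  using assms
proof (induction F rule: finite_induct)
  case (insert i F)
  then have "0 \<le> s i * (\<Sum>i\<in>F. s i)" by (intro mult_nonneg_nonneg sum_nonneg) auto
  then show ?case using insert by (simp add: power2_sum)
qed simp

context local_sample begin

lemma m_mono:
  assumes [measurable]: "\<phi> \<in> borel_measurable S"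
    and int: "integrable M (\<lambda>w. indicator B (X 0 w) * \<psi> (Y 0 w))"
    and le: "\<And>y. y \<in> space S \<Longrightarrow> 0 \<le> \<phi> y \<and> \<phi> y \<le> \<psi> y"
  shows "m \<phi> \<le> m \<psi>" "integrable M (\<lambda>w. indicator B (X 0 w) * \<phi> (Y 0 w))"
proof -
  show i: "integrable M (\<lambda>w. indicator B (X 0 w) * \<phi> (Y 0 w))"
  proof (rule Bochner_Integration.integrable_bound[OF int])
    show "AE w in M. norm (indicator B (X 0 w) * \<phi> (Y 0 w)) \<le> norm (indicator B (X 0 w) * \<psi> (Y 0 w))"
    proof (rule AE_I2)
      fix w assume "w \<in> space M"
      then show "norm (indicator B (X 0 w) * \<phi> (Y 0 w)) \<le> norm (indicator B (X 0 w) * \<psi> (Y 0 w))"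
        using le[OF Y_space[of w 0]] by (auto simp: indicator_def)
    qed
  qed measurable
  have "(\<integral>w. indicator B (X 0 w) * \<phi> (Y 0 w) \<partial>M) \<le> (\<integral>w. indicator B (X 0 w) * \<psi> (Y 0 w) \<partial>M)"
    by (rule integral_mono[OF i int]) (use le Y_space in \<open>auto simp: indicator_def\<close>)
  then show "m \<phi> \<le> m \<psi>" unfolding m_def using k by (intro mult_left_mono) auto
qed

definition tail_env :: "real \<Rightarrow> 's \<Rightarrow> real" where
  "tail_env \<tau> y = 2 * G y * (if sqrt k * \<tau> < 2 * G y then 1 else 0)"

definition tail_mass :: "real \<Rightarrow> real" where
  "tail_mass \<tau> = m (\<lambda>y. (2 * G y)\<^sup>2 * (if sqrt k * \<tau> < 2 * G y then 1 else 0))"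

lemma tail_env_measurable [measurable]: "tail_env \<tau> \<in> borel_measurable S"
  unfolding tail_env_def[abs_def] by measurable

lemma tail_env_bounded: "bounded_by_envelope (tail_env \<tau>)"
  unfolding bounded_by_envelope_def using G_nonneg by (auto simp: tail_env_def intro!: exI[of _ 2])

lemma tail_env_prob:
  assumes "\<tau> > 0" "\<eta> > 0"
  shows "prob {w \<in> space M. \<eta> \<le> U (tail_env \<tau>) w + U' (tail_env \<tau>) w} \<le> 2 * tail_mass \<tau> / (\<tau> * \<eta>)"
proof -
  have kk: "sqrt k > 0" using k by simp
  let ?t2 = "\<lambda>y. (2 * G y)\<^sup>2 * (if sqrt k * \<tau> < 2 * G y then 1 else 0) / (sqrt k * \<tau>)"
  have i: "integrable M (\<lambda>w. indicator B (X 0 w) * (4 / (sqrt k * \<tau>) * (G (Y 0 w))\<^sup>2))"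
    using integrable_mult_right[OF G_square, of "4 / (sqrt k * \<tau>)"] by (simp add: ac_simps)
  have i2: "integrable M (\<lambda>w. indicator B (X 0 w) * ?t2 (Y 0 w))"
    by (rule m_mono(2)[OF _ i]) (use kk assms in \<open>auto simp: power_mult_distrib field_simps\<close>)
  have le: "0 \<le> tail_env \<tau> y \<and> tail_env \<tau> y \<le> ?t2 y" if "y \<in> space S" for y
  proof -
    have "2 * G y * (sqrt k * \<tau>) \<le> 2 * G y * (2 * G y)" if "sqrt k * \<tau> < 2 * G y"
      using that G_nonneg[OF \<open>y \<in> space S\<close>] by (intro mult_left_mono) auto
    then show ?thesis
      using kk assms G_nonneg[OF that] by (auto simp: tail_env_def pos_le_divide_eq power2_eq_square)
  qed
  note mm = m_mono[OF tail_env_measurable i2 le]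
  have "prob {w \<in> space M. \<eta> \<le> U (tail_env \<tau>) w + U' (tail_env \<tau>) w} \<le> 2 * sqrt k * m (tail_env \<tau>) / \<eta>"
    by (rule U_markov[OF tail_env_measurable _ mm(2) assms(2)]) (use le in blast)
  also have "\<dots> \<le> 2 * sqrt k * m ?t2 / \<eta>"
    using mm(1) kk assms by (intro divide_right_mono mult_left_mono) auto
  also have "m ?t2 = tail_mass \<tau> / (sqrt k * \<tau>)"
    by (simp add: m_def tail_mass_def)
  also have "2 * sqrt k * (tail_mass \<tau> / (sqrt k * \<tau>)) / \<eta> = 2 * tail_mass \<tau> / (\<tau> * \<eta>)"
    using kk by simp
  finally show ?thesis .
qed

end

subsection \<open>Chaining by brackets\<close>

locale chaining = local_sample M S X Y \<kappa> J N B k G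
  for M :: "'w measure" and S :: "'s measure" and X :: "nat \<Rightarrow> 'w \<Rightarrow> 'a::euclidean_space"
    and Y :: "nat \<Rightarrow> 'w \<Rightarrow> 's" and \<kappa> :: "'a \<Rightarrow> 's measure"
    and J :: "nat set" and N :: "(nat \<Rightarrow> 'a) \<Rightarrow> nat set" and B :: "'a set" and k :: real and G :: "'s \<Rightarrow> real" +
  fixes \<G> :: "('s \<Rightarrow> real) set" and C :: "nat \<Rightarrow> (('s \<Rightarrow> real) \<times> ('s \<Rightarrow> real)) set"
    and q0 :: nat and c \<Lambda> :: real
  assumes class_measurable: "\<And>g. g \<in> \<G> \<Longrightarrow> g \<in> borel_measurable S"
    and class_bound: "\<And>g y. g \<in> \<G> \<Longrightarrow> y \<in> space S \<Longrightarrow> \<bar>g y\<bar> \<le> G y"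
    and C_finite: "\<And>j. finite (C j)"
    and C_cover: "\<And>j g. g \<in> \<G> \<Longrightarrow> \<exists>p\<in>C j. \<forall>y\<in>space S. fst p y \<le> g y \<and> g y \<le> snd p y"
    and C_meas: "\<And>j p. p \<in> C j \<Longrightarrow> fst p \<in> borel_measurable S \<and> snd p \<in> borel_measurable S"
    and C_int: "\<And>j p. p \<in> C j \<Longrightarrow> integrable M (\<lambda>w. indicator B (X 0 w) * (fst p (Y 0 w) - snd p (Y 0 w))\<^sup>2)"
    and C_small: "\<And>j p. p \<in> C j \<Longrightarrow> m (\<lambda>y. (fst p y - snd p y)\<^sup>2) \<le> c\<^sup>2 * (1/4) ^ (q0 + j)"
    and \<Lambda>: "\<And>n. (\<Sum>j\<le>n. (1/2) ^ (q0 + j) * (real (q0 + j + 1) + (\<Sum>p\<le>Suc j. sqrt (ln (card (C p)))))) \<le> \<Lambda>"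
begin

definition s :: "nat \<Rightarrow> real" where "s j = sqrt (ln (card (C j)))"

definition L :: "nat \<Rightarrow> real" where "L j = real (q0 + j + 1) + (\<Sum>p\<le>Suc j. s p)"

definition a :: "nat \<Rightarrow> real" where "a j = (1/2) ^ (q0 + j) / L j"

text \<open>
  The truncation at \<open>sqrt k * a j\<close> keeps the links of level \<open>j\<close> in the Gaussian range of the
  Bernstein inequality, where their number is absorbed by \<open>L j\<close>. A chain is followed as long as
  the bracket widths stay below the thresholds, and is stopped at the first level where they do not.
\<close>

definition br :: "nat \<Rightarrow> ('s \<Rightarrow> real) \<Rightarrow> ('s \<Rightarrow> real) \<times> ('s \<Rightarrow> real)" where
  "br j g = (SOME p. p \<in> C j \<and> (\<forall>y\<in>space S. fst p y \<le> g y \<and> g y \<le> snd p y))"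

definition code :: "nat \<Rightarrow> ('s \<Rightarrow> real) \<Rightarrow> (('s \<Rightarrow> real) \<times> ('s \<Rightarrow> real)) list" where
  "code j g = map (\<lambda>p. br p g) [0..<Suc j]"

fun width :: "nat \<Rightarrow> ('s \<Rightarrow> real) \<Rightarrow> 's \<Rightarrow> real" where
  "width 0 g y = min (2 * G y) (snd (br 0 g) y - fst (br 0 g) y)"
| "width (Suc j) g y = min (width j g y) (snd (br (Suc j) g) y - fst (br (Suc j) g) y)"

definition rep :: "nat \<Rightarrow> ('s \<Rightarrow> real) \<Rightarrow> 's \<Rightarrow> real" where
  "rep j g = (SOME f. f \<in> \<G> \<and> code j f = code j g)"

definition inside :: "nat \<Rightarrow> ('s \<Rightarrow> real) \<Rightarrow> 's \<Rightarrow> real" where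
  "inside j g y = (if \<forall>p\<le>j. width p g y \<le> sqrt k * a p then 1 else 0)"

definition psi :: "nat \<Rightarrow> ('s \<Rightarrow> real) \<Rightarrow> 's \<Rightarrow> real" where
  "psi j g y = width (Suc j) g y * (inside j g y - inside (Suc j) g y)"

definition theta :: "nat \<Rightarrow> ('s \<Rightarrow> real) \<Rightarrow> 's \<Rightarrow> real" where
  "theta j g y = (rep (Suc j) g y - rep j g y) * inside j g y"

lemma br: "g \<in> \<G> \<Longrightarrow> br j g \<in> C j"
  "g \<in> \<G> \<Longrightarrow> y \<in> space S \<Longrightarrow> fst (br j g) y \<le> g y \<and> g y \<le> snd (br j g) y"
proof -
  assume g: "g \<in> \<G>"
  have "\<exists>p. p \<in> C j \<and> (\<forall>y\<in>space S. fst p y \<le> g y \<and> g y \<le> snd p y)" using C_cover[OF g, of j] by blast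
  from someI_ex[OF this, folded br_def] show "br j g \<in> C j"
    "y \<in> space S \<Longrightarrow> fst (br j g) y \<le> g y \<and> g y \<le> snd (br j g) y" by auto
qed

lemma code_Suc: "code (Suc j) g = code j g @ [br (Suc j) g]"
  by (simp add: code_def)

lemma code_Suc_eq: "code (Suc j) f = code (Suc j) g \<longleftrightarrow> code j f = code j g \<and> br (Suc j) f = br (Suc j) g"
  by (simp add: code_Suc)

lemma code_0_eq: "code 0 f = code 0 g \<longleftrightarrow> br 0 f = br 0 g"
  by (simp add: code_def)

lemma rep: "g \<in> \<G> \<Longrightarrow> rep j g \<in> \<G>" "g \<in> \<G> \<Longrightarrow> code j (rep j g) = code j g"
proof -
  assume "g \<in> \<G>"
  then have "\<exists>f. f \<in> \<G> \<and> code j f = code j g" by blast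
  from someI_ex[OF this, folded rep_def] show "rep j g \<in> \<G>" "code j (rep j g) = code j g" by auto
qed

lemma rep_cong: "code j f = code j g \<Longrightarrow> rep j f = rep j g"
  by (simp add: rep_def)

lemma width_cong: "code j f = code j g \<Longrightarrow> width j f y = width j g y"
  by (induction j) (auto simp: code_Suc_eq code_0_eq)

lemma code_le: "code j f = code j g \<Longrightarrow> p \<le> j \<Longrightarrow> code p f = code p g"
proof (induction j)
  case (Suc j)
  then show ?case by (cases "p = Suc j") (auto simp: code_Suc_eq)
qed simp

lemma inside_cong: "code j f = code j g \<Longrightarrow> inside j f y = inside j g y"
  unfolding inside_def using width_cong[OF code_le[of j f g]] by auto

lemma psi_cong: "code (Suc j) f = code (Suc j) g \<Longrightarrow> psi j f = psi j g"
  unfolding psi_def[abs_def] using width_cong[of "Suc j" f g] inside_cong[of "Suc j" f g] inside_cong[of j f g] code_Suc_eq[of j f g] by auto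

lemma theta_cong: "code (Suc j) f = code (Suc j) g \<Longrightarrow> theta j f = theta j g"
  unfolding theta_def[abs_def] using rep_cong[of "Suc j" f g] rep_cong[of j f g] inside_cong[of j f g] code_Suc_eq[of j f g] by auto

lemma width_nonneg:
  assumes "g \<in> \<G>" "y \<in> space S"
  shows "0 \<le> width j g y"
  using br(2)[OF assms] G_nonneg[OF assms(2)] by (induction j) (auto intro: order_trans)

lemma width_le: "width j g y \<le> snd (br j g) y - fst (br j g) y"
  by (cases j) auto

lemma width_le_G: "width j g y \<le> 2 * G y"
  by (induction j) auto

lemma diff_le_width:
  assumes "f \<in> \<G>" "g \<in> \<G>" "y \<in> space S" "code j f = code j g"
  shows "\<bar>f y - g y\<bar> \<le> width j g y"
  using assms(4)
proof (induction j)
  case 0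
  then have "br 0 f = br 0 g" by (simp add: code_0_eq)
  then show ?case
    using br(2)[OF assms(1,3), of 0] br(2)[OF assms(2,3), of 0] class_bound[OF assms(1,3)] class_bound[OF assms(2,3)] by auto
next
  case (Suc j)
  then have "br (Suc j) f = br (Suc j) g" "code j f = code j g" by (auto simp: code_Suc_eq)
  then show ?case
    using Suc.IH br(2)[OF assms(1,3), of "Suc j"] br(2)[OF assms(2,3), of "Suc j"] by auto
qed

lemma width_measurable [measurable]: "g \<in> \<G> \<Longrightarrow> width j g \<in> borel_measurable S"
proof (induction j)
  case 0
  have [measurable]: "fst (br 0 g) \<in> borel_measurable S" "snd (br 0 g) \<in> borel_measurable S"
    using C_meas[OF br(1)[OF 0]] by auto
  have "width 0 g = (\<lambda>y. min (2 * G y) (snd (br 0 g) y - fst (br 0 g) y))" by auto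
  then show ?case by simp
next
  case (Suc j)
  have [measurable]: "fst (br (Suc j) g) \<in> borel_measurable S" "snd (br (Suc j) g) \<in> borel_measurable S" "width j g \<in> borel_measurable S"
    using C_meas[OF br(1)[OF Suc.prems, of "Suc j"]] Suc by auto
  have "width (Suc j) g = (\<lambda>y. min (width j g y) (snd (br (Suc j) g) y - fst (br (Suc j) g) y))" by auto
  then show ?case by simp
qed

lemma inside_measurable [measurable]: "g \<in> \<G> \<Longrightarrow> inside j g \<in> borel_measurable S"
  unfolding inside_def[abs_def] by measurable

lemma inside_01: "inside j g y = 0 \<or> inside j g y = 1"
  by (simp add: inside_def)

lemma inside_Suc_le: "inside (Suc j) g y \<le> inside j g y"
  by (auto simp: inside_def)

lemma inside_width: "inside j g y = 1 \<Longrightarrow> p \<le> j \<Longrightarrow> width p g y \<le> sqrt k * a p"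
  by (auto simp: inside_def split: if_splits)

lemma psi_measurable [measurable]: "g \<in> \<G> \<Longrightarrow> psi j g \<in> borel_measurable S"
  unfolding psi_def[abs_def] by measurable

lemma theta_measurable [measurable]: "g \<in> \<G> \<Longrightarrow> theta j g \<in> borel_measurable S"
  unfolding theta_def[abs_def] using class_measurable[OF rep(1)] by measurable

lemma s_nonneg: "0 \<le> s j"
  by (cases "card (C j) = 0") (auto simp: s_def)

lemma L_ge: "real (q0 + j + 1) \<le> L j" "1 \<le> L j"
proof -
  have "0 \<le> (\<Sum>p\<le>Suc j. s p)" by (intro sum_nonneg s_nonneg)
  then show "real (q0 + j + 1) \<le> L j" "1 \<le> L j" by (auto simp: L_def)
qed

lemma a_pos: "0 < a j"
  using L_ge(2)[of j] by (simp add: a_def)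

lemma finite_code: "finite (code j ` \<G>)" "card (code j ` \<G>) \<le> (\<Prod>p\<le>j. card (C p))"
proof -
  have "finite (code j ` \<G>) \<and> card (code j ` \<G>) \<le> (\<Prod>p\<le>j. card (C p))"
  proof (induction j)
    case 0
    have sub: "code 0 ` \<G> \<subseteq> (\<lambda>x. [x]) ` C 0" using br(1) by (auto simp: code_def)
    then show ?case
      using C_finite[of 0] finite_subset[OF sub] card_mono[OF _ sub] card_image_le[OF C_finite, of "\<lambda>x. [x]" 0] by auto
  next
    case (Suc j)
    have sub: "code (Suc j) ` \<G> \<subseteq> (\<lambda>(x, y). x @ [y]) ` (code j ` \<G> \<times> C (Suc j))"
      using br(1) by (auto simp: code_Suc)
    have fin: "finite (code j ` \<G> \<times> C (Suc j))" using Suc C_finite by simp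
    have "card (code (Suc j) ` \<G>) \<le> card ((\<lambda>(x, y). x @ [y]) ` (code j ` \<G> \<times> C (Suc j)))"
      by (rule card_mono[OF _ sub]) (use fin in simp)
    also have "\<dots> \<le> card (code j ` \<G> \<times> C (Suc j))" by (rule card_image_le[OF fin])
    also have "\<dots> \<le> (\<Prod>p\<le>j. card (C p)) * card (C (Suc j))" using Suc by (simp add: card_cartesian_product)
    finally show ?case using finite_subset[OF sub] fin by simp
  qed
  then show "finite (code j ` \<G>)" "card (code j ` \<G>) \<le> (\<Prod>p\<le>j. card (C p))" by auto
qed

lemma count_bound: "real (card (code (Suc j) ` \<G>)) \<le> exp ((L j)\<^sup>2 - real (q0 + j + 1))"
proof (cases "\<G> = {}")
  case False
  then obtain g where g: "g \<in> \<G>" by blast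
  have pos: "0 < card (C p)" for p using br(1)[OF g, of p] C_finite by (auto simp: card_gt_0_iff)
  have "real (card (code (Suc j) ` \<G>)) \<le> (\<Prod>p\<le>Suc j. real (card (C p)))"
    using finite_code(2)[of "Suc j"] by (metis of_nat_le_iff of_nat_prod)
  also have "\<dots> = (\<Prod>p\<le>Suc j. exp ((s p)\<^sup>2))"
  proof (rule prod.cong[OF refl])
    fix p
    have "0 \<le> ln (real (card (C p)))" using pos[of p] by simp
    then show "real (card (C p)) = exp ((s p)\<^sup>2)" using pos[of p] by (simp add: s_def)
  qed
  also have "\<dots> = exp (\<Sum>p\<le>Suc j. (s p)\<^sup>2)" by (rule exp_sum[symmetric]) simp
  also have "\<dots> \<le> exp ((L j)\<^sup>2 - real (q0 + j + 1))"
  proof -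
    let ?S = "\<Sum>p\<le>Suc j. s p" and ?q = "real (q0 + j + 1)"
    have S0: "0 \<le> ?S" by (intro sum_nonneg s_nonneg)
    have "(\<Sum>p\<le>Suc j. (s p)\<^sup>2) \<le> ?S\<^sup>2" by (rule sum_power2_le) (auto intro: s_nonneg)
    moreover have "(L j)\<^sup>2 = ?q\<^sup>2 + 2 * ?q * ?S + ?S\<^sup>2" unfolding L_def power2_sum by simp
    moreover have "?q \<le> ?q\<^sup>2" unfolding power2_eq_square by (rule order_trans[OF _ mult_left_mono[of 1]]) auto
    moreover have "0 \<le> 2 * ?q * ?S" using S0 by (intro mult_nonneg_nonneg) auto
    moreover have "x \<le> l - q" if "x \<le> y" "l = q' + t + y" "q \<le> q'" "0 \<le> t" for x y l q q' t :: real
      using that by linarith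
    ultimately have "(\<Sum>p\<le>Suc j. (s p)\<^sup>2) \<le> (L j)\<^sup>2 - ?q" by blast
    then show ?thesis by (simp only: exp_le_cancel_iff)
  qed
  finally show ?thesis .
qed simp

lemma decomposition:
  "g y - rep 0 g y = (g y - rep 0 g y) * (1 - inside 0 g y) +
    (\<Sum>j<n. (g y - rep (Suc j) g y) * (inside j g y - inside (Suc j) g y) + theta j g y) +
    (g y - rep n g y) * inside n g y"
proof (induction n)
  case (Suc n)
  then show ?case by (simp add: theta_def algebra_simps)
qed (simp add: algebra_simps)

lemma rep_diff_bounds:
  assumes g: "g \<in> \<G>" and y: "y \<in> space S"
  shows "\<bar>(g y - rep 0 g y) * (1 - inside 0 g y)\<bar> \<le> tail_env (a 0) y"
    "\<bar>(g y - rep (Suc j) g y) * (inside j g y - inside (Suc j) g y)\<bar> \<le> psi j g y"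
    "\<bar>(g y - rep n g y) * inside n g y\<bar> \<le> sqrt k * a n"
    "0 \<le> psi j g y" "psi j g y \<le> sqrt k * a j" "psi j g y \<le> (fst (br (Suc j) g) y - snd (br (Suc j) g) y)\<^sup>2 / (sqrt k * a (Suc j))"
    "\<bar>theta j g y\<bar> \<le> sqrt k * a j" "(theta j g y)\<^sup>2 \<le> (fst (br j g) y - snd (br j g) y)\<^sup>2"
    "psi j g y \<le> 2 * G y"
proof -
  have kk: "sqrt k > 0" using k by simp
  have rd: "\<bar>g y - rep j g y\<bar> \<le> width j g y" for j
    using diff_le_width[OF rep(1)[OF g] g y rep(2)[OF g], of j] by (simp add: abs_minus_commute)
  have w0: "0 \<le> width j g y" for j by (rule width_nonneg[OF g y])
  show "\<bar>(g y - rep 0 g y) * (1 - inside 0 g y)\<bar> \<le> tail_env (a 0) y"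
  proof (cases "width 0 g y \<le> sqrt k * a 0")
    case False
    then have "sqrt k * a 0 < 2 * G y" using width_le_G[of 0 g y] by linarith
    then show ?thesis using rd[of 0] width_le_G[of 0 g y] by (auto simp: tail_env_def inside_def)
  next
    case True
    then show ?thesis using G_nonneg[OF y] by (simp add: inside_def tail_env_def)
  qed
  have ii: "inside j g y - inside (Suc j) g y = 0 \<or> inside j g y - inside (Suc j) g y = 1" for j
    using inside_01[of j g y] inside_01[of "Suc j" g y] inside_Suc_le[of j g y] by auto
  show "\<bar>(g y - rep (Suc j) g y) * (inside j g y - inside (Suc j) g y)\<bar> \<le> psi j g y"
    using ii[of j] rd[of "Suc j"] by (auto simp: psi_def)
  show "\<bar>(g y - rep n g y) * inside n g y\<bar> \<le> sqrt k * a n"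
    using inside_01[of n g y] rd[of n] inside_width[of n g y n] kk a_pos[of n] by auto
  show "0 \<le> psi j g y" using ii[of j] w0[of "Suc j"] by (auto simp: psi_def)
  show "psi j g y \<le> 2 * G y" using ii[of j] width_le_G[of "Suc j" g y] G_nonneg[OF y] by (auto simp: psi_def)
  have in1: "inside j g y = 1" "inside (Suc j) g y = 0" if "inside j g y - inside (Suc j) g y = 1"
    using that inside_01[of j g y] inside_01[of "Suc j" g y] by auto
  show "psi j g y \<le> sqrt k * a j"
  proof (cases "inside j g y - inside (Suc j) g y = 1")
    case True
    have "width (Suc j) g y \<le> width j g y" by simp
    also have "\<dots> \<le> sqrt k * a j" by (rule inside_width[OF in1(1)[OF True]]) simp
    finally show ?thesis using True by (simp add: psi_def)
  next
    case False
    then show ?thesis using ii[of j] kk a_pos[of j] by (auto simp: psi_def)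
  qed
  show "psi j g y \<le> (fst (br (Suc j) g) y - snd (br (Suc j) g) y)\<^sup>2 / (sqrt k * a (Suc j))"
  proof (cases "inside j g y - inside (Suc j) g y = 1")
    case True
    let ?w = "width (Suc j) g y" and ?b = "snd (br (Suc j) g) y - fst (br (Suc j) g) y"
    have "\<not> ?w \<le> sqrt k * a (Suc j)"
      using in1[OF True] unfolding inside_def by (auto simp: le_Suc_eq split: if_splits)
    then have "?w * (sqrt k * a (Suc j)) \<le> ?w * ?w" using w0[of "Suc j"] by (intro mult_left_mono) auto
    also have "\<dots> \<le> ?b * ?b" using w0[of "Suc j"] width_le[of "Suc j" g y] by (intro mult_mono) linarith+
    also have "\<dots> = (fst (br (Suc j) g) y - snd (br (Suc j) g) y)\<^sup>2" by (simp add: power2_eq_square algebra_simps)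
    finally show ?thesis using True kk a_pos[of "Suc j"] by (simp add: psi_def pos_le_divide_eq)
  next
    case False
    then show ?thesis using ii[of j] kk a_pos[of "Suc j"] by (auto simp: psi_def)
  qed
  have th: "\<bar>rep (Suc j) g y - rep j g y\<bar> \<le> width j g y" for j
  proof -
    have "code j (rep (Suc j) g) = code j (rep j g)"
      using rep(2)[OF g, of "Suc j"] rep(2)[OF g, of j] by (simp add: code_Suc_eq)
    from diff_le_width[OF rep(1)[OF g] rep(1)[OF g] y this] show ?thesis
      using width_cong[OF rep(2)[OF g]] by simp
  qed
  show "\<bar>theta j g y\<bar> \<le> sqrt k * a j"
    using inside_01[of j g y] th[of j] inside_width[of j g y j] kk a_pos[of j] by (auto simp: theta_def)
  show "(theta j g y)\<^sup>2 \<le> (fst (br j g) y - snd (br j g) y)\<^sup>2"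
  proof -
    have "\<bar>theta j g y\<bar> \<le> \<bar>fst (br j g) y - snd (br j g) y\<bar>"
      using inside_01[of j g y] th[of j] width_le[of j g y] by (auto simp: theta_def)
    then show ?thesis by (simp add: abs_le_square_iff)
  qed
qed

definition u :: "nat \<Rightarrow> real" where
  "u j = 2 * c\<^sup>2 * (1/2) ^ (q0 + Suc j) * L (Suc j) + 2 * (1/2) ^ (q0 + j) * L j"

definition v :: "nat \<Rightarrow> real" where
  "v j = (4 + c\<^sup>2 / 2) * (1/2) ^ (q0 + j) * L j"

definition bad :: "nat \<Rightarrow> 'w set" where
  "bad j = (\<Union>\<psi>\<in>psi j ` \<G>. {w \<in> space M. u j \<le> U \<psi> w} \<union> {w \<in> space M. u j \<le> U' \<psi> w}) \<union>
    (\<Union>\<theta>\<in>theta j ` \<G>. {w \<in> space M. v j \<le> \<bar>V \<theta> w\<bar>})"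

lemma psi_prob:
  assumes g: "g \<in> \<G>"
  shows "prob {\<omega> \<in> space M. u j \<le> U (psi j g) \<omega>} \<le> exp (- 2 * (L j)\<^sup>2)"
    "prob {\<omega> \<in> space M. u j \<le> U' (psi j g) \<omega>} \<le> exp (- 2 * (L j)\<^sup>2)"
proof -
  have kk: "sqrt k > 0" using k by simp
  note b = rep_diff_bounds[OF g]
  let ?w = "\<lambda>y. (fst (br (Suc j) g) y - snd (br (Suc j) g) y)\<^sup>2"
  have i: "integrable M (\<lambda>\<omega>. indicator B (X 0 \<omega>) * (?w (Y 0 \<omega>) / (sqrt k * a (Suc j))))"
    using integrable_mult_right[OF C_int[OF br(1)[OF g, of "Suc j"]], of "1 / (sqrt k * a (Suc j))"] by (simp add: ac_simps)
  have "m (psi j g) \<le> m (\<lambda>y. ?w y / (sqrt k * a (Suc j)))"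
    by (rule m_mono(1)[OF psi_measurable[OF g] i]) (use b in blast)
  also have "\<dots> = m ?w / (sqrt k * a (Suc j))" by (simp add: m_def)
  also have "\<dots> \<le> c\<^sup>2 * (1/4) ^ (q0 + Suc j) / (sqrt k * a (Suc j))"
    by (rule divide_right_mono[OF C_small[OF br(1)[OF g]]]) (use kk a_pos[of "Suc j"] in simp)
  finally have mp: "sqrt k * m (psi j g) \<le> c\<^sup>2 * (1/4) ^ (q0 + Suc j) / a (Suc j)"
    using kk a_pos[of "Suc j"] by (simp add: field_simps)
  have "(1/4 :: real) ^ (q0 + Suc j) = (1/2) ^ (q0 + Suc j) * (1/2) ^ (q0 + Suc j)"
    by (simp add: power_mult_distrib[symmetric])
  then have "c\<^sup>2 * (1/4) ^ (q0 + Suc j) / a (Suc j) = c\<^sup>2 * (1/2) ^ (q0 + Suc j) * L (Suc j)"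
    by (simp add: a_def)
  with mp have d: "2 * (1/2) ^ (q0 + j) * L j \<le> u j - 2 * sqrt k * m (psi j g)" by (simp add: u_def)
  have "2 * (L j)\<^sup>2 = 2 * (1/2) ^ (q0 + j) * L j / a j"
    using L_ge(2)[of j] by (simp add: a_def power2_eq_square)
  also have "\<dots> \<le> (u j - 2 * sqrt k * m (psi j g)) / a j"
    by (rule divide_right_mono[OF d]) (use a_pos[of j] in simp)
  finally have e: "exp (- (u j - 2 * sqrt k * m (psi j g)) / a j) \<le> exp (- 2 * (L j)\<^sup>2)"
    by (simp only: exp_le_cancel_iff minus_divide_left[symmetric])
  have pb: "0 \<le> psi j g y \<and> psi j g y \<le> sqrt k * a j" if "y \<in> space S" for y using b that by blast
  show "prob {\<omega> \<in> space M. u j \<le> U (psi j g) \<omega>} \<le> exp (- 2 * (L j)\<^sup>2)"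
    "prob {\<omega> \<in> space M. u j \<le> U' (psi j g) \<omega>} \<le> exp (- 2 * (L j)\<^sup>2)"
    using U_tail[OF psi_measurable[OF g] pb a_pos, of "u j"] e by (auto intro: order_trans)
qed

lemma theta_prob:
  assumes g: "g \<in> \<G>"
  shows "prob {w \<in> space M. v j \<le> \<bar>V (theta j g) w\<bar>} \<le> 2 * exp (- 2 * (L j)\<^sup>2)"
proof -
  note b = rep_diff_bounds[OF g]
  have "m (\<lambda>y. (theta j g y)\<^sup>2) \<le> m (\<lambda>y. (fst (br j g) y - snd (br j g) y)\<^sup>2)"
    by (rule m_mono(1)[OF _ C_int[OF br(1)[OF g]]]) (use b theta_measurable[OF g] in auto)
  also have "\<dots> \<le> c\<^sup>2 * (1/4) ^ (q0 + j)" by (rule C_small[OF br(1)[OF g]])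
  finally have mv: "m (\<lambda>y. (theta j g y)\<^sup>2) \<le> c\<^sup>2 * (1/4) ^ (q0 + j)" .
  let ?l = "1 / (2 * a j)"
  have a0: "a j > 0" by (rule a_pos)
  have "prob {w \<in> space M. v j \<le> \<bar>V (theta j g) w\<bar>} \<le> 2 * exp (- ?l * v j + ?l\<^sup>2 * (c\<^sup>2 * (1/4) ^ (q0 + j)))"
    by (rule V_tail[OF theta_measurable[OF g] _ _ _ mv]) (use b a0 in auto)
  also have "- ?l * v j + ?l\<^sup>2 * (c\<^sup>2 * (1/4) ^ (q0 + j)) = - 2 * (L j)\<^sup>2"
  proof -
    have q: "(1/4 :: real) ^ (q0 + j) = ((1/2) ^ (q0 + j))\<^sup>2" by (simp add: power2_eq_square power_mult_distrib[symmetric])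
    define p where "p = (1/2 :: real) ^ (q0 + j)"
    have p: "p > 0" by (simp add: p_def)
    have l: "?l = L j / (2 * p)" by (simp add: a_def p_def)
    have "- ?l * v j + ?l\<^sup>2 * (c\<^sup>2 * p\<^sup>2) = - 2 * (L j)\<^sup>2"
      unfolding l v_def p_def[symmetric] using p by (simp add: field_simps power2_eq_square)
    then show ?thesis by (simp only: q p_def)
  qed
  finally show ?thesis .
qed

lemma bad:
  shows "bad j \<in> events" "prob (bad j) \<le> 4 * (1/2) ^ (q0 + j + 1)"
proof -
  note fp = card_image_factor[of "code (Suc j)" \<G> "psi j", OF finite_code(1) psi_cong]
    and ft = card_image_factor[of "code (Suc j)" \<G> "theta j", OF finite_code(1) theta_cong]
  let ?E = "exp (- 2 * (L j)\<^sup>2)" and ?c = "real (card (code (Suc j) ` \<G>))"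
  let ?P = "\<lambda>\<psi>. {w \<in> space M. u j \<le> U \<psi> w} \<union> {w \<in> space M. u j \<le> U' \<psi> w}"
  let ?T = "\<lambda>\<theta>. {w \<in> space M. v j \<le> \<bar>V \<theta> w\<bar>}"
  have mP: "?P (psi j g) \<in> events" if "g \<in> \<G>" for g using psi_measurable[OF that] by measurable
  have mT: "?T (theta j g) \<in> events" if "g \<in> \<G>" for g using theta_measurable[OF that] by measurable
  have mP': "?P \<psi> \<in> events" if "\<psi> \<in> psi j ` \<G>" for \<psi>
    using that by (elim imageE) (simp only: mP)
  have mT': "?T \<theta> \<in> events" if "\<theta> \<in> theta j ` \<G>" for \<theta>
    using that by (elim imageE) (simp only: mT)
  have eP: "(\<Union>\<psi>\<in>psi j ` \<G>. ?P \<psi>) \<in> events" by (rule sets.finite_UN[OF fp(1) mP'])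
  have eT: "(\<Union>\<theta>\<in>theta j ` \<G>. ?T \<theta>) \<in> events" by (rule sets.finite_UN[OF ft(1) mT'])
  show "bad j \<in> events" unfolding bad_def using eP eT by (rule sets.Un)
  have "prob (?P (psi j g)) \<le> 2 * ?E" if "g \<in> \<G>" for g
  proof -
    have "prob (?P (psi j g)) \<le> prob {w \<in> space M. u j \<le> U (psi j g) w} + prob {w \<in> space M. u j \<le> U' (psi j g) w}"
      by (rule measure_Un_le) (use psi_measurable[OF that] in measurable)
    then show ?thesis using psi_prob[OF that, of j] by linarith
  qed
  then have pP: "prob (?P \<psi>) \<le> 2 * ?E" if "\<psi> \<in> psi j ` \<G>" for \<psi>
    using that by (elim imageE) (simp only:)
  have pT: "prob (?T \<theta>) \<le> 2 * ?E" if "\<theta> \<in> theta j ` \<G>" for \<theta>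
    using that by (elim imageE) (simp only: theta_prob)
  have "prob (\<Union>\<psi>\<in>psi j ` \<G>. ?P \<psi>) \<le> (\<Sum>\<psi>\<in>psi j ` \<G>. 2 * ?E)"
    by (rule order_trans[OF measure_UNION_le[OF fp(1) mP'] sum_mono[OF pP]])
  also have "\<dots> \<le> ?c * (2 * ?E)" using fp(2) by simp
  finally have p1: "prob (\<Union>\<psi>\<in>psi j ` \<G>. ?P \<psi>) \<le> ?c * (2 * ?E)" .
  have "prob (\<Union>\<theta>\<in>theta j ` \<G>. ?T \<theta>) \<le> (\<Sum>\<theta>\<in>theta j ` \<G>. 2 * ?E)"
    by (rule order_trans[OF measure_UNION_le[OF ft(1) mT'] sum_mono[OF pT]])
  also have "\<dots> \<le> ?c * (2 * ?E)" using ft(2) by simp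
  finally have p2: "prob (\<Union>\<theta>\<in>theta j ` \<G>. ?T \<theta>) \<le> ?c * (2 * ?E)" .
  have "prob (bad j) \<le> ?c * (2 * ?E) + ?c * (2 * ?E)"
    unfolding bad_def using measure_Un_le[OF eP eT] p1 p2 by linarith
  also have "\<dots> = 4 * (?c * ?E)" by simp
  also have "\<dots> \<le> 4 * (exp ((L j)\<^sup>2 - real (q0 + j + 1)) * ?E)"
    by (intro mult_left_mono mult_right_mono count_bound) auto
  also have "exp ((L j)\<^sup>2 - real (q0 + j + 1)) * ?E = exp (- (L j)\<^sup>2 - real (q0 + j + 1))"
    by (simp add: exp_add[symmetric])
  also have "\<dots> \<le> exp (- real (q0 + j + 1))" by simp
  also have "\<dots> = exp (- 1) ^ (q0 + j + 1)" by (simp only: exp_of_nat_mult[symmetric]) simp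
  also have "\<dots> \<le> (1/2) ^ (q0 + j + 1)"
  proof (rule power_mono)
    show "exp (- 1 :: real) \<le> 1 / 2" using exp_ge_add_one_self[of 1] by (simp add: exp_minus field_simps)
  qed simp
  finally show "prob (bad j) \<le> 4 * (1/2) ^ (q0 + j + 1)" by simp
qed

lemma levels_sum: "(\<Sum>j<n. 2 * u j + v j) \<le> (8 + 5 * c\<^sup>2) * \<Lambda>"
proof -
  let ?f = "\<lambda>j. (1/2) ^ (q0 + j) * L j"
  have f0: "0 \<le> ?f j" for j using L_ge(2)[of j] by simp
  have le: "(\<Sum>j\<le>n. ?f j) \<le> \<Lambda>" using \<Lambda>[of n] by (simp add: L_def s_def)
  have 1: "(\<Sum>j<n. ?f (Suc j)) \<le> \<Lambda>"
  proof -
    have "(\<Sum>j<n. ?f (Suc j)) = (\<Sum>j\<in>{1..n}. ?f j)"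
      by (rule sum.reindex_bij_witness[of _ "\<lambda>j. j - 1" Suc]) auto
    also have "\<dots> \<le> (\<Sum>j\<le>n. ?f j)" by (rule sum_mono2) (use f0 in auto)
    finally show ?thesis using le by simp
  qed
  have 2: "(\<Sum>j<n. ?f j) \<le> \<Lambda>"
    by (rule order_trans[OF sum_mono2 le]) (use f0 in auto)
  have L0: "0 \<le> \<Lambda>" by (rule order_trans[OF sum_nonneg le]) (rule f0)
  have "(\<Sum>j<n. 2 * u j + v j) = 4 * c\<^sup>2 * (\<Sum>j<n. ?f (Suc j)) + (8 + c\<^sup>2 / 2) * (\<Sum>j<n. ?f j)"
    unfolding sum_distrib_left sum.distrib[symmetric] by (rule sum.cong) (auto simp: u_def v_def algebra_simps)
  also have "\<dots> \<le> 4 * c\<^sup>2 * \<Lambda> + (8 + c\<^sup>2 / 2) * \<Lambda>"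
    using 1 2 by (intro add_mono mult_left_mono) auto
  also have "\<dots> \<le> (8 + 5 * c\<^sup>2) * \<Lambda>"
    using mult_nonneg_nonneg[OF zero_le_power2[of c] L0] by (simp add: algebra_simps)
  finally show ?thesis .
qed

lemma class_envelope: "g \<in> \<G> \<Longrightarrow> bounded_by_envelope g"
  unfolding bounded_by_envelope_def using class_measurable class_bound by (auto intro!: exI[of _ 1])

theorem chaining_bound:
  assumes \<eta>: "\<eta> > 0"
  obtains A where "A \<in> events" "prob A \<le> 4 * (1/2) ^ q0 + 2 * tail_mass (a 0) / (a 0 * \<eta>)" "space M - A \<subseteq> regular"
    "\<And>w g. w \<in> space M - A \<Longrightarrow> g \<in> \<G> \<Longrightarrow> \<bar>V g w - V (rep 0 g) w\<bar> \<le> (8 + 5 * c\<^sup>2) * \<Lambda> + 2 * \<eta>"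
proof -
  have kk: "sqrt k > 0" "sqrt k * sqrt k = k" using k by auto
  have "(\<lambda>n. 2 * k * (1/2) ^ (q0 + n)) \<longlonglongrightarrow> 2 * k * 0"
    unfolding power_add by (intro tendsto_mult tendsto_const tendsto_mult_right_zero LIMSEQ_power_zero) auto
  then have "eventually (\<lambda>n. 2 * k * (1/2) ^ (q0 + n) < \<eta>) sequentially"
    by (rule order_tendstoD) (use \<eta> in simp)
  then obtain n where n: "2 * k * (1/2) ^ (q0 + n) < \<eta>" using eventually_happens by fastforce
  define E0 where "E0 = {w \<in> space M. \<eta> \<le> U (tail_env (a 0)) w + U' (tail_env (a 0)) w}"
  have E0: "E0 \<in> events" unfolding E0_def by measurable
  define A where "A = (space M - regular) \<union> (E0 \<union> (\<Union>j<n. bad j))"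
  have UA: "(\<Union>j<n. bad j) \<in> events" using bad(1) by auto
  have A: "A \<in> events" unfolding A_def using E0 UA by auto
  have "prob (space M - regular) = 0"
    using AE_regular prob_compl[OF regular_sets] prob_eq_1[OF regular_sets] by simp
  moreover have "prob (\<Union>j<n. bad j) \<le> 4 * (1/2) ^ q0"
  proof -
    have "prob (\<Union>j<n. bad j) \<le> (\<Sum>j<n. prob (bad j))" by (rule measure_UNION_le) (use bad(1) in auto)
    also have "\<dots> \<le> (\<Sum>j<n. 4 * (1/2) ^ q0 * ((1/2) ^ j - (1/2) ^ Suc j))"
      by (rule sum_mono) (use bad(2) in \<open>auto simp: power_add\<close>)
    also have "\<dots> = 4 * (1/2) ^ q0 * (1 - (1/2) ^ n)"
      unfolding sum_distrib_left[symmetric] by (simp only: sum_lessThan_telescope') simp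
    also have "\<dots> \<le> 4 * (1/2) ^ q0 * 1" by (intro mult_left_mono) auto
    finally show ?thesis by simp
  qed
  moreover have "prob E0 \<le> 2 * tail_mass (a 0) / (a 0 * \<eta>)"
    unfolding E0_def by (rule tail_env_prob[OF a_pos \<eta>])
  moreover have "prob A \<le> prob (space M - regular) + (prob E0 + prob (\<Union>j<n. bad j))"
    unfolding A_def using E0 UA
    by (intro order_trans[OF measure_Un_le] add_left_mono measure_Un_le) auto
  ultimately have pA: "prob A \<le> 4 * (1/2) ^ q0 + 2 * tail_mass (a 0) / (a 0 * \<eta>)" by linarith
  have reg: "space M - A \<subseteq> regular" unfolding A_def by auto
  have bound: "\<bar>V g w - V (rep 0 g) w\<bar> \<le> (8 + 5 * c\<^sup>2) * \<Lambda> + 2 * \<eta>" if wM: "w \<in> space M - A" and g: "g \<in> \<G>" for w g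
  proof -
    have wr: "w \<in> regular" using wM reg by blast
    note b = rep_diff_bounds[OF g]
    have gm [measurable]: "g \<in> borel_measurable S" "rep j g \<in> borel_measurable S" "inside j g \<in> borel_measurable S" for j
      using class_measurable[OF g] class_measurable[OF rep(1)[OF g]] inside_measurable[OF g] by auto
    let ?p1 = "\<lambda>y. (g y - rep 0 g y) * (1 - inside 0 g y)"
    let ?p2 = "\<lambda>j y. (g y - rep (Suc j) g y) * (inside j g y - inside (Suc j) g y)"
    let ?p4 = "\<lambda>y. (g y - rep n g y) * inside n g y"
    have env2: "bounded_by_envelope (\<lambda>y. 2 * G y)" unfolding bounded_by_envelope_def by (auto intro!: exI[of _ 2] simp: G_nonneg)
    have le2: "\<bar>f y - f' y\<bar> \<le> 2 * G y" if "f \<in> \<G>" "f' \<in> \<G>" "y \<in> space S" for f f' y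
      using class_bound[OF that(1,3)] class_bound[OF that(2,3)] by linarith
    have sm: "bounded_by_envelope (\<lambda>y. (f y - f' y) * h y)"
      if "f \<in> \<G>" "f' \<in> \<G>" "h \<in> borel_measurable S" "\<And>y. \<bar>h y\<bar> \<le> 1" for f f' h
    proof (rule bounded_by_envelope_mono[OF env2])
      show "(\<lambda>y. (f y - f' y) * h y) \<in> borel_measurable S"
        using class_measurable[OF that(1)] class_measurable[OF that(2)] that(3) by measurable
      show "\<bar>(f y - f' y) * h y\<bar> \<le> \<bar>2 * G y\<bar>" if y: "y \<in> space S" for y
      proof -
        have "\<bar>f y - f' y\<bar> * \<bar>h y\<bar> \<le> 2 * G y * 1"
          using le2[OF \<open>f \<in> \<G>\<close> \<open>f' \<in> \<G>\<close> y] \<open>\<And>y. \<bar>h y\<bar> \<le> 1\<close> G_nonneg[OF y] by (intro mult_mono) auto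
        then show ?thesis using G_nonneg[OF y] by (simp add: abs_mult)
      qed
    qed
    have i1: "\<bar>inside j g y\<bar> \<le> 1" "\<bar>1 - inside j g y\<bar> \<le> 1" "\<bar>inside j g y - inside (Suc j) g y\<bar> \<le> 1" for j y
      using inside_01[of j g y] inside_01[of "Suc j" g y] by auto
    have e1: "bounded_by_envelope ?p1" by (rule sm[OF g rep(1)[OF g]]) (auto simp: i1)
    have e2: "bounded_by_envelope (?p2 j)" for j by (rule sm[OF g rep(1)[OF g]]) (auto simp: i1)
    have e3: "bounded_by_envelope (theta j g)" for j
      unfolding theta_def[abs_def] by (rule sm[OF rep(1)[OF g] rep(1)[OF g]]) (auto simp: i1)
    have e4: "bounded_by_envelope ?p4" by (rule sm[OF g rep(1)[OF g]]) (auto simp: i1)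
    have e5: "bounded_by_envelope (psi j g)" for j
    proof (rule bounded_by_envelope_mono[OF env2 psi_measurable[OF g]])
      show "\<bar>psi j g y\<bar> \<le> \<bar>2 * G y\<bar>" if "y \<in> space S" for y
        using b(4)[OF that, of j] b(9)[OF that, of j] by linarith
    qed
    have "V g w - V (rep 0 g) w = V (\<lambda>y. g y - rep 0 g y) w"
      using V_add(2)[OF wr class_envelope[OF g] class_envelope[OF rep(1)[OF g]]] by simp
    also have "(\<lambda>y. g y - rep 0 g y) = (\<lambda>y. (?p1 y + (\<Sum>j<n. ?p2 j y + theta j g y)) + ?p4 y)"
      using decomposition[of g _ n] by (intro ext) simp
    also have "V \<dots> w = (V ?p1 w + (\<Sum>j<n. V (?p2 j) w + V (theta j g) w)) + V ?p4 w"
    proof -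
      note vs = V_sum[OF wr, of "{..<n}" "\<lambda>j y. ?p2 j y + theta j g y", OF _ bounded_by_envelope_add(1)[OF e2 e3]]
      have vs1: "V (\<lambda>y. \<Sum>j<n. ?p2 j y + theta j g y) w = (\<Sum>j<n. V (?p2 j) w + V (theta j g) w)"
        by (rule trans[OF conjunct1[OF vs] sum.cong[OF refl V_add(1)[OF wr e2 e3]]]) simp
      have vs2: "bounded_by_envelope (\<lambda>y. \<Sum>j<n. ?p2 j y + theta j g y)"
        by (rule conjunct2[OF vs]) simp
      show ?thesis
        unfolding V_add(1)[OF wr bounded_by_envelope_add(1)[OF e1 vs2] e4] V_add(1)[OF wr e1 vs2] vs1 ..
    qed
    finally have eq: "V g w - V (rep 0 g) w = (V ?p1 w + (\<Sum>j<n. V (?p2 j) w + V (theta j g) w)) + V ?p4 w" .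
    have "\<bar>V ?p1 w\<bar> \<le> U (tail_env (a 0)) w + U' (tail_env (a 0)) w"
      by (rule V_le_U[OF wr bounded_by_envelopeD[OF e1] tail_env_bounded]) (rule b(1))
    also have "\<dots> \<le> \<eta>" using wM by (auto simp: A_def E0_def)
    finally have t1: "\<bar>V ?p1 w\<bar> \<le> \<eta>" .
    have t2: "\<bar>V (?p2 j) w + V (theta j g) w\<bar> \<le> 2 * u j + v j" if j: "j < n" for j
    proof -
      have nb: "w \<notin> bad j" "w \<in> space M" using wM j by (auto simp: A_def)
      have "U (psi j g) w < u j" "U' (psi j g) w < u j" "\<bar>V (theta j g) w\<bar> < v j"
        using nb g by (auto simp: bad_def not_le)
      moreover have "\<bar>V (?p2 j) w\<bar> \<le> U (psi j g) w + U' (psi j g) w"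
        by (rule V_le_U[OF wr bounded_by_envelopeD[OF e2] e5]) (rule b(2))
      ultimately show ?thesis by linarith
    qed
    have "\<bar>\<Sum>j<n. V (?p2 j) w + V (theta j g) w\<bar> \<le> (\<Sum>j<n. \<bar>V (?p2 j) w + V (theta j g) w\<bar>)" by (rule sum_abs)
    also have "\<dots> \<le> (\<Sum>j<n. 2 * u j + v j)" by (rule sum_mono) (use t2 in simp)
    also have "\<dots> \<le> (8 + 5 * c\<^sup>2) * \<Lambda>" by (rule levels_sum)
    finally have t3: "\<bar>\<Sum>j<n. V (?p2 j) w + V (theta j g) w\<bar> \<le> (8 + 5 * c\<^sup>2) * \<Lambda>" .
    have "\<bar>V ?p4 w\<bar> \<le> 2 * sqrt k * (sqrt k * a n)"
      by (rule V_sup_bound[OF wr b(3) bounded_by_envelopeD[OF e4]])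
    also have "\<dots> = 2 * k * a n" using kk by simp
    also have "\<dots> \<le> 2 * k * (1/2) ^ (q0 + n)"
    proof (rule mult_left_mono)
      show "a n \<le> (1/2) ^ (q0 + n)" unfolding a_def using L_ge(2)[of n] by (simp add: divide_le_eq mult_le_cancel_left1)
    qed (use k in simp)
    finally have t4: "\<bar>V ?p4 w\<bar> \<le> \<eta>" using n by simp
    show ?thesis unfolding eq using t1 t3 t4 by linarith
  qed
  show ?thesis by (rule that[OF A pA reg bound])
qed

text \<open>
  By \<open>chaining_bound\<close>, both functions may be replaced by others with the same coarsest brackets;
  hence only one pair per pair of coarsest brackets needs a tail bound.
\<close>

theorem net_bound:
  assumes \<eta>: "\<eta> > 0" and \<tau>: "\<tau> > 0" and p: "\<And>g. g \<in> \<G> \<Longrightarrow> p g \<in> \<G>"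
    and close: "\<And>g. g \<in> \<G> \<Longrightarrow> m (\<lambda>y. (g y - p g y)\<^sup>2) \<le> \<tau>\<^sup>2"
  obtains A where "A \<in> events"
    "prob A \<le> 4 * (1/2) ^ q0 + 2 * tail_mass (a 0) / (a 0 * \<eta>) + 2 * tail_mass \<tau> / (\<tau> * \<eta>)
      + 4 * (real (card (C 0)))\<^sup>2 * exp (- \<eta> / (2 * \<tau>))"
    "space M - A \<subseteq> regular"
    "\<And>w g. w \<in> space M - A \<Longrightarrow> g \<in> \<G> \<Longrightarrow> \<bar>V g w - V (p g) w\<bar> \<le> 4 * ((8 + 5 * c\<^sup>2) * \<Lambda> + 2 * \<eta>) + 2 * \<eta>"
proof -
  define b where "b = (8 + 5 * c\<^sup>2) * \<Lambda> + 2 * \<eta>"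
  obtain A0 where A0: "A0 \<in> events" "prob A0 \<le> 4 * (1/2) ^ q0 + 2 * tail_mass (a 0) / (a 0 * \<eta>)" "space M - A0 \<subseteq> regular"
    "\<And>w g. w \<in> space M - A0 \<Longrightarrow> g \<in> \<G> \<Longrightarrow> \<bar>V g w - V (rep 0 g) w\<bar> \<le> b"
    by (rule chaining_bound[OF \<eta>, folded b_def]) blast
  define pr where "pr g = (br 0 g, br 0 (p g))" for g
  define ch where "ch x = (SOME g. g \<in> \<G> \<and> pr g = x)" for x
  have ch: "ch (pr g) \<in> \<G>" "pr (ch (pr g)) = pr g" if "g \<in> \<G>" for g
  proof -
    have "\<exists>h. h \<in> \<G> \<and> pr h = pr g" using that by blast
    from someI_ex[OF this, folded ch_def] show "ch (pr g) \<in> \<G>" "pr (ch (pr g)) = pr g" by auto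
  qed
  have sub: "pr ` \<G> \<subseteq> C 0 \<times> C 0" using br(1) p by (auto simp: pr_def)
  have fin: "finite (pr ` \<G>)" by (rule finite_subset[OF sub]) (use C_finite in simp)
  have card: "card (pr ` \<G>) \<le> card (C 0) * card (C 0)"
    using card_mono[OF _ sub] C_finite by (simp add: card_cartesian_product)
  define th where "th h y = (h y - p h y) * (if 2 * G y \<le> sqrt k * \<tau> then 1 else 0)" for h y
  have thmeas [measurable]: "th h \<in> borel_measurable S" if "h \<in> \<G>" for h
    unfolding th_def[abs_def] using class_measurable[OF that] class_measurable[OF p[OF that]] by measurable
  have two: "\<bar>h y - p h y\<bar> \<le> 2 * G y" if "h \<in> \<G>" "y \<in> space S" for h y
    using class_bound[OF that] class_bound[OF p[OF that(1)] that(2)] by linarith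
  define E where "E x = {w \<in> space M. \<eta> \<le> \<bar>V (th (ch x)) w\<bar>}" for x
  have E: "E x \<in> events" "prob (E x) \<le> 4 * exp (- \<eta> / (2 * \<tau>))" if x: "x \<in> pr ` \<G>" for x
  proof -
    have h: "ch x \<in> \<G>" using x ch by auto
    show "E x \<in> events" unfolding E_def using thmeas[OF h] by measurable
    have sq: "integrable M (\<lambda>w. indicator B (X 0 w) * (4 * (G (Y 0 w))\<^sup>2))"
      using integrable_mult_right[OF G_square, of 4] by (simp add: ac_simps)
    have i: "integrable M (\<lambda>w. indicator B (X 0 w) * (ch x (Y 0 w) - p (ch x) (Y 0 w))\<^sup>2)"
    proof (rule m_mono(2)[OF _ sq])
      show "(\<lambda>y. (ch x y - p (ch x) y)\<^sup>2) \<in> borel_measurable S"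
        using class_measurable[OF h] class_measurable[OF p[OF h]] by measurable
      show "0 \<le> (ch x y - p (ch x) y)\<^sup>2 \<and> (ch x y - p (ch x) y)\<^sup>2 \<le> 4 * (G y)\<^sup>2" if "y \<in> space S" for y
        using power_mono[OF two[OF h that] abs_ge_zero, of 2] by (simp add: power_mult_distrib)
    qed
    have "m (\<lambda>y. (th (ch x) y)\<^sup>2) \<le> m (\<lambda>y. (ch x y - p (ch x) y)\<^sup>2)"
      by (rule m_mono(1)[OF borel_measurable_power[OF thmeas[OF h]] i]) (auto simp: th_def)
    also have "\<dots> \<le> \<tau>\<^sup>2" by (rule close[OF h])
    finally have mv: "m (\<lambda>y. (th (ch x) y)\<^sup>2) \<le> \<tau>\<^sup>2" .
    have "prob (E x) \<le> 2 * exp (- (1 / (2 * \<tau>)) * \<eta> + (1 / (2 * \<tau>))\<^sup>2 * \<tau>\<^sup>2)"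
      unfolding E_def
    proof (rule V_tail[OF thmeas[OF h] _ _ _ mv])
      show "\<bar>th (ch x) y\<bar> \<le> sqrt k * \<tau>" if "y \<in> space S" for y
        using two[OF h that] \<tau> k by (auto simp: th_def)
      show "0 \<le> 1 / (2 * \<tau>)" "2 * (1 / (2 * \<tau>)) * \<tau> \<le> 1" using \<tau> by auto
    qed
    also have "(1 / (2 * \<tau>))\<^sup>2 * \<tau>\<^sup>2 = 1 / 4" using \<tau> by (simp add: power2_eq_square)
    also have "- (1 / (2 * \<tau>)) * \<eta> + 1 / 4 = 1 / 4 + - \<eta> / (2 * \<tau>)" by simp
    also have "2 * exp (1 / 4 + - \<eta> / (2 * \<tau>)) = 2 * exp (1/4) * exp (- \<eta> / (2 * \<tau>))"
      by (simp only: exp_add mult.assoc)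
    also have "\<dots> \<le> 2 * 2 * exp (- \<eta> / (2 * \<tau>))"
    proof (intro mult_right_mono mult_left_mono)
      show "exp (1/4 :: real) \<le> 2" using exp_bound[of "1/4"] by (simp add: power2_eq_square)
    qed auto
    finally show "prob (E x) \<le> 4 * exp (- \<eta> / (2 * \<tau>))" by simp
  qed
  define F where "F = {w \<in> space M. \<eta> \<le> U (tail_env \<tau>) w + U' (tail_env \<tau>) w}"
  have F: "F \<in> events" "prob F \<le> 2 * tail_mass \<tau> / (\<tau> * \<eta>)"
    unfolding F_def using tail_env_prob[OF \<tau> \<eta>] by auto
  have UE: "(\<Union>x\<in>pr ` \<G>. E x) \<in> events" by (rule sets.finite_UN[OF fin E(1)])
  have "prob (\<Union>x\<in>pr ` \<G>. E x) \<le> (\<Sum>x\<in>pr ` \<G>. 4 * exp (- \<eta> / (2 * \<tau>)))"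
    by (rule order_trans[OF measure_UNION_le[OF fin E(1)] sum_mono[OF E(2)]])
  also have "\<dots> \<le> real (card (C 0) * card (C 0)) * (4 * exp (- \<eta> / (2 * \<tau>)))"
    using card by (simp add: mult_right_mono flip: of_nat_mult)
  finally have pUE: "prob (\<Union>x\<in>pr ` \<G>. E x) \<le> 4 * (real (card (C 0)))\<^sup>2 * exp (- \<eta> / (2 * \<tau>))"
    by (simp add: power2_eq_square ac_simps)
  define A where "A = A0 \<union> (F \<union> (\<Union>x\<in>pr ` \<G>. E x))"
  have A: "A \<in> events" unfolding A_def using A0(1) F(1) UE by blast
  have "prob A \<le> prob A0 + (prob F + prob (\<Union>x\<in>pr ` \<G>. E x))"
    unfolding A_def using A0(1) F(1) UE by (intro order_trans[OF measure_Un_le] add_left_mono measure_Un_le) auto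
  then have pA: "prob A \<le> 4 * (1/2) ^ q0 + 2 * tail_mass (a 0) / (a 0 * \<eta>) + 2 * tail_mass \<tau> / (\<tau> * \<eta>)
      + 4 * (real (card (C 0)))\<^sup>2 * exp (- \<eta> / (2 * \<tau>))"
    using A0(2) F(2) pUE by linarith
  have reg: "space M - A \<subseteq> regular" using A0(3) by (auto simp: A_def)
  have "\<bar>V g w - V (p g) w\<bar> \<le> 4 * b + 2 * \<eta>" if wM: "w \<in> space M - A" and g: "g \<in> \<G>" for w g
  proof -
    have wr: "w \<in> regular" and w0: "w \<in> space M - A0" using wM reg by (auto simp: A_def)
    define h where "h = ch (pr g)"
    have h: "h \<in> \<G>" "pr h = pr g" using ch[OF g] by (auto simp: h_def)
    have r: "rep 0 h = rep 0 g" "rep 0 (p h) = rep 0 (p g)"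
      using h(2) by (auto intro!: rep_cong simp: code_0_eq pr_def)
    have 1: "\<bar>V g w - V h w\<bar> \<le> 2 * b"
      using A0(4)[OF w0 g] A0(4)[OF w0 h(1)] unfolding r by linarith
    have 2: "\<bar>V (p h) w - V (p g) w\<bar> \<le> 2 * b"
      using A0(4)[OF w0 p[OF g]] A0(4)[OF w0 p[OF h(1)]] unfolding r by linarith
    let ?q = "\<lambda>y. (h y - p h y) * (if sqrt k * \<tau> < 2 * G y then 1 else 0)"
    have [measurable]: "h \<in> borel_measurable S" "p h \<in> borel_measurable S"
      using class_measurable[OF h(1)] class_measurable[OF p[OF h(1)]] by auto
    have qm: "?q \<in> borel_measurable S" by measurable
    have qle: "\<bar>?q y\<bar> \<le> tail_env \<tau> y" if "y \<in> space S" for y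
      using two[OF h(1) that] by (auto simp: tail_env_def)
    have qe: "bounded_by_envelope ?q"
      by (rule bounded_by_envelope_mono[OF tail_env_bounded[of \<tau>] qm]) (rule order_trans[OF qle abs_ge_self])
    have d: "bounded_by_envelope (\<lambda>y. h y - p h y)"
      by (rule bounded_by_envelope_add(2)[OF class_envelope[OF h(1)] class_envelope[OF p[OF h(1)]]])
    have te: "bounded_by_envelope (th h)"
      by (rule bounded_by_envelope_mono[OF d thmeas[OF h(1)]]) (auto simp: th_def)
    have eq: "(\<lambda>y. h y - p h y) = (\<lambda>y. th h y + ?q y)" by (auto simp: th_def)
    have "V h w - V (p h) w = V (\<lambda>y. h y - p h y) w"
      using V_add(2)[OF wr class_envelope[OF h(1)] class_envelope[OF p[OF h(1)]]] by simp
    also have "\<dots> = V (th h) w + V ?q w" unfolding eq by (rule V_add(1)[OF wr te qe])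
    finally have e3: "V h w - V (p h) w = V (th h) w + V ?q w" .
    have "\<bar>V ?q w\<bar> \<le> U (tail_env \<tau>) w + U' (tail_env \<tau>) w" by (rule V_le_U[OF wr qm tail_env_bounded qle])
    also have "\<dots> \<le> \<eta>" using wM by (auto simp: A_def F_def)
    finally have 3: "\<bar>V ?q w\<bar> \<le> \<eta>" .
    have 4: "\<bar>V (th h) w\<bar> \<le> \<eta>"
    proof -
      have "w \<notin> E (pr g)" "w \<in> space M" using wM g by (auto simp: A_def)
      then show ?thesis by (simp add: E_def h_def[symmetric])
    qed
    show ?thesis using 1 2 3 4 e3 by linarith
  qed
  then show ?thesis unfolding b_def by (rule that[OF A pA reg])
qed

end

context local_sample begin

text \<open>Lindeberg's expansion, conditionally on the covariates; \<open>K\<close> separates the cubic from the quadratic remainder.\<close>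

lemma char_V:
  assumes g: "g \<in> borel_measurable S" and gG: "\<And>y. y \<in> space S \<Longrightarrow> \<bar>g y\<bar> \<le> c * G y" and c: "c > 0"
    and kn: "k = real kn" and \<sigma>: "0 \<le> \<sigma>" "\<sigma> \<le> 2 * k" and e0: "0 \<le> e0" and D: "2 * D \<le> K" "0 < K"
    and cond: "\<And>i. AE w in M. X i w \<in> B \<longrightarrow>
      \<bar>(\<integral>y. (g y)\<^sup>2 \<partial>\<kappa> (X i w)) - (\<integral>y. g y \<partial>\<kappa> (X i w))\<^sup>2 - \<sigma>\<bar> \<le> e0 \<and> \<bar>\<integral>y. g y \<partial>\<kappa> (X i w)\<bar> \<le> D"
  shows "cmod ((\<integral>w. iexp (V g w) \<partial>M) - complex_of_real ((1 - \<sigma> / (2 * k)) ^ kn)) \<le>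
    2 * prob {w \<in> space M. card (sel N w) \<noteq> kn} + e0 / 2
    + K ^ 3 / (6 * sqrt k) * (card J * prob {w \<in> space M. X 0 w \<in> B} / k)
    + 4 * c\<^sup>2 * m (\<lambda>y. (G y)\<^sup>2 * (if K < 2 * c * G y then 1 else 0))"
proof -
  note [measurable] = g
  have kk: "sqrt k > 0" "sqrt k * sqrt k = k" "(sqrt k)\<^sup>2 = k" using k by auto
  have ge: "bounded_by_envelope g" unfolding bounded_by_envelope_def using g gG by auto
  define t where "t = 1 / sqrt k"
  have t: "t > 0" "t\<^sup>2 = 1 / k" using kk by (auto simp: t_def power_divide)
  define a where "a p = iexp (t * cent g (fst p) (snd p))" for p
  have am [measurable]: "a \<in> borel_measurable (borel \<Otimes>\<^sub>M S)" unfolding a_def[abs_def] by measurable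
  have ab: "norm (a (z, y)) \<le> 1" for z y by (simp add: a_def)
  define R where "R p = min (6 * (cent g (fst p) (snd p))\<^sup>2) (t * \<bar>cent g (fst p) (snd p)\<bar> ^ 3)" for p
  have Rm [measurable]: "R \<in> borel_measurable (borel \<Otimes>\<^sub>M S)" unfolding R_def[abs_def] by measurable
  have R0: "0 \<le> R p" for p using t by (auto simp: R_def)
  define \<beta> where "\<beta> = 1 - \<sigma> / (2 * k)"
  have \<beta>: "\<bar>\<beta>\<bar> \<le> 1" using \<sigma> k by (auto simp: \<beta>_def field_simps)
  define F where "F w = (\<Prod>i\<in>sel N w. kint a (X i w))" for w
  have na: "norm (kint a z) \<le> 1" for z by (rule kint_bound[OF am]) (rule ab)
  have Fm [measurable]: "F \<in> borel_measurable M"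
    unfolding F_def[abs_def] by (rule sel_measurable[OF N, where F="\<lambda>I w. \<Prod>i\<in>I. kint a (X i w)"]) measurable
  have EF: "(\<integral>w. iexp (V g w) \<partial>M) = (\<integral>w. F w \<partial>M)"
  proof -
    have "iexp (V g w) = (\<Prod>i\<in>sel N w. a (X i w, Y i w))" for w
    proof -
      have "V g w = (\<Sum>i\<in>sel N w. t * cent g (X i w) (Y i w))"
        by (simp add: V_def csum_def t_def sum_divide_distrib)
      then show ?thesis by (simp add: a_def exp_sum[OF finN] sum_distrib_left)
    qed
    then show ?thesis using cond_selection[OF N am ab] by (simp add: F_def)
  qed
  define bad where "bad = {w \<in> space M. card (sel N w) \<noteq> kn}"
  have bad [measurable]: "bad \<in> events"
  proof -
    have "(\<lambda>w. real (card (sel N w))) \<in> borel_measurable M"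
      by (rule sel_measurable[OF N, where F="\<lambda>I w. real (card I)"]) simp
    then have "{w \<in> space M. real (card (sel N w)) \<noteq> real kn} \<in> events" by measurable
    then show ?thesis by (simp add: bad_def)
  qed
  have point: "cmod (kint a z - complex_of_real \<beta>) \<le> kint R z / (6 * k) + e0 / (2 * k)"
    if z: "integrable (\<kappa> z) (\<lambda>y. (G y)\<^sup>2)" "integrable (\<kappa> z) g"
      "\<bar>(\<integral>y. (g y)\<^sup>2 \<partial>\<kappa> z) - (\<integral>y. g y \<partial>\<kappa> z)\<^sup>2 - \<sigma>\<bar> \<le> e0" for z
  proof -
    interpret K: prob_space "\<kappa> z" by (rule kernel_prob)
    have gK [measurable]: "g \<in> borel_measurable (\<kappa> z)" by (simp add: kernel_measurable_iff)
    have i2: "integrable (\<kappa> z) (\<lambda>y. (g y)\<^sup>2)"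
    proof (rule Bochner_Integration.integrable_bound[OF integrable_mult_right[OF z(1), of "c\<^sup>2"]])
      show "AE y in \<kappa> z. norm ((g y)\<^sup>2) \<le> norm (c\<^sup>2 * (G y)\<^sup>2)"
        using power_mono[OF gG abs_ge_zero, of _ 2] by (intro AE_I2) (simp add: power_mult_distrib)
    qed measurable
    let ?m = "\<integral>y. g y \<partial>\<kappa> z" and ?v = "(\<integral>y. (g y)\<^sup>2 \<partial>\<kappa> z) - (\<integral>y. g y \<partial>\<kappa> z)\<^sup>2"
    have c1: "integrable (\<kappa> z) (cent g z)" unfolding cent_def[abs_def] using z(2) by simp
    have c2: "integrable (\<kappa> z) (\<lambda>y. (cent g z y)\<^sup>2)" unfolding cent_def power2_diff using z(2) i2 by auto
    have c0: "K.expectation (cent g z) = 0" unfolding cent_def[abs_def] using z(2) K.prob_space by simp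
    have cm: "cent g z \<in> borel_measurable (\<kappa> z)" using c1 by simp
    have var: "K.variance (cent g z) = ?v"
      using K.variance_eq[OF z(2) i2] c0 by (simp add: cent_def)
    have "cmod (char (distr (\<kappa> z) borel (cent g z)) t - (1 - t\<^sup>2 * ?v / 2)) \<le>
        (t\<^sup>2 / 6) * K.expectation (\<lambda>y. min (6 * (cent g z y)\<^sup>2) (\<bar>t\<bar> * \<bar>cent g z y\<bar> ^ 3))"
      by (rule K.char_approx3'[OF cm c1 c2 c0 var refl])
    also have "char (distr (\<kappa> z) borel (cent g z)) t = kint a z"
      unfolding char_def kint_def a_def by (subst integral_distr[OF cm]) auto
    also have "K.expectation (\<lambda>y. min (6 * (cent g z y)\<^sup>2) (\<bar>t\<bar> * \<bar>cent g z y\<bar> ^ 3)) = kint R z"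
      using t by (simp add: kint_def R_def)
    finally have 1: "cmod (kint a z - complex_of_real (1 - ?v / (2 * k))) \<le> kint R z / (6 * k)"
      unfolding t(2) by (simp add: mult.commute)
    have "cmod (complex_of_real (1 - ?v / (2 * k)) - complex_of_real \<beta>) = \<bar>(1 - ?v / (2 * k)) - \<beta>\<bar>"
      by (simp only: of_real_diff[symmetric] norm_of_real)
    also have "(1 - ?v / (2 * k)) - \<beta> = - ((?v - \<sigma>) / (2 * k))" by (simp add: \<beta>_def diff_divide_distrib)
    also have "\<bar>- ((?v - \<sigma>) / (2 * k))\<bar> = \<bar>?v - \<sigma>\<bar> / (2 * k)" using k by simp
    also have "\<dots> \<le> e0 / (2 * k)" using z(3) k by (intro divide_right_mono) auto
    finally show ?thesis
      using 1 norm_triangle_ineq[of "kint a z - complex_of_real (1 - ?v / (2 * k))" "complex_of_real (1 - ?v / (2 * k)) - complex_of_real \<beta>"]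
      by simp
  qed
  have kR0: "0 \<le> kint R z" for z unfolding kint_def by (rule integral_nonneg_AE) (use R0 in auto)
  have Fb: "cmod (F w - complex_of_real (\<beta> ^ kn)) \<le> 2" for w
  proof -
    have "cmod (F w) \<le> 1" unfolding F_def prod_norm[symmetric] using na by (intro prod_le_1) auto
    moreover have "\<bar>\<beta>\<bar> ^ kn \<le> 1" using \<beta> by (intro power_le_one) auto
    ultimately show ?thesis
      using norm_triangle_ineq4[of "F w" "complex_of_real (\<beta> ^ kn)"] by (simp add: norm_power)
  qed
  let ?T = "\<lambda>w. 2 * indicator bad w + e0 / 2 + (\<Sum>i\<in>J. indicator B (X i w) * (kint R (X i w) / (6 * k)))"
  have AEc: "AE w in M. \<forall>i\<in>J. X i w \<in> B \<longrightarrow>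
      \<bar>(\<integral>y. (g y)\<^sup>2 \<partial>\<kappa> (X i w)) - (\<integral>y. g y \<partial>\<kappa> (X i w))\<^sup>2 - \<sigma>\<bar> \<le> e0 \<and> \<bar>\<integral>y. g y \<partial>\<kappa> (X i w)\<bar> \<le> D"
    using cond by (intro AE_finite_allI finJ) auto
  have AEF: "AE w in M. cmod (F w - complex_of_real (\<beta> ^ kn)) \<le> ?T w"
    using AE_regular AEc AE_space
  proof eventually_elim
    case (elim w)
    have s0: "0 \<le> (\<Sum>i\<in>J. indicator B (X i w) * (kint R (X i w) / (6 * k)))"
      using kR0 k by (intro sum_nonneg mult_nonneg_nonneg) auto
    show ?case
    proof (cases "w \<in> bad")
      case True
      then have "indicator bad w = (1 :: real)" by simp
      then show ?thesis using Fb[of w] s0 e0 by linarith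
    next
      case False
      then have ck: "card (sel N w) = kn" using elim by (auto simp: bad_def)
      have iB: "i \<in> J" "X i w \<in> B" if "i \<in> sel N w" for i
        using that spec[OF NB, of "\<lambda>j. X j w"] N_sub[of "\<lambda>j. X j w"] by auto
      have "cmod (F w - complex_of_real (\<beta> ^ kn)) = cmod ((\<Prod>i\<in>sel N w. kint a (X i w)) - (\<Prod>i\<in>sel N w. complex_of_real \<beta>))"
        by (simp add: F_def ck)
      also have "\<dots> \<le> (\<Sum>i\<in>sel N w. cmod (kint a (X i w) - complex_of_real \<beta>))"
        by (rule norm_prod_diff) (use na \<beta> in auto)
      also have "\<dots> \<le> (\<Sum>i\<in>sel N w. indicator B (X i w) * (kint R (X i w) / (6 * k)) + e0 / (2 * k))"
      proof (rule sum_mono)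
        fix i assume i: "i \<in> sel N w"
        have "integrable (\<kappa> (X i w)) (\<lambda>y. (G y)\<^sup>2)" using elim(1) iB[OF i] by (auto simp: regular_def)
        moreover have "integrable (\<kappa> (X i w)) g" by (rule kernel_integrable[OF elim(1) iB[OF i] ge])
        ultimately show "cmod (kint a (X i w) - complex_of_real \<beta>) \<le> indicator B (X i w) * (kint R (X i w) / (6 * k)) + e0 / (2 * k)"
          using point[of "X i w"] elim(2) iB[OF i] by simp
      qed
      also have "\<dots> = (\<Sum>i\<in>sel N w. indicator B (X i w) * (kint R (X i w) / (6 * k))) + k * (e0 / (2 * k))"
        by (simp add: sum.distrib ck kn)
      also have "\<dots> \<le> (\<Sum>i\<in>J. indicator B (X i w) * (kint R (X i w) / (6 * k))) + e0 / 2"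
      proof (rule add_mono)
        show "(\<Sum>i\<in>sel N w. indicator B (X i w) * (kint R (X i w) / (6 * k))) \<le> (\<Sum>i\<in>J. indicator B (X i w) * (kint R (X i w) / (6 * k)))"
          by (rule sum_mono2[OF finJ N_sub]) (use kR0 k in auto)
      qed (use k in simp)
      finally show ?thesis using False by simp
    qed
  qed
  let ?p = "prob {w \<in> space M. X 0 w \<in> B}"
  let ?tl = "\<lambda>y. (G y)\<^sup>2 * (if K < 2 * c * G y then 1 else 0) :: real"
  have tl_int: "integrable M (\<lambda>w. indicator B (X 0 w) * ?tl (Y 0 w))"
    by (rule m_mono(2)[OF _ G_square]) auto
  define W where "W w = indicator B (X 0 w) * (t * K ^ 3 + 24 * c\<^sup>2 * ?tl (Y 0 w))" for w
  have iB: "integrable M (\<lambda>w. indicator B (X 0 w) :: real)"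
    by (rule integrable_const_bound[where B=1]) auto
  have W_eq: "W w = t * K ^ 3 * indicator B (X 0 w) + 24 * c\<^sup>2 * (indicator B (X 0 w) * ?tl (Y 0 w))" for w
    by (simp add: W_def algebra_simps)
  have W_int: "integrable M W" unfolding W_eq[abs_def] using tl_int iB by simp
  have pB: "(\<integral>w. indicator B (X 0 w) \<partial>M) = ?p"
  proof -
    have "(\<integral>w. indicator B (X 0 w) \<partial>M) = (\<integral>w. indicator {w \<in> space M. X 0 w \<in> B} w \<partial>M :: real)"
      by (rule Bochner_Integration.integral_cong) (auto simp: indicator_def)
    then show ?thesis by simp
  qed
  have EW: "(\<integral>w. W w \<partial>M) = t * K ^ 3 * ?p + 24 * c\<^sup>2 * (\<integral>w. indicator B (X 0 w) * ?tl (Y 0 w) \<partial>M)"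
    unfolding W_eq using tl_int iB by (simp add: pB)
  have W0: "0 \<le> W w" for w using t D by (auto simp: W_def)
  have nnR: "(\<integral>\<^sup>+w. ennreal (indicator B (X i w) * kint R (X i w)) \<partial>M) \<le> ennreal (\<integral>w. W w \<partial>M)" for i
  proof -
    have "(\<integral>\<^sup>+w. ennreal (indicator B (X i w) * kint R (X i w)) \<partial>M) = (\<integral>\<^sup>+w. ennreal (indicator B (X 0 w) * kint R (X 0 w)) \<partial>M)"
      by (rule nn_integral_X_ident[of "\<lambda>z. ennreal (indicator B z * kint R z)"]) measurable
    also have "\<dots> \<le> (\<integral>\<^sup>+w. (\<integral>\<^sup>+y. ennreal (indicator B (X 0 w) * R (X 0 w, y)) \<partial>\<kappa> (X 0 w)) \<partial>M)"
    proof (rule nn_integral_mono)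
      fix w
      show "ennreal (indicator B (X 0 w) * kint R (X 0 w)) \<le> (\<integral>\<^sup>+y. ennreal (indicator B (X 0 w) * R (X 0 w, y)) \<partial>\<kappa> (X 0 w))"
      proof (cases "X 0 w \<in> B")
        case True
        show ?thesis
        proof (cases "integrable (\<kappa> (X 0 w)) (\<lambda>y. R (X 0 w, y))")
          case True
          then show ?thesis using \<open>X 0 w \<in> B\<close> R0 by (subst nn_integral_eq_integral) (auto simp: kint_def)
        qed (simp add: not_integrable_integral_eq kint_def)
      qed simp
    qed
    also have "\<dots> = (\<integral>\<^sup>+w. ennreal (indicator B (X 0 w) * R (X 0 w, Y 0 w)) \<partial>M)"
      using nn_disint[of "\<lambda>p. ennreal (indicator B (fst p) * R p)" 0] by simp
    also have "\<dots> \<le> (\<integral>\<^sup>+w. ennreal (W w) \<partial>M)"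
    proof (rule nn_integral_mono_AE)
      show "AE w in M. ennreal (indicator B (X 0 w) * R (X 0 w, Y 0 w)) \<le> ennreal (W w)"
        using cond[of 0] AE_space
      proof eventually_elim
        case (elim w)
        show ?case
        proof (cases "X 0 w \<in> B")
          case True
          let ?y = "Y 0 w" and ?x = "cent g (X 0 w) (Y 0 w)"
          have y: "?y \<in> space S" by (rule Y_space[OF elim(2)])
          have xb: "\<bar>?x\<bar> \<le> c * G ?y + D"
            unfolding cent_def using gG[OF y] elim(1) True by linarith
          have G0: "0 \<le> c * G ?y" using G_nonneg[OF y] c by simp
          have "R (X 0 w, ?y) \<le> t * K ^ 3 + 24 * c\<^sup>2 * ?tl ?y"
          proof (cases "\<bar>?x\<bar> \<le> K")
            case True
            have "R (X 0 w, ?y) \<le> t * \<bar>?x\<bar> ^ 3" by (simp add: R_def)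
            also have "\<dots> \<le> t * K ^ 3" using True t by (intro mult_left_mono power_mono) auto
            finally show ?thesis by (simp add: add_increasing2)
          next
            case False
            then have l: "K < 2 * c * G ?y" "\<bar>?x\<bar> \<le> 2 * (c * G ?y)" using xb D by linarith+
            have "R (X 0 w, ?y) \<le> 6 * ?x\<^sup>2" by (simp add: R_def)
            also have "\<dots> \<le> 6 * (2 * (c * G ?y))\<^sup>2"
              using power_mono[OF l(2) abs_ge_zero, of 2] by simp
            also have "\<dots> = 24 * c\<^sup>2 * ?tl ?y" using l(1) by (simp add: power_mult_distrib)
            also have "\<dots> \<le> t * K ^ 3 + 24 * c\<^sup>2 * ?tl ?y" using t D by simp
            finally show ?thesis .
          qed
          then show ?thesis using True by (auto simp: W_def intro!: ennreal_leI)
        qed simp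
      qed
    qed
    also have "\<dots> = ennreal (\<integral>w. W w \<partial>M)" by (rule nn_integral_eq_integral[OF W_int]) (use W0 in auto)
    finally show ?thesis .
  qed
  have EW0: "0 \<le> (\<integral>w. W w \<partial>M)" by (rule integral_nonneg_AE) (use W0 in auto)
  have k6: "0 \<le> 1 / (6 * k)" using k by simp
  have nnT: "(\<integral>\<^sup>+w. ennreal (?T w) \<partial>M) \<le> ennreal (2 * prob bad + e0 / 2 + card J * ((\<integral>w. W w \<partial>M) / (6 * k)))"
  proof -
    have "(\<integral>\<^sup>+w. ennreal (?T w) \<partial>M) = (\<integral>\<^sup>+w. ennreal (2 * indicator bad w) + ennreal (e0 / 2) +
        (\<Sum>i\<in>J. ennreal (1 / (6 * k)) * ennreal (indicator B (X i w) * kint R (X i w))) \<partial>M)"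
    proof (rule nn_integral_cong)
      fix w
      have "ennreal (\<Sum>i\<in>J. indicator B (X i w) * (kint R (X i w) / (6 * k))) =
          (\<Sum>i\<in>J. ennreal (1 / (6 * k)) * ennreal (indicator B (X i w) * kint R (X i w)))"
        using kR0 k k6 by (subst sum_ennreal[symmetric]) (auto simp: ennreal_mult[symmetric] intro!: sum.cong)
      moreover have "0 \<le> (\<Sum>i\<in>J. indicator B (X i w) * (kint R (X i w) / (6 * k)))"
        using kR0 k by (intro sum_nonneg) auto
      ultimately show "ennreal (?T w) = ennreal (2 * indicator bad w) + ennreal (e0 / 2) +
        (\<Sum>i\<in>J. ennreal (1 / (6 * k)) * ennreal (indicator B (X i w) * kint R (X i w)))"
        using e0 by (simp add: ennreal_plus)
    qed
    also have "\<dots> = (\<integral>\<^sup>+w. ennreal (2 * indicator bad w) \<partial>M) + ennreal (e0 / 2) +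
        (\<Sum>i\<in>J. ennreal (1 / (6 * k)) * (\<integral>\<^sup>+w. ennreal (indicator B (X i w) * kint R (X i w)) \<partial>M))"
      by (simp add: nn_integral_add nn_integral_sum nn_integral_cmult emeasure_space_1)
    also have "(\<integral>\<^sup>+w. ennreal (2 * indicator bad w) \<partial>M) = ennreal (2 * prob bad)"
      using bad by (simp add: ennreal_mult' nn_integral_cmult ennreal_indicator emeasure_eq_measure ennreal_mult)
    also have "ennreal (2 * prob bad) + ennreal (e0 / 2) +
        (\<Sum>i\<in>J. ennreal (1 / (6 * k)) * (\<integral>\<^sup>+w. ennreal (indicator B (X i w) * kint R (X i w)) \<partial>M)) \<le>
        ennreal (2 * prob bad) + ennreal (e0 / 2) + (\<Sum>i\<in>J. ennreal (1 / (6 * k)) * ennreal (\<integral>w. W w \<partial>M))"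
      by (intro add_left_mono sum_mono mult_left_mono nnR) auto
    also have "(\<Sum>i\<in>J. ennreal (1 / (6 * k)) * ennreal (\<integral>w. W w \<partial>M)) = ennreal (card J * ((\<integral>w. W w \<partial>M) / (6 * k)))"
      using EW0 k k6 by (simp add: ennreal_mult[symmetric] ennreal_of_nat_eq_real_of_nat)
    also have "ennreal (2 * prob bad) + ennreal (e0 / 2) + ennreal (card J * ((\<integral>w. W w \<partial>M) / (6 * k))) =
        ennreal (2 * prob bad + e0 / 2 + card J * ((\<integral>w. W w \<partial>M) / (6 * k)))"
      using EW0 k e0 by (simp add: ennreal_plus)
    finally show ?thesis .
  qed
  have Fint: "integrable M (\<lambda>w. F w - complex_of_real (\<beta> ^ kn))"
    by (rule integrable_const_bound[where B=2]) (use Fb in auto)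
  have "ennreal (cmod (\<integral>w. F w - complex_of_real (\<beta> ^ kn) \<partial>M)) \<le> (\<integral>\<^sup>+w. ennreal (cmod (F w - complex_of_real (\<beta> ^ kn))) \<partial>M)"
    by (rule integral_norm_bound_ennreal[OF Fint])
  also have "\<dots> \<le> (\<integral>\<^sup>+w. ennreal (?T w) \<partial>M)"
    by (rule nn_integral_mono_AE) (use AEF in \<open>eventually_elim, auto intro: ennreal_leI\<close>)
  also note nnT
  finally have fin: "cmod (\<integral>w. F w - complex_of_real (\<beta> ^ kn) \<partial>M) \<le> 2 * prob bad + e0 / 2 + card J * ((\<integral>w. W w \<partial>M) / (6 * k))"
    using e0 EW0 k by (subst (asm) ennreal_le_iff) auto
  have "integrable M F"
  proof (rule integrable_const_bound[where B=1])
    show "AE w in M. norm (F w) \<le> 1"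
      unfolding F_def prod_norm[symmetric] using na by (intro AE_I2 prod_le_1) auto
  qed simp
  then have "(\<integral>w. F w - complex_of_real (\<beta> ^ kn) \<partial>M) = (\<integral>w. F w \<partial>M) - complex_of_real (\<beta> ^ kn)"
    by (simp add: prob_space)
  moreover have "card J * ((\<integral>w. W w \<partial>M) / (6 * k)) = K ^ 3 / (6 * sqrt k) * (card J * ?p / k) + 4 * c\<^sup>2 * m ?tl"
    unfolding EW using k kk(1) by (simp add: m_def t_def field_simps)
  ultimately show ?thesis
    using fin unfolding EF bad_def[symmetric] \<beta>_def[symmetric] by simp
qed

end

subsection \<open>Nearest neighbours\<close>

lemma nn_before_trans: "nn_before x X i j \<Longrightarrow> nn_before x X j l \<Longrightarrow> nn_before x X i l"
  by (auto simp: nn_before_def)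

lemma nn_before_irrefl: "\<not> nn_before x X i i"
  by (simp add: nn_before_def)

lemma nn_before_total: "i \<noteq> j \<Longrightarrow> nn_before x X i j \<or> nn_before x X j i"
  by (auto simp: nn_before_def)

definition nn_rank :: "(nat \<Rightarrow> 'a::metric_space) \<Rightarrow> nat \<Rightarrow> 'a \<Rightarrow> nat \<Rightarrow> nat" where
  "nn_rank X n x i = card {j \<in> {1..n}. nn_before x X j i}"

lemma nn_rank_less:
  assumes "i \<in> {1..n}" "nn_before x X i j"
  shows "nn_rank X n x i < nn_rank X n x j"
  unfolding nn_rank_def
proof (rule psubset_card_mono)
  have "i \<notin> {l \<in> {1..n}. nn_before x X l i}" "i \<in> {l \<in> {1..n}. nn_before x X l j}"
    using assms by (auto simp: nn_before_irrefl)
  moreover have "{l \<in> {1..n}. nn_before x X l i} \<subseteq> {l \<in> {1..n}. nn_before x X l j}"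
    using assms(2) nn_before_trans by blast
  ultimately show "{l \<in> {1..n}. nn_before x X l i} \<subset> {l \<in> {1..n}. nn_before x X l j}" by blast
qed simp

lemma nn_rank_bij: "bij_betw (nn_rank X n x) {1..n} {..<n}"
proof -
  have inj: "inj_on (nn_rank X n x) {1..n}"
  proof (rule inj_onI)
    fix i j assume ij: "i \<in> {1..n}" "j \<in> {1..n}" "nn_rank X n x i = nn_rank X n x j"
    show "i = j"
      using nn_before_total[of i j x X] nn_rank_less[of i n x X j] nn_rank_less[of j n x X i] ij by fastforce
  qed
  have "nn_rank X n x i < n" if "i \<in> {1..n}" for i
  proof -
    have "{j \<in> {1..n}. nn_before x X j i} \<subset> {1..n}" using that nn_before_irrefl by blast
    then have "card {j \<in> {1..n}. nn_before x X j i} < card {1..n}" by (rule psubset_card_mono[OF finite_atLeastAtMost])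
    then show ?thesis by (simp add: nn_rank_def)
  qed
  then have "nn_rank X n x ` {1..n} \<subseteq> {..<n}" by auto
  moreover have "card (nn_rank X n x ` {1..n}) = card {..<n}" using card_image[OF inj] by simp
  ultimately have "nn_rank X n x ` {1..n} = {..<n}" by (intro card_subset_eq) auto
  then show ?thesis using inj by (simp add: bij_betw_def)
qed

lemma card_nn_set:
  assumes "k \<le> n"
  shows "card (nn_set X n k x) = k"
proof -
  have eq: "nn_rank X n x ` nn_set X n k x = {..<k}"
  proof
    show "nn_rank X n x ` nn_set X n k x \<subseteq> {..<k}" by (auto simp: nn_set_def nn_rank_def)
    show "{..<k} \<subseteq> nn_rank X n x ` nn_set X n k x"
    proof
      fix l assume l: "l \<in> {..<k}"
      then have "l \<in> nn_rank X n x ` {1..n}" using nn_rank_bij[of X n x] assms by (auto simp: bij_betw_def)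
      then show "l \<in> nn_rank X n x ` nn_set X n k x" using l by (auto simp: nn_set_def nn_rank_def)
    qed
  qed
  have "inj_on (nn_rank X n x) (nn_set X n k x)"
    using nn_rank_bij[of X n x] by (auto simp: bij_betw_def nn_set_def intro: inj_on_subset)
  from card_image[OF this] show ?thesis unfolding eq by simp
qed

lemma nn_set_subset_ball:
  assumes "k \<le> card {i \<in> {1..n}. X i \<in> cball x r}" "i \<in> nn_set X n k x"
  shows "X i \<in> cball x r"
proof (rule ccontr)
  assume no: "X i \<notin> cball x r"
  have "{j \<in> {1..n}. X j \<in> cball x r} \<subseteq> {j \<in> {1..n}. nn_before x X j i}"
    using no by (auto simp: nn_before_def)
  then have "card {j \<in> {1..n}. X j \<in> cball x r} \<le> card {j \<in> {1..n}. nn_before x X j i}"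
    by (intro card_mono) auto
  then show False using assms by (auto simp: nn_set_def)
qed

lemma nn_set_restrict: "nn_set (restrict X {1..n}) n k x = nn_set X n k x"
proof -
  have "{j \<in> {1..n}. nn_before x (restrict X {1..n}) j i} = {j \<in> {1..n}. nn_before x X j i}" if "i \<in> {1..n}" for i
    using that by (auto simp: nn_before_def)
  then show ?thesis unfolding nn_set_def by (intro Collect_cong conj_cong refl) simp
qed

lemma (in regression_sample) selection_nn:
  fixes x :: 'a
  assumes n: "n \<ge> 1" and B [measurable]: "B \<in> sets borel"
  shows "selection {1..n} (\<lambda>X. nn_set X n k x \<inter> {i. X i \<in> B})"
  unfolding selection_def
proof (intro conjI allI)
  show "nn_set X n k x \<inter> {i. X i \<in> B} \<subseteq> {1..n}" for X by (auto simp: nn_set_def)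
  show "nn_set (restrict X {1..n}) n k x \<inter> {i. restrict X {1..n} i \<in> B} = nn_set X n k x \<inter> {i. X i \<in> B}" for X
    unfolding nn_set_restrict by (auto simp: nn_set_def)
  let ?P = "\<Pi>\<^sub>M j\<in>{1..n}. borel :: 'a measure"
  have comp: "(\<lambda>X. X j) \<in> borel_measurable ?P" if "j \<in> {1..n}" for j
    using that by (rule measurable_component_singleton)
  have before: "{X \<in> space ?P. nn_before x X j i} \<in> sets ?P" if "i \<in> {1..n}" "j \<in> {1..n}" for i j
  proof -
    have di: "(\<lambda>X. dist x (X i)) \<in> borel_measurable ?P" if "i \<in> {1..n}" for i
      by (rule borel_measurable_dist[OF measurable_const comp[OF that]]) simp
    show ?thesis
      using borel_measurable_less[OF di[OF that(2)] di[OF that(1)]] borel_measurable_le[OF di[OF that(2)] di[OF that(1)]]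
      by (cases "j < i") (simp_all add: nn_before_def le_less)
  qed
  have rank: "{X \<in> space ?P. card {j \<in> {1..n}. nn_before x X j i} < k} \<in> sets ?P" if i: "i \<in> {1..n}" for i
  proof -
    have c: "real (card {j \<in> {1..n}. nn_before x X j i}) = (\<Sum>j\<in>{1..n}. indicator {X \<in> space ?P. nn_before x X j i} X)"
      if "X \<in> space ?P" for X
    proof -
      have "(\<Sum>j\<in>{1..n}. indicator {X \<in> space ?P. nn_before x X j i} X) = (\<Sum>j\<in>{1..n}. if nn_before x X j i then 1 else 0 :: real)"
        using that by (intro sum.cong) (auto simp: indicator_def)
      also have "\<dots> = real (card {j \<in> {1..n}. nn_before x X j i})"
        by (simp add: sum.If_cases Int_def)
      finally show ?thesis by simp
    qed
    have m: "(\<lambda>X. \<Sum>j\<in>{1..n}. indicator {X \<in> space ?P. nn_before x X j i} X :: real) \<in> borel_measurable ?P"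
      using before[OF i] by (intro borel_measurable_sum borel_measurable_indicator) auto
    have "{X \<in> space ?P. card {j \<in> {1..n}. nn_before x X j i} < k} =
      {X \<in> space ?P. (\<Sum>j\<in>{1..n}. indicator {X \<in> space ?P. nn_before x X j i} X) < real k}"
    proof (intro Collect_cong conj_cong refl)
      fix X assume "X \<in> space ?P"
      from c[OF this] show "(card {j \<in> {1..n}. nn_before x X j i} < k) =
        ((\<Sum>j\<in>{1..n}. indicator {X \<in> space ?P. nn_before x X j i} X) < real k)"
        by (simp only: of_nat_less_iff[symmetric, where 'a=real])
    qed
    also have "\<dots> \<in> sets ?P" using m by measurable
    finally show ?thesis .
  qed
  fix I
  show "{X \<in> space ?P. nn_set X n k x \<inter> {i. X i \<in> B} = I} \<in> sets ?P"
  proof (cases "I \<subseteq> {1..n}")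
    case False
    then have "{X \<in> space ?P. nn_set X n k x \<inter> {i. X i \<in> B} = I} = {}" by (auto simp: nn_set_def)
    then show ?thesis by (simp only: sets.empty_sets)
  next
    case True
    have "{X \<in> space ?P. nn_set X n k x \<inter> {i. X i \<in> B} = I} =
      {X \<in> space ?P. \<forall>i\<in>{1..n}. (card {j \<in> {1..n}. nn_before x X j i} < k \<and> X i \<in> B) \<longleftrightarrow> i \<in> I}"
      using True by (auto simp: nn_set_def)
    also have "\<dots> \<in> sets ?P"
    proof (rule sets.sets_Collect_finite_All)
      fix i assume i: "i \<in> {1..n}"
      have [measurable]: "{X \<in> space ?P. card {j \<in> {1..n}. nn_before x X j i} < k} \<in> sets ?P" by (rule rank[OF i])
      have [measurable]: "{X \<in> space ?P. X i \<in> B} \<in> sets ?P"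
        using measurable_sets[OF comp[OF i] B] by (simp add: vimage_def Int_def conj_commute)
      show "{X \<in> space ?P. (card {j \<in> {1..n}. nn_before x X j i} < k \<and> X i \<in> B) = (i \<in> I)} \<in> sets ?P"
        by measurable
    qed simp
    finally show ?thesis .
  qed
qed (use n in auto)

lemma regular_cond_dist_kernel:
  fixes X :: "'w \<Rightarrow> 'a::euclidean_space"
  assumes M: "prob_space M" and X [measurable]: "X \<in> borel_measurable M" and Y [measurable]: "Y \<in> measurable M S"
    and dens: "distributed M lborel X (\<lambda>z. ennreal (f z))" and cond: "regular_cond_dist M S X Y f \<mu>"
  obtains N0 \<kappa> where "N0 \<in> sets borel" "AE w in M. X w \<notin> N0" "\<kappa> \<in> measurable borel (prob_algebra S)"
    "\<And>z. z \<notin> N0 \<Longrightarrow> \<kappa> z = \<mu> z"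
    "\<And>A B. A \<in> sets S \<Longrightarrow> B \<in> sets borel \<Longrightarrow> emeasure M {w \<in> space M. X w \<in> B \<and> Y w \<in> A} =
      (\<integral>\<^sup>+w. emeasure (\<kappa> (X w)) A * indicator B (X w) \<partial>M)"
proof -
  interpret prob_space M by fact
  have AEg: "AE z in distr M borel X. prob_space (\<mu> z) \<and> sets (\<mu> z) = sets S"
    using cond by (simp add: regular_cond_dist_def)
  then obtain N0 where N0: "{z \<in> space (distr M borel X). \<not> (prob_space (\<mu> z) \<and> sets (\<mu> z) = sets S)} \<subseteq> N0"
    "emeasure (distr M borel X) N0 = 0" "N0 \<in> sets (distr M borel X)" by (rule AE_E)
  have N0b: "N0 \<in> sets borel" using N0(3) by simp
  have good: "prob_space (\<mu> z)" "sets (\<mu> z) = sets S" if "z \<notin> N0" for z using N0(1) that by auto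
  have AEN: "AE w in M. X w \<notin> N0"
  proof (rule AE_I)
    show "{w \<in> space M. \<not> X w \<notin> N0} \<subseteq> X -` N0 \<inter> space M" by auto
    show "emeasure M (X -` N0 \<inter> space M) = 0" using N0(2) N0b by (simp add: emeasure_distr)
    show "X -` N0 \<inter> space M \<in> sets M" using N0b by measurable
  qed
  define \<kappa> where "\<kappa> z = (if z \<in> N0 then distr M S Y else \<mu> z)" for z
  have pk: "prob_space (\<kappa> z)" "sets (\<kappa> z) = sets S" for z
    using good[of z] prob_space_distr[OF Y] by (auto simp: \<kappa>_def)
  have meas\<mu> [measurable]: "(\<lambda>z. emeasure (\<mu> z) A) \<in> borel_measurable borel" if "A \<in> sets S" for A
    using cond that by (simp add: regular_cond_dist_def)
  have "\<kappa> \<in> measurable borel (subprob_algebra S)"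
  proof (rule measurable_subprob_algebra)
    show "subprob_space (\<kappa> z)" for z by (rule prob_space_imp_subprob_space[OF pk(1)])
    show "sets (\<kappa> z) = sets S" for z by (rule pk(2))
    fix A assume A: "A \<in> sets S"
    have "emeasure (\<kappa> z) A = (if z \<in> N0 then emeasure (distr M S Y) A else emeasure (\<mu> z) A)" for z
      by (simp add: \<kappa>_def)
    then show "(\<lambda>z. emeasure (\<kappa> z) A) \<in> borel_measurable borel"
      using meas\<mu>[OF A] N0b by simp
  qed
  then have \<kappa>: "\<kappa> \<in> measurable borel (prob_algebra S)"
    by (intro measurable_prob_algebraI pk(1))
  have dis: "emeasure M {w \<in> space M. X w \<in> B \<and> Y w \<in> A} =
      (\<integral>\<^sup>+w. emeasure (\<kappa> (X w)) A * indicator B (X w) \<partial>M)"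
    if A: "A \<in> sets S" and B: "B \<in> sets borel" for A B
  proof -
    have "{w \<in> space M. X w \<in> B \<and> Y w \<in> A} = {w \<in> space M. Y w \<in> A \<and> X w \<in> B}" by auto
    then have "emeasure M {w \<in> space M. X w \<in> B \<and> Y w \<in> A} =
        (\<integral>\<^sup>+z. emeasure (\<mu> z) A * ennreal (f z) * indicator B z \<partial>lborel)"
      using cond A B by (simp add: regular_cond_dist_def)
    also have "\<dots> = (\<integral>\<^sup>+z. ennreal (f z) * (emeasure (\<mu> z) A * indicator B z) \<partial>lborel)"
      by (simp add: ac_simps)
    also have "\<dots> = (\<integral>\<^sup>+w. emeasure (\<mu> (X w)) A * indicator B (X w) \<partial>M)"
      using meas\<mu>[OF A] B by (intro distributed_nn_integral[OF dens]) auto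
    also have "\<dots> = (\<integral>\<^sup>+w. emeasure (\<kappa> (X w)) A * indicator B (X w) \<partial>M)"
      by (rule nn_integral_cong_AE) (use AEN in \<open>eventually_elim, simp add: \<kappa>_def\<close>)
    finally show ?thesis .
  qed
  show ?thesis by (rule that[OF N0b AEN \<kappa> _ dis]) (simp add: \<kappa>_def)
qed

context regression_sample begin

definition localized :: "'a set \<Rightarrow> 's measure" where
  "localized B = distr (density M (\<lambda>w. ennreal (indicator B (X 0 w) / prob {w \<in> space M. X 0 w \<in> B}))) S (Y 0)"

lemma sets_localized [simp]: "sets (localized B) = sets S"
  by (simp add: localized_def)

lemma space_localized [simp]: "space (localized B) = space S"
  by (simp add: localized_def)

lemma nn_integral_localized:
  assumes B [measurable]: "B \<in> sets borel" and [measurable]: "\<phi> \<in> borel_measurable S"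
  shows "(\<integral>\<^sup>+y. \<phi> y \<partial>localized B) =
    (\<integral>\<^sup>+w. ennreal (indicator B (X 0 w) / prob {w \<in> space M. X 0 w \<in> B}) * \<phi> (Y 0 w) \<partial>M)"
  unfolding localized_def by (subst nn_integral_distr) (auto simp: nn_integral_density)

lemma integral_localized:
  fixes \<phi> :: "'s \<Rightarrow> real"
  assumes B [measurable]: "B \<in> sets borel" and [measurable]: "\<phi> \<in> borel_measurable S"
    and p: "0 < prob {w \<in> space M. X 0 w \<in> B}"
  shows "integrable (localized B) \<phi> \<longleftrightarrow> integrable M (\<lambda>w. indicator B (X 0 w) * \<phi> (Y 0 w))"
    "(\<integral>y. \<phi> y \<partial>localized B) = (\<integral>w. indicator B (X 0 w) * \<phi> (Y 0 w) \<partial>M) / prob {w \<in> space M. X 0 w \<in> B}"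
proof -
  let ?p = "prob {w \<in> space M. X 0 w \<in> B}"
  let ?D = "density M (\<lambda>w. ennreal (indicator B (X 0 w) / ?p))"
  have Ym: "Y 0 \<in> measurable ?D S" by simp
  have eq: "indicator B (X 0 w) / ?p * \<phi> (Y 0 w) = (1 / ?p) * (indicator B (X 0 w) * \<phi> (Y 0 w))" for w by simp
  have "integrable (localized B) \<phi> \<longleftrightarrow> integrable ?D (\<lambda>w. \<phi> (Y 0 w))"
    unfolding localized_def by (rule integrable_distr_eq[OF Ym]) simp
  also have "\<dots> \<longleftrightarrow> integrable M (\<lambda>w. indicator B (X 0 w) / ?p * \<phi> (Y 0 w))"
    using p by (subst integrable_density) auto
  also have "\<dots> \<longleftrightarrow> integrable M (\<lambda>w. indicator B (X 0 w) * \<phi> (Y 0 w))"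
    unfolding eq
  proof
    assume "integrable M (\<lambda>w. 1 / ?p * (indicator B (X 0 w) * \<phi> (Y 0 w)))"
    from integrable_mult_right[OF this, of ?p] show "integrable M (\<lambda>w. indicator B (X 0 w) * \<phi> (Y 0 w))"
      using p by simp
  qed (rule integrable_mult_right)
  finally show "integrable (localized B) \<phi> \<longleftrightarrow> integrable M (\<lambda>w. indicator B (X 0 w) * \<phi> (Y 0 w))" .
  have "(\<integral>y. \<phi> y \<partial>localized B) = (\<integral>w. \<phi> (Y 0 w) \<partial>?D)"
    unfolding localized_def by (rule integral_distr[OF Ym]) simp
  also have "\<dots> = (\<integral>w. indicator B (X 0 w) / ?p * \<phi> (Y 0 w) \<partial>M)"
    using p by (subst integral_density) auto
  finally show "(\<integral>y. \<phi> y \<partial>localized B) = (\<integral>w. indicator B (X 0 w) * \<phi> (Y 0 w) \<partial>M) / ?p"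
    unfolding eq by simp
qed

lemma emeasure_localized:
  assumes B [measurable]: "B \<in> sets borel" and A [measurable]: "A \<in> sets S" and p: "0 < prob {w \<in> space M. X 0 w \<in> B}"
  shows "emeasure (localized B) A = emeasure M {w \<in> space M. X 0 w \<in> B \<and> Y 0 w \<in> A} / emeasure M {w \<in> space M. X 0 w \<in> B}"
proof -
  let ?p = "prob {w \<in> space M. X 0 w \<in> B}"
  let ?E = "{w \<in> space M. X 0 w \<in> B \<and> Y 0 w \<in> A}"
  have E [measurable]: "?E \<in> sets M" by measurable
  have "emeasure (localized B) A = (\<integral>\<^sup>+y. indicator A y \<partial>localized B)" by simp
  also have "\<dots> = (\<integral>\<^sup>+w. ennreal (indicator B (X 0 w) / ?p) * indicator A (Y 0 w) \<partial>M)"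
    by (rule nn_integral_localized[OF B]) simp
  also have "\<dots> = (\<integral>\<^sup>+w. ennreal (1 / ?p) * indicator ?E w \<partial>M)"
    by (rule nn_integral_cong) (auto simp: indicator_def)
  also have "\<dots> = ennreal (1 / ?p) * emeasure M ?E" by (simp add: nn_integral_cmult)
  also have "\<dots> = ennreal (prob ?E / ?p)" using p by (simp add: emeasure_eq_measure ennreal_mult[symmetric])
  also have "\<dots> = emeasure M ?E / emeasure M {w \<in> space M. X 0 w \<in> B}"
    using p by (simp add: emeasure_eq_measure divide_ennreal)
  finally show ?thesis .
qed

end

lemma local_mixture_eq:
  fixes X :: "nat \<Rightarrow> 'w \<Rightarrow> real ^ 'd" and x :: "real ^ 'd" and \<mu> :: "real ^ 'd \<Rightarrow> 's measure" and u :: real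
  assumes RS: "regression_sample M S X Y \<kappa>" and AE\<mu>: "AE w in M. \<mu> (X 0 w) = \<kappa> (X 0 w)"
  defines "B \<equiv> cball x (u powr (1 / real CARD('d)))"
  assumes p: "0 < measure M {w \<in> space M. X 0 w \<in> B}"
  shows "local_mixture M S (X 0) \<mu> x u = regression_sample.localized M S X Y B"
proof -
  interpret regression_sample M S X Y \<kappa> by fact
  have B [measurable]: "B \<in> sets borel" by (simp add: B_def)
  have den: "(\<integral>\<^sup>+w. indicator B (X 0 w) \<partial>M) = emeasure M {w \<in> space M. X 0 w \<in> B}"
  proof -
    have "(\<integral>\<^sup>+w. indicator B (X 0 w) \<partial>M) = (\<integral>\<^sup>+w. indicator {w \<in> space M. X 0 w \<in> B} w \<partial>M)"
      by (rule nn_integral_cong) (auto simp: indicator_def)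
    then show ?thesis by simp
  qed
  have num: "(\<integral>\<^sup>+w. emeasure (\<mu> (X 0 w)) A * indicator B (X 0 w) \<partial>M) =
      emeasure M {w \<in> space M. X 0 w \<in> B \<and> Y 0 w \<in> A}" if A: "A \<in> sets S" for A
  proof -
    have "(\<integral>\<^sup>+w. emeasure (\<mu> (X 0 w)) A * indicator B (X 0 w) \<partial>M) =
        (\<integral>\<^sup>+w. emeasure (\<kappa> (X 0 w)) A * indicator B (X 0 w) \<partial>M)"
      by (rule nn_integral_cong_AE) (use AE\<mu> in \<open>eventually_elim, simp\<close>)
    then show ?thesis using disintegration[OF A B] by simp
  qed
  have "local_mixture M S (X 0) \<mu> x u = measure_of (space S) (sets S) (emeasure (localized B))"
    unfolding local_mixture_def Let_def B_def[symmetric]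
  proof (rule measure_of_eq)
    show "sets S \<subseteq> Pow (space S)" by (rule sets.space_closed)
    fix A assume "A \<in> sigma_sets (space S) (sets S)"
    then have A: "A \<in> sets S" by (simp add: sets.sigma_sets_eq)
    show "(\<integral>\<^sup>+w. emeasure (\<mu> (X 0 w)) A * indicator B (X 0 w) \<partial>M) / (\<integral>\<^sup>+w. indicator B (X 0 w) \<partial>M) = emeasure (localized B) A"
      unfolding num[OF A] den by (rule emeasure_localized[OF B A p, symmetric])
  qed
  also have "\<dots> = localized B" using measure_of_of_measure[of "localized B"] by simp
  finally show ?thesis .
qed

subsection \<open>Brackets\<close>

lemma bracketing_number_antimono:
  assumes "\<epsilon> \<le> \<epsilon>'"
  shows "bracketing_number \<G> Q \<epsilon>' \<le> bracketing_number \<G> Q \<epsilon>"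
  unfolding bracketing_number_def
proof (rule Inf_superset_mono, rule subsetI)
  fix N assume "N \<in> {enat (card C) | C. finite C \<and>
       (\<forall>(l, h)\<in>C. l \<in> L2_space Q \<and> h \<in> L2_space Q \<and> L2_nrm Q (\<lambda>s. l s - h s) \<le> \<epsilon>) \<and>
       \<G> \<subseteq> (\<Union>(l, h)\<in>C. bracket Q l h)}"
  then obtain C where C: "N = enat (card C)" "finite C"
    "\<forall>(l, h)\<in>C. l \<in> L2_space Q \<and> h \<in> L2_space Q \<and> L2_nrm Q (\<lambda>s. l s - h s) \<le> \<epsilon>"
    "\<G> \<subseteq> (\<Union>(l, h)\<in>C. bracket Q l h)" by blast
  have "\<forall>(l, h)\<in>C. l \<in> L2_space Q \<and> h \<in> L2_space Q \<and> L2_nrm Q (\<lambda>s. l s - h s) \<le> \<epsilon>'"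
    using C(3) assms by fastforce
  then show "N \<in> {enat (card C) | C. finite C \<and>
       (\<forall>(l, h)\<in>C. l \<in> L2_space Q \<and> h \<in> L2_space Q \<and> L2_nrm Q (\<lambda>s. l s - h s) \<le> \<epsilon>') \<and>
       \<G> \<subseteq> (\<Union>(l, h)\<in>C. bracket Q l h)}" using C by blast
qed

lemma bracketing_number_cover:
  assumes "bracketing_number \<G> Q \<epsilon> = enat n"
  obtains C where "finite C" "card C = n"
    "\<And>p. p \<in> C \<Longrightarrow> fst p \<in> L2_space Q \<and> snd p \<in> L2_space Q \<and> L2_nrm Q (\<lambda>s. fst p s - snd p s) \<le> \<epsilon>"
    "\<And>g. g \<in> \<G> \<Longrightarrow> \<exists>p\<in>C. \<forall>s\<in>space Q. fst p s \<le> g s \<and> g s \<le> snd p s"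
proof -
  let ?S = "{enat (card C) | C. finite C \<and>
       (\<forall>(l, h)\<in>C. l \<in> L2_space Q \<and> h \<in> L2_space Q \<and> L2_nrm Q (\<lambda>s. l s - h s) \<le> \<epsilon>) \<and>
       \<G> \<subseteq> (\<Union>(l, h)\<in>C. bracket Q l h)}"
  have inf: "Inf ?S = enat n" using assms by (simp add: bracketing_number_def)
  have "?S \<noteq> {}"
  proof
    assume "?S = {}"
    then have "Inf ?S = \<infinity>" by (simp only: Inf_empty top_enat_def)
    then show False using inf by simp
  qed
  then have "Inf ?S \<in> ?S" using wellorder_InfI[of _ ?S] by blast
  then have "enat n \<in> ?S" unfolding inf .
  then obtain C where C: "enat n = enat (card C)" "finite C"
    "\<forall>(l, h)\<in>C. l \<in> L2_space Q \<and> h \<in> L2_space Q \<and> L2_nrm Q (\<lambda>s. l s - h s) \<le> \<epsilon>"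
    "\<G> \<subseteq> (\<Union>(l, h)\<in>C. bracket Q l h)" by blast
  show ?thesis
  proof (rule that[OF C(2)])
    show "card C = n" using C(1) by simp
    show "fst p \<in> L2_space Q \<and> snd p \<in> L2_space Q \<and> L2_nrm Q (\<lambda>s. fst p s - snd p s) \<le> \<epsilon>" if "p \<in> C" for p
      using C(3) that by (cases p) auto
    show "\<exists>p\<in>C. \<forall>s\<in>space Q. fst p s \<le> g s \<and> g s \<le> snd p s" if "g \<in> \<G>" for g
    proof -
      have "g \<in> (\<Union>(l, h)\<in>C. bracket Q l h)" using C(4) that by (rule subsetD)
      then obtain p where p: "p \<in> C" "g \<in> (case p of (l, h) \<Rightarrow> bracket Q l h)" by (rule UN_E)
      then have "\<forall>s\<in>space Q. fst p s \<le> g s \<and> g s \<le> snd p s" by (cases p) (simp add: bracket_def)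
      then show ?thesis using p(1) by blast
    qed
  qed
qed

lemma sqrt_log_mono: "a \<le> b \<Longrightarrow> sqrt_log a \<le> sqrt_log b"
proof (cases b)
  case (enat m)
  assume "a \<le> b"
  then obtain n where n: "a = enat n" "n \<le> m" using enat by (cases a) auto
  have "ln (real n) \<le> ln (real m)" if "n \<noteq> 0" using n(2) that by simp
  then show ?thesis
    using n enat by (cases "n = 0") (auto simp: sqrt_log_def intro!: ennreal_leI)
qed (simp add: sqrt_log_def)

lemma bracketing_integral_levels:
  assumes J: "bracketing_integral \<G> G Q ((1/2) ^ q0) \<le> ennreal j" and G: "0 \<le> L2_nrm Q G" and j: "j \<ge> 0"
  obtains n where "\<And>p. bracketing_number \<G> Q ((1/2) ^ (q0 + p) * L2_nrm Q G) = enat (n p)"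
    "\<And>P. (\<Sum>p\<le>P. (1/2) ^ (q0 + p + 1) * sqrt (ln (n p))) \<le> j"
proof -
  define b where "b p = bracketing_number \<G> Q ((1/2) ^ (q0 + p) * L2_nrm Q G)" for p
  define I where "I p = {(1/2 :: real) ^ (q0 + p + 1)<..<(1/2) ^ (q0 + p)}" for p
  have sum_le: "(\<Sum>p\<le>P. sqrt_log (b p) * ennreal ((1/2) ^ (q0 + p + 1))) \<le> ennreal j" for P
  proof -
    have len: "emeasure lborel (I p) = ennreal ((1/2) ^ (q0 + p + 1))" for p
      unfolding I_def by (subst emeasure_lborel_Ioo) auto
    have "(\<Sum>p\<le>P. sqrt_log (b p) * ennreal ((1/2) ^ (q0 + p + 1))) = (\<integral>\<^sup>+\<epsilon>. (\<Sum>p\<le>P. sqrt_log (b p) * indicator (I p) \<epsilon>) \<partial>lborel)"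
      by (subst nn_integral_sum) (auto simp: nn_integral_cmult_indicator len I_def)
    also have "\<dots> \<le> (\<integral>\<^sup>+\<epsilon>. sqrt_log (bracketing_number \<G> Q (\<epsilon> * L2_nrm Q G)) * indicator {0<..<(1/2) ^ q0} \<epsilon> \<partial>lborel)"
    proof (rule nn_integral_mono)
      fix \<epsilon> :: real
      show "(\<Sum>p\<le>P. sqrt_log (b p) * indicator (I p) \<epsilon>) \<le> sqrt_log (bracketing_number \<G> Q (\<epsilon> * L2_nrm Q G)) * indicator {0<..<(1/2) ^ q0} \<epsilon>"
      proof (cases "\<exists>p\<le>P. \<epsilon> \<in> I p")
        case False
        then have "(\<Sum>p\<le>P. sqrt_log (b p) * indicator (I p) \<epsilon>) = 0" by (intro sum.neutral) auto
        then show ?thesis by simp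
      next
        case True
        then obtain p where p: "p \<le> P" "\<epsilon> \<in> I p" by blast
        have uniq: "\<epsilon> \<notin> I p'" if "p' \<noteq> p" for p'
        proof
          assume "\<epsilon> \<in> I p'"
          show False
          proof (cases "p < p'")
            case True
            then have "(1/2 :: real) ^ (q0 + p') \<le> (1/2) ^ (q0 + p + 1)" by (intro power_decreasing) auto
            then show False using \<open>\<epsilon> \<in> I p'\<close> p(2) by (auto simp: I_def)
          next
            case False
            then have "(1/2 :: real) ^ (q0 + p) \<le> (1/2) ^ (q0 + p' + 1)" using that by (intro power_decreasing) auto
            then show False using \<open>\<epsilon> \<in> I p'\<close> p(2) by (auto simp: I_def)
          qed
        qed
        have "(\<Sum>p\<le>P. sqrt_log (b p) * indicator (I p) \<epsilon>) = (\<Sum>p'\<in>{p}. sqrt_log (b p') * indicator (I p') \<epsilon>)"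
          using p uniq by (intro sum.mono_neutral_right) auto
        also have "\<dots> = sqrt_log (b p)" using p by simp
        also have "\<dots> \<le> sqrt_log (bracketing_number \<G> Q (\<epsilon> * L2_nrm Q G))"
          unfolding b_def using p(2) G
          by (intro sqrt_log_mono bracketing_number_antimono mult_right_mono) (auto simp: I_def)
        also have "\<dots> = sqrt_log (bracketing_number \<G> Q (\<epsilon> * L2_nrm Q G)) * indicator {0<..<(1/2) ^ q0} \<epsilon>"
        proof -
          have "(1/2 :: real) ^ (q0 + p) \<le> (1/2) ^ q0" by (intro power_decreasing) auto
          moreover have "0 < (1/2 :: real) ^ (q0 + p + 1)" by simp
          moreover have "(1/2 :: real) ^ (q0 + p + 1) < \<epsilon>" "\<epsilon> < (1/2) ^ (q0 + p)"
            using p(2) by (simp_all only: I_def greaterThanLessThan_iff)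
          ultimately have "0 < \<epsilon>" "\<epsilon> < (1/2) ^ q0" by linarith+
          then have "\<epsilon> \<in> {0<..<(1/2) ^ q0}" by (simp only: greaterThanLessThan_iff)
          then show ?thesis by simp
        qed
        finally show ?thesis .
      qed
    qed
    also have "\<dots> \<le> ennreal j" using J by (simp add: bracketing_integral_def)
    finally show ?thesis .
  qed
  have fin: "\<exists>n. b p = enat n" for p
  proof (rule ccontr)
    assume "\<nexists>n. b p = enat n"
    then have "b p = \<infinity>" by (cases "b p") auto
    then have A: "sqrt_log (b p) * ennreal ((1/2) ^ (q0 + p + 1)) = \<infinity>"
      by (simp add: sqrt_log_def ennreal_top_mult)
    have "sqrt_log (b p) * ennreal ((1/2) ^ (q0 + p + 1)) \<le> (\<Sum>p\<le>p. sqrt_log (b p) * ennreal ((1/2) ^ (q0 + p + 1)))"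
      by (rule member_le_sum) auto
    from order_trans[OF this sum_le] show False unfolding A by (simp add: top_unique)
  qed
  then obtain n where n: "\<And>p. b p = enat (n p)" by metis
  show ?thesis
  proof (rule that)
    show "bracketing_number \<G> Q ((1/2) ^ (q0 + p) * L2_nrm Q G) = enat (n p)" for p using n by (simp add: b_def)
    fix P
    have s0: "0 \<le> sqrt (ln (real (n p)))" for p by (cases "n p = 0") auto
    have "ennreal (\<Sum>p\<le>P. (1/2) ^ (q0 + p + 1) * sqrt (ln (n p))) = (\<Sum>p\<le>P. sqrt_log (b p) * ennreal ((1/2) ^ (q0 + p + 1)))"
      using s0 by (subst sum_ennreal[symmetric]) (auto simp: n sqrt_log_def ennreal_mult[symmetric] mult.commute intro!: sum.cong)
    also have "\<dots> \<le> ennreal j" by (rule sum_le)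
    finally show "(\<Sum>p\<le>P. (1/2) ^ (q0 + p + 1) * sqrt (ln (n p))) \<le> j" using j by (simp add: ennreal_le_iff)
  qed
qed

lemma level_sum_bound:
  fixes s :: "nat \<Rightarrow> real"
  assumes s0: "\<And>p. 0 \<le> s p" and j: "\<And>P. (\<Sum>p\<le>P. (1/2) ^ (q0 + p + 1) * s p) \<le> j"
  shows "(\<Sum>j\<le>n. (1/2) ^ (q0 + j) * (real (q0 + j + 1) + (\<Sum>p\<le>Suc j. s p))) \<le> (2 * real q0 + 4) * (1/2) ^ q0 + 8 * j"
proof -
  let ?w = "\<lambda>j. (1/2 :: real) ^ (q0 + j)"
  have A: "(\<Sum>j\<le>n. ?w j * real (q0 + j + 1)) \<le> (2 * real q0 + 4) * (1/2) ^ q0 - (2 * real (q0 + n) + 6) * ?w (Suc n)"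
  proof (induction n)
    case (Suc n)
    define w where "w = (1/2 :: real) ^ (q0 + n) / 4"
    have "?w (Suc n) = 2 * w" "?w (Suc (Suc n)) = w" by (simp_all add: w_def)
    then show ?case using Suc by (simp add: algebra_simps)
  qed (simp add: algebra_simps)
  have Bd: "(\<Sum>j\<le>n. ?w j * (\<Sum>p\<le>Suc j. s p)) + ?w n * (\<Sum>p\<le>Suc n. s p) \<le> 4 * (\<Sum>p\<le>Suc n. ?w p * s p)"
  proof (induction n)
    case 0
    then show ?case using s0[of 0] by (simp add: algebra_simps)
  next
    case (Suc n)
    have "(\<Sum>j\<le>Suc n. ?w j * (\<Sum>p\<le>Suc j. s p)) + ?w (Suc n) * (\<Sum>p\<le>Suc (Suc n). s p) =
      ((\<Sum>j\<le>n. ?w j * (\<Sum>p\<le>Suc j. s p)) + ?w n * (\<Sum>p\<le>Suc n. s p)) + 4 * (?w (Suc (Suc n)) * s (Suc (Suc n)))"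
    proof -
      define w where "w = (1/2 :: real) ^ (q0 + n) / 4"
      have w: "?w n = 4 * w" "?w (Suc n) = 2 * w" "?w (Suc (Suc n)) = w" by (simp_all add: w_def)
      have e: "(\<Sum>j\<le>Suc n. ?w j * (\<Sum>p\<le>Suc j. s p)) = (\<Sum>j\<le>n. ?w j * (\<Sum>p\<le>Suc j. s p)) + ?w (Suc n) * (\<Sum>p\<le>Suc (Suc n). s p)"
        "(\<Sum>p\<le>Suc (Suc n). s p) = (\<Sum>p\<le>Suc n. s p) + s (Suc (Suc n))"
        by simp_all
      show ?thesis unfolding e w by (simp only: algebra_simps)
    qed
    also have "\<dots> \<le> 4 * (\<Sum>p\<le>Suc n. ?w p * s p) + 4 * (?w (Suc (Suc n)) * s (Suc (Suc n)))"
      using Suc by simp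
    also have "\<dots> = 4 * (\<Sum>p\<le>Suc (Suc n). ?w p * s p)" by simp
    finally show ?case .
  qed
  have "4 * (\<Sum>p\<le>Suc n. ?w p * s p) = 8 * (\<Sum>p\<le>Suc n. (1/2) ^ (q0 + p + 1) * s p)"
    by (simp add: sum_distrib_left mult_ac)
  also have "\<dots> \<le> 8 * j" by (rule mult_left_mono[OF j]) simp
  finally have "4 * (\<Sum>p\<le>Suc n. ?w p * s p) \<le> 8 * j" .
  moreover have "0 \<le> ?w n * (\<Sum>p\<le>Suc n. s p)" using s0 by (intro mult_nonneg_nonneg sum_nonneg) auto
  moreover have "0 \<le> (2 * real (q0 + n) + 6) * ?w (Suc n)" by simp
  moreover have "(\<Sum>j\<le>n. ?w j * (real (q0 + j + 1) + (\<Sum>p\<le>Suc j. s p))) =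
      (\<Sum>j\<le>n. ?w j * real (q0 + j + 1)) + (\<Sum>j\<le>n. ?w j * (\<Sum>p\<le>Suc j. s p))"
    by (simp add: distrib_left sum.distrib)
  ultimately show ?thesis using A Bd by linarith
qed

subsection \<open>Small balls\<close>

lemma small_ball_prob:
  fixes x :: "real ^ 'd" and X :: "'w \<Rightarrow> real ^ 'd"
  assumes M: "prob_space M" and X: "distributed M lborel X (\<lambda>z. ennreal (f z))"
    and cont: "isCont f x" and f: "f x > 0"
  obtains b u0 where "b > 0" "u0 > 0"
    "\<And>u. 0 < u \<Longrightarrow> u \<le> u0 \<Longrightarrow>
      b * u \<le> measure M {w \<in> space M. X w \<in> cball x (u powr (1 / real CARD('d)))} \<and>
      measure M {w \<in> space M. X w \<in> cball x (u powr (1 / real CARD('d)))} \<le> 4 * b * u"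
proof -
  interpret prob_space M by fact
  have "eventually (\<lambda>z. f z > f x / 2) (at x)" "eventually (\<lambda>z. f z < 2 * f x) (at x)"
    using order_tendstoD(1)[OF cont[unfolded isCont_def], of "f x / 2"] order_tendstoD(2)[OF cont[unfolded isCont_def], of "2 * f x"] f
    by simp_all
  then have "eventually (\<lambda>z. f x / 2 < f z \<and> f z < 2 * f x) (at x)" by (rule eventually_conj)
  then obtain r where r: "r > 0" "\<And>z. z \<noteq> x \<Longrightarrow> dist z x < r \<Longrightarrow> f x / 2 < f z \<and> f z < 2 * f x"
    unfolding eventually_at by auto
  have r': "f x / 2 \<le> f z \<and> f z \<le> 2 * f x" if "dist z x < r" for z
    using r(2)[of z] that f by (cases "z = x") force+
  define d where "d = real CARD('d)"
  have d: "d > 0" by (simp add: d_def)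
  define v where "v = unit_ball_vol d"
  have v: "v > 0" by (simp add: v_def d_def)
  define u0 where "u0 = (r / 2) powr d"
  have u0: "u0 > 0" using r(1) by (simp add: u0_def)
  have main: "f x / 2 * v * u \<le> prob {w \<in> space M. X w \<in> cball x (u powr (1 / d))} \<and>
      prob {w \<in> space M. X w \<in> cball x (u powr (1 / d))} \<le> 2 * f x * v * u" if u: "0 < u" "u \<le> u0" for u
  proof -
    let ?\<rho> = "u powr (1 / d)"
    let ?B = "cball x ?\<rho>"
    have "?\<rho> \<le> u0 powr (1 / d)" using u d by (intro powr_mono2) auto
    also have "\<dots> = r / 2" using r(1) d by (simp add: u0_def powr_powr)
    finally have small: "?\<rho> < r" using r(1) by simp
    have inB: "dist z x < r" if "z \<in> ?B" for z using that small by (simp add: dist_commute)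
    have vol: "emeasure lborel ?B = ennreal (v * u)"
    proof -
      have "?\<rho> ^ CARD('d) = u"
        using u d by (simp add: powr_realpow[symmetric] powr_powr d_def)
      then show ?thesis by (subst emeasure_cball) (auto simp: v_def d_def)
    qed
    have Xm: "X \<in> measurable M lborel" using X by (simp add: distributed_def)
    have "emeasure M (X -` ?B \<inter> space M) = (\<integral>\<^sup>+z. ennreal (f z) * indicator ?B z \<partial>lborel)"
      by (rule distributed_emeasure[OF X]) simp
    moreover have "X -` ?B \<inter> space M = {w \<in> space M. X w \<in> ?B}" by auto
    ultimately have eq: "ennreal (prob {w \<in> space M. X w \<in> ?B}) = (\<integral>\<^sup>+z. ennreal (f z) * indicator ?B z \<partial>lborel)"
      by (simp add: emeasure_eq_measure)
    have "ennreal (f x / 2 * v * u) = (\<integral>\<^sup>+z. ennreal (f x / 2) * indicator ?B z \<partial>lborel)"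
      using f v u by (simp add: nn_integral_cmult_indicator vol ennreal_mult[symmetric] mult.assoc)
    also have "\<dots> \<le> (\<integral>\<^sup>+z. ennreal (f z) * indicator ?B z \<partial>lborel)"
      by (rule nn_integral_mono) (use r' inB in \<open>auto simp: indicator_def intro!: ennreal_leI\<close>)
    finally have lo: "f x / 2 * v * u \<le> prob {w \<in> space M. X w \<in> ?B}" unfolding eq[symmetric] by (simp add: ennreal_le_iff)
    have "(\<integral>\<^sup>+z. ennreal (f z) * indicator ?B z \<partial>lborel) \<le> (\<integral>\<^sup>+z. ennreal (2 * f x) * indicator ?B z \<partial>lborel)"
      by (rule nn_integral_mono) (use r' inB in \<open>auto simp: indicator_def intro!: ennreal_leI\<close>)
    also have "\<dots> = ennreal (2 * f x * v * u)"
      using f v u by (simp add: nn_integral_cmult_indicator vol ennreal_mult[symmetric] mult.assoc)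
    finally have "prob {w \<in> space M. X w \<in> ?B} \<le> 2 * f x * v * u"
      unfolding eq[symmetric] using f v u by (simp add: ennreal_le_iff)
    then show ?thesis using lo by simp
  qed
  show ?thesis
  proof (rule that[of "f x / 2 * v" u0])
    show "f x / 2 * v > 0" using f v by simp
    show "u0 > 0" by (rule u0)
    show "f x / 2 * v * u \<le> prob {w \<in> space M. X w \<in> cball x (u powr (1 / real CARD('d)))} \<and>
      prob {w \<in> space M. X w \<in> cball x (u powr (1 / real CARD('d)))} \<le> 4 * (f x / 2 * v) * u" if "0 < u" "u \<le> u0" for u
      using main[OF that] by (simp add: d_def algebra_simps)
  qed
qed

subsection \<open>The nearest neighbour process\<close>

locale neighbour_sample = regression_sample M S X Y \<kappa>
  for M :: "'w measure" and S :: "'s measure" and X :: "nat \<Rightarrow> 'w \<Rightarrow> 'a::euclidean_space"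
    and Y :: "nat \<Rightarrow> 'w \<Rightarrow> 's" and \<kappa> :: "'a \<Rightarrow> 's measure" +
  fixes x :: 'a and k :: "nat \<Rightarrow> nat" and \<rho> :: "nat \<Rightarrow> real" and n0 :: nat and N0 :: "'a set"
    and \<G> :: "('s \<Rightarrow> real) set" and G :: "'s \<Rightarrow> real"
    and c2 :: "('s \<Rightarrow> real) \<Rightarrow> ('s \<Rightarrow> real) \<Rightarrow> real" and c1 :: "('s \<Rightarrow> real) \<Rightarrow> real"
  assumes n0: "n0 \<ge> 1" and k_range: "\<And>n. n \<ge> n0 \<Longrightarrow> 1 \<le> k n \<and> k n \<le> n" and k_lim: "filterlim k at_top sequentially"
    and \<rho>_lim: "\<rho> \<longlonglongrightarrow> 0"
    and ball_prob: "\<And>n. n \<ge> n0 \<Longrightarrow> 4 * real (k n) \<le> n * prob {w \<in> space M. X 0 w \<in> cball x (\<rho> n)} \<and>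
      n * prob {w \<in> space M. X 0 w \<in> cball x (\<rho> n)} \<le> 16 * real (k n)"
    and nonempty: "\<G> \<noteq> {}" and class_meas: "\<G> \<subseteq> borel_measurable S" and env: "is_envelope S \<G> G"
    and brackets: "\<And>e :: real. e > 0 \<Longrightarrow> \<exists>q. \<forall>q0\<ge>q. \<forall>n\<ge>n0.
      bracketing_integral \<G> G (localized (cball x (\<rho> n))) ((1/2) ^ q0) \<le> ennreal e"
    and tails: "\<And>e :: real. e > 0 \<Longrightarrow> \<exists>t>0. \<forall>n\<ge>n0.
      (\<integral>\<^sup>+y. ennreal ((G y)\<^sup>2) * indicator {y. G y > t} y \<partial>localized (cball x (\<rho> n))) \<le> ennreal e"
    and net: "\<And>e :: real. e > 0 \<Longrightarrow> \<exists>F. finite F \<and> F \<subseteq> \<G> \<and> (\<forall>g\<in>\<G>. \<exists>h\<in>F. \<forall>n\<ge>n0.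
      L2_nrm (localized (cball x (\<rho> n))) (\<lambda>y. h y - g y) < e)"
    and N0: "N0 \<in> sets borel" "AE w in M. X 0 w \<notin> N0"
    and lim2: "\<And>g h. g \<in> \<G> \<Longrightarrow> h \<in> \<G> \<Longrightarrow>
      ((\<lambda>z. \<integral>y. g y * h y \<partial>\<kappa> z) \<longlongrightarrow> c2 g h) (inf (nhds x) (principal (- N0)))"
    and lim1: "\<And>g. g \<in> \<G> \<Longrightarrow> ((\<lambda>z. \<integral>y. g y \<partial>\<kappa> z) \<longlongrightarrow> c1 g) (inf (nhds x) (principal (- N0)))"
begin

definition B :: "nat \<Rightarrow> 'a set" where "B n = cball x (\<rho> n)"

definition p :: "nat \<Rightarrow> real" where "p n = prob {w \<in> space M. X 0 w \<in> B n}"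

definition N :: "nat \<Rightarrow> (nat \<Rightarrow> 'a) \<Rightarrow> nat set" where
  "N n \<xi> = nn_set \<xi> n (k n) x \<inter> {i. \<xi> i \<in> B n}"

definition V :: "nat \<Rightarrow> ('s \<Rightarrow> real) \<Rightarrow> 'w \<Rightarrow> real" where
  "V n g w = csum (N n) g w / sqrt (real (k n))"

definition Z :: "nat \<Rightarrow> 'w \<Rightarrow> ('s \<Rightarrow> real) \<Rightarrow> real" where
  "Z n w g = (1 / sqrt (real (k n))) *
     (\<Sum>i\<in>nn_set (\<lambda>j. X j w) n (k n) x. (g (Y i w) - (\<integral>y. g y \<partial>\<kappa> (X i w))))"

definition K :: "('s \<Rightarrow> real) \<Rightarrow> ('s \<Rightarrow> real) \<Rightarrow> real" where
  "K g h = c2 g h - c1 g * c1 h"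

lemma B_sets [measurable]: "B n \<in> sets borel"
  by (simp add: B_def)

lemma G_meas [measurable]: "G \<in> borel_measurable S" and G_bound: "g \<in> \<G> \<Longrightarrow> y \<in> space S \<Longrightarrow> \<bar>g y\<bar> \<le> G y"
  using env by (auto simp: is_envelope_def)

lemma G_nonneg: "y \<in> space S \<Longrightarrow> 0 \<le> G y"
  using nonempty G_bound by (metis abs_ge_zero ex_in_conv order_trans)

lemma g_meas [measurable]: "g \<in> \<G> \<Longrightarrow> g \<in> borel_measurable S"
  using class_meas by auto

lemma k_pos: "n \<ge> n0 \<Longrightarrow> 0 < real (k n)"
  using k_range[of n] by simp

lemma np: "n \<ge> n0 \<Longrightarrow> 4 * real (k n) \<le> n * p n" "n \<ge> n0 \<Longrightarrow> n * p n \<le> 16 * real (k n)"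
  using ball_prob[of n] by (auto simp: p_def B_def)

lemma p_pos: "n \<ge> n0 \<Longrightarrow> 0 < p n"
proof (rule ccontr)
  assume n: "n \<ge> n0" and "\<not> 0 < p n"
  then have "real n * p n \<le> 0" by (intro mult_nonneg_nonpos) auto
  then show False using np(1)[OF n] k_pos[OF n] by linarith
qed

lemma measurable_Q: "borel_measurable (localized (B n)) = borel_measurable S"
  by (intro measurable_cong_sets sets_localized refl)

lemma prob_Q: "n \<ge> n0 \<Longrightarrow> prob_space (localized (B n))"
proof (rule prob_spaceI)
  assume n: "n \<ge> n0"
  have "{w \<in> space M. X 0 w \<in> B n \<and> Y 0 w \<in> space S} = {w \<in> space M. X 0 w \<in> B n}"
    using Y_space by auto
  then show "emeasure (localized (B n)) (space (localized (B n))) = 1"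
    using p_pos[OF n] by (simp add: emeasure_localized p_def emeasure_eq_measure divide_ennreal)
qed

lemma second_moment:
  obtains c where "c \<ge> 1" "\<And>n. n \<ge> n0 \<Longrightarrow> integrable (localized (B n)) (\<lambda>y. (G y)\<^sup>2) \<and> (\<integral>y. (G y)\<^sup>2 \<partial>localized (B n)) \<le> c\<^sup>2"
proof -
  obtain t where t: "t > 0" "\<And>n. n \<ge> n0 \<Longrightarrow>
      (\<integral>\<^sup>+y. ennreal ((G y)\<^sup>2) * indicator {y. G y > t} y \<partial>localized (B n)) \<le> ennreal 1"
    using tails[of 1] unfolding B_def by auto
  show ?thesis
  proof (rule that[of "t + 1"])
    show "t + 1 \<ge> 1" using t(1) by simp
    fix n assume n: "n \<ge> n0"
    interpret Q: prob_space "localized (B n)" by (rule prob_Q[OF n])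
    have [measurable]: "G \<in> borel_measurable (localized (B n))" by (simp add: measurable_Q)
    have "(\<integral>\<^sup>+y. ennreal ((G y)\<^sup>2) \<partial>localized (B n)) \<le>
      (\<integral>\<^sup>+y. ennreal (t\<^sup>2) + ennreal ((G y)\<^sup>2) * indicator {y. G y > t} y \<partial>localized (B n))"
    proof (rule nn_integral_mono)
      fix y assume "y \<in> space (localized (B n))"
      then have "0 \<le> G y" using G_nonneg by simp
      then have "G y \<le> t \<Longrightarrow> (G y)\<^sup>2 \<le> t\<^sup>2" by (rule power_mono[rotated])
      then show "ennreal ((G y)\<^sup>2) \<le> ennreal (t\<^sup>2) + ennreal ((G y)\<^sup>2) * indicator {y. G y > t} y"
        by (cases "G y > t") (auto intro: ennreal_leI)
    qed
    also have "\<dots> = ennreal (t\<^sup>2) + (\<integral>\<^sup>+y. ennreal ((G y)\<^sup>2) * indicator {y. G y > t} y \<partial>localized (B n))"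
      using Q.emeasure_space_1 by (subst nn_integral_add) auto
    also have "\<dots> \<le> ennreal (t\<^sup>2) + ennreal 1" by (intro add_left_mono t(2) n)
    also have "\<dots> \<le> ennreal ((t + 1)\<^sup>2)"
      using t(1) by (subst ennreal_plus[symmetric]) (auto intro!: ennreal_leI simp: power2_sum)
    finally have le: "(\<integral>\<^sup>+y. ennreal ((G y)\<^sup>2) \<partial>localized (B n)) \<le> ennreal ((t + 1)\<^sup>2)" .
    then have int: "integrable (localized (B n)) (\<lambda>y. (G y)\<^sup>2)"
      by (intro integrableI_bounded) (auto intro: le_less_trans)
    moreover have "(\<integral>y. (G y)\<^sup>2 \<partial>localized (B n)) \<le> (t + 1)\<^sup>2"
      using le nn_integral_eq_integral[OF int] by (simp add: ennreal_le_iff)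
    ultimately show "integrable (localized (B n)) (\<lambda>y. (G y)\<^sup>2) \<and> (\<integral>y. (G y)\<^sup>2 \<partial>localized (B n)) \<le> (t + 1)\<^sup>2" ..
  qed
qed

lemma local_sample:
  assumes n: "n \<ge> n0"
  shows "local_sample M S X Y \<kappa> {1..n} (N n) (B n) (real (k n)) G"
proof -
  have n1: "n \<ge> 1" using n n0 by simp
  have "card (N n y) \<le> k n" for y
  proof -
    have "card (N n y) \<le> card (nn_set y n (k n) x)" by (rule card_mono) (auto simp: N_def nn_set_def)
    then show ?thesis using card_nn_set[of "k n" n y x] k_range[OF n] by simp
  qed
  moreover have "integrable M (\<lambda>w. indicator (B n) (X 0 w) * (G (Y 0 w))\<^sup>2)"
  proof -
    obtain c where "integrable (localized (B n)) (\<lambda>y. (G y)\<^sup>2)" using second_moment n by blast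
    then show ?thesis by (subst (asm) integral_localized) (use p_pos[OF n] in \<open>simp_all add: p_def\<close>)
  qed
  moreover have "selection {1..n} (N n)"
    unfolding N_def[abs_def] by (rule selection_nn[OF n1 B_sets])
  ultimately show ?thesis
    using k_pos[OF n] G_nonneg by unfold_locales (auto simp: N_def)
qed

lemma m_le:
  assumes n: "n \<ge> n0" and [measurable]: "\<phi> \<in> borel_measurable S" and \<phi>: "\<And>y. y \<in> space S \<Longrightarrow> 0 \<le> \<phi> y"
  shows "local_sample.m M X Y {1..n} (B n) (real (k n)) \<phi> \<le> 16 * (\<integral>y. \<phi> y \<partial>localized (B n))"
proof -
  interpret L: local_sample M S X Y \<kappa> "{1..n}" "N n" "B n" "real (k n)" G by (rule local_sample[OF n])
  have i0: "0 \<le> (\<integral>y. \<phi> y \<partial>localized (B n))" using \<phi> by (intro Bochner_Integration.integral_nonneg) simp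
  have "(\<integral>w. indicator (B n) (X 0 w) * \<phi> (Y 0 w) \<partial>M) = p n * (\<integral>y. \<phi> y \<partial>localized (B n))"
    using p_pos[OF n] by (subst integral_localized(2)) (auto simp: p_def)
  then have "L.m \<phi> = (real n * p n / real (k n)) * (\<integral>y. \<phi> y \<partial>localized (B n))"
    unfolding L.m_def by simp
  also have "\<dots> \<le> 16 * (\<integral>y. \<phi> y \<partial>localized (B n))"
    using np(2)[OF n] k_pos[OF n] by (intro mult_right_mono i0) (simp add: divide_le_eq)
  finally show ?thesis .
qed

lemma m_tail:
  fixes e :: real
  assumes e: "e > 0"
  obtains t where "t > 0" "\<And>n s. n \<ge> n0 \<Longrightarrow> t \<le> s \<Longrightarrow>
    local_sample.m M X Y {1..n} (B n) (real (k n)) (\<lambda>y. (G y)\<^sup>2 * (if s < G y then 1 else 0)) \<le> e"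
proof -
  obtain t where t: "t > 0" "\<And>n. n \<ge> n0 \<Longrightarrow>
      (\<integral>\<^sup>+y. ennreal ((G y)\<^sup>2) * indicator {y. G y > t} y \<partial>localized (B n)) \<le> ennreal (e / 16)"
    using tails[of "e / 16"] e unfolding B_def by auto
  show ?thesis
  proof (rule that[OF t(1)])
    fix n s assume n: "n \<ge> n0" and s: "t \<le> s"
    let ?f = "\<lambda>y. (G y)\<^sup>2 * (if s < G y then 1 else 0)"
    have m [measurable]: "?f \<in> borel_measurable S" by measurable
    have "(\<integral>\<^sup>+y. ennreal (?f y) \<partial>localized (B n)) \<le> (\<integral>\<^sup>+y. ennreal ((G y)\<^sup>2) * indicator {y. G y > t} y \<partial>localized (B n))"
      by (rule nn_integral_mono) (use s in \<open>auto simp: indicator_def\<close>)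
    also have "\<dots> \<le> ennreal (e / 16)" by (rule t(2)[OF n])
    finally have le: "(\<integral>\<^sup>+y. ennreal (?f y) \<partial>localized (B n)) \<le> ennreal (e / 16)" .
    have "(\<integral>y. ?f y \<partial>localized (B n)) = enn2real (\<integral>\<^sup>+y. ennreal (?f y) \<partial>localized (B n))"
      by (rule integral_eq_nn_integral) (auto simp: measurable_Q)
    also have "\<dots> \<le> e / 16" using enn2real_mono[OF le] e by simp
    finally show "local_sample.m M X Y {1..n} (B n) (real (k n)) ?f \<le> e"
      using m_le[OF n m] by simp
  qed
qed

lemma neighbours_in_ball:
  assumes n: "n \<ge> n0"
  obtains E where "E \<in> events" "prob E \<le> exp (- real (k n))"
    "\<And>w. w \<in> space M - E \<Longrightarrow> N n (\<lambda>j. X j w) = nn_set (\<lambda>j. X j w) n (k n) x"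
proof
  let ?E = "{w \<in> space M. (\<Sum>i\<in>{1..n}. indicator (B n) (X i w)) \<le> real (k n)}"
  show "?E \<in> events" by measurable
  have "prob ?E \<le> exp (real (k n) - card {1..n} * p n / 2)"
    unfolding p_def by (rule count_lower_tail) auto
  also have "\<dots> \<le> exp (- real (k n))" using np(1)[OF n] by simp
  finally show "prob ?E \<le> exp (- real (k n))" .
  fix w assume wM: "w \<in> space M - ?E"
  have "(\<Sum>i\<in>{1..n}. indicator (B n) (X i w)) = real (card {i \<in> {1..n}. X i w \<in> B n})"
    by (simp add: indicator_def sum.If_cases Int_def)
  moreover have "\<not> (\<Sum>i\<in>{1..n}. indicator (B n) (X i w)) \<le> real (k n)" using wM by blast
  ultimately have "real (k n) < real (card {i \<in> {1..n}. X i w \<in> B n})" by linarith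
  then have "k n \<le> card {i \<in> {1..n}. X i w \<in> cball x (\<rho> n)}" by (simp add: B_def)
  then show "N n (\<lambda>j. X j w) = nn_set (\<lambda>j. X j w) n (k n) x"
    using nn_set_subset_ball[of "k n" n "\<lambda>j. X j w" x "\<rho> n"] by (auto simp: N_def B_def)
qed

lemma Z_eq_V: "N n (\<lambda>j. X j w) = nn_set (\<lambda>j. X j w) n (k n) x \<Longrightarrow> Z n w g = V n g w"
  by (simp add: Z_def V_def csum_def cent_def)

lemma Z_measurable: "n \<ge> 1 \<Longrightarrow> g \<in> borel_measurable S \<Longrightarrow> (\<lambda>w. Z n w g) \<in> borel_measurable M"
proof -
  assume n: "n \<ge> 1" and g: "g \<in> borel_measurable S"
  have "selection {1..n} (\<lambda>X. nn_set X n (k n) x \<inter> {i. X i \<in> UNIV})" by (rule selection_nn[OF n]) simp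
  then have "selection {1..n} (\<lambda>X. nn_set X n (k n) x)" by simp
  from csum_measurable[OF this g]
  have "(\<lambda>w. csum (\<lambda>X. nn_set X n (k n) x) g w / sqrt (real (k n))) \<in> borel_measurable M" by simp
  then show ?thesis by (simp add: Z_def csum_def cent_def)
qed

lemma Z_measurable': "g \<in> borel_measurable S \<Longrightarrow> (\<lambda>w. Z n w g) \<in> borel_measurable M"
proof (cases "n \<ge> 1")
  case False
  then have "n = 0" by simp
  then show ?thesis by (simp add: Z_def nn_set_def)
qed (rule Z_measurable)

lemma exp_k_small: "e > 0 \<Longrightarrow> eventually (\<lambda>n. exp (- real (k n)) \<le> e) sequentially"
proof -
  assume e: "e > 0"
  have "filterlim (\<lambda>n. real (k n)) at_top sequentially"
    by (rule filterlim_compose[OF filterlim_real_sequentially k_lim])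
  then have "eventually (\<lambda>n. - ln e \<le> real (k n)) sequentially" by (simp add: filterlim_at_top)
  then show ?thesis
  proof eventually_elim
    case (elim n)
    then have "exp (- real (k n)) \<le> exp (ln e)" by simp
    then show ?case using e by simp
  qed
qed

lemma B_shrinks:
  assumes "eventually P (inf (nhds x) (principal (- N0)))"
  shows "eventually (\<lambda>n. \<forall>z\<in>B n. z \<notin> N0 \<longrightarrow> P z) sequentially"
proof -
  obtain r where r: "r > 0" "\<And>z. dist z x < r \<Longrightarrow> z \<notin> N0 \<Longrightarrow> P z"
    using assms unfolding eventually_inf_principal eventually_nhds_metric by auto
  have "eventually (\<lambda>n. \<rho> n < r) sequentially" using \<rho>_lim r(1) by (rule order_tendstoD(2))
  then show ?thesis
    by eventually_elim (auto simp: B_def dist_commute intro!: r(2))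
qed

lemma AE_X_notin_N0: "AE w in M. X i w \<notin> N0"
proof -
  have [simp]: "{z. z \<notin> N0} \<in> sets borel" using N0(1) by (simp add: Collect_neg_eq)
  have "AE z in distr M borel (X 0). z \<notin> N0" using N0(2) by (subst AE_distr_iff) simp_all
  then have "AE z in distr M borel (X i). z \<notin> N0" by (simp only: X_ident[of i])
  then show ?thesis by (subst (asm) AE_distr_iff) simp_all
qed

lemma kernel_product_integrable:
  assumes G2: "integrable (\<kappa> z) (\<lambda>y. (G y)\<^sup>2)" and g: "g \<in> \<G>" and h: "h \<in> \<G>"
  shows "integrable (\<kappa> z) (\<lambda>y. g y * h y)" "integrable (\<kappa> z) g"
proof -
  interpret K: prob_space "\<kappa> z" by (rule kernel_prob)
  have [measurable]: "g \<in> borel_measurable (\<kappa> z)" "h \<in> borel_measurable (\<kappa> z)"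
    using g_meas[OF g] g_meas[OF h] by (simp_all add: kernel_measurable_iff)
  have b: "\<bar>g y\<bar> \<le> G y" "\<bar>h y\<bar> \<le> G y" if "y \<in> space (\<kappa> z)" for y
    using G_bound[OF g, of y] G_bound[OF h, of y] that by simp_all
  show "integrable (\<kappa> z) (\<lambda>y. g y * h y)"
  proof (rule Bochner_Integration.integrable_bound[OF G2])
    show "AE y in \<kappa> z. norm (g y * h y) \<le> norm ((G y)\<^sup>2)"
    proof (rule AE_I2)
      fix y assume y: "y \<in> space (\<kappa> z)"
      have "\<bar>g y\<bar> * \<bar>h y\<bar> \<le> G y * G y" using b[OF y] by (intro mult_mono) auto
      then show "norm (g y * h y) \<le> norm ((G y)\<^sup>2)" by (simp add: abs_mult power2_eq_square)
    qed
  qed measurable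
  have "integrable (\<kappa> z) (\<lambda>y. 1 + (G y)\<^sup>2)" using G2 by simp
  then show "integrable (\<kappa> z) g"
  proof (rule Bochner_Integration.integrable_bound)
    show "AE y in \<kappa> z. norm (g y) \<le> norm (1 + (G y)\<^sup>2)"
    proof (rule AE_I2)
      fix y assume y: "y \<in> space (\<kappa> z)"
      have "0 \<le> (\<bar>G y\<bar> - 1)\<^sup>2 + \<bar>G y\<bar>" by simp
      then have "\<bar>G y\<bar> \<le> 1 + (G y)\<^sup>2" by (simp add: power2_diff)
      moreover have "\<bar>g y\<bar> \<le> \<bar>G y\<bar>" using b(1)[OF y] by linarith
      ultimately have "\<bar>g y\<bar> \<le> 1 + (G y)\<^sup>2" by linarith
      also have "\<dots> \<le> norm (1 + (G y)\<^sup>2)" by simp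
      finally show "norm (g y) \<le> norm (1 + (G y)\<^sup>2)" by simp
    qed
  qed measurable
qed

lemma kernel_moments:
  fixes e :: "nat \<Rightarrow> 's \<Rightarrow> real" and c :: "nat \<Rightarrow> real"
  assumes G2: "integrable (\<kappa> z) (\<lambda>y. (G y)\<^sup>2)" and e: "\<And>i. i < r \<Longrightarrow> e i \<in> \<G>"
  shows "(\<integral>y. (\<Sum>i<r. c i * e i y)\<^sup>2 \<partial>\<kappa> z) = (\<Sum>i<r. \<Sum>j<r. c i * c j * (\<integral>y. e i y * e j y \<partial>\<kappa> z))"
    "(\<integral>y. (\<Sum>i<r. c i * e i y) \<partial>\<kappa> z) = (\<Sum>i<r. c i * (\<integral>y. e i y \<partial>\<kappa> z))"
    "(\<integral>y. (\<Sum>i<r. c i * e i y) \<partial>\<kappa> z)\<^sup>2 \<le> (\<integral>y. (\<Sum>i<r. c i * e i y)\<^sup>2 \<partial>\<kappa> z)"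
proof -
  interpret K: prob_space "\<kappa> z" by (rule kernel_prob)
  have i2: "integrable (\<kappa> z) (\<lambda>y. e i y * e j y)" and i1: "integrable (\<kappa> z) (e i)" if "i < r" "j < r" for i j
    using kernel_product_integrable[OF G2 e[OF that(1)] e[OF that(2)]] by auto
  have sq: "(\<Sum>i<r. c i * e i y)\<^sup>2 = (\<Sum>i<r. \<Sum>j<r. c i * c j * (e i y * e j y))" for y
    by (simp add: power2_eq_square sum_product mult_ac)
  have i1': "integrable (\<kappa> z) (e i)" if "i < r" for i using i1[OF that that] .
  show m2: "(\<integral>y. (\<Sum>i<r. c i * e i y)\<^sup>2 \<partial>\<kappa> z) = (\<Sum>i<r. \<Sum>j<r. c i * c j * (\<integral>y. e i y * e j y \<partial>\<kappa> z))"
  proof -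
    have "(\<integral>y. (\<Sum>i<r. \<Sum>j<r. c i * c j * (e i y * e j y)) \<partial>\<kappa> z) = (\<Sum>i<r. \<integral>y. (\<Sum>j<r. c i * c j * (e i y * e j y)) \<partial>\<kappa> z)"
      by (rule Bochner_Integration.integral_sum) (auto intro!: Bochner_Integration.integrable_sum i2)
    also have "\<dots> = (\<Sum>i<r. \<Sum>j<r. \<integral>y. c i * c j * (e i y * e j y) \<partial>\<kappa> z)"
      by (intro sum.cong refl Bochner_Integration.integral_sum) (use i2 in simp)
    finally show ?thesis unfolding sq by simp
  qed
  show "(\<integral>y. (\<Sum>i<r. c i * e i y) \<partial>\<kappa> z) = (\<Sum>i<r. c i * (\<integral>y. e i y \<partial>\<kappa> z))"
    using i1' by (simp add: Bochner_Integration.integral_sum)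
  have "integrable (\<kappa> z) (\<lambda>y. (\<Sum>i<r. c i * e i y)\<^sup>2)"
    unfolding sq by (auto intro!: Bochner_Integration.integrable_sum i2)
  moreover have "integrable (\<kappa> z) (\<lambda>y. \<Sum>i<r. c i * e i y)" by (auto intro!: Bochner_Integration.integrable_sum i1')
  ultimately have "0 \<le> (\<integral>y. (\<Sum>i<r. c i * e i y)\<^sup>2 \<partial>\<kappa> z) - (\<integral>y. (\<Sum>i<r. c i * e i y) \<partial>\<kappa> z)\<^sup>2"
    by (subst K.variance_eq[symmetric]) (auto intro!: Bochner_Integration.integral_nonneg)
  then show "(\<integral>y. (\<Sum>i<r. c i * e i y) \<partial>\<kappa> z)\<^sup>2 \<le> (\<integral>y. (\<Sum>i<r. c i * e i y)\<^sup>2 \<partial>\<kappa> z)" by simp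
qed

lemma local_moments:
  fixes e :: "nat \<Rightarrow> 's \<Rightarrow> real" and c :: "nat \<Rightarrow> real" and \<epsilon> :: real and r :: nat
  defines "g \<equiv> \<lambda>y. \<Sum>i<r. c i * e i y" and "\<sigma> \<equiv> \<Sum>i<r. \<Sum>j<r. c i * c j * K (e i) (e j)"
    and "D \<equiv> \<bar>\<Sum>i<r. c i * c1 (e i)\<bar> + 1"
  assumes e: "\<And>i. i < r \<Longrightarrow> e i \<in> \<G>" and \<epsilon>: "\<epsilon> > 0"
  shows "eventually (\<lambda>n. n \<ge> n0 \<and> (\<forall>i. AE w in M. X i w \<in> B n \<longrightarrow>
      \<bar>(\<integral>y. (g y)\<^sup>2 \<partial>\<kappa> (X i w)) - (\<integral>y. g y \<partial>\<kappa> (X i w))\<^sup>2 - \<sigma>\<bar> \<le> \<epsilon> \<and> \<bar>\<integral>y. g y \<partial>\<kappa> (X i w)\<bar> \<le> D \<and>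
      0 \<le> (\<integral>y. (g y)\<^sup>2 \<partial>\<kappa> (X i w)) - (\<integral>y. g y \<partial>\<kappa> (X i w))\<^sup>2)) sequentially"
proof -
  let ?F = "inf (nhds x) (principal (- N0))"
  let ?m1 = "\<lambda>z. \<Sum>i<r. c i * (\<integral>y. e i y \<partial>\<kappa> z)"
  let ?m2 = "\<lambda>z. \<Sum>i<r. \<Sum>j<r. c i * c j * (\<integral>y. e i y * e j y \<partial>\<kappa> z)"
  have t1: "(?m1 \<longlongrightarrow> (\<Sum>i<r. c i * c1 (e i))) ?F" by (intro tendsto_intros lim1) (simp add: e)
  have t2: "(?m2 \<longlongrightarrow> (\<Sum>i<r. \<Sum>j<r. c i * c j * c2 (e i) (e j))) ?F" by (intro tendsto_intros lim2) (simp_all add: e)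
  have \<sigma>: "\<sigma> = (\<Sum>i<r. \<Sum>j<r. c i * c j * c2 (e i) (e j)) - (\<Sum>i<r. c i * c1 (e i))\<^sup>2"
    by (simp add: \<sigma>_def K_def power2_eq_square sum_product sum_subtractf[symmetric] algebra_simps)
  have "((\<lambda>z. \<bar>?m2 z - (?m1 z)\<^sup>2 - \<sigma>\<bar>) \<longlongrightarrow> \<bar>\<sigma> - \<sigma>\<bar>) ?F"
    unfolding \<sigma> by (intro tendsto_intros t1 t2)
  then have "eventually (\<lambda>z. \<bar>?m2 z - (?m1 z)\<^sup>2 - \<sigma>\<bar> < \<epsilon>) ?F" using \<epsilon> by (auto intro: order_tendstoD(2))
  moreover have "((\<lambda>z. \<bar>?m1 z\<bar>) \<longlongrightarrow> \<bar>\<Sum>i<r. c i * c1 (e i)\<bar>) ?F" by (intro tendsto_intros t1)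
  then have "eventually (\<lambda>z. \<bar>?m1 z\<bar> < D) ?F" by (rule order_tendstoD(2)) (simp add: D_def)
  ultimately have "eventually (\<lambda>z. \<bar>?m2 z - (?m1 z)\<^sup>2 - \<sigma>\<bar> < \<epsilon> \<and> \<bar>?m1 z\<bar> < D) ?F" by (rule eventually_conj)
  from B_shrinks[OF this] eventually_ge_at_top[of n0]
  show ?thesis
  proof eventually_elim
    case (elim n)
    interpret L: local_sample M S X Y \<kappa> "{1..n}" "N n" "B n" "real (k n)" G by (rule local_sample[OF elim(2)])
    have "AE w in M. X i w \<in> B n \<longrightarrow>
      \<bar>(\<integral>y. (g y)\<^sup>2 \<partial>\<kappa> (X i w)) - (\<integral>y. g y \<partial>\<kappa> (X i w))\<^sup>2 - \<sigma>\<bar> \<le> \<epsilon> \<and> \<bar>\<integral>y. g y \<partial>\<kappa> (X i w)\<bar> \<le> D \<and>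
      0 \<le> (\<integral>y. (g y)\<^sup>2 \<partial>\<kappa> (X i w)) - (\<integral>y. g y \<partial>\<kappa> (X i w))\<^sup>2" for i
      using L.AE_kernel_integrable[of i] AE_X_notin_N0[of i]
    proof eventually_elim
      case (elim w)
      show ?case
      proof
        assume wM: "X i w \<in> B n"
        have G2: "integrable (\<kappa> (X i w)) (\<lambda>y. (G y)\<^sup>2)" using elim(1) wM by blast
        have "\<bar>?m2 (X i w) - (?m1 (X i w))\<^sup>2 - \<sigma>\<bar> < \<epsilon> \<and> \<bar>?m1 (X i w)\<bar> < D"
          using \<open>\<forall>z\<in>B n. z \<notin> N0 \<longrightarrow> \<bar>?m2 z - (?m1 z)\<^sup>2 - \<sigma>\<bar> < \<epsilon> \<and> \<bar>?m1 z\<bar> < D\<close> wM elim(2) by blast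
        then show "\<bar>(\<integral>y. (g y)\<^sup>2 \<partial>\<kappa> (X i w)) - (\<integral>y. g y \<partial>\<kappa> (X i w))\<^sup>2 - \<sigma>\<bar> \<le> \<epsilon> \<and> \<bar>\<integral>y. g y \<partial>\<kappa> (X i w)\<bar> \<le> D \<and>
          0 \<le> (\<integral>y. (g y)\<^sup>2 \<partial>\<kappa> (X i w)) - (\<integral>y. g y \<partial>\<kappa> (X i w))\<^sup>2"
          using kernel_moments(3)[OF G2, of r e c] e unfolding g_def
          by (simp add: kernel_moments(1,2)[OF G2, of r e c] e)
      qed
    qed
    then show ?case using elim(2) by blast
  qed
qed

lemma K_nonneg:
  fixes e :: "nat \<Rightarrow> 's \<Rightarrow> real" and c :: "nat \<Rightarrow> real"
  assumes e: "\<And>i. i < r \<Longrightarrow> e i \<in> \<G>"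
  shows "0 \<le> (\<Sum>i<r. \<Sum>j<r. c i * c j * K (e i) (e j))" (is "0 \<le> ?\<sigma>")
proof (rule field_le_epsilon)
  fix \<epsilon> :: real assume \<epsilon>: "\<epsilon> > 0"
  obtain n where n: "n \<ge> n0" and ae: "AE w in M. X 0 w \<in> B n \<longrightarrow>
      \<bar>(\<integral>y. (\<Sum>i<r. c i * e i y)\<^sup>2 \<partial>\<kappa> (X 0 w)) - (\<integral>y. (\<Sum>i<r. c i * e i y) \<partial>\<kappa> (X 0 w))\<^sup>2 - ?\<sigma>\<bar> \<le> \<epsilon> \<and>
      \<bar>\<integral>y. (\<Sum>i<r. c i * e i y) \<partial>\<kappa> (X 0 w)\<bar> \<le> \<bar>\<Sum>i<r. c i * c1 (e i)\<bar> + 1 \<and>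
      0 \<le> (\<integral>y. (\<Sum>i<r. c i * e i y)\<^sup>2 \<partial>\<kappa> (X 0 w)) - (\<integral>y. (\<Sum>i<r. c i * e i y) \<partial>\<kappa> (X 0 w))\<^sup>2"
    using eventually_happens'[OF sequentially_bot local_moments[where r=r and c=c and e=e, OF e \<epsilon>]] by blast
  show "0 \<le> ?\<sigma> + \<epsilon>"
  proof (rule ccontr)
    assume neg: "\<not> 0 \<le> ?\<sigma> + \<epsilon>"
    have "AE w in M. X 0 w \<notin> B n" using ae by eventually_elim (use neg in linarith)
    then have "prob {w \<in> space M. X 0 w \<in> B n} = 0"
      by (subst prob_Collect_eq_0) auto
    then show False using p_pos[OF n] by (simp add: p_def)
  qed
qed

end

lemma (in prob_space) integral_close:
  fixes u v :: "'a \<Rightarrow> complex"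
  assumes [measurable]: "u \<in> borel_measurable M" "v \<in> borel_measurable M" and E [measurable]: "E \<in> events"
    and u: "\<And>w. cmod (u w) \<le> 1" and v: "\<And>w. cmod (v w) \<le> 1" and eq: "AE w in M. w \<notin> E \<longrightarrow> u w = v w"
  shows "cmod ((\<integral>w. u w \<partial>M) - (\<integral>w. v w \<partial>M)) \<le> 2 * prob E"
proof -
  have iu: "integrable M u" by (rule integrable_const_bound[of _ 1]) (use u in auto)
  have iv: "integrable M v" by (rule integrable_const_bound[of _ 1]) (use v in auto)
  have "cmod ((\<integral>w. u w \<partial>M) - (\<integral>w. v w \<partial>M)) = cmod (\<integral>w. u w - v w \<partial>M)" using iu iv by simp
  also have "\<dots> \<le> (\<integral>w. cmod (u w - v w) \<partial>M)" by (rule integral_norm_bound)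
  also have "\<dots> \<le> (\<integral>w. 2 * indicator E w \<partial>M)"
  proof (rule integral_mono_AE)
    show "integrable M (\<lambda>w. cmod (u w - v w))" using iu iv by simp
    show "integrable M (\<lambda>w. 2 * indicator E w :: real)"
      by (intro integrable_mult_right integrable_real_indicator) (auto simp: emeasure_eq_measure)
    show "AE w in M. cmod (u w - v w) \<le> 2 * indicator E w"
      using eq
    proof eventually_elim
      case (elim w)
      have "cmod (u w - v w) \<le> cmod (u w) + cmod (v w)" by (rule norm_triangle_ineq4)
      then have "cmod (u w - v w) \<le> 2" using u[of w] v[of w] by linarith
      then show ?case using elim by (auto simp: indicator_def)
    qed
  qed
  also have "\<dots> = 2 * prob E" by simp
  finally show ?thesis .
qed

context neighbour_sample begin

lemma k_real_lim: "filterlim (\<lambda>n. real (k n)) at_top sequentially"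
  by (rule filterlim_compose[OF filterlim_real_sequentially k_lim])

lemma sqrt_k_ge: "eventually (\<lambda>n. n \<ge> n0 \<and> t \<le> sqrt (real (k n))) sequentially"
proof -
  have "filterlim (\<lambda>n. sqrt (real (k n))) at_top sequentially"
    by (rule filterlim_compose[OF sqrt_at_top k_real_lim])
  then have "eventually (\<lambda>n. t \<le> sqrt (real (k n))) sequentially" by (simp add: filterlim_at_top)
  then show ?thesis using eventually_ge_at_top[of n0] by eventually_elim simp
qed

lemma combination_bound:
  fixes e :: "nat \<Rightarrow> 's \<Rightarrow> real" and c :: "nat \<Rightarrow> real" and r :: nat
  assumes e: "\<And>i. i < r \<Longrightarrow> e i \<in> \<G>" and y: "y \<in> space S"
  shows "\<bar>\<Sum>i<r. c i * e i y\<bar> \<le> ((\<Sum>i<r. \<bar>c i\<bar>) + 1) * G y"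
proof -
  have "\<bar>\<Sum>i<r. c i * e i y\<bar> \<le> (\<Sum>i<r. \<bar>c i * e i y\<bar>)" by (rule sum_abs)
  also have "\<dots> \<le> (\<Sum>i<r. \<bar>c i\<bar> * G y)"
    by (rule sum_mono) (auto simp: abs_mult intro!: mult_left_mono G_bound[OF e y])
  also have "\<dots> \<le> ((\<Sum>i<r. \<bar>c i\<bar>) + 1) * G y" using G_nonneg[OF y] by (simp add: sum_distrib_right[symmetric] distrib_right)
  finally show ?thesis .
qed

lemma char_V_limit:
  fixes e :: "nat \<Rightarrow> 's \<Rightarrow> real" and c :: "nat \<Rightarrow> real" and r :: nat
  assumes e: "\<And>i. i < r \<Longrightarrow> e i \<in> \<G>"
  shows "(\<lambda>n. \<integral>w. iexp (V n (\<lambda>y. \<Sum>i<r. c i * e i y) w) \<partial>M) \<longlonglongrightarrow>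
    complex_of_real (exp (- (\<Sum>i<r. \<Sum>j<r. c i * c j * K (e i) (e j)) / 2))"
proof -
  define g where "g = (\<lambda>y. \<Sum>i<r. c i * e i y)"
  define \<sigma> where "\<sigma> = (\<Sum>i<r. \<Sum>j<r. c i * c j * K (e i) (e j))"
  define D where "D = \<bar>\<Sum>i<r. c i * c1 (e i)\<bar> + 1"
  define A where "A = (\<Sum>i<r. \<bar>c i\<bar>) + 1"
  have A: "A > 0" unfolding A_def by (intro add_nonneg_pos sum_nonneg) auto
  have gG: "\<bar>g y\<bar> \<le> A * G y" if "y \<in> space S" for y using combination_bound[where r=r and c=c and e=e, OF e that] by (simp add: g_def A_def)
  have gm: "g \<in> borel_measurable S" unfolding g_def using g_meas[OF e] by measurable
  have \<sigma>0: "0 \<le> \<sigma>" unfolding \<sigma>_def by (rule K_nonneg[OF e])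
  let ?pow = "\<lambda>n. (1 - \<sigma> / (2 * real (k n))) ^ k n"
  have "(\<lambda>n. (1 + (- \<sigma> / 2) / real n) ^ n) \<longlonglongrightarrow> exp (- \<sigma> / 2)" by (rule tendsto_exp_limit_sequentially)
  from filterlim_compose[OF this k_lim] have pow: "?pow \<longlonglongrightarrow> exp (- \<sigma> / 2)" by (simp add: field_simps)
  have close: "(\<lambda>n. (\<integral>w. iexp (V n g w) \<partial>M) - complex_of_real (?pow n)) \<longlonglongrightarrow> 0"
  proof (rule LIMSEQ_I)
    fix \<epsilon> :: real assume \<epsilon>: "\<epsilon> > 0"
    have \<epsilon>4: "\<epsilon> / 4 > 0" and \<epsilon>16: "\<epsilon> / 16 > 0" using \<epsilon> by simp_all
    obtain t where t: "t > 0" "\<And>n s. n \<ge> n0 \<Longrightarrow> t \<le> s \<Longrightarrow>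
      local_sample.m M X Y {1..n} (B n) (real (k n)) (\<lambda>y. (G y)\<^sup>2 * (if s < G y then 1 else 0)) \<le> \<epsilon> / (16 * A\<^sup>2)"
      using m_tail[of "\<epsilon> / (16 * A\<^sup>2)"] \<epsilon> A by auto
    define R where "R = max (2 * D) (2 * A * t)"
    have R: "2 * D \<le> R" "0 < R" "t \<le> R / (2 * A)"
      using A by (auto simp: R_def D_def field_simps less_max_iff_disj le_max_iff_disj)
    have lm: "eventually (\<lambda>n. n \<ge> n0 \<and> (\<forall>i. AE w in M. X i w \<in> B n \<longrightarrow>
      \<bar>(\<integral>y. (g y)\<^sup>2 \<partial>\<kappa> (X i w)) - (\<integral>y. g y \<partial>\<kappa> (X i w))\<^sup>2 - \<sigma>\<bar> \<le> \<epsilon> / 4 \<and> \<bar>\<integral>y. g y \<partial>\<kappa> (X i w)\<bar> \<le> D \<and>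
      0 \<le> (\<integral>y. (g y)\<^sup>2 \<partial>\<kappa> (X i w)) - (\<integral>y. g y \<partial>\<kappa> (X i w))\<^sup>2)) sequentially"
      unfolding g_def \<sigma>_def D_def by (rule local_moments[OF e \<epsilon>4])
    have "eventually (\<lambda>n. n \<ge> n0 \<and> max (64 * R ^ 3 / \<epsilon>) (sqrt \<sigma>) \<le> sqrt (real (k n))) sequentially"
      by (rule sqrt_k_ge)
    then have "eventually (\<lambda>n. cmod ((\<integral>w. iexp (V n g w) \<partial>M) - complex_of_real (?pow n)) < \<epsilon>) sequentially"
      using lm exp_k_small[OF \<epsilon>16]
    proof eventually_elim
      case (elim n)
      then have n: "n \<ge> n0" and k64: "64 * R ^ 3 / \<epsilon> \<le> sqrt (real (k n))" and k\<sigma>: "sqrt \<sigma> \<le> sqrt (real (k n))" by simp_all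
      interpret L: local_sample M S X Y \<kappa> "{1..n}" "N n" "B n" "real (k n)" G by (rule local_sample[OF n])
      have kp: "real (k n) > 0" by (rule k_pos[OF n])
      obtain E where E: "E \<in> events" "prob E \<le> exp (- real (k n))"
        "\<And>w. w \<in> space M - E \<Longrightarrow> N n (\<lambda>j. X j w) = nn_set (\<lambda>j. X j w) n (k n) x"
        using neighbours_in_ball[OF n] by blast
      have "{w \<in> space M. card (sel (N n) w) \<noteq> k n} \<subseteq> E"
        using E(3) card_nn_set[of "k n" n] k_range[OF n] by fastforce
      then have "prob {w \<in> space M. card (sel (N n) w) \<noteq> k n} \<le> prob E" by (intro finite_measure_mono E(1))
      also have "\<dots> \<le> \<epsilon> / 16" using E(2) \<epsilon> elim(3) by linarith
      finally have b1: "prob {w \<in> space M. card (sel (N n) w) \<noteq> k n} \<le> \<epsilon> / 16" .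
      have "cmod ((\<integral>w. iexp (L.V g w) \<partial>M) - complex_of_real ((1 - \<sigma> / (2 * real (k n))) ^ k n)) \<le>
        2 * prob {w \<in> space M. card (sel (N n) w) \<noteq> k n} + (\<epsilon> / 4) / 2
        + R ^ 3 / (6 * sqrt (real (k n))) * (card {1..n} * prob {w \<in> space M. X 0 w \<in> B n} / real (k n))
        + 4 * A\<^sup>2 * L.m (\<lambda>y. (G y)\<^sup>2 * (if R < 2 * A * G y then 1 else 0))"
      proof (rule L.char_V[OF gm gG A refl \<sigma>0 _ _ R(1,2)])
        have "\<sigma> \<le> real (k n)" using k\<sigma> by simp
        then show "\<sigma> \<le> 2 * real (k n)" using kp by linarith
        show "0 \<le> \<epsilon> / 4" using \<epsilon> by simp
        have ae: "AE w in M. X i w \<in> B n \<longrightarrow>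
          \<bar>(\<integral>y. (g y)\<^sup>2 \<partial>\<kappa> (X i w)) - (\<integral>y. g y \<partial>\<kappa> (X i w))\<^sup>2 - \<sigma>\<bar> \<le> \<epsilon> / 4 \<and> \<bar>\<integral>y. g y \<partial>\<kappa> (X i w)\<bar> \<le> D \<and>
          0 \<le> (\<integral>y. (g y)\<^sup>2 \<partial>\<kappa> (X i w)) - (\<integral>y. g y \<partial>\<kappa> (X i w))\<^sup>2" for i
          using elim(2) by blast
        show "AE w in M. X i w \<in> B n \<longrightarrow>
          \<bar>(\<integral>y. (g y)\<^sup>2 \<partial>\<kappa> (X i w)) - (\<integral>y. g y \<partial>\<kappa> (X i w))\<^sup>2 - \<sigma>\<bar> \<le> \<epsilon> / 4 \<and> \<bar>\<integral>y. g y \<partial>\<kappa> (X i w)\<bar> \<le> D" for i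
          using ae[of i] by eventually_elim blast
      qed
      moreover have "R ^ 3 / (6 * sqrt (real (k n))) * (card {1..n} * prob {w \<in> space M. X 0 w \<in> B n} / real (k n)) \<le> \<epsilon> / 16"
      proof -
        have "64 * R ^ 3 \<le> \<epsilon> * sqrt (real (k n))" using k64 \<epsilon> by (simp add: divide_le_eq mult.commute)
        then have "R ^ 3 / (6 * sqrt (real (k n))) \<le> \<epsilon> / (6 * 64)" using kp by (simp add: divide_le_eq)
        moreover have "card {1..n} * prob {w \<in> space M. X 0 w \<in> B n} / real (k n) \<le> 16"
          using np(2)[OF n] kp by (simp add: divide_le_eq p_def)
        ultimately have "R ^ 3 / (6 * sqrt (real (k n))) * (card {1..n} * prob {w \<in> space M. X 0 w \<in> B n} / real (k n)) \<le> \<epsilon> / (6 * 64) * 16"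
          using \<epsilon> kp by (intro mult_mono) auto
        moreover have "\<epsilon> / (6 * 64) * 16 \<le> \<epsilon> / 16" using \<epsilon> by simp
        ultimately show ?thesis by (rule order_trans)
      qed
      moreover have "4 * A\<^sup>2 * L.m (\<lambda>y. (G y)\<^sup>2 * (if R < 2 * A * G y then 1 else 0)) \<le> \<epsilon> / 4"
      proof -
        have "(R < 2 * A * G y) = (R / (2 * A) < G y)" for y using A by (simp add: divide_less_eq mult.commute)
        then have "L.m (\<lambda>y. (G y)\<^sup>2 * (if R < 2 * A * G y then 1 else 0)) \<le> \<epsilon> / (16 * A\<^sup>2)"
          using t(2)[OF n R(3)] by simp
        then have "4 * A\<^sup>2 * L.m (\<lambda>y. (G y)\<^sup>2 * (if R < 2 * A * G y then 1 else 0)) \<le> 4 * A\<^sup>2 * (\<epsilon> / (16 * A\<^sup>2))"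
          by (rule mult_left_mono) simp
        also have "\<dots> = \<epsilon> / 4" using A by simp
        finally show ?thesis .
      qed
      ultimately have "cmod ((\<integral>w. iexp (L.V g w) \<partial>M) - complex_of_real (?pow n)) < \<epsilon>" using b1 \<epsilon> by linarith
      moreover have "L.V g = V n g" by (rule ext) (simp add: L.V_def V_def)
      ultimately show ?case by simp
    qed
    then show "\<exists>no. \<forall>n\<ge>no. cmod ((\<integral>w. iexp (V n g w) \<partial>M) - complex_of_real (?pow n) - 0) < \<epsilon>"
      by (simp add: eventually_sequentially)
  qed
  have "(\<lambda>n. complex_of_real (?pow n)) \<longlonglongrightarrow> complex_of_real (exp (- \<sigma> / 2))" by (intro tendsto_of_real pow)
  from tendsto_add[OF close this] show ?thesis by (simp add: g_def \<sigma>_def)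
qed

lemma char_Z_limit:
  fixes e :: "nat \<Rightarrow> 's \<Rightarrow> real" and c :: "nat \<Rightarrow> real" and r :: nat
  assumes e: "\<And>i. i < r \<Longrightarrow> e i \<in> \<G>"
  shows "(\<lambda>n. \<integral>w. iexp (\<Sum>i<r. c i * Z n w (e i)) \<partial>M) \<longlonglongrightarrow>
    complex_of_real (exp (- (\<Sum>i<r. \<Sum>j<r. c i * c j * K (e i) (e j)) / 2))"
proof -
  let ?g = "\<lambda>y. \<Sum>i<r. c i * e i y"
  have gm: "?g \<in> borel_measurable S" using g_meas[OF e] by measurable
  have "(\<lambda>n. (\<integral>w. iexp (\<Sum>i<r. c i * Z n w (e i)) \<partial>M) - (\<integral>w. iexp (V n ?g w) \<partial>M)) \<longlonglongrightarrow> 0"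
  proof (rule LIMSEQ_I)
    fix \<epsilon> :: real assume \<epsilon>: "\<epsilon> > 0"
    then have \<epsilon>4: "\<epsilon> / 4 > 0" by simp
    have "eventually (\<lambda>n. cmod ((\<integral>w. iexp (\<Sum>i<r. c i * Z n w (e i)) \<partial>M) - (\<integral>w. iexp (V n ?g w) \<partial>M)) < \<epsilon>) sequentially"
      using eventually_ge_at_top[of n0] exp_k_small[OF \<epsilon>4]
    proof eventually_elim
      case (elim n)
      interpret L: local_sample M S X Y \<kappa> "{1..n}" "N n" "B n" "real (k n)" G by (rule local_sample[OF elim(1)])
      have LV: "L.V h w = V n h w" for h w by (simp add: L.V_def V_def)
      obtain E where E: "E \<in> events" "prob E \<le> exp (- real (k n))"
        "\<And>w. w \<in> space M - E \<Longrightarrow> N n (\<lambda>j. X j w) = nn_set (\<lambda>j. X j w) n (k n) x"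
        using neighbours_in_ball[OF elim(1)] by blast
      have "cmod ((\<integral>w. iexp (\<Sum>i<r. c i * Z n w (e i)) \<partial>M) - (\<integral>w. iexp (V n ?g w) \<partial>M)) \<le> 2 * prob E"
      proof (rule integral_close)
        have [measurable]: "(\<lambda>w. Z n w (e i)) \<in> borel_measurable M" if "i < r" for i
          by (rule Z_measurable'[OF g_meas[OF e[OF that]]])
        have "(\<lambda>w. \<Sum>i<r. c i * Z n w (e i)) \<in> borel_measurable M" by measurable
        then show "(\<lambda>w. iexp (\<Sum>i<r. c i * Z n w (e i))) \<in> borel_measurable M" by measurable
        have "V n ?g \<in> borel_measurable M" using L.V_measurable[OF gm] by (simp add: LV[abs_def])
        then show "(\<lambda>w. iexp (V n ?g w)) \<in> borel_measurable M" by measurable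
        show "AE w in M. w \<notin> E \<longrightarrow> iexp (\<Sum>i<r. c i * Z n w (e i)) = iexp (V n ?g w)"
          using L.AE_regular AE_space
        proof eventually_elim
          case (elim w)
          have be: "L.bounded_by_envelope (\<lambda>y. c i * e i y)" if "i < r" for i
            unfolding L.bounded_by_envelope_def
          proof (intro conjI exI ballI)
            show "(\<lambda>y. c i * e i y) \<in> borel_measurable S" using g_meas[OF e[OF that]] by measurable
            show "\<bar>c i * e i y\<bar> \<le> \<bar>c i\<bar> * G y" if "y \<in> space S" for y
              unfolding abs_mult by (intro mult_left_mono G_bound e \<open>i < r\<close> that) simp
          qed
          have "V n (\<lambda>y. c i * e i y) w = c i * V n (e i) w" for i
            by (simp add: V_def csum_def cent_def sum_distrib_left right_diff_distrib)
          then have "V n ?g w = (\<Sum>i<r. c i * V n (e i) w)"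
            using L.V_sum[OF elim(1), of "{..<r}" "\<lambda>i y. c i * e i y"] be by (simp add: LV)
          then show ?case using E(3)[of w] elim(2) by (simp add: Z_eq_V)
        qed
      qed (use E(1) in auto)
      then show ?case using E(2) elim(2) \<epsilon> by linarith
    qed
    then show "\<exists>no. \<forall>n\<ge>no. cmod ((\<integral>w. iexp (\<Sum>i<r. c i * Z n w (e i)) \<partial>M) - (\<integral>w. iexp (V n ?g w) \<partial>M) - 0) < \<epsilon>"
      by (simp add: eventually_sequentially)
  qed
  from tendsto_add[OF this char_V_limit[where r=r and c=c and e=e, OF e]] show ?thesis by simp
qed

lemma chaining_system:
  fixes j c :: real
  assumes n: "n \<ge> n0" and J: "bracketing_integral \<G> G (localized (B n)) ((1/2) ^ q0) \<le> ennreal j" and j: "j \<ge> 0"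
    and c: "c \<ge> 1" "(\<integral>y. (G y)\<^sup>2 \<partial>localized (B n)) \<le> c\<^sup>2"
  obtains C where "chaining M S X Y \<kappa> {1..n} (N n) (B n) (real (k n)) G \<G> C q0 (4 * c) ((2 * real q0 + 4) * (1/2) ^ q0 + 8 * j)"
    "\<And>P. (\<Sum>p\<le>P. (1/2) ^ (q0 + p + 1) * sqrt (ln (card (C p)))) \<le> j"
proof -
  let ?Q = "localized (B n)"
  interpret L: local_sample M S X Y \<kappa> "{1..n}" "N n" "B n" "real (k n)" G by (rule local_sample[OF n])
  have nrm0: "0 \<le> L2_nrm ?Q G" unfolding L2_nrm_def by simp
  have nrm: "L2_nrm ?Q G \<le> c" unfolding L2_nrm_def using c by (intro real_le_lsqrt) auto
  obtain num where num: "\<And>p. bracketing_number \<G> ?Q ((1/2) ^ (q0 + p) * L2_nrm ?Q G) = enat (num p)"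
    "\<And>P. (\<Sum>p\<le>P. (1/2) ^ (q0 + p + 1) * sqrt (ln (num p))) \<le> j"
    using bracketing_integral_levels[OF J nrm0 j] by blast
  define \<Phi> where "\<Phi> p C \<longleftrightarrow> finite C \<and> card C = num p \<and> (\<forall>b\<in>C. fst b \<in> L2_space ?Q \<and> snd b \<in> L2_space ?Q \<and>
      L2_nrm ?Q (\<lambda>s. fst b s - snd b s) \<le> (1/2) ^ (q0 + p) * L2_nrm ?Q G) \<and>
      (\<forall>g\<in>\<G>. \<exists>b\<in>C. \<forall>s\<in>space ?Q. fst b s \<le> g s \<and> g s \<le> snd b s)" for p C
  have "\<exists>C. \<Phi> p C" for p
    unfolding \<Phi>_def by (rule bracketing_number_cover[OF num(1)[of p]]) blast
  then obtain C where "\<And>p. \<Phi> p (C p)" using choice[of \<Phi>] by blast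
  then have C: "\<And>p. finite (C p)" "\<And>p. card (C p) = num p"
    "\<And>p b. b \<in> C p \<Longrightarrow> fst b \<in> L2_space ?Q \<and> snd b \<in> L2_space ?Q \<and>
      L2_nrm ?Q (\<lambda>s. fst b s - snd b s) \<le> (1/2) ^ (q0 + p) * L2_nrm ?Q G"
    "\<And>p g. g \<in> \<G> \<Longrightarrow> \<exists>b\<in>C p. \<forall>s\<in>space ?Q. fst b s \<le> g s \<and> g s \<le> snd b s"
    unfolding \<Phi>_def by blast+
  have sum: "(\<Sum>p\<le>P. (1/2) ^ (q0 + p + 1) * sqrt (ln (card (C p)))) \<le> j" for P
    using num(2)[of P] by (simp only: C(2))
  have s0: "0 \<le> sqrt (ln (real (card (C p))))" for p by (cases "card (C p) = 0") auto
  show ?thesis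
  proof (rule that)
    show "(\<Sum>p\<le>P. (1/2) ^ (q0 + p + 1) * sqrt (ln (card (C p)))) \<le> j" for P by (rule sum)
    show "chaining M S X Y \<kappa> {1..n} (N n) (B n) (real (k n)) G \<G> C q0 (4 * c) ((2 * real q0 + 4) * (1/2) ^ q0 + 8 * j)"
    proof unfold_locales
      show "g \<in> borel_measurable S" if "g \<in> \<G>" for g by (rule g_meas[OF that])
      show "\<bar>g y\<bar> \<le> G y" if "g \<in> \<G>" "y \<in> space S" for g y by (rule G_bound[OF that])
      show "finite (C p)" for p by (rule C(1))
      show "\<exists>b\<in>C p. \<forall>y\<in>space S. fst b y \<le> g y \<and> g y \<le> snd b y" if "g \<in> \<G>" for p g
        using C(4)[OF that, of p] by simp
      show meas: "fst b \<in> borel_measurable S \<and> snd b \<in> borel_measurable S" if "b \<in> C p" for p b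
        using C(3)[OF that] by (simp add: L2_space_def measurable_Q)
      have sq: "integrable ?Q (\<lambda>y. (fst b y - snd b y)\<^sup>2)" if "b \<in> C p" for p b
      proof -
        have "integrable ?Q (\<lambda>y. 2 * (fst b y)\<^sup>2 + 2 * (snd b y)\<^sup>2)"
          using C(3)[OF that] by (simp add: L2_space_def)
        then show ?thesis
        proof (rule Bochner_Integration.integrable_bound)
          show "(\<lambda>y. (fst b y - snd b y)\<^sup>2) \<in> borel_measurable ?Q" using meas[OF that] by (auto simp: measurable_Q intro!: borel_measurable_power borel_measurable_diff)
          have "(u - v)\<^sup>2 \<le> 2 * u\<^sup>2 + 2 * v\<^sup>2" for u v :: real
            using zero_le_power2[of "u + v"] by (simp add: power2_sum power2_diff)
          then show "AE y in ?Q. norm ((fst b y - snd b y)\<^sup>2) \<le> norm (2 * (fst b y)\<^sup>2 + 2 * (snd b y)\<^sup>2)" by simp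
        qed
      qed
      show "integrable M (\<lambda>w. indicator (B n) (X 0 w) * (fst b (Y 0 w) - snd b (Y 0 w))\<^sup>2)" if "b \<in> C p" for p b
      proof -
        have [measurable]: "fst b \<in> borel_measurable S" "snd b \<in> borel_measurable S" using meas[OF that] by auto
        show ?thesis using sq[OF that] p_pos[OF n] by (subst (asm) integral_localized(1)) (simp_all add: p_def)
      qed
      show "L.m (\<lambda>y. (fst b y - snd b y)\<^sup>2) \<le> (4 * c)\<^sup>2 * (1/4) ^ (q0 + p)" if "b \<in> C p" for p b
      proof -
        have [measurable]: "fst b \<in> borel_measurable S" "snd b \<in> borel_measurable S" using meas[OF that] by auto
        have "L.m (\<lambda>y. (fst b y - snd b y)\<^sup>2) \<le> 16 * (\<integral>y. (fst b y - snd b y)\<^sup>2 \<partial>?Q)"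
          by (rule m_le[OF n]) auto
        also have "(\<integral>y. (fst b y - snd b y)\<^sup>2 \<partial>?Q) = (L2_nrm ?Q (\<lambda>s. fst b s - snd b s))\<^sup>2"
          by (simp add: L2_nrm_def)
        also have "\<dots> \<le> ((1/2) ^ (q0 + p) * c)\<^sup>2"
        proof (rule power_mono)
          have "L2_nrm ?Q (\<lambda>s. fst b s - snd b s) \<le> (1/2) ^ (q0 + p) * L2_nrm ?Q G" using C(3)[OF that] by blast
          also have "\<dots> \<le> (1/2) ^ (q0 + p) * c" using nrm by (intro mult_left_mono) auto
          finally show "L2_nrm ?Q (\<lambda>s. fst b s - snd b s) \<le> (1/2) ^ (q0 + p) * c" .
        qed (simp add: L2_nrm_def)
        also have "16 * ((1/2) ^ (q0 + p) * c)\<^sup>2 = (4 * c)\<^sup>2 * (1/4) ^ (q0 + p)"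
        proof -
          have "((1/2 :: real) ^ (q0 + p))\<^sup>2 = (1/4) ^ (q0 + p)"
            by (simp only: power2_eq_square power_mult_distrib[symmetric]) simp
          then show ?thesis by (simp add: power_mult_distrib)
        qed
        finally show ?thesis by simp
      qed
      show "(\<Sum>i\<le>m. (1/2) ^ (q0 + i) * (real (q0 + i + 1) + (\<Sum>p\<le>Suc i. sqrt (ln (card (C p)))))) \<le>
          (2 * real q0 + 4) * (1/2) ^ q0 + 8 * j" for m
        by (rule level_sum_bound[OF s0 sum])
    qed
  qed
qed

lemma exp_bound_of_level:
  fixes j :: real and q0 :: nat
  defines "w \<equiv> 2 ^ (q0 + 1) * j"
  assumes sum: "\<And>P. (\<Sum>p\<le>P. (1/2) ^ (q0 + p + 1) * sqrt (ln (real (u p)))) \<le> j" and j: "j \<ge> 0"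
  shows "real (u 0) \<le> exp (w\<^sup>2)" "sqrt (ln (u 0)) + sqrt (ln (u (Suc 0))) \<le> 3 * w"
proof -
  have s0: "0 \<le> sqrt (ln (real (u p)))" for p by (cases "u p = 0") auto
  have w: "0 \<le> w" using j by (simp add: w_def)
  have inv: "2 ^ a * (1/2 :: real) ^ a = 1" for a by (simp add: power_mult_distrib[symmetric])
  have "(1/2) ^ (q0 + 1) * sqrt (ln (u 0)) \<le> j" using sum[of 0] by simp
  then have "2 ^ (q0 + 1) * ((1/2) ^ (q0 + 1) * sqrt (ln (u 0))) \<le> w"
    unfolding w_def by (rule mult_left_mono) simp
  then have u0: "sqrt (ln (u 0)) \<le> w" unfolding mult.assoc[symmetric] inv by simp
  have "(1/2) ^ (q0 + 2) * sqrt (ln (u 1)) \<le> (\<Sum>p\<le>1. (1/2) ^ (q0 + p + 1) * sqrt (ln (u p)))"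
    using s0[of 0] by simp
  also have "\<dots> \<le> j" by (rule sum)
  finally have "2 ^ (q0 + 2) * ((1/2) ^ (q0 + 2) * sqrt (ln (u 1))) \<le> 2 ^ (q0 + 2) * j"
    by (rule mult_left_mono) simp
  then have "sqrt (ln (u 1)) \<le> 2 * w" unfolding mult.assoc[symmetric] inv by (simp add: w_def)
  then show "sqrt (ln (u 0)) + sqrt (ln (u (Suc 0))) \<le> 3 * w" using u0 by simp
  show "real (u 0) \<le> exp (w\<^sup>2)"
  proof (cases "u 0 = 0")
    case False
    then have pos: "0 < real (u 0)" "0 \<le> ln (real (u 0))" by simp_all
    have "ln (real (u 0)) = (sqrt (ln (real (u 0))))\<^sup>2" using pos(2) by simp
    also have "\<dots> \<le> w\<^sup>2" by (rule power_mono[OF u0 s0])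
    finally have "exp (ln (real (u 0))) \<le> exp (w\<^sup>2)" by simp
    then show ?thesis using pos(1) by simp
  qed simp
qed

end

lemma (in local_sample) m_cmult: "m (\<lambda>y. c * \<phi> y) = c * m \<phi>"
proof -
  have e: "(\<lambda>w. indicator B (X 0 w) * (c * \<phi> (Y 0 w))) = (\<lambda>w. c * (indicator B (X 0 w) * \<phi> (Y 0 w)))"
    by (rule ext) simp
  show ?thesis unfolding m_def e by simp
qed

context neighbour_sample begin

theorem Z_equicontinuous:
  fixes \<epsilon> :: real
  assumes \<epsilon>: "\<epsilon> > 0"
  shows "\<exists>\<pi>. finite (\<pi> ` \<G>) \<and> \<pi> ` \<G> \<subseteq> \<G> \<and> (\<forall>\<^sub>F n in sequentially. \<exists>A\<in>events. prob A \<le> \<epsilon> \<and>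
    (\<forall>\<omega>\<in>space M - A. \<forall>g\<in>\<G>. \<bar>Z n \<omega> g - Z n \<omega> (\<pi> g)\<bar> \<le> \<epsilon>))"
proof -
  obtain c where c1': "c \<ge> 1" "\<And>n. n \<ge> n0 \<Longrightarrow> integrable (localized (B n)) (\<lambda>y. (G y)\<^sup>2) \<and>
      (\<integral>y. (G y)\<^sup>2 \<partial>localized (B n)) \<le> c\<^sup>2"
    using second_moment by blast
  then have c: "c \<ge> 1" "\<And>n. n \<ge> n0 \<Longrightarrow> (\<integral>y. (G y)\<^sup>2 \<partial>localized (B n)) \<le> c\<^sup>2" by blast+
  define d where "d = 8 + 5 * (4 * c)\<^sup>2"
  have d: "d > 0" unfolding d_def by (intro add_pos_nonneg) auto
  define \<Lambda> where "\<Lambda> = \<epsilon> / (8 * d)"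
  have \<Lambda>: "\<Lambda> > 0" using \<epsilon> d by (simp add: \<Lambda>_def)
  define j where "j = \<Lambda> / 16"
  have j: "j > 0" using \<Lambda> by (simp add: j_def)
  define \<eta> where "\<eta> = \<epsilon> / 20"
  have \<eta>: "\<eta> > 0" using \<epsilon> by (simp add: \<eta>_def)
  obtain q1 where q1: "\<And>q n. q \<ge> q1 \<Longrightarrow> n \<ge> n0 \<Longrightarrow> bracketing_integral \<G> G (localized (B n)) ((1/2) ^ q) \<le> ennreal j"
    using brackets[OF j] unfolding B_def by blast
  have "(\<lambda>q. (2 * real q + 4) * (1/2) ^ q) \<longlonglongrightarrow> 2 * 0 + 4 * 0"
    unfolding distrib_right mult.assoc
    by (intro tendsto_add tendsto_mult_left LIMSEQ_power_zero powser_times_n_limit_0) auto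
  then have "eventually (\<lambda>q. (2 * real q + 4) * (1/2) ^ q < min (\<Lambda> / 2) (\<epsilon> / 4)) sequentially"
    by (rule order_tendstoD(2)) (use \<Lambda> \<epsilon> in simp)
  then obtain q2 where q2: "\<And>q. q \<ge> q2 \<Longrightarrow> (2 * real q + 4) * (1/2) ^ q < min (\<Lambda> / 2) (\<epsilon> / 4)"
    unfolding eventually_sequentially by blast
  define q0 where "q0 = max q1 q2"
  have q0: "(2 * real q0 + 4) * (1/2) ^ q0 \<le> \<Lambda> / 2" "4 * (1/2) ^ q0 \<le> \<epsilon> / 4"
  proof -
    have *: "(2 * real q0 + 4) * (1/2) ^ q0 < min (\<Lambda> / 2) (\<epsilon> / 4)" by (rule q2) (simp add: q0_def)
    then show "(2 * real q0 + 4) * (1/2) ^ q0 \<le> \<Lambda> / 2" by simp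
    have "4 * (1/2 :: real) ^ q0 \<le> (2 * real q0 + 4) * (1/2) ^ q0" by (intro mult_right_mono) auto
    moreover have "(2 * real q0 + 4) * (1/2) ^ q0 < \<epsilon> / 4" using * unfolding min_less_iff_conj by (rule conjunct2)
    ultimately show "4 * (1/2) ^ q0 \<le> \<epsilon> / 4" by linarith
  qed
  define w where "w = 2 ^ (q0 + 1) * j"
  have w: "w > 0" using j by (simp add: w_def)
  define \<alpha> where "\<alpha> = (1/2) ^ q0 / (real q0 + 1 + 3 * w)"
  have \<alpha>: "\<alpha> > 0" using w by (simp add: \<alpha>_def)
  define T where "T = max 1 (2 * w\<^sup>2 + ln (16 / \<epsilon>))"
  have T: "T \<ge> 1" "2 * w\<^sup>2 + ln (16 / \<epsilon>) \<le> T" by (simp_all add: T_def)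
  define \<tau> where "\<tau> = \<eta> / (2 * T)"
  have \<tau>: "\<tau> > 0" using \<eta> T by (simp add: \<tau>_def)
  have expT: "4 * (exp (w\<^sup>2))\<^sup>2 * exp (- \<eta> / (2 * \<tau>)) \<le> \<epsilon> / 4"
  proof -
    have "- \<eta> / (2 * \<tau>) = - T" using \<eta> T by (simp add: \<tau>_def)
    then have "(exp (w\<^sup>2))\<^sup>2 * exp (- \<eta> / (2 * \<tau>)) = exp (2 * w\<^sup>2 - T)"
      by (simp add: exp_double[symmetric] exp_add[symmetric])
    also have "\<dots> \<le> exp (ln (\<epsilon> / 16))" using T(2) \<epsilon> by (simp add: ln_div)
    also have "\<dots> = \<epsilon> / 16" using \<epsilon> by simp
    finally show ?thesis by simp
  qed
  define \<beta> where "\<beta> = \<epsilon> * \<eta> * min \<alpha> \<tau> / 64"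
  have \<beta>: "\<beta> > 0" using \<epsilon> \<eta> \<alpha> \<tau> by (simp add: \<beta>_def)
  obtain t where t: "t > 0" "\<And>n s. n \<ge> n0 \<Longrightarrow> t \<le> s \<Longrightarrow>
    local_sample.m M X Y {1..n} (B n) (real (k n)) (\<lambda>y. (G y)\<^sup>2 * (if s < G y then 1 else 0)) \<le> \<beta>"
    using m_tail[OF \<beta>] by blast
  obtain F where F: "finite F" "F \<subseteq> \<G>" "\<And>g. g \<in> \<G> \<Longrightarrow> \<exists>h\<in>F. \<forall>n\<ge>n0. L2_nrm (localized (B n)) (\<lambda>y. h y - g y) < \<tau> / 4"
    using net[of "\<tau> / 4"] \<tau> unfolding B_def by auto
  define \<pi> where "\<pi> g = (SOME h. h \<in> F \<and> (\<forall>n\<ge>n0. L2_nrm (localized (B n)) (\<lambda>y. h y - g y) < \<tau> / 4))" for g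
  have \<pi>: "\<pi> g \<in> F \<and> (\<forall>n\<ge>n0. L2_nrm (localized (B n)) (\<lambda>y. \<pi> g y - g y) < \<tau> / 4)" if "g \<in> \<G>" for g
  proof -
    have "\<exists>h. h \<in> F \<and> (\<forall>n\<ge>n0. L2_nrm (localized (B n)) (\<lambda>y. h y - g y) < \<tau> / 4)" using F(3)[OF that] by blast
    from someI_ex[OF this] show ?thesis unfolding \<pi>_def .
  qed
  have "eventually (\<lambda>n. n \<ge> n0 \<and> 2 * t / min \<alpha> \<tau> \<le> sqrt (real (k n))) sequentially" by (rule sqrt_k_ge)
  moreover have "eventually (\<lambda>n. exp (- real (k n)) \<le> \<epsilon> / 8) sequentially" by (rule exp_k_small) (use \<epsilon> in simp)
  ultimately have "eventually (\<lambda>n. \<exists>A\<in>events. prob A \<le> \<epsilon> \<and>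
    (\<forall>\<omega>\<in>space M - A. \<forall>g\<in>\<G>. \<bar>Z n \<omega> g - Z n \<omega> (\<pi> g)\<bar> \<le> \<epsilon>)) sequentially"
  proof eventually_elim
    case (elim n)
    then have n: "n \<ge> n0" and kt: "2 * t / min \<alpha> \<tau> \<le> sqrt (real (k n))" by simp_all
    have kp: "0 < sqrt (real (k n))" using k_pos[OF n] by simp
    have Jn: "bracketing_integral \<G> G (localized (B n)) ((1/2) ^ q0) \<le> ennreal j"
      by (rule q1[OF _ n]) (simp add: q0_def)
    obtain C where ch: "chaining M S X Y \<kappa> {1..n} (N n) (B n) (real (k n)) G \<G> C q0 (4 * c) ((2 * real q0 + 4) * (1/2) ^ q0 + 8 * j)"
      and lev: "\<And>P. (\<Sum>p\<le>P. (1/2) ^ (q0 + p + 1) * sqrt (ln (real (card (C p))))) \<le> j"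
      using chaining_system[OF n Jn less_imp_le[OF j] c(1) c(2)[OF n]] by blast
    interpret L: chaining M S X Y \<kappa> "{1..n}" "N n" "B n" "real (k n)" G \<G> C q0 "4 * c" "(2 * real q0 + 4) * (1/2) ^ q0 + 8 * j"
      by (rule ch)
    have LV: "L.V h \<omega> = V n h \<omega>" for h \<omega> by (simp add: L.V_def V_def)
    have num: "real (card (C 0)) \<le> exp (w\<^sup>2)" "sqrt (ln (card (C 0))) + sqrt (ln (card (C (Suc 0)))) \<le> 3 * w"
      using exp_bound_of_level[of q0 "\<lambda>p. card (C p)" j, OF lev less_imp_le[OF j]] unfolding w_def by auto
    have a0: "\<alpha> \<le> L.a 0"
    proof -
      have "0 < L.L 0" using L.L_ge(2)[of 0] by simp
      moreover have "L.L 0 \<le> real q0 + 1 + 3 * w" using num(2) by (simp add: L.L_def L.s_def)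
      ultimately show ?thesis unfolding \<alpha>_def L.a_def by (simp add: frac_le)
    qed
    have tail: "2 * L.tail_mass s / (s * \<eta>) \<le> \<epsilon> / 8" if s: "min \<alpha> \<tau> \<le> s" for s
    proof -
      have mp: "0 < min \<alpha> \<tau>" using \<alpha> \<tau> by simp
      then have s0: "s > 0" using s by linarith
      have "2 * t \<le> sqrt (real (k n)) * min \<alpha> \<tau>" using kt mp by (simp only: divide_le_eq if_True)
      also have "\<dots> \<le> sqrt (real (k n)) * s" using s kp by (intro mult_left_mono) auto
      finally have ts: "t \<le> sqrt (real (k n)) * s / 2" by simp
      have "L.tail_mass s = L.m (\<lambda>y. 4 * ((G y)\<^sup>2 * (if sqrt (real (k n)) * s / 2 < G y then 1 else 0)))"
        unfolding L.tail_mass_def by (intro arg_cong[where f=L.m] ext) (auto simp: power_mult_distrib)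
      also have "\<dots> = 4 * L.m (\<lambda>y. (G y)\<^sup>2 * (if sqrt (real (k n)) * s / 2 < G y then 1 else 0))"
        by (rule L.m_cmult)
      also have "\<dots> \<le> 4 * \<beta>" by (intro mult_left_mono t(2)[OF n ts]) simp
      also have "\<dots> \<le> \<epsilon> * \<eta> * s / 16" using s \<epsilon> \<eta> by (simp add: \<beta>_def mult_left_mono)
      finally have "L.tail_mass s \<le> \<epsilon> * \<eta> * s / 16" .
      then show ?thesis using s0 \<eta> by (simp add: divide_le_eq mult_ac)
    qed
    have close: "L.m (\<lambda>y. (g y - \<pi> g y)\<^sup>2) \<le> \<tau>\<^sup>2" if g: "g \<in> \<G>" for g
    proof -
      have [measurable]: "g \<in> borel_measurable S" "\<pi> g \<in> borel_measurable S"
        using g \<pi>[OF g] F(2) g_meas by auto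
      have "L.m (\<lambda>y. (g y - \<pi> g y)\<^sup>2) \<le> 16 * (\<integral>y. (g y - \<pi> g y)\<^sup>2 \<partial>localized (B n))"
        by (rule m_le[OF n]) auto
      also have "(\<integral>y. (g y - \<pi> g y)\<^sup>2 \<partial>localized (B n)) = (L2_nrm (localized (B n)) (\<lambda>y. \<pi> g y - g y))\<^sup>2"
        by (simp add: L2_nrm_def power2_commute[of "g _"])
      also have "\<dots> \<le> (\<tau> / 4)\<^sup>2"
        by (rule power_mono) (use \<pi>[OF g] n in \<open>auto simp: L2_nrm_def less_imp_le\<close>)
      finally show ?thesis by (simp add: power_divide)
    qed
    have \<pi>\<G>: "\<pi> g \<in> \<G>" if "g \<in> \<G>" for g using \<pi>[OF that] F(2) by blast
    have "\<exists>A\<in>events. prob A \<le> 4 * (1/2) ^ q0 + 2 * L.tail_mass (L.a 0) / (L.a 0 * \<eta>) + 2 * L.tail_mass \<tau> / (\<tau> * \<eta>)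
        + 4 * (real (card (C 0)))\<^sup>2 * exp (- \<eta> / (2 * \<tau>)) \<and>
      (\<forall>\<omega>\<in>space M - A. \<forall>g\<in>\<G>. \<bar>L.V g \<omega> - L.V (\<pi> g) \<omega>\<bar> \<le> 4 * ((8 + 5 * (4 * c)\<^sup>2) * ((2 * real q0 + 4) * (1/2) ^ q0 + 8 * j) + 2 * \<eta>) + 2 * \<eta>)"
    proof (rule L.net_bound[where p=\<pi>, OF \<eta> \<tau>])
      show "\<pi> g \<in> \<G>" if "g \<in> \<G>" for g by (rule \<pi>\<G>[OF that])
      show "L.m (\<lambda>y. (g y - \<pi> g y)\<^sup>2) \<le> \<tau>\<^sup>2" if "g \<in> \<G>" for g by (rule close[OF that])
      fix A assume "A \<in> events" and pA: "prob A \<le> 4 * (1/2) ^ q0 + 2 * L.tail_mass (L.a 0) / (L.a 0 * \<eta>) + 2 * L.tail_mass \<tau> / (\<tau> * \<eta>)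
        + 4 * (real (card (C 0)))\<^sup>2 * exp (- \<eta> / (2 * \<tau>))"
        and dA: "\<And>\<omega> g. \<omega> \<in> space M - A \<Longrightarrow> g \<in> \<G> \<Longrightarrow> \<bar>L.V g \<omega> - L.V (\<pi> g) \<omega>\<bar> \<le> 4 * ((8 + 5 * (4 * c)\<^sup>2) * ((2 * real q0 + 4) * (1/2) ^ q0 + 8 * j) + 2 * \<eta>) + 2 * \<eta>"
      show ?thesis
      proof (rule bexI)
        show "A \<in> events" by fact
      qed (intro conjI ballI pA dA)
    qed
    then obtain A where A: "A \<in> events"
      "prob A \<le> 4 * (1/2) ^ q0 + 2 * L.tail_mass (L.a 0) / (L.a 0 * \<eta>) + 2 * L.tail_mass \<tau> / (\<tau> * \<eta>)
        + 4 * (real (card (C 0)))\<^sup>2 * exp (- \<eta> / (2 * \<tau>))"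
      and dist_A: "\<forall>\<omega>\<in>space M - A. \<forall>g\<in>\<G>. \<bar>L.V g \<omega> - L.V (\<pi> g) \<omega>\<bar> \<le> 4 * ((8 + 5 * (4 * c)\<^sup>2) * ((2 * real q0 + 4) * (1/2) ^ q0 + 8 * j) + 2 * \<eta>) + 2 * \<eta>"
      by (elim bexE conjE)
    obtain E where E: "E \<in> events" "prob E \<le> exp (- real (k n))"
      "\<And>\<omega>. \<omega> \<in> space M - E \<Longrightarrow> N n (\<lambda>j. X j \<omega>) = nn_set (\<lambda>j. X j \<omega>) n (k n) x"
      using neighbours_in_ball[OF n] by blast
    show ?case
    proof (intro bexI[of _ "A \<union> E"] conjI ballI)
      show "A \<union> E \<in> events" using A(1) E(1) by simp
      have "prob (A \<union> E) \<le> prob A + prob E" using A(1) E(1) by (rule measure_Un_le)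
      moreover have "4 * (real (card (C 0)))\<^sup>2 * exp (- \<eta> / (2 * \<tau>)) \<le> 4 * (exp (w\<^sup>2))\<^sup>2 * exp (- \<eta> / (2 * \<tau>))"
        using num(1) by (intro mult_right_mono mult_left_mono power_mono) auto
      moreover have "2 * L.tail_mass (L.a 0) / (L.a 0 * \<eta>) \<le> \<epsilon> / 8" by (rule tail) (use a0 in simp)
      moreover have "2 * L.tail_mass \<tau> / (\<tau> * \<eta>) \<le> \<epsilon> / 8" by (rule tail) simp
      ultimately show "prob (A \<union> E) \<le> \<epsilon>" using A(2) E(2) elim(2) q0(2) expT \<epsilon> by linarith
      fix \<omega> g assume w: "\<omega> \<in> space M - (A \<union> E)" and g: "g \<in> \<G>"
      have "\<bar>V n g \<omega> - V n (\<pi> g) \<omega>\<bar> \<le> 4 * (d * ((2 * real q0 + 4) * (1/2) ^ q0 + 8 * j) + 2 * \<eta>) + 2 * \<eta>"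
        using bspec[OF bspec[OF dist_A, of \<omega>] g] w by (simp add: LV d_def)
      also have "\<dots> \<le> 4 * (d * \<Lambda> + 2 * \<eta>) + 2 * \<eta>"
        using q0(1) d by (intro add_right_mono mult_left_mono) (auto simp: j_def)
      also have "\<dots> = \<epsilon>" using d by (simp add: \<Lambda>_def \<eta>_def)
      finally show "\<bar>Z n \<omega> g - Z n \<omega> (\<pi> g)\<bar> \<le> \<epsilon>" using E(3)[of \<omega>] w by (simp add: Z_eq_V)
    qed
  qed
  moreover have "\<pi> ` \<G> \<subseteq> F" using \<pi> by blast
  ultimately show ?thesis using F(1,2) finite_subset by (intro exI[of _ \<pi>]) blast
qed

theorem gaussian_limit_Z:
  assumes sym: "\<And>g h. g \<in> \<G> \<Longrightarrow> h \<in> \<G> \<Longrightarrow> c2 g h = c2 h g"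
  shows "gaussian_limit M Z \<G> K"
proof unfold_locales
  show "\<G> \<noteq> {}" by (rule nonempty)
  show "(\<lambda>w. Z n w g) \<in> borel_measurable M" if "g \<in> \<G>" for n g by (rule Z_measurable'[OF g_meas[OF that]])
qed (use sym char_Z_limit Z_equicontinuous in \<open>auto simp: K_def mult.commute\<close>)

end

(* The generic pair (X, Y) is (X 0, Y 0); the sample is (X i, Y i) for i \<ge> 1. *)
theorem theorem3:
  fixes M :: "'w measure" and S :: "'s measure"
    and X :: "nat \<Rightarrow> 'w \<Rightarrow> real ^ 'd" and Y :: "nat \<Rightarrow> 'w \<Rightarrow> 's"
    and P :: "((real ^ 'd) \<times> 's) measure"
    and f :: "real ^ 'd \<Rightarrow> real" and \<mu> :: "real ^ 'd \<Rightarrow> 's measure"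
    and x :: "real ^ 'd" and \<G> :: "('s \<Rightarrow> real) set" and G :: "'s \<Rightarrow> real"
    and \<delta> :: real and k :: "nat \<Rightarrow> nat"
  defines "\<mu>\<^sub>x\<^sub>u \<equiv> local_mixture M S (X 0) \<mu> x"
  assumes "prob_space M"
    and iid: "prob_space.indep_vars M (\<lambda>i. borel \<Otimes>\<^sub>M S) (\<lambda>i \<omega>. (X i \<omega>, Y i \<omega>)) UNIV"
             "\<And>i. distr M (borel \<Otimes>\<^sub>M S) (\<lambda>\<omega>. (X i \<omega>, Y i \<omega>)) = P"
    and dens: "\<And>z. f z \<ge> 0" "distributed M lborel (X 0) (\<lambda>z. ennreal (f z))"
    and cond: "regular_cond_dist M S (X 0) (Y 0) f \<mu>"
    and at_x: "isCont f x" "f x > 0"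
    and meas: "\<G> \<subseteq> borel_measurable S"
    and env: "\<delta> > 0" "is_envelope S \<G> G"
    and i: "\<And>\<delta>n. (\<forall>n. \<delta>n n > 0) \<Longrightarrow> \<delta>n \<longlonglongrightarrow> 0 \<Longrightarrow>
              limsup (\<lambda>n. SUP u\<in>{0<..\<delta>}. bracketing_integral \<G> G (\<mu>\<^sub>x\<^sub>u u) (\<delta>n n)) = 0"
    and ii: "\<And>\<epsilon>::real. \<epsilon> > 0 \<Longrightarrow> \<exists>m>0.
              (SUP u\<in>{0<..\<delta>}. \<integral>\<^sup>+s. ennreal ((G s)\<^sup>2) * indicator {s. G s > m} s \<partial>\<mu>\<^sub>x\<^sub>u u) \<le> ennreal \<epsilon>"
    and iii: "totally_bounded_wrt
               (\<lambda>g1 g2. SUP u\<in>{0<..\<delta>}. ennreal (L2_nrm (\<mu>\<^sub>x\<^sub>u u) (\<lambda>s. g1 s - g2 s))) \<G>"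
    and cont: "\<And>g1 g2. g1 \<in> \<G> \<Longrightarrow> g2 \<in> \<G> \<Longrightarrow>
              isCont (\<lambda>z. (\<integral>s. g1 s * g2 s \<partial>\<mu> z, \<integral>s. g1 s \<partial>\<mu> z, \<integral>s. (G s)\<^sup>2 \<partial>\<mu> z)) x"
    and k: "\<And>n. n \<ge> 1 \<Longrightarrow> 1 \<le> k n \<and> k n \<le> n"
           "filterlim k at_top sequentially"
           "(\<lambda>n. real (k n) / real n) \<longlonglongrightarrow> 0"
  shows "\<exists>(N :: (('s \<Rightarrow> real) \<Rightarrow> real) measure) (W :: (('s \<Rightarrow> real) \<Rightarrow> real) \<Rightarrow> ('s \<Rightarrow> real) \<Rightarrow> real).
           prob_space N \<and>
           centered_gaussian_process N W \<G>
             (\<lambda>g1 g2. (\<integral>s. g1 s * g2 s \<partial>\<mu> x) - (\<integral>s. g1 s \<partial>\<mu> x) * (\<integral>s. g2 s \<partial>\<mu> x)) \<and>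
           weakly_converges_linf M (nn_process X Y \<mu> k x) \<G> N W"
proof -
  interpret prob_space M by fact
  have XY: "(\<lambda>\<omega>. (X i \<omega>, Y i \<omega>)) \<in> measurable M (borel \<Otimes>\<^sub>M S)" for i
    using iid(1) by (simp add: indep_vars_def)
  have Xm: "X 0 \<in> borel_measurable M" using measurable_compose[OF XY measurable_fst] by simp
  have Ym: "Y 0 \<in> measurable M S" using measurable_compose[OF XY measurable_snd] by simp
  obtain N0 \<kappa> where N0: "N0 \<in> sets borel" "AE \<omega> in M. X 0 \<omega> \<notin> N0"
    and \<kappa>: "\<kappa> \<in> measurable borel (prob_algebra S)" "\<And>z. z \<notin> N0 \<Longrightarrow> \<kappa> z = \<mu> z"
    "\<And>A B. A \<in> sets S \<Longrightarrow> B \<in> sets borel \<Longrightarrow> emeasure M {\<omega> \<in> space M. X 0 \<omega> \<in> B \<and> Y 0 \<omega> \<in> A} =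
      (\<integral>\<^sup>+\<omega>. emeasure (\<kappa> (X 0 \<omega>)) A * indicator B (X 0 \<omega>) \<partial>M)"
    using regular_cond_dist_kernel[OF assms(2) Xm Ym dens(2) cond] by blast
  have RS: "regression_sample M S X Y \<kappa>"
    using XY iid \<kappa>(1,3) by unfold_locales auto
  interpret R: regression_sample M S X Y \<kappa> by (rule RS)
  show ?thesis
  proof (cases "\<G> = {}")
    case True
    then show ?thesis using weak_limit_empty by simp
  next
    case False
    define d where "d = real CARD('d)"
    have d: "d > 0" by (simp add: d_def)
    obtain b u0 where b: "b > 0" "u0 > 0" "\<And>u. 0 < u \<Longrightarrow> u \<le> u0 \<Longrightarrow>
        b * u \<le> measure M {\<omega> \<in> space M. X 0 \<omega> \<in> cball x (u powr (1 / d))} \<and>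
        measure M {\<omega> \<in> space M. X 0 \<omega> \<in> cball x (u powr (1 / d))} \<le> 4 * b * u"
      using small_ball_prob[OF assms(2) dens(2) at_x] unfolding d_def by blast
    define u where "u n = 4 / b * (real (k n) / real n)" for n
    define \<rho> where "\<rho> n = u n powr (1 / d)" for n
    have "u \<longlonglongrightarrow> 4 / b * 0" unfolding u_def[abs_def] by (intro tendsto_intros k(3))
    then have u_lim: "u \<longlonglongrightarrow> 0" by simp
    have \<rho>_lim: "\<rho> \<longlonglongrightarrow> 0" unfolding \<rho>_def[abs_def]
      by (rule tendsto_zero_powrI[OF u_lim tendsto_const]) (use b(1) d in \<open>auto simp: u_def\<close>)
    have "eventually (\<lambda>n. u n < min u0 \<delta>) sequentially"
      by (rule order_tendstoD(2)[OF u_lim]) (use b(2) env(1) in simp)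
    then obtain n1 where n1: "\<And>n. n \<ge> n1 \<Longrightarrow> u n < min u0 \<delta>" unfolding eventually_sequentially by blast
    define n0 where "n0 = max n1 1"
    have n0: "n \<ge> 1" "u n \<le> u0" "u n \<in> {0<..\<delta>}" if "n \<ge> n0" for n
    proof -
      show "n \<ge> 1" using that by (simp add: n0_def)
      then have "0 < u n" using k(1)[of n] b(1) by (simp add: u_def)
      then show "u n \<le> u0" "u n \<in> {0<..\<delta>}" using n1[of n] that by (simp_all add: n0_def)
    qed
    have prob_ball: "b * u n \<le> prob {\<omega> \<in> space M. X 0 \<omega> \<in> cball x (\<rho> n)} \<and>
        prob {\<omega> \<in> space M. X 0 \<omega> \<in> cball x (\<rho> n)} \<le> 4 * b * u n" if "n \<ge> n0" for n
      unfolding \<rho>_def by (rule b(3)) (use n0[OF that] in auto)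
    have mix: "\<mu>\<^sub>x\<^sub>u (u n) = R.localized (cball x (\<rho> n))" if "n \<ge> n0" for n
    proof -
      have "0 < b * u n" using n0(3)[OF that] b(1) by simp
      then have "0 < prob {\<omega> \<in> space M. X 0 \<omega> \<in> cball x (\<rho> n)}" using prob_ball[OF that] by linarith
      moreover have "AE \<omega> in M. \<mu> (X 0 \<omega>) = \<kappa> (X 0 \<omega>)" using N0(2) by eventually_elim (simp add: \<kappa>(2))
      ultimately show ?thesis unfolding \<mu>\<^sub>x\<^sub>u_def \<rho>_def d_def by (intro local_mixture_eq[OF RS])
    qed
    have nhds_lim: "((\<lambda>z. h (\<kappa> z)) \<longlongrightarrow> h (\<mu> x)) (inf (nhds x) (principal (- N0)))" if "isCont (\<lambda>z. h (\<mu> z)) x"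
      for h :: "'s measure \<Rightarrow> real"
    proof -
      have "((\<lambda>z. h (\<mu> z)) \<longlongrightarrow> h (\<mu> x)) (nhds x)"
        using that tendsto_at_iff_tendsto_nhds[of "\<lambda>z. h (\<mu> z)" x] unfolding isCont_def by blast
      then have "((\<lambda>z. h (\<mu> z)) \<longlongrightarrow> h (\<mu> x)) (inf (nhds x) (principal (- N0)))" by (rule tendsto_mono[rotated]) simp
      moreover have "eventually (\<lambda>z. h (\<kappa> z) = h (\<mu> z)) (inf (nhds x) (principal (- N0)))"
        by (simp add: eventually_inf_principal \<kappa>(2))
      ultimately show ?thesis by (simp add: tendsto_cong)
    qed
    interpret NS: neighbour_sample M S X Y \<kappa> x k \<rho> n0 N0 \<G> G "\<lambda>g h. \<integral>y. g y * h y \<partial>\<mu> x" "\<lambda>g. \<integral>y. g y \<partial>\<mu> x"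
    proof unfold_locales
      show "n0 \<ge> 1" by (simp add: n0_def)
      show "1 \<le> k n \<and> k n \<le> n" if "n \<ge> n0" for n by (rule k(1)[OF n0(1)[OF that]])
      show "4 * real (k n) \<le> n * prob {\<omega> \<in> space M. X 0 \<omega> \<in> cball x (\<rho> n)} \<and>
          n * prob {\<omega> \<in> space M. X 0 \<omega> \<in> cball x (\<rho> n)} \<le> 16 * real (k n)" if "n \<ge> n0" for n
      proof -
        have e: "real n * (b * u n) = 4 * real (k n)" using b(1) n0(1)[OF that] by (simp add: u_def)
        have "real n * (b * u n) \<le> n * prob {\<omega> \<in> space M. X 0 \<omega> \<in> cball x (\<rho> n)}"
          using prob_ball[OF that] by (intro mult_left_mono) auto
        moreover have "n * prob {\<omega> \<in> space M. X 0 \<omega> \<in> cball x (\<rho> n)} \<le> n * (4 * b * u n)"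
          using prob_ball[OF that] by (intro mult_left_mono) auto
        moreover have "n * (4 * b * u n) = 4 * (real n * (b * u n))" by simp
        ultimately show ?thesis using e by linarith
      qed
      show "\<exists>q. \<forall>q0\<ge>q. \<forall>n\<ge>n0. bracketing_integral \<G> G (R.localized (cball x (\<rho> n))) ((1/2) ^ q0) \<le> ennreal e"
        if e: "e > 0" for e :: real
      proof -
        have "limsup (\<lambda>n. SUP u\<in>{0<..\<delta>}. bracketing_integral \<G> G (\<mu>\<^sub>x\<^sub>u u) ((1/2) ^ n)) = 0"
          by (rule i) (auto intro: LIMSEQ_power_zero)
        then have "limsup (\<lambda>n. SUP u\<in>{0<..\<delta>}. bracketing_integral \<G> G (\<mu>\<^sub>x\<^sub>u u) ((1/2) ^ n)) < ennreal e" using e by simp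
        then have "eventually (\<lambda>n. (SUP u\<in>{0<..\<delta>}. bracketing_integral \<G> G (\<mu>\<^sub>x\<^sub>u u) ((1/2) ^ n)) < ennreal e) sequentially"
          by (rule Limsup_lessD)
        then obtain q where q: "\<And>q0. q0 \<ge> q \<Longrightarrow> (SUP u\<in>{0<..\<delta>}. bracketing_integral \<G> G (\<mu>\<^sub>x\<^sub>u u) ((1/2) ^ q0)) < ennreal e"
          unfolding eventually_sequentially by blast
        have "bracketing_integral \<G> G (R.localized (cball x (\<rho> n))) ((1/2) ^ q0) \<le> ennreal e" if "q0 \<ge> q" "n \<ge> n0" for q0 n
        proof -
          have "bracketing_integral \<G> G (\<mu>\<^sub>x\<^sub>u (u n)) ((1/2) ^ q0) \<le> (SUP u\<in>{0<..\<delta>}. bracketing_integral \<G> G (\<mu>\<^sub>x\<^sub>u u) ((1/2) ^ q0))"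
            by (rule SUP_upper[OF n0(3)[OF that(2)]])
          then show ?thesis using q[OF that(1)] mix[OF that(2)] by (auto intro: order_trans less_imp_le)
        qed
        then show ?thesis by blast
      qed
      show "\<exists>t>0. \<forall>n\<ge>n0. (\<integral>\<^sup>+y. ennreal ((G y)\<^sup>2) * indicator {y. G y > t} y \<partial>R.localized (cball x (\<rho> n))) \<le> ennreal e"
        if "e > 0" for e :: real
      proof -
        obtain t where t: "t > 0" "(SUP u\<in>{0<..\<delta>}. \<integral>\<^sup>+s. ennreal ((G s)\<^sup>2) * indicator {s. G s > t} s \<partial>\<mu>\<^sub>x\<^sub>u u) \<le> ennreal e"
          using ii[OF \<open>e > 0\<close>] by blast
        have "(\<integral>\<^sup>+s. ennreal ((G s)\<^sup>2) * indicator {s. G s > t} s \<partial>\<mu>\<^sub>x\<^sub>u (u n)) \<le> ennreal e" if "n \<ge> n0" for n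
          by (rule order_trans[OF SUP_upper[OF n0(3)[OF that]] t(2)])
        then show ?thesis using t(1) mix by auto
      qed
      show "\<exists>F. finite F \<and> F \<subseteq> \<G> \<and> (\<forall>g\<in>\<G>. \<exists>h\<in>F. \<forall>n\<ge>n0. L2_nrm (R.localized (cball x (\<rho> n))) (\<lambda>y. h y - g y) < e)"
        if e: "e > 0" for e :: real
      proof -
        have "\<exists>F. finite F \<and> F \<subseteq> \<G> \<and> (\<forall>g\<in>\<G>. \<exists>h\<in>F. (SUP u\<in>{0<..\<delta>}. ennreal (L2_nrm (\<mu>\<^sub>x\<^sub>u u) (\<lambda>s. h s - g s))) < ennreal e)"
          using iii[unfolded totally_bounded_wrt_def, rule_format, OF e] .
        then obtain F where F: "finite F" "F \<subseteq> \<G>"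
          "\<forall>g\<in>\<G>. \<exists>h\<in>F. (SUP u\<in>{0<..\<delta>}. ennreal (L2_nrm (\<mu>\<^sub>x\<^sub>u u) (\<lambda>s. h s - g s))) < ennreal e"
          by (elim exE conjE)
        have near: "L2_nrm (R.localized (cball x (\<rho> n))) (\<lambda>y. h y - g y) < e"
          if "(SUP u\<in>{0<..\<delta>}. ennreal (L2_nrm (\<mu>\<^sub>x\<^sub>u u) (\<lambda>s. h s - g s))) < ennreal e" "n \<ge> n0" for g h n
        proof -
          have "ennreal (L2_nrm (\<mu>\<^sub>x\<^sub>u (u n)) (\<lambda>s. h s - g s)) < ennreal e"
            by (rule le_less_trans[OF SUP_upper[OF n0(3)[OF that(2)]] that(1)])
          moreover have "0 \<le> L2_nrm (\<mu>\<^sub>x\<^sub>u (u n)) (\<lambda>s. h s - g s)" by (simp add: L2_nrm_def)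
          ultimately show ?thesis using mix[OF that(2)] by (simp add: ennreal_less_iff)
        qed
        show ?thesis
        proof (intro exI conjI ballI)
          fix g assume "g \<in> \<G>"
          then obtain h where h: "h \<in> F" "(SUP u\<in>{0<..\<delta>}. ennreal (L2_nrm (\<mu>\<^sub>x\<^sub>u u) (\<lambda>s. h s - g s))) < ennreal e"
            using F(3) by blast
          then show "\<exists>h\<in>F. \<forall>n\<ge>n0. L2_nrm (R.localized (cball x (\<rho> n))) (\<lambda>y. h y - g y) < e"
            using near[OF h(2)] by blast
        qed (rule F)+
      qed
      show "((\<lambda>z. \<integral>y. g y * h y \<partial>\<kappa> z) \<longlongrightarrow> (\<integral>y. g y * h y \<partial>\<mu> x)) (inf (nhds x) (principal (- N0)))"
        if "g \<in> \<G>" "h \<in> \<G>" for g h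
        by (rule nhds_lim[of "\<lambda>D. \<integral>y. g y * h y \<partial>D"]) (use continuous_fst[OF cont[OF that]] in simp)
      show "((\<lambda>z. \<integral>y. g y \<partial>\<kappa> z) \<longlongrightarrow> (\<integral>y. g y \<partial>\<mu> x)) (inf (nhds x) (principal (- N0)))"
        if "g \<in> \<G>" for g
        by (rule nhds_lim[of "\<lambda>D. \<integral>y. g y \<partial>D"]) (use continuous_fst[OF continuous_snd[OF cont[OF that that]]] in simp)
    qed (use k(2) \<rho>_lim False meas env N0 in auto)
    interpret GL: gaussian_limit M NS.Z \<G> NS.K
      by (rule NS.gaussian_limit_Z) (simp add: mult.commute)
    have "AE \<omega> in M. \<forall>i. X i \<omega> \<notin> N0" using NS.AE_X_notin_N0 by (simp add: AE_all_countable)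
    then obtain A where A: "{\<omega> \<in> space M. \<not> (\<forall>i. X i \<omega> \<notin> N0)} \<subseteq> A" "A \<in> null_sets M"
      unfolding eventually_ae_filter by blast
    have "weakly_converges_linf M (nn_process X Y \<mu> k x) \<G> GL.limit_law (\<lambda>z. z)"
    proof (rule weakly_converges_linf_cong_null[OF A(2) _ GL.weak_limit])
      fix n \<omega> g assume "\<omega> \<in> space M - A"
      then have "\<kappa> (X i \<omega>) = \<mu> (X i \<omega>)" for i using A(1) by (intro \<kappa>(2)) blast
      then show "nn_process X Y \<mu> k x n \<omega> g = NS.Z n \<omega> g" by (simp add: nn_process_def NS.Z_def)
    qed
    moreover have "NS.K = (\<lambda>g1 g2. (\<integral>s. g1 s * g2 s \<partial>\<mu> x) - (\<integral>s. g1 s \<partial>\<mu> x) * (\<integral>s. g2 s \<partial>\<mu> x))"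
      by (intro ext) (simp add: NS.K_def)
    ultimately show ?thesis using GL.prob_space_limit_law GL.gaussian_limit_law
      by (intro exI[of _ GL.limit_law] exI[of _ "\<lambda>z. z"]) simp
  qed
qed

end
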